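(* Let $S,T\in\tilde{\mathcal M}$ be $*$-free $R$-diagonal elements. Then $$\tilde\mu_{|S+T|}=\tilde\mu_{|S|}\boxplus\tilde\mu_{|T|}.$$
   Context: $\mathcal M$ is a von Neumann algebra with a faithful, normal, tracial state $\tau$; $\tilde{\mathcal M}$ is the $*$-algebra of closed, densely defined operators affiliated with $\mathcal M$ (sums and products are closures of the algebraic ones). For self-adjoint $A\in\tilde{\mathcal M}$ with spectral measure $E_A$, $\mu_A(B)=\tau(E_A(B))$ for Borel $B\subseteq\mathbb R$. For a Borel probability measure $\mu$ on $\mathbb R$, its symmetrization is $\tilde\mu(B)=\frac12(\mu(B)+\mu(-B))$; thus $\tilde\mu_{|S|}$ denotes the symmetrization of $\mu_{|S|}$. For $T\in\tilde{\mathcal M}$ with polar decomposition $T=U|T|$, $W^*(T)$ is the von Neumann algebra generated by $U$ and all spectral projections of $|T|$ (the smallest von Neumann subalgebra of $\mathcal M$ to which $T$ is affiliated). A trace-preserving $*$-isomorphism $\phi:\mathcal M_1\to\mathcal M_2$ between von Neumann algebras with faithful normal tracial states extends uniquely to a $*$-isomorphism $\tilde\phi:\tilde{\mathcal M}_1\to\tilde{\mathcal M}_2$ continuous in the measure topologies. Two operators $S,T$ (affiliated with possibly different such algebras) have the same $*$-distribution if there is a trace-preserving $*$-isomorphism $\phi$ from $W^*(S)$ onto $W^*(T)$ with $\tilde\phi(S)=T$. Operators in $\tilde{\mathcal M}$ are $*$-free if the von Neumann algebras $W^*(\cdot)$ they generate are $*$-free with respect to the trace (free independence in the sense of Voiculescu).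 A unitary $U$ is Haar unitary if $\tau(U^n)=0$ for all nonzero integers $n$. $T\in\tilde{\mathcal M}$ is $R$-diagonal if there exist a von Neumann algebra $\mathcal N$ with a faithful, normal, tracial state and $*$-free elements $U,H\in\tilde{\mathcal N}$ such that $U$ is Haar unitary, $H\ge0$, and $T$ has the same $*$-distribution as $UH$. $\boxplus$ denotes the additive free convolution of probability measures on $\mathbb R$ (Bercovici–Voiculescu): $\mu\boxplus\nu$ is the distribution of $A+B$ for free self-adjoint operators $A,B$ (affiliated with a tracial von Neumann algebra) with distributions $\mu,\nu$. *)

theory Defs
  imports "HOL-Analysis.Analysis"
begin

section \<open>Complex Hilbert spaces\<close>

(* The norm, metric and topology are those of the underlying real inner product space.
   The inner product is antilinear in its first argument. *)
class complex_hilbert_space = real_inner + complete_space +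
  fixes scaleC :: "complex \<Rightarrow> 'a \<Rightarrow> 'a"  (infixr \<open>*\<^sub>C\<close> 75)
    and cinner :: "'a \<Rightarrow> 'a \<Rightarrow> complex"
  assumes scaleC_add_right: "c *\<^sub>C (x + y) = c *\<^sub>C x + c *\<^sub>C y"
    and scaleC_add_left: "(b + c) *\<^sub>C x = b *\<^sub>C x + c *\<^sub>C x"
    and scaleC_scaleC: "b *\<^sub>C c *\<^sub>C x = (b * c) *\<^sub>C x"
    and scaleR_scaleC: "r *\<^sub>R x = complex_of_real r *\<^sub>C x"
    and cinner_commute: "cinner x y = cnj (cinner y x)"
    and cinner_add_right: "cinner x (y + z) = cinner x y + cinner x z"
    and cinner_scaleC_right: "cinner x (c *\<^sub>C y) = c * cinner x y"
    and inner_eq_Re_cinner: "inner x y = Re (cinner x y)"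


subsection \<open>The space of square-summable sequences\<close>

typedef ell2 = "{f :: nat \<Rightarrow> complex. summable (\<lambda>n. (cmod (f n))\<^sup>2)}"
  by (intro exI[of _ "\<lambda>_. 0"]) simp

setup_lifting type_definition_ell2

lemma ell2_summable_mult:
  fixes f g :: "nat \<Rightarrow> complex"
  assumes "summable (\<lambda>n. (cmod (f n))\<^sup>2)" "summable (\<lambda>n. (cmod (g n))\<^sup>2)"
  shows "summable (\<lambda>n. cnj (f n) * g n)"
proof (rule summable_comparison_test'[OF summable_add[OF assms], where N = 0])
  fix n :: nat
  show "norm (cnj (f n) * g n) \<le> (cmod (f n))\<^sup>2 + (cmod (g n))\<^sup>2"
    using sum_squares_bound[of "cmod (f n)" "cmod (g n)"]
      mult_nonneg_nonneg[OF norm_ge_zero norm_ge_zero, of "f n" "g n"]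
    unfolding norm_mult complex_mod_cnj mult.assoc by linarith
qed

lemma ell2_summable_add:
  fixes f g :: "nat \<Rightarrow> complex"
  assumes "summable (\<lambda>n. (cmod (f n))\<^sup>2)" "summable (\<lambda>n. (cmod (g n))\<^sup>2)"
  shows "summable (\<lambda>n. (cmod (f n + g n))\<^sup>2)"
proof (rule summable_comparison_test'[where N = 0])
  show "summable (\<lambda>n. 2 * (cmod (f n))\<^sup>2 + 2 * (cmod (g n))\<^sup>2)"
    using assms by (intro summable_add summable_mult)
  fix n :: nat
  have "(cmod (f n + g n))\<^sup>2 \<le> (cmod (f n) + cmod (g n))\<^sup>2"
    by (intro power_mono norm_triangle_ineq) auto
  also have "\<dots> \<le> 2 * (cmod (f n))\<^sup>2 + 2 * (cmod (g n))\<^sup>2"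
    using sum_squares_bound[of "cmod (f n)" "cmod (g n)"]
    by (simp add: power2_eq_square algebra_simps)
  finally show "norm ((cmod (f n + g n))\<^sup>2) \<le> 2 * (cmod (f n))\<^sup>2 + 2 * (cmod (g n))\<^sup>2"
    by simp
qed

lemma ell2_summable_scale:
  fixes f :: "nat \<Rightarrow> complex"
  assumes "summable (\<lambda>n. (cmod (f n))\<^sup>2)"
  shows "summable (\<lambda>n. (cmod (c * f n))\<^sup>2)"
  using summable_mult[OF assms, of "(cmod c)\<^sup>2"] by (simp add: norm_mult power_mult_distrib)

lemma ell2_summable_diff:
  fixes f g :: "nat \<Rightarrow> complex"
  assumes "summable (\<lambda>n. (cmod (f n))\<^sup>2)" "summable (\<lambda>n. (cmod (g n))\<^sup>2)"
  shows "summable (\<lambda>n. (cmod (f n - g n))\<^sup>2)"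
  using ell2_summable_add[OF assms(1) ell2_summable_scale[OF assms(2), of "-1"]] by simp

lemma ell2_mult_self:
  fixes f :: "nat \<Rightarrow> complex"
  assumes "summable (\<lambda>n. (cmod (f n))\<^sup>2)"
  shows "Re (\<Sum>n. cnj (f n) * f n) = (\<Sum>n. (cmod (f n))\<^sup>2)"
proof -
  have eq: "cnj (f n) * f n = complex_of_real ((cmod (f n))\<^sup>2)" for n
    by (simp add: complex_norm_square mult.commute del: of_real_power)
  show ?thesis unfolding eq suminf_of_real[OF assms, symmetric] by simp
qed

lemma ell2_mult_add:
  fixes f g h :: "nat \<Rightarrow> complex"
  assumes "summable (\<lambda>n. (cmod (f n))\<^sup>2)" "summable (\<lambda>n. (cmod (g n))\<^sup>2)"
    "summable (\<lambda>n. (cmod (h n))\<^sup>2)"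
  shows "(\<Sum>n. cnj (f n) * (g n + h n)) = (\<Sum>n. cnj (f n) * g n) + (\<Sum>n. cnj (f n) * h n)"
    and "(\<Sum>n. cnj (g n + h n) * f n) = (\<Sum>n. cnj (g n) * f n) + (\<Sum>n. cnj (h n) * f n)"
  unfolding distrib_left distrib_right complex_cnj_add
  by (rule suminf_add[symmetric] ell2_summable_mult assms)+

lemma ell2_mult_commute:
  fixes f g :: "nat \<Rightarrow> complex"
  assumes "summable (\<lambda>n. (cmod (f n))\<^sup>2)" "summable (\<lambda>n. (cmod (g n))\<^sup>2)"
  shows "(\<Sum>n. cnj (f n) * g n) = cnj (\<Sum>n. cnj (g n) * f n)"
proof -
  have "(\<lambda>n. cnj (cnj (g n) * f n)) sums cnj (\<Sum>n. cnj (g n) * f n)"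
    using summable_sums[OF ell2_summable_mult[OF assms(2,1)]] by (simp only: sums_cnj)
  then show ?thesis by (simp add: sums_iff mult.commute)
qed

lemma ell2_mult_scale:
  fixes f g :: "nat \<Rightarrow> complex"
  assumes "summable (\<lambda>n. (cmod (f n))\<^sup>2)" "summable (\<lambda>n. (cmod (g n))\<^sup>2)"
  shows "(\<Sum>n. cnj (f n) * (c * g n)) = c * (\<Sum>n. cnj (f n) * g n)"
  unfolding mult.left_commute[of _ c] by (rule suminf_mult[OF ell2_summable_mult[OF assms]])

instantiation ell2 :: real_inner
begin

lift_definition zero_ell2 :: ell2 is "\<lambda>_. 0" by simp
lift_definition plus_ell2 :: "ell2 \<Rightarrow> ell2 \<Rightarrow> ell2" is "\<lambda>f g n. f n + g n"
  by (rule ell2_summable_add)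
lift_definition minus_ell2 :: "ell2 \<Rightarrow> ell2 \<Rightarrow> ell2" is "\<lambda>f g n. f n - g n"
  by (rule ell2_summable_diff)
lift_definition uminus_ell2 :: "ell2 \<Rightarrow> ell2" is "\<lambda>f n. - f n" by simp
lift_definition scaleR_ell2 :: "real \<Rightarrow> ell2 \<Rightarrow> ell2" is "\<lambda>r f n. of_real r * f n"
  by (rule ell2_summable_scale)
lift_definition inner_ell2 :: "ell2 \<Rightarrow> ell2 \<Rightarrow> real" is "\<lambda>f g. Re (\<Sum>n. cnj (f n) * g n)" .
definition norm_ell2 :: "ell2 \<Rightarrow> real" where "norm_ell2 x = sqrt (inner x x)"
definition dist_ell2 :: "ell2 \<Rightarrow> ell2 \<Rightarrow> real" where "dist_ell2 x y = norm (x - y)"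
definition sgn_ell2 :: "ell2 \<Rightarrow> ell2" where "sgn_ell2 x = inverse (norm x) *\<^sub>R x"
definition uniformity_ell2 :: "(ell2 \<times> ell2) filter"
  where "uniformity_ell2 = (INF e\<in>{0 <..}. principal {(x, y). dist x y < e})"
definition open_ell2 :: "ell2 set \<Rightarrow> bool"
  where "open_ell2 U \<longleftrightarrow> (\<forall>x\<in>U. \<forall>\<^sub>F (x', y) in uniformity. x' = x \<longrightarrow> y \<in> U)"

instance
proof
  fix x y z :: ell2 and a b r :: real and U :: "ell2 set"
  show "x + y + z = x + (y + z)" by transfer (simp add: algebra_simps)
  show "x + y = y + x" by transfer (simp add: algebra_simps)
  show "0 + x = x" by transfer simp
  show "- x + x = 0" by transfer simp
  show "x - y = x + - y" by transfer simp
  show "a *\<^sub>R (x + y) = a *\<^sub>R x + a *\<^sub>R y" by transfer (simp add: algebra_simps)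
  show "(a + b) *\<^sub>R x = a *\<^sub>R x + b *\<^sub>R x" by transfer (simp add: algebra_simps)
  show "a *\<^sub>R b *\<^sub>R x = (a * b) *\<^sub>R x" by transfer (simp add: algebra_simps)
  show "1 *\<^sub>R x = x" by transfer simp
  show "dist x y = norm (x - y)" by (rule dist_ell2_def)
  show "sgn x = inverse (norm x) *\<^sub>R x" by (rule sgn_ell2_def)
  show "uniformity = (INF e\<in>{0 <..}. principal {(x :: ell2, y). dist x y < e})"
    by (rule uniformity_ell2_def)
  show "open U \<longleftrightarrow> (\<forall>x\<in>U. \<forall>\<^sub>F (x', y) in uniformity. x' = x \<longrightarrow> y \<in> U)"
    by (rule open_ell2_def)
  show "inner x y = inner y x"
    by transfer (rule trans[OF arg_cong[where f = Re, OF ell2_mult_commute] cnj.sel(1)])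
  show "inner (x + y) z = inner x z + inner y z"
    by transfer (simp only: ell2_mult_add plus_complex.sel)
  show "inner (r *\<^sub>R x) y = r * inner x y"
  proof transfer
    fix r :: real and f g :: "nat \<Rightarrow> complex"
    assume s: "summable (\<lambda>n. (cmod (f n))\<^sup>2)" "summable (\<lambda>n. (cmod (g n))\<^sup>2)"
    have "(\<Sum>n. cnj (of_real r * f n) * g n) = cnj (\<Sum>n. cnj (g n) * (of_real r * f n))"
      by (rule ell2_mult_commute[OF ell2_summable_scale[OF s(1)] s(2)])
    also have "\<dots> = cnj (of_real r * (\<Sum>n. cnj (g n) * f n))"
      by (rule arg_cong[OF ell2_mult_scale[OF s(2,1)]])
    also have "\<dots> = of_real r * (\<Sum>n. cnj (f n) * g n)"
      unfolding complex_cnj_mult complex_cnj_complex_of_real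
      by (rule arg_cong[OF ell2_mult_commute[OF s, symmetric]])
    finally show "Re (\<Sum>n. cnj (of_real r * f n) * g n) = r * Re (\<Sum>n. cnj (f n) * g n)"
      by (simp only: Re_complex_of_real times_complex.sel Im_complex_of_real)
  qed
  show "0 \<le> inner x x" by transfer (simp add: ell2_mult_self suminf_nonneg)
  show "inner x x = 0 \<longleftrightarrow> x = 0"
    by transfer (simp add: ell2_mult_self suminf_eq_zero_iff fun_eq_iff)
  show "norm x = sqrt (inner x x)" by (rule norm_ell2_def)
qed

end

lemma norm_ell2_eq: "(norm x)\<^sup>2 = (\<Sum>n. (cmod (Rep_ell2 x n))\<^sup>2)"
proof -
  have s: "summable (\<lambda>n. (cmod (Rep_ell2 x n))\<^sup>2)" using Rep_ell2[of x] by simp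
  have "(norm x)\<^sup>2 = inner x x" by (simp add: power2_norm_eq_inner)
  also have "\<dots> = (\<Sum>n. (cmod (Rep_ell2 x n))\<^sup>2)"
    by (simp add: inner_ell2.rep_eq ell2_mult_self[OF s])
  finally show ?thesis .
qed

lemma sum_le_norm_ell2: "(\<Sum>k<K. (cmod (Rep_ell2 x k))\<^sup>2) \<le> (norm x)\<^sup>2"
  unfolding norm_ell2_eq using Rep_ell2[of x] by (intro sum_le_suminf) auto

instance ell2 :: complete_space
proof
  fix X :: "nat \<Rightarrow> ell2"
  assume X: "Cauchy X"
  have coord: "cmod (Rep_ell2 x k) \<le> norm x" for x k
  proof -
    have "(cmod (Rep_ell2 x k))\<^sup>2 \<le> (\<Sum>k<Suc k. (cmod (Rep_ell2 x k))\<^sup>2)"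
      by (simp add: sum_nonneg)
    also have "\<dots> \<le> (norm x)\<^sup>2" by (rule sum_le_norm_ell2)
    finally show ?thesis by (rule power2_le_imp_le) simp
  qed
  have "Cauchy (\<lambda>n. Rep_ell2 (X n) k)" for k
  proof (rule metric_CauchyI)
    fix e :: real assume "0 < e"
    then obtain M where M: "\<And>m n. m \<ge> M \<Longrightarrow> n \<ge> M \<Longrightarrow> dist (X m) (X n) < e"
      using X unfolding Cauchy_def by blast
    have "dist (Rep_ell2 (X m) k) (Rep_ell2 (X n) k) < e" if "m \<ge> M" "n \<ge> M" for m n
      using coord[of "X m - X n" k] M[OF that] by (simp add: minus_ell2.rep_eq dist_norm)
    then show "\<exists>M. \<forall>m\<ge>M. \<forall>n\<ge>M. dist (Rep_ell2 (X m) k) (Rep_ell2 (X n) k) < e" by blast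
  qed
  then have "\<exists>l. (\<lambda>n. Rep_ell2 (X n) k) \<longlonglongrightarrow> l" for k
    by (simp add: Cauchy_convergent_iff convergent_def)
  then obtain L where L: "\<And>k. (\<lambda>n. Rep_ell2 (X n) k) \<longlonglongrightarrow> L k" by metis
  have bound: "\<exists>N. \<forall>n\<ge>N. summable (\<lambda>k. (cmod (Rep_ell2 (X n) k - L k))\<^sup>2) \<and>
      (\<Sum>k. (cmod (Rep_ell2 (X n) k - L k))\<^sup>2) \<le> e\<^sup>2" if e: "0 < e" for e :: real
  proof -
    obtain N where N: "\<And>m n. m \<ge> N \<Longrightarrow> n \<ge> N \<Longrightarrow> dist (X m) (X n) < e"
      using X e unfolding Cauchy_def by blast
    have part: "(\<Sum>k<K. (cmod (Rep_ell2 (X n) k - L k))\<^sup>2) \<le> e\<^sup>2" if n: "n \<ge> N" for n K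
    proof (rule tendsto_upperbound)
      show "(\<lambda>m. \<Sum>k<K. (cmod (Rep_ell2 (X n) k - Rep_ell2 (X m) k))\<^sup>2) \<longlonglongrightarrow>
          (\<Sum>k<K. (cmod (Rep_ell2 (X n) k - L k))\<^sup>2)"
        by (intro tendsto_intros L)
      have "(\<Sum>k<K. (cmod (Rep_ell2 (X n) k - Rep_ell2 (X m) k))\<^sup>2) \<le> e\<^sup>2" if "m \<ge> N" for m
      proof -
        have "(\<Sum>k<K. (cmod (Rep_ell2 (X n) k - Rep_ell2 (X m) k))\<^sup>2) \<le> (norm (X n - X m))\<^sup>2"
          using sum_le_norm_ell2[of "X n - X m" K] by (simp add: minus_ell2.rep_eq)
        also have "\<dots> \<le> e\<^sup>2"
          using N[OF n that] by (intro power_mono) (simp_all add: dist_norm)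
        finally show ?thesis .
      qed
      then show "\<forall>\<^sub>F m in sequentially.
          (\<Sum>k<K. (cmod (Rep_ell2 (X n) k - Rep_ell2 (X m) k))\<^sup>2) \<le> e\<^sup>2"
        by (auto simp: eventually_sequentially)
    qed simp
    have "summable (\<lambda>k. (cmod (Rep_ell2 (X n) k - L k))\<^sup>2)" if "n \<ge> N" for n
      by (rule summableI_nonneg_bounded[OF _ part[OF that]]) simp
    moreover have "(\<Sum>k. (cmod (Rep_ell2 (X n) k - L k))\<^sup>2) \<le> e\<^sup>2" if "n \<ge> N" for n
      by (rule suminf_le_const[OF calculation[OF that] part[OF that]])
    ultimately show ?thesis by blast
  qed
  obtain N where "summable (\<lambda>k. (cmod (Rep_ell2 (X N) k - L k))\<^sup>2)"
    using bound[of 1] by auto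
  then have "summable (\<lambda>k. (cmod (Rep_ell2 (X N) k - (Rep_ell2 (X N) k - L k)))\<^sup>2)"
    by (rule ell2_summable_diff[rotated]) (use Rep_ell2[of "X N"] in simp)
  then have "L \<in> {f. summable (\<lambda>n. (cmod (f n))\<^sup>2)}" by simp
  then have R: "Rep_ell2 (Abs_ell2 L) = L" by (rule Abs_ell2_inverse)
  have "X \<longlonglongrightarrow> Abs_ell2 L"
  proof (rule metric_LIMSEQ_I)
    fix e :: real assume "0 < e"
    then obtain N where N: "\<forall>n\<ge>N. (\<Sum>k. (cmod (Rep_ell2 (X n) k - L k))\<^sup>2) \<le> (e/2)\<^sup>2"
      using bound[of "e/2"] by auto
    have "dist (X n) (Abs_ell2 L) < e" if "n \<ge> N" for n
    proof -
      have "(norm (X n - Abs_ell2 L))\<^sup>2 \<le> (e/2)\<^sup>2"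
        using N that by (simp add: norm_ell2_eq minus_ell2.rep_eq R)
      then have "norm (X n - Abs_ell2 L) \<le> e/2"
        by (rule power2_le_imp_le) (use \<open>0 < e\<close> in simp)
      then show ?thesis using \<open>0 < e\<close> by (simp add: dist_norm)
    qed
    then show "\<exists>no. \<forall>n\<ge>no. dist (X n) (Abs_ell2 L) < e" by blast
  qed
  then show "convergent X" by (auto simp: convergent_def)
qed

instantiation ell2 :: complex_hilbert_space
begin

lift_definition scaleC_ell2 :: "complex \<Rightarrow> ell2 \<Rightarrow> ell2" is "\<lambda>c f n. c * f n"
  by (rule ell2_summable_scale)
lift_definition cinner_ell2 :: "ell2 \<Rightarrow> ell2 \<Rightarrow> complex" is "\<lambda>f g. \<Sum>n. cnj (f n) * g n" .

instance
proof
  fix x y z :: ell2 and b c :: complex and r :: real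
  show "c *\<^sub>C (x + y) = c *\<^sub>C x + c *\<^sub>C y" by transfer (simp add: algebra_simps)
  show "(b + c) *\<^sub>C x = b *\<^sub>C x + c *\<^sub>C x" by transfer (simp add: algebra_simps)
  show "b *\<^sub>C c *\<^sub>C x = (b * c) *\<^sub>C x" by transfer (simp add: algebra_simps)
  show "r *\<^sub>R x = complex_of_real r *\<^sub>C x" by transfer simp
  show "cinner x y = cnj (cinner y x)" by transfer (rule ell2_mult_commute)
  show "cinner x (y + z) = cinner x y + cinner x z"
    by transfer (rule ell2_mult_add(1))
  show "cinner x (c *\<^sub>C y) = c * cinner x y" by transfer (rule ell2_mult_scale)
  show "inner x y = Re (cinner x y)" by transfer simp
qed

end


section \<open>Bounded operators and tracial von Neumann algebras\<close>

definition bounded_clinear :: "('h::complex_hilbert_space \<Rightarrow> 'k::complex_hilbert_space) \<Rightarrow> bool"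
  where "bounded_clinear a \<longleftrightarrow> bounded_linear a \<and> (\<forall>c x. a (c *\<^sub>C x) = c *\<^sub>C a x)"

definition cadj :: "('h::complex_hilbert_space \<Rightarrow> 'h) \<Rightarrow> 'h \<Rightarrow> 'h"
  where "cadj a = (THE b. \<forall>x y. cinner (a x) y = cinner x (b y))"

definition unitary_op :: "('h::complex_hilbert_space \<Rightarrow> 'h) \<Rightarrow> bool"
  where "unitary_op u \<longleftrightarrow> bounded_clinear u \<and> cadj u \<circ> u = id \<and> u \<circ> cadj u = id"

definition projection_op :: "('h::complex_hilbert_space \<Rightarrow> 'h) \<Rightarrow> bool"
  where "projection_op p \<longleftrightarrow> bounded_clinear p \<and> p \<circ> p = p \<and> cadj p = p"

definition op_le :: "('h::complex_hilbert_space \<Rightarrow> 'h) \<Rightarrow> ('h \<Rightarrow> 'h) \<Rightarrow> bool"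
  where "op_le a b \<longleftrightarrow> (\<forall>x. cinner x (b x - a x) \<in> \<real>\<^sub>\<ge>\<^sub>0)"

definition commutant :: "('h::complex_hilbert_space \<Rightarrow> 'h) set \<Rightarrow> ('h \<Rightarrow> 'h) set"
  where "commutant X = {a. bounded_clinear a \<and> (\<forall>x\<in>X. a \<circ> x = x \<circ> a)}"

definition von_neumann_algebra :: "('h::complex_hilbert_space \<Rightarrow> 'h) set \<Rightarrow> bool"
  where "von_neumann_algebra M \<longleftrightarrow> (\<forall>a\<in>M. cadj a \<in> M) \<and> commutant (commutant M) = M"

definition vn_generated :: "('h::complex_hilbert_space \<Rightarrow> 'h) set \<Rightarrow> ('h \<Rightarrow> 'h) set"
  where "vn_generated X = \<Inter> {N. von_neumann_algebra N \<and> X \<subseteq> N}"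

(* Positive, upward directed families are bounded increasing nets indexed by themselves. *)
definition normal_functional ::
  "('h::complex_hilbert_space \<Rightarrow> 'h) set \<Rightarrow> (('h \<Rightarrow> 'h) \<Rightarrow> complex) \<Rightarrow> bool"
  where "normal_functional M \<tau> \<longleftrightarrow>
    (\<forall>D a. D \<subseteq> {d \<in> M. op_le (\<lambda>_. 0) d} \<and> D \<noteq> {}
        \<and> (\<forall>d\<in>D. \<forall>e\<in>D. \<exists>f\<in>D. op_le d f \<and> op_le e f)
        \<and> a \<in> M \<and> (\<forall>d\<in>D. op_le d a)
        \<and> (\<forall>b\<in>M. (\<forall>d\<in>D. op_le d b) \<longrightarrow> op_le a b)
      \<longrightarrow> \<tau> a = complex_of_real (SUP d\<in>D. Re (\<tau> d)))"

(* A von Neumann algebra together with a faithful normal tracial state;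
   the values of \<tau> outside M are irrelevant. *)
definition tracial_vna ::
  "('h::complex_hilbert_space \<Rightarrow> 'h) set \<Rightarrow> (('h \<Rightarrow> 'h) \<Rightarrow> complex) \<Rightarrow> bool"
  where "tracial_vna M \<tau> \<longleftrightarrow> von_neumann_algebra M
    \<and> (\<forall>a\<in>M. \<forall>b\<in>M. \<tau> (\<lambda>x. a x + b x) = \<tau> a + \<tau> b)
    \<and> (\<forall>c. \<forall>a\<in>M. \<tau> (\<lambda>x. c *\<^sub>C a x) = c * \<tau> a)
    \<and> (\<forall>a\<in>M. \<tau> (cadj a \<circ> a) \<in> \<real>\<^sub>\<ge>\<^sub>0)
    \<and> \<tau> id = 1
    \<and> (\<forall>a\<in>M. \<tau> (cadj a \<circ> a) = 0 \<longrightarrow> a = (\<lambda>_. 0))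
    \<and> (\<forall>a\<in>M. \<forall>b\<in>M. \<tau> (a \<circ> b) = \<tau> (b \<circ> a))
    \<and> normal_functional M \<tau>"


section \<open>Closed operators and affiliation\<close>

(* An unbounded operator is represented by its graph, a set of pairs (x, A x). *)
type_synonym 'h opgraph = "('h \<times> 'h) set"

definition op_graph :: "('h \<Rightarrow> 'h) \<Rightarrow> 'h opgraph"
  where "op_graph a = {(x, a x) | x. True}"

definition closed_dd_op :: "'h::complex_hilbert_space opgraph \<Rightarrow> bool"
  where "closed_dd_op A \<longleftrightarrow> closed A \<and> single_valued A \<and> closure (Domain A) = UNIV
    \<and> (0, 0) \<in> A
    \<and> (\<forall>x y x' y'. (x, y) \<in> A \<longrightarrow> (x', y') \<in> A \<longrightarrow> (x + x', y + y') \<in> A)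
    \<and> (\<forall>c x y. (x, y) \<in> A \<longrightarrow> (c *\<^sub>C x, c *\<^sub>C y) \<in> A)"

definition op_adj :: "'h::complex_hilbert_space opgraph \<Rightarrow> 'h opgraph"
  where "op_adj A = {(u, v). \<forall>(x, y)\<in>A. cinner u y = cinner v x}"

definition op_add :: "'h::complex_hilbert_space opgraph \<Rightarrow> 'h opgraph \<Rightarrow> 'h opgraph"
  where "op_add A B = closure {(x, y + z) | x y z. (x, y) \<in> A \<and> (x, z) \<in> B}"

(* The product "first B, then A"; relcomp reads from left to right. *)
definition op_mult :: "'h::complex_hilbert_space opgraph \<Rightarrow> 'h opgraph \<Rightarrow> 'h opgraph"
  where "op_mult A B = closure (B O A)"

(* The closure only matters for c = 0. *)
definition op_scale :: "complex \<Rightarrow> 'h::complex_hilbert_space opgraph \<Rightarrow> 'h opgraph"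
  where "op_scale c A = closure {(x, c *\<^sub>C y) | x y. (x, y) \<in> A}"

definition op_selfadjoint :: "'h::complex_hilbert_space opgraph \<Rightarrow> bool"
  where "op_selfadjoint A \<longleftrightarrow> closed_dd_op A \<and> op_adj A = A"

definition op_positive :: "'h::complex_hilbert_space opgraph \<Rightarrow> bool"
  where "op_positive A \<longleftrightarrow> op_selfadjoint A \<and> (\<forall>(x, y)\<in>A. cinner x y \<in> \<real>\<^sub>\<ge>\<^sub>0)"

definition affiliated :: "('h::complex_hilbert_space \<Rightarrow> 'h) set \<Rightarrow> 'h opgraph set"
  where "affiliated M = {A. closed_dd_op A \<and>
    (\<forall>u\<in>commutant M. unitary_op u \<longrightarrow> (\<forall>(x, y)\<in>A. (u x, u y) \<in> A))}"

(* For closed densely defined T, the algebraic product of T and its adjoint is already closed. *)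
definition op_abs :: "'h::complex_hilbert_space opgraph \<Rightarrow> 'h opgraph"
  where "op_abs T = (THE P. op_positive P \<and> P O P = T O op_adj T)"

(* The partial isometry U in the polar decomposition T = U|T|; its kernel is that of T. *)
definition op_phase :: "'h::complex_hilbert_space opgraph \<Rightarrow> 'h \<Rightarrow> 'h"
  where "op_phase T = (THE U. bounded_clinear U \<and> projection_op (cadj U \<circ> U)
    \<and> T = {(x, U y) | x y. (x, y) \<in> op_abs T}
    \<and> (\<forall>x. U x = 0 \<longleftrightarrow> (x, 0) \<in> T))"


section \<open>Spectral measures and distributions\<close>

definition borel_measure_of :: "(real set \<Rightarrow> real) \<Rightarrow> real measure"
  where "borel_measure_of f = measure_of UNIV (sets borel) (\<lambda>B. ennreal (f B))"

(* The value 0 outside the Borel sets makes the spectral measure of an operator unique. *)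
definition projection_valued_measure ::
  "(real set \<Rightarrow> 'h::complex_hilbert_space \<Rightarrow> 'h) \<Rightarrow> bool"
  where "projection_valued_measure E \<longleftrightarrow>
    (\<forall>B\<in>sets borel. projection_op (E B)) \<and> (\<forall>B. B \<notin> sets borel \<longrightarrow> E B = (\<lambda>_. 0))
    \<and> E UNIV = id
    \<and> (\<forall>B::nat \<Rightarrow> real set. range B \<subseteq> sets borel \<longrightarrow> disjoint_family B \<longrightarrow>
         (\<forall>x. (\<lambda>n. E (B n) x) sums E (\<Union>n. B n) x))"

(* A is the integral of t with respect to E: its domain consists of the vectors x with t
   square integrable against <x, E(dt) x>, and there <x, A x> is the integral of t against
   this measure (the other matrix coefficients follow by polarization). *)
definition is_spectral_measure ::
  "'h::complex_hilbert_space opgraph \<Rightarrow> (real set \<Rightarrow> 'h \<Rightarrow> 'h) \<Rightarrow> bool"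
  where "is_spectral_measure A E \<longleftrightarrow> projection_valued_measure E
    \<and> Domain A = {x. integrable (borel_measure_of (\<lambda>B. Re (cinner x (E B x)))) (\<lambda>t. t\<^sup>2)}
    \<and> (\<forall>(x, y)\<in>A. cinner x y =
         complex_of_real (\<integral>t. t \<partial>borel_measure_of (\<lambda>B. Re (cinner x (E B x)))))"

definition spectral_measure ::
  "'h::complex_hilbert_space opgraph \<Rightarrow> real set \<Rightarrow> 'h \<Rightarrow> 'h"
  where "spectral_measure A = (THE E. is_spectral_measure A E)"

definition op_distr ::
  "(('h::complex_hilbert_space \<Rightarrow> 'h) \<Rightarrow> complex) \<Rightarrow> 'h opgraph \<Rightarrow> real measure"
  where "op_distr \<tau> A = borel_measure_of (\<lambda>B. Re (\<tau> (spectral_measure A B)))"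

definition symmetrization :: "real measure \<Rightarrow> real measure"
  where "symmetrization \<mu> =
    measure_of UNIV (sets borel) (\<lambda>B. (emeasure \<mu> B + emeasure \<mu> (uminus ` B)) / 2)"

definition Wstar :: "'h::complex_hilbert_space opgraph \<Rightarrow> ('h \<Rightarrow> 'h) set"
  where "Wstar T = vn_generated ({op_phase T} \<union> spectral_measure (op_abs T) ` sets borel)"


section \<open>Measure topology and *-distribution\<close>

definition measure_nbhd :: "('h::complex_hilbert_space \<Rightarrow> 'h) set \<Rightarrow>
    (('h \<Rightarrow> 'h) \<Rightarrow> complex) \<Rightarrow> real \<Rightarrow> real \<Rightarrow> 'h opgraph set"
  where "measure_nbhd M \<tau> \<epsilon> \<delta> = {A \<in> affiliated M.
    \<exists>p\<in>M. projection_op p \<and> Re (\<tau> (\<lambda>x. x - p x)) \<le> \<delta>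
      \<and> (\<forall>x. \<exists>y. (p x, y) \<in> A \<and> norm y \<le> \<epsilon> * norm x)}"

definition measure_open :: "('h::complex_hilbert_space \<Rightarrow> 'h) set \<Rightarrow>
    (('h \<Rightarrow> 'h) \<Rightarrow> complex) \<Rightarrow> 'h opgraph set \<Rightarrow> bool"
  where "measure_open M \<tau> V \<longleftrightarrow> V \<subseteq> affiliated M
    \<and> (\<forall>A\<in>V. \<exists>\<epsilon>>0. \<exists>\<delta>>0. \<forall>B\<in>affiliated M.
         op_add B (op_scale (-1) A) \<in> measure_nbhd M \<tau> \<epsilon> \<delta> \<longrightarrow> B \<in> V)"

definition measure_topology :: "('h::complex_hilbert_space \<Rightarrow> 'h) set \<Rightarrow>
    (('h \<Rightarrow> 'h) \<Rightarrow> complex) \<Rightarrow> 'h opgraph topology"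
  where "measure_topology M \<tau> = topology (measure_open M \<tau>)"

lemma measure_nbhd_mono:
  assumes "\<epsilon> \<le> \<epsilon>'" "\<delta> \<le> \<delta>'"
  shows "measure_nbhd M \<tau> \<epsilon> \<delta> \<subseteq> measure_nbhd M \<tau> \<epsilon>' \<delta>'"
proof
  fix A assume "A \<in> measure_nbhd M \<tau> \<epsilon> \<delta>"
  then obtain p where A: "A \<in> affiliated M" and p: "p \<in> M" "projection_op p"
      "Re (\<tau> (\<lambda>x. x - p x)) \<le> \<delta>" "\<forall>x. \<exists>y. (p x, y) \<in> A \<and> norm y \<le> \<epsilon> * norm x"
    unfolding measure_nbhd_def by blast
  have "\<exists>y. (p x, y) \<in> A \<and> norm y \<le> \<epsilon>' * norm x" for x
    using p(4) mult_right_mono[OF assms(1), of "norm x"] by (meson norm_ge_zero order_trans)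
  then show "A \<in> measure_nbhd M \<tau> \<epsilon>' \<delta>'"
    using A p assms(2) unfolding measure_nbhd_def by force
qed

lemma istopology_measure_open: "istopology (measure_open M \<tau>)"
  unfolding istopology_def
proof (intro conjI allI impI)
  fix V W assume V: "measure_open M \<tau> V" and W: "measure_open M \<tau> W"
  show "measure_open M \<tau> (V \<inter> W)"
    unfolding measure_open_def
  proof (intro conjI ballI)
    show "V \<inter> W \<subseteq> affiliated M" using V unfolding measure_open_def by blast
    fix A assume "A \<in> V \<inter> W"
    then obtain \<epsilon> \<delta> \<epsilon>' \<delta>' where pos: "\<epsilon> > 0" "\<delta> > 0" "\<epsilon>' > 0" "\<delta>' > 0"
      and *: "\<forall>B\<in>affiliated M. op_add B (op_scale (-1) A) \<in> measure_nbhd M \<tau> \<epsilon> \<delta> \<longrightarrow> B \<in> V"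
        "\<forall>B\<in>affiliated M. op_add B (op_scale (-1) A) \<in> measure_nbhd M \<tau> \<epsilon>' \<delta>' \<longrightarrow> B \<in> W"
      using V W unfolding measure_open_def by (metis IntD1 IntD2)
    have "measure_nbhd M \<tau> (min \<epsilon> \<epsilon>') (min \<delta> \<delta>') \<subseteq> measure_nbhd M \<tau> \<epsilon> \<delta>"
      "measure_nbhd M \<tau> (min \<epsilon> \<epsilon>') (min \<delta> \<delta>') \<subseteq> measure_nbhd M \<tau> \<epsilon>' \<delta>'"
      by (simp_all add: measure_nbhd_mono)
    then show "\<exists>\<epsilon>>0. \<exists>\<delta>>0. \<forall>B\<in>affiliated M.
        op_add B (op_scale (-1) A) \<in> measure_nbhd M \<tau> \<epsilon> \<delta> \<longrightarrow> B \<in> V \<inter> W"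
      using pos * by (intro exI[of _ "min \<epsilon> \<epsilon>'"] conjI exI[of _ "min \<delta> \<delta>'"]) auto
  qed
next
  fix \<K> assume *: "\<forall>K\<in>\<K>. measure_open M \<tau> K"
  show "measure_open M \<tau> (\<Union>\<K>)"
    unfolding measure_open_def
  proof (intro conjI ballI)
    show "\<Union>\<K> \<subseteq> affiliated M" using * unfolding measure_open_def by blast
    fix A assume "A \<in> \<Union>\<K>"
    then obtain K where K: "K \<in> \<K>" "A \<in> K" by blast
    then obtain \<epsilon> \<delta> where "\<epsilon> > 0" "\<delta> > 0"
      "\<forall>B\<in>affiliated M. op_add B (op_scale (-1) A) \<in> measure_nbhd M \<tau> \<epsilon> \<delta> \<longrightarrow> B \<in> K"
      using * unfolding measure_open_def by metis
    then show "\<exists>\<epsilon>>0. \<exists>\<delta>>0. \<forall>B\<in>affiliated M.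
        op_add B (op_scale (-1) A) \<in> measure_nbhd M \<tau> \<epsilon> \<delta> \<longrightarrow> B \<in> \<Union>\<K>"
      using K by blast
  qed
qed

lemma openin_measure_topology: "openin (measure_topology M \<tau>) = measure_open M \<tau>"
  unfolding measure_topology_def using istopology_measure_open by (rule topology_inverse')

definition trace_isomorphism ::
  "('h::complex_hilbert_space \<Rightarrow> 'h) set \<Rightarrow> (('h \<Rightarrow> 'h) \<Rightarrow> complex) \<Rightarrow>
   ('k::complex_hilbert_space \<Rightarrow> 'k) set \<Rightarrow> (('k \<Rightarrow> 'k) \<Rightarrow> complex) \<Rightarrow>
   (('h \<Rightarrow> 'h) \<Rightarrow> ('k \<Rightarrow> 'k)) \<Rightarrow> bool"
  where "trace_isomorphism M \<tau> N \<sigma> \<phi> \<longleftrightarrow> bij_betw \<phi> M N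
    \<and> (\<forall>a\<in>M. \<forall>b\<in>M. \<phi> (\<lambda>x. a x + b x) = (\<lambda>x. \<phi> a x + \<phi> b x))
    \<and> (\<forall>c. \<forall>a\<in>M. \<phi> (\<lambda>x. c *\<^sub>C a x) = (\<lambda>x. c *\<^sub>C \<phi> a x))
    \<and> (\<forall>a\<in>M. \<forall>b\<in>M. \<phi> (a \<circ> b) = \<phi> a \<circ> \<phi> b)
    \<and> (\<forall>a\<in>M. \<phi> (cadj a) = cadj (\<phi> a))
    \<and> (\<forall>a\<in>M. \<sigma> (\<phi> a) = \<tau> a)"

definition extends_to_affiliated ::
  "('h::complex_hilbert_space \<Rightarrow> 'h) set \<Rightarrow> (('h \<Rightarrow> 'h) \<Rightarrow> complex) \<Rightarrow>
   ('k::complex_hilbert_space \<Rightarrow> 'k) set \<Rightarrow> (('k \<Rightarrow> 'k) \<Rightarrow> complex) \<Rightarrow>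
   (('h \<Rightarrow> 'h) \<Rightarrow> ('k \<Rightarrow> 'k)) \<Rightarrow> ('h opgraph \<Rightarrow> 'k opgraph) \<Rightarrow> bool"
  where "extends_to_affiliated M \<tau> N \<sigma> \<phi> \<psi> \<longleftrightarrow> bij_betw \<psi> (affiliated M) (affiliated N)
    \<and> (\<forall>A\<in>affiliated M. \<forall>B\<in>affiliated M. \<psi> (op_add A B) = op_add (\<psi> A) (\<psi> B))
    \<and> (\<forall>c. \<forall>A\<in>affiliated M. \<psi> (op_scale c A) = op_scale c (\<psi> A))
    \<and> (\<forall>A\<in>affiliated M. \<forall>B\<in>affiliated M. \<psi> (op_mult A B) = op_mult (\<psi> A) (\<psi> B))
    \<and> (\<forall>A\<in>affiliated M. \<psi> (op_adj A) = op_adj (\<psi> A))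
    \<and> (\<forall>a\<in>M. \<psi> (op_graph a) = op_graph (\<phi> a))
    \<and> continuous_map (measure_topology M \<tau>) (measure_topology N \<sigma>) \<psi>"

(* The extension \<psi> exists and is unique on the affiliated operators. *)
definition same_star_distr ::
  "(('h::complex_hilbert_space \<Rightarrow> 'h) \<Rightarrow> complex) \<Rightarrow> 'h opgraph \<Rightarrow>
   (('k::complex_hilbert_space \<Rightarrow> 'k) \<Rightarrow> complex) \<Rightarrow> 'k opgraph \<Rightarrow> bool"
  where "same_star_distr \<tau> S \<sigma> T \<longleftrightarrow> (\<exists>\<phi> \<psi>.
    trace_isomorphism (Wstar S) \<tau> (Wstar T) \<sigma> \<phi> \<and>
    extends_to_affiliated (Wstar S) \<tau> (Wstar T) \<sigma> \<phi> \<psi> \<and> \<psi> S = T)"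


section \<open>Freeness, R-diagonality and free convolution\<close>

definition free_algebras ::
  "(('h \<Rightarrow> 'h) \<Rightarrow> complex) \<Rightarrow> 'i set \<Rightarrow> ('i \<Rightarrow> ('h \<Rightarrow> 'h) set) \<Rightarrow> bool"
  where "free_algebras \<tau> I \<A> \<longleftrightarrow>
    (\<forall>ix as. ix \<noteq> [] \<and> length as = length ix \<and> set ix \<subseteq> I \<and> distinct_adj ix
       \<and> (\<forall>k<length ix. as ! k \<in> \<A> (ix ! k) \<and> \<tau> (as ! k) = 0)
     \<longrightarrow> \<tau> (foldr (\<circ>) as id) = 0)"

definition star_free ::
  "(('h::complex_hilbert_space \<Rightarrow> 'h) \<Rightarrow> complex) \<Rightarrow> 'h opgraph \<Rightarrow> 'h opgraph \<Rightarrow> bool"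
  where "star_free \<tau> S T \<longleftrightarrow> free_algebras \<tau> {0::nat, 1} (\<lambda>i. Wstar (if i = 0 then S else T))"

definition haar_unitary ::
  "(('h::complex_hilbert_space \<Rightarrow> 'h) \<Rightarrow> complex) \<Rightarrow> ('h \<Rightarrow> 'h) \<Rightarrow> bool"
  where "haar_unitary \<tau> u \<longleftrightarrow> unitary_op u
    \<and> (\<forall>n>0. \<tau> (u ^^ n) = 0 \<and> \<tau> (cadj u ^^ n) = 0)"

(* HOL cannot quantify over the Hilbert space on which the algebra N acts inside a formula, so
   its type is a parameter.  Assuming R_diagonal TYPE('k) for a free type variable 'k
   amounts to assuming the existence of N on some complex Hilbert space. *)
definition R_diagonal ::
  "'k::complex_hilbert_space itself \<Rightarrow>
   (('h::complex_hilbert_space \<Rightarrow> 'h) \<Rightarrow> complex) \<Rightarrow> 'h opgraph \<Rightarrow> bool"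
  where "R_diagonal _ \<tau> T \<longleftrightarrow> (\<exists>(N :: ('k \<Rightarrow> 'k) set) \<sigma> u H.
    tracial_vna N \<sigma> \<and> u \<in> N \<and> haar_unitary \<sigma> u \<and> H \<in> affiliated N \<and> op_positive H
    \<and> star_free \<sigma> (op_graph u) H \<and> same_star_distr \<tau> T \<sigma> (op_mult (op_graph u) H))"

(* Every pair of Borel probability measures on the reals is realized by free operators on
   ell2: the free product of the two L^infinity algebras acts on a separable Hilbert space, and
   tensoring with ell2 makes it infinite dimensional.  The distribution of A + B does not depend
   on the realization. *)
definition free_add_convolution :: "real measure \<Rightarrow> real measure \<Rightarrow> real measure"
    (infixl \<open>\<boxplus>\<close> 65)
  where "\<mu> \<boxplus> \<nu> = (THE \<rho>. \<exists>(N :: (ell2 \<Rightarrow> ell2) set) \<sigma> A B. tracial_vna N \<sigma>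
    \<and> A \<in> affiliated N \<and> op_selfadjoint A \<and> B \<in> affiliated N \<and> op_selfadjoint B
    \<and> star_free \<sigma> A B \<and> op_distr \<sigma> A = \<mu> \<and> op_distr \<sigma> B = \<nu>
    \<and> op_distr \<sigma> (op_add A B) = \<rho>)"

end

theory Submission
  imports Defs "HOL-Real_Asymp.Real_Asymp"
begin

text \<open>
  For closed \<open>T\<close> let \<open>hat T\<close> be the self-adjoint matrix with rows \<open>(0, T)\<close>, \<open>(T*, 0)\<close>.
  Its distribution under the normalized matrix trace is the symmetrized distribution of \<open>|T|\<close>, and
  \<open>hat (S + T) = hat S + hat T\<close>. If \<open>S\<close> is R-diagonal, the off-diagonal corners of functions of
  \<open>hat S\<close> have trace zero, and the two diagonal corners always have equal trace. So centred functions of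
  \<open>hat S\<close> and \<open>hat T\<close> have centred entries, and \<open>hat S\<close>, \<open>hat T\<close> are free. The distribution of a
  sum of free operators depends only on the two distributions: this is clear for moments of bounded operators,
  and resolvents converge under spectral truncation. Finally a GNS construction realizes the pair on a
  separable space.
\<close>

text \<open>Unbounded operators have no moments in general, so resolvents stand in for them:
  equality of distributions, vanishing of corners and passage to truncations are all checked on
  resolvents and carried over by Stieltjes inversion. Two definite descriptions shape the work.
  \<open>spectral_measure\<close> has a value only once an operator is known to determine its
  measure, and \<open>free_add_convolution\<close> only once a free pair with the given
  distributions exists on \<open>ell2\<close> and every such pair yields the same distribution of
  the sum. R-diagonality is given through an isomorphism with an algebra on another Hilbert space.
  Equations between products of affiliated operators pass through it, which is why the resolvent
  corners are characterized by two such equations. \<open>hat T\<close> also supplies the polar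
  decomposition, as corners of its sign and of its absolute value. Finiteness of the trace enters
  through the equal traces of support and range projections: it makes closed sums of self-adjoint
  affiliated operators self-adjoint and confines the effect of truncation to a piece of small
  trace.\<close>

abbreviation (input) iff_ascii (infixr "<->" 25) where "A <-> B \<equiv> A \<longleftrightarrow> B"
abbreviation (input) op_sa where "op_sa \<equiv> op_selfadjoint"
abbreviation (input) spm where "spm \<equiv> spectral_measure"
abbreviation (input) projop where "projop \<equiv> projection_op"
abbreviation (input) pvmeas where "pvmeas \<equiv> projection_valued_measure"
abbreviation (input) bcl where "bcl \<equiv> bounded_clinear"
abbreviation (input) cr where "cr \<equiv> complex_of_real"
notation scaleC (infixr "*c" 75)
abbreviation (input) seq_tendsto (infix "~>" 60) where "f ~> l \<equiv> f \<longlonglongrightarrow> l"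

section \<open>Complex Hilbert spaces\<close>

lemma cinner_add_left: "cinner (x + y) z = cinner x z + cinner y z"
 by (metis cinner_commute cinner_add_right complex_cnj_add)

lemma cinner_scaleC_left [simp]: "cinner (c *c x) y = cnj c * cinner x y"
 by (metis cinner_commute cinner_scaleC_right complex_cnj_mult)

declare cinner_scaleC_right [simp] scaleC_scaleC [simp]

lemma scaleC_one [simp]: "1 *c x = x"
 using scaleR_scaleC[of 1 x] by simp

lemma scaleC_zero_left [simp]: "0 *c x = 0"
 using scaleR_scaleC[of 0 x] by simp

lemma scaleC_zero_right [simp]: "c *c (0::'a::complex_hilbert_space) = 0"
 using scaleC_add_right[of c 0 0] by simp

lemma cinner_self: "cinner x x = cr ((norm x)^2)"
proof (rule complex_eqI)
 show "Re (cinner x x) = Re (cr ((norm x)^2))"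
  by (simp add: inner_eq_Re_cinner[symmetric] power2_norm_eq_inner)
 have "Im (cinner x x) = - Im (cinner x x)"
  by (metis cinner_commute cnj.sel(2))
 thus "Im (cinner x x) = Im (cr ((norm x)^2))" by simp
qed

lemma norm_scaleC [simp]: "norm (c *c x) = cmod c * norm x"
proof -
 have "cr ((norm (c *c x))^2) = cr ((cmod c * norm x)^2)"
  unfolding cinner_self[symmetric] cinner_scaleC_left cinner_scaleC_right
  by (simp add: cinner_self power_mult_distrib complex_norm_square[symmetric] mult.assoc[symmetric]
  mult.commute[of _ "cnj c"] flip: complex_norm_square)
 hence "(norm (c *c x))^2 = (cmod c * norm x)^2" by (simp only: of_real_eq_iff)
 thus ?thesis by (simp add: power2_eq_iff_nonneg)
qed

text \<open>Rotating \<open>y\<close> by the phase of the inner product makes it real, so the real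
  Cauchy-Schwarz inequality applies.\<close>

lemma norm_cinner_le: "cmod (cinner x y) <= norm x * norm y"
proof (cases "cinner x y = 0")
 case False
 define c where "c = cnj (sgn (cinner x y))"
 have c: "cmod c = 1" using False by (simp add: c_def norm_sgn)
 have "c * cinner x y = cr (cmod (cinner x y))"
  using False unfolding c_def
  by (simp add: sgn_eq complex_cnj_divide complex_norm_square[symmetric] mult.commute
  power2_eq_square)
 hence "cmod (cinner x y) = inner x (c *c y)"
  by (simp add: inner_eq_Re_cinner)
 also have "... <= norm x * norm (c *c y)" by (rule norm_cauchy_schwarz)
 finally show ?thesis using c by simp
qed simp

lemma bounded_bilinear_cinner: "bounded_bilinear (cinner :: 'a::complex_hilbert_space => _)"
proof
 fix x y z :: 'a and r :: real
 show "cinner (x + y) z = cinner x z + cinner y z" by (rule cinner_add_left)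
 show "cinner z (x + y) = cinner z x + cinner z y" by (rule cinner_add_right)
 show "cinner (r *\<^sub>R x) y = r *\<^sub>R cinner x y"
  unfolding scaleR_scaleC by (simp add: scaleR_conv_of_real)
 show "cinner x (r *\<^sub>R y) = r *\<^sub>R cinner x y"
  unfolding scaleR_scaleC by (simp add: scaleR_conv_of_real)
 show "EX K. ALL a b::'a. norm (cinner a b) <= norm a * norm b * K"
  by (intro exI[of _ 1]) (simp add: norm_cinner_le)
qed

interpretation cinner: bounded_bilinear cinner
 by (rule bounded_bilinear_cinner)

lemma bounded_bilinear_scaleC: "bounded_bilinear (scaleC :: _ => 'a::complex_hilbert_space => _)"
proof
 fix x y :: 'a and a b :: complex and r :: real
 show "(a + b) *c x = a *c x + b *c x" by (rule scaleC_add_left)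
 show "a *c (x + y) = a *c x + a *c y" by (rule scaleC_add_right)
 show "(r *\<^sub>R a) *c x = r *\<^sub>R (a *c x)" unfolding scaleR_scaleC by (simp add: scaleR_conv_of_real)
 show "a *c (r *\<^sub>R x) = r *\<^sub>R (a *c x)" unfolding scaleR_scaleC by (simp add: mult.commute)
 show "EX K. ALL a (b::'a). norm (a *c b) <= norm a * norm b * K"
  by (intro exI[of _ 1]) simp
qed

interpretation scaleC: bounded_bilinear scaleC
 by (rule bounded_bilinear_scaleC)

lemmas cinner_simps = cinner_add_left cinner_add_right cinner.diff_left cinner.diff_right

declare cinner.zero_left [simp] cinner.zero_right [simp] cinner.minus_left [simp]
 cinner.minus_right [simp] scaleC.minus_left [simp] scaleC.minus_right [simp]

lemma cinner_ext:
 assumes "!!z. cinner z x = cinner z y"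
 shows "x = y"
proof -
 have "cinner (x - y) (x - y) = 0" using assms[of "x - y"] by (simp add: cinner.diff_right)
 thus ?thesis by (simp add: cinner_self)
qed

lemma cinner_ext_left:
 assumes "!!z. cinner x z = cinner y z"
 shows "x = y"
 by (rule cinner_ext) (metis assms cinner_commute)

lemma norm_add_sq: "(norm (x + y))^2 = (norm x)^2 + 2 * Re (cinner x y) + (norm (y::'a::complex_hilbert_space))^2"
 unfolding inner_eq_Re_cinner[symmetric] power2_norm_eq_inner
 by (simp add: inner_add_left inner_add_right inner_commute)

lemma norm_diff_sq: "(norm (x - y))^2 = (norm x)^2 - 2 * Re (cinner x y) + (norm (y::'a::complex_hilbert_space))^2"
 using norm_add_sq[of x "- y"] by simp

lemma complex_Cauchy_imp_limit:
 fixes f :: "nat => 'a::complete_space"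
 assumes "Cauchy f" obtains l where "f ~> l"
 using assms Cauchy_convergent_iff convergent_def by metis

subsection \<open>Bounded operators\<close>

lemma bcl_iff: "bcl a <-> (ALL x y. a (x + y) = a x + a y) & (ALL c x. a (c *c x) = c *c a x)
  & (EX C. ALL x. norm (a x) <= C * norm x)"
proof
 assume "bcl a"
 thus "(ALL x y. a (x + y) = a x + a y) & (ALL c x. a (c *c x) = c *c a x)
  & (EX C. ALL x. norm (a x) <= C * norm x)"
  unfolding bounded_clinear_def
  by (metis bounded_linear.nonneg_bounded linear_simps(1) mult.commute)
next
 assume *: "(ALL x y. a (x + y) = a x + a y) & (ALL c x. a (c *c x) = c *c a x)
  & (EX C. ALL x. norm (a x) <= C * norm x)"
 then obtain C where "ALL x. norm (a x) <= C * norm x" by blast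
 hence "bounded_linear a"
  using * by (intro bounded_linear_intro[of _ C]) (auto simp: scaleR_scaleC mult.commute)
 thus "bcl a" unfolding bounded_clinear_def using * by blast
qed

lemma bclI:
 assumes "!!x y. a (x + y) = a x + a y" "!!c x. a (c *c x) = c *c a x"
  "!!x. norm (a x) <= C * norm x"
 shows "bcl a"
 unfolding bcl_iff using assms by blast

lemma bcl_add: "bcl a ==> a (x + y) = a x + a y"
 and bcl_scale: "bcl a ==> a (c *c x) = c *c a x"
 unfolding bcl_iff by auto

lemma bcl_linear: "bcl a ==> bounded_linear a"
 unfolding bounded_clinear_def by blast

lemma bcl_zero: "bcl a ==> a 0 = 0"
 and bcl_diff: "bcl a ==> a (x - y) = a x - a y"
 and bcl_minus: "bcl a ==> a (- x) = - a x"
 and bcl_scaleR: "bcl a ==> a (r *\<^sub>R x) = r *\<^sub>R a x"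
 by (auto dest!: bcl_linear simp: linear_simps)

lemma bcl_sum: "bcl a ==> a (sum f I) = (\<Sum>i\<in>I. a (f i))"
 using bcl_linear bounded_linear.linear linear_sum by blast

lemma bcl_bound: assumes "bcl a" obtains C where "C > 0" "!!x. norm (a x) <= C * norm x"
 using bounded_linear.pos_bounded[OF bcl_linear[OF assms]] by (auto simp: mult.commute)

lemma bcl_tendsto: "bcl a ==> (f \<longlongrightarrow> l) F ==> ((%x. a (f x)) \<longlongrightarrow> a l) F"
 using bounded_linear.tendsto bcl_linear by blast

lemmas bcl_simps = bcl_add bcl_scale bcl_zero bcl_diff bcl_minus

lemma bcl_id [simp]: "bcl id" "bcl (%x. x)"
 by (rule bclI[of _ 1]; simp)+

lemma bcl_0 [simp]: "bcl (%x. 0)"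
 by (rule bclI[of _ 0]) auto

lemma bcl_comp: assumes "bcl a" "bcl b"
 shows "bcl (a \<circ> b)" "bcl (%x. a (b x))"
proof -
 obtain C D where C: "C > 0" "!!x. norm (a x) <= C * norm x" and D: "!!x. norm (b x) <= D * norm x"
  using assms bcl_bound by metis
 show "bcl (%x. a (b x))"
 proof (rule bclI[of _ "C * D"])
  fix x show "norm (a (b x)) <= C * D * norm x"
  using order_trans[OF C(2)[of "b x"] mult_left_mono[OF D[of x], of C]] C(1) by (simp add: mult.assoc)
 qed (use assms in \<open>simp_all add: bcl_simps\<close>)
 thus "bcl (a \<circ> b)" by (simp add: comp_def)
qed

lemma bcl_plus: assumes "bcl a" "bcl b" shows "bcl (%x. a x + b x)"
 using assms unfolding bounded_clinear_def by (auto intro: bounded_linear_add simp: scaleC_add_right)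

lemma bcl_scaleC: assumes "bcl a" shows "bcl (%x. c *c a x)"
proof -
 obtain C where C: "!!x. norm (a x) <= C * norm x" using assms bcl_bound by metis
 show ?thesis
 proof (rule bclI[of _ "cmod c * C"])
  fix x show "norm (c *c a x) <= cmod c * C * norm x"
  using mult_left_mono[OF C[of x], of "cmod c"] by (simp add: mult.assoc)
 qed (use assms in \<open>simp_all add: bcl_simps scaleC_add_right mult.commute\<close>)
qed

lemma bcl_uminus: "bcl a ==> bcl (%x. - a x)"
 using bcl_scaleC[of a "-1"] by simp

lemma bcl_minusop: assumes "bcl a" "bcl b" shows "bcl (%x. a x - b x)"
 using bcl_plus[OF assms(1) bcl_uminus[OF assms(2)]] by simp

lemma bcl_sumop: "(!!i. i : I ==> bcl (f i)) ==> bcl (%x. \<Sum>i\<in>I. f i x)"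
 by (induction I rule: infinite_finite_induct) (auto intro: bcl_plus)

lemmas bcl_intros = bcl_id bcl_0 bcl_plus bcl_scaleC bcl_uminus bcl_minusop bcl_sumop

lemma bcl_limit:
 assumes a: "!!n. bcl (f n)" and l: "!!x. (%n. f n x) ~> g x"
  and C: "!!n x. norm (f n x) <= C * norm x"
 shows "bcl g"
proof (rule bclI[of _ C])
 fix x y c
 show "g (x + y) = g x + g y"
  using LIMSEQ_unique[OF l[of "x + y"]] tendsto_add[OF l[of x] l[of y]] by (simp add: bcl_add[OF a])
 show "g (c *c x) = c *c g x"
  using LIMSEQ_unique[OF l[of "c *c x"]] scaleC.tendsto[OF tendsto_const l[of x]]
  by (simp add: bcl_scale[OF a])
 show "norm (g x) <= C * norm x"
  by (rule tendsto_upperbound[OF tendsto_norm[OF l[of x]]]) (use C in auto)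
qed

text \<open>Minimizing \<open>\<parallel>x\<parallel>\<^sup>2 - 2 f x\<close> over the subspace yields orthogonal projections (\<open>f\<close> an inner product)
  and the Riesz representation (\<open>K\<close> the whole space) at once.\<close>

lemma riesz_subspace:
 fixes f :: "'a::{real_inner,complete_space} => real"
 assumes K: "subspace K" "closed K" and f: "bounded_linear f"
 shows "EX u:K. ALL y:K. inner u y = f y"
proof -
 define J where "J x = (norm x)^2 - 2 * f x" for x
 obtain C where C: "!!x. \<bar>f x\<bar> <= norm x * C" using bounded_linear.bounded[OF f] by auto
 have lb: "J x >= - (C^2)" for x
  using C[of x] zero_le_power2[of "norm x - C"] unfolding J_def power2_diff by (simp add: abs_le_iff)
 have bdd: "bdd_below (J ` K)" using lb by (intro bdd_belowI2)
 define m where "m = Inf (J ` K)"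
 have 0: "0 : K" using K(1) subspace_0 by blast
 have m: "m <= J x" if "x : K" for x unfolding m_def using bdd that by (intro cINF_lower)
 have "EX x:K. J x < m + inverse (real (Suc n))" for n
  using cInf_lessD[of "J ` K" "m + inverse (real (Suc n))"] 0 unfolding m_def by auto
 then obtain X where X: "!!n. X n : K" "!!n. J (X n) < m + inverse (real (Suc n))" by metis
 \<comment> \<open>Parallelogram law: the midpoint stays in \<open>K\<close>, so near-minimizers of
   \<open>J\<close> are close together.\<close>
 have par: "(norm (x - y))^2 <= 2 * (J x - m) + 2 * (J y - m)" if "x : K" "y : K" for x y
 proof -
  have "(1/2) *\<^sub>R (x + y) : K" using K(1) that subspace_add subspace_scale by blast
  hence "m <= J ((1/2) *\<^sub>R (x + y))" by (rule m)
  moreover have "4 * J ((1/2) *\<^sub>R (x + y)) = (norm (x + y))^2 - 4 * (f x + f y)"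
  unfolding J_def using f by (simp add: linear_simps power_mult_distrib power_divide algebra_simps flip: scaleR_add_right)
  moreover have "(norm (x - y))^2 + (norm (x + y))^2 = 2 * (norm x)^2 + 2 * (norm y)^2"
  by (simp add: power2_norm_eq_inner inner_diff inner_add inner_commute)
  ultimately have "(norm (x - y))^2 <= 2 * (norm x)^2 + 2 * (norm y)^2 - 4 * m - 4 * (f x + f y)"
  by linarith
  thus ?thesis unfolding J_def by (simp add: algebra_simps)
 qed
 have "Cauchy X"
 proof (rule metric_CauchyI)
  fix e :: real assume e: "0 < e"
  obtain N where N: "inverse (real (Suc N)) < e^2 / 4"
  using reals_Archimedean[of "e^2/4"] e by auto
  have small: "J (X n) - m < e^2/4" if "n >= N" for n
  proof -
  have "inverse (real (Suc n)) <= inverse (real (Suc N))" using that by (intro le_imp_inverse_le) auto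
  thus ?thesis using X(2)[of n] N by linarith
  qed
  have "dist (X a) (X b) < e" if "a >= N" "b >= N" for a b
  proof -
  have "(norm (X a - X b))^2 < e^2"
  using par[OF X(1) X(1), of a b] small[OF that(1)] small[OF that(2)] by argo
  thus ?thesis using e by (simp add: dist_norm power2_less_imp_less)
  qed
  thus "EX M. ALL m>=M. ALL n>=M. dist (X m) (X n) < e" by blast
 qed
 then obtain u where u: "X ~> u" by (rule complex_Cauchy_imp_limit)
 have uK: "u : K" using K(2) X(1) u closed_sequentially by blast
 have "(%n. J (X n)) ~> J u" unfolding J_def
  by (intro tendsto_intros u bounded_linear.tendsto[OF f])
 hence Ju: "J u <= m + 0"
  by (rule LIMSEQ_le[OF _ tendsto_add[OF tendsto_const LIMSEQ_inverse_real_of_nat]])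
  (use X(2) less_imp_le in blast)
 have "inner u y = f y" if y: "y : K" for y
 proof -
  define b where "b = inner u y - f y"
  have ineq: "0 <= 2 * t * b + t^2 * (norm y)^2" for t
  proof -
  have "u + t *\<^sub>R y : K" using K(1) uK y subspace_add subspace_scale by blast
  hence "J u <= J (u + t *\<^sub>R y)" using m Ju by fastforce
  moreover have "(norm (u + t *\<^sub>R y))^2 = (norm u)^2 + 2 * t * inner u y + t^2 * (norm y)^2"
  unfolding power2_norm_eq_inner
  by (simp add: inner_add inner_commute algebra_simps) (simp add: power2_eq_square)
  ultimately show ?thesis unfolding J_def b_def using f
  by (simp add: linear_simps algebra_simps)
  qed
  have "b = 0"
  proof (rule ccontr)
  assume b: "b ~= 0"
  define N where "N = (norm y)^2 + 1"
  \<comment> \<open>The summand 1 keeps \<open>N\<close> positive even for \<open>y = 0\<close>; at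
    this \<open>t\<close> the quadratic is at most \<open>- b^2 / N\<close>.\<close>
  define t where "t = - b / N"
  have pos: "N > 0" by (simp add: N_def add_nonneg_pos)
  have "2 * t * b + t^2 * (norm y)^2 <= 2 * t * b + t^2 * N"
  unfolding N_def by (intro add_left_mono mult_left_mono) auto
  also have "... = - (b^2) / N"
  unfolding t_def using pos by (simp add: power2_eq_square field_simps)
  also have "... < 0" using b pos by (simp add: divide_neg_pos)
  finally show False using ineq[of t] by linarith
  qed
  thus ?thesis by (simp add: b_def)
 qed
 thus ?thesis using uK by blast
qed

text \<open>A complex-linear functional is determined by its real part, so the real representation
  on the whole space suffices; the imaginary part is recovered by testing with
  \<open>i y\<close>.\<close>

lemma riesz:
 fixes g :: "'a::complex_hilbert_space => complex"
 assumes g: "bounded_linear g" "!!c x. g (c *c x) = c * g x"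
 shows "EX u. ALL x. g x = cinner u x"
proof -
 have "bounded_linear (%x. Re (g x))"
  using bounded_linear_compose[OF bounded_linear_Re g(1)] by (simp add: comp_def)
 from riesz_subspace[OF subspace_UNIV closed_UNIV this]
 obtain u where u: "!!y. inner u y = Re (g y)" by auto
 have "g x = cinner u x" for x
 proof (rule complex_eqI)
  show "Re (g x) = Re (cinner u x)" using u[of x] by (simp add: inner_eq_Re_cinner)
  show "Im (g x) = Im (cinner u x)"
  using u[of "\<i> *c x"] by (simp add: inner_eq_Re_cinner g(2))
 qed
 thus ?thesis by blast
qed

text \<open>Riesz representation in the first argument, one vector \<open>a y\<close> for each
  \<open>y\<close>. Adjoints are the case of the form \<open>cinner (a x) y\<close>.\<close>

lemma form_operator:
 fixes B :: "'a::complex_hilbert_space => 'b::complex_hilbert_space => complex"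
 assumes add1: "!!x y z. B (x + y) z = B x z + B y z"
  and scale1: "!!c x z. B (c *c x) z = cnj c * B x z"
  and add2: "!!x y z. B x (y + z) = B x y + B x z"
  and scale2: "!!c x y. B x (c *c y) = c * B x y"
  and bound: "!!x y. cmod (B x y) <= C * norm x * norm y" and bound0: "C >= 0"
 shows "EX a. bcl a & (ALL x y. cinner x (a y) = B x y)"
proof -
 have "EX u. ALL x. cnj (B x y) = cinner u x" for y
 proof (rule riesz)
  show "bounded_linear (%x. cnj (B x y))"
  proof (rule bounded_linear_intro[of _ "C * norm y"])
  fix x z r
  show "cnj (B (x + z) y) = cnj (B x y) + cnj (B z y)" by (simp add: add1)
  show "cnj (B (r *\<^sub>R x) y) = r *\<^sub>R cnj (B x y)"
  by (simp add: scaleR_scaleC scale1) (simp add: scaleR_conv_of_real)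
  show "norm (cnj (B x y)) <= norm x * (C * norm y)"
  using bound[of x y] by (simp add: algebra_simps)
  qed
 qed (simp add: scale1)
 then obtain a where a: "!!x y. cnj (B x y) = cinner (a y) x" by metis
 have a': "cinner x (a y) = B x y" for x y
  by (metis a cinner_commute complex_cnj_cnj)
 have C: "norm (a y) <= C * norm y" for y
 proof (cases "a y = 0")
  case False
  have "norm (a y) * norm (a y) = cmod (B (a y) y)"
  unfolding a'[symmetric] cinner_self by (simp add: norm_mult power2_eq_square)
  also have "... <= C * norm (a y) * norm y" by (rule bound)
  finally have "norm (a y) * norm (a y) <= norm (a y) * (C * norm y)" by (simp add: algebra_simps)
  thus ?thesis using False by simp
 next
  case True
  show ?thesis using bound0 True by simp
 qed
 have "bcl a"
 proof (rule bclI[of _ C])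
  show "a (x + y) = a x + a y" for x y
  by (rule cinner_ext) (simp add: a' add2 cinner_add_right)
  show "a (c *c x) = c *c a x" for c x
  by (rule cinner_ext) (simp add: a' scale2)
 qed (rule C)
 thus ?thesis using a' by blast
qed

lemma cadj_exists:
 assumes "bcl a"
 shows "EX b. bcl b & (ALL x y. cinner (a x) y = cinner x (b y))"
proof -
 obtain C where C: "C > 0" "!!x. norm (a x) <= C * norm x" using assms bcl_bound by metis
 have "EX b. bcl b & (ALL x y. cinner x (b y) = cinner (a x) y)"
 proof (rule form_operator)
  show "cmod (cinner (a x) y) <= C * norm x * norm y" for x y
  using norm_cinner_le[of "a x" y] mult_right_mono[OF C(2)[of x], of "norm y"] by simp
  show "C >= 0" using C(1) by simp
 qed (use assms in \<open>simp_all add: bcl_simps cinner_simps\<close>)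
 thus ?thesis by metis
qed

lemma cadj_unique:
 assumes "!!x y. cinner (a x) y = cinner x (b y)"
 shows "cadj a = b"
 unfolding cadj_def
proof (rule the_equality)
 show "ALL x y. cinner (a x) y = cinner x (b y)" using assms by blast
 fix c assume c: "ALL x y. cinner (a x) y = cinner x (c y)"
 show "c = b" by (rule ext, rule cinner_ext) (metis assms c)
qed

lemma cadj:
 assumes "bcl a"
 shows "bcl (cadj a)" "cinner (a x) y = cinner x (cadj a y)" "cinner (cadj a x) y = cinner x (a y)"
proof -
 obtain b where b: "bcl b" "!!x y. cinner (a x) y = cinner x (b y)"
  using cadj_exists[OF assms] by blast
 have "cadj a = b" by (rule cadj_unique) (rule b(2))
 thus "bcl (cadj a)" "cinner (a x) y = cinner x (cadj a y)" using b by auto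
 show "cinner (cadj a x) y = cinner x (a y)"
  using `cadj a = b` b(2) by (metis cinner_commute)
qed

lemma cadj_cadj [simp]: "bcl a ==> cadj (cadj a) = a"
 by (rule cadj_unique) (rule cadj(3))

lemma cadj_comp: "bcl a ==> bcl b ==> cadj (a \<circ> b) = cadj b \<circ> cadj a"
 by (rule cadj_unique) (simp add: cadj(2))

lemma cadj_id [simp]: "cadj id = id" "cadj (%x. x) = (%x. x)" by (rule cadj_unique; simp)+

lemma cadj_zero [simp]: "cadj (%x. 0) = (%x. 0)" by (rule cadj_unique) simp

lemma cadj_plus: "bcl a ==> bcl b ==> cadj (%x. a x + b x) = (%x. cadj a x + cadj b x)"
 by (rule cadj_unique) (simp add: cadj(2) cinner_simps)

lemma cadj_minus: "bcl a ==> bcl b ==> cadj (%x. a x - b x) = (%x. cadj a x - cadj b x)"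
 by (rule cadj_unique) (simp add: cadj(2) cinner_simps)

lemma cadj_scale: "bcl a ==> cadj (%x. c *c a x) = (%x. cnj c *c cadj a x)"
 by (rule cadj_unique) (simp add: cadj(2))

lemma cadj_norm_le:
 assumes a: "bcl a" and C: "!!x. norm (a x) <= C * norm x"
 shows "norm (cadj a x) <= C * norm x"
proof (cases "cadj a x = 0")
 case False
 have "norm (cadj a x) * norm (cadj a x) = cmod (cinner (cadj a x) (cadj a x))"
  by (simp add: cinner_self norm_mult power2_eq_square)
 also have "... = cmod (cinner (a (cadj a x)) x)" using cadj[OF a] by simp
 also have "... <= norm (a (cadj a x)) * norm x" by (rule norm_cinner_le)
 also have "... <= norm (cadj a x) * (C * norm x)"
  using mult_right_mono[OF C[of "cadj a x"], of "norm x"] by (simp add: algebra_simps)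
 finally show ?thesis using False by simp
next
 case True
 have "0 <= C * norm x" using C[of x] norm_ge_zero order_trans by blast
 thus ?thesis using True by simp
qed

lemma polarization:
 assumes a: "!!x y. a (x + y) = a x + a y" "!!c x. a (c *c x) = c *c a x"
 shows "4 * cinner x (a y) = cinner (x + y) (a (x + y)) - cinner (x - y) (a (x - y))
  - \<i> * cinner (x + \<i> *c y) (a (x + \<i> *c y)) + \<i> * cinner (x - \<i> *c y) (a (x - \<i> *c y))"
proof -
 have m: "a (x - y) = a x - a y" for x y
  using a(1)[of x "(-1) *c y"] a(2)[of "-1" y] by simp
 show ?thesis by (simp add: a m cinner_simps) (simp add: algebra_simps)
qed

lemma op_eqI:
 assumes a: "bcl a" and b: "bcl b"
  and q: "!!x. cinner x (a x) = cinner x (b x)"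
 shows "a = b"
proof (rule ext, rule cinner_ext)
 fix y z
 have "4 * cinner z (a y) = 4 * cinner z (b y)"
  unfolding polarization[of a, OF bcl_add[OF a] bcl_scale[OF a]]
  polarization[of b, OF bcl_add[OF b] bcl_scale[OF b]] q ..
 thus "cinner z (a y) = cinner z (b y)" by simp
qed

lemma selfadj_iff_real:
 assumes a: "bcl a"
 shows "cadj a = a <-> (ALL x. cinner x (a x) : \<real>)"
proof
 assume *: "cadj a = a"
 show "ALL x. cinner x (a x) : \<real>"
 proof
  fix x
  have "cinner x (a x) = cinner (a x) x" using cadj(2)[OF a, of x x] * by simp
  also have "... = cnj (cinner x (a x))" by (rule cinner_commute)
  finally show "cinner x (a x) : \<real>" by (metis Reals_cnj_iff)
 qed
next
 assume *: "ALL x. cinner x (a x) : \<real>"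
 show "cadj a = a"
 proof (rule op_eqI[OF cadj(1)[OF a] a])
  fix x
  have "cinner x (cadj a x) = cinner (a x) x" using cadj(2)[OF a] by simp
  also have "... = cnj (cinner x (a x))" by (rule cinner_commute)
  also have "... = cinner x (a x)" using * by (simp add: Reals_cnj_iff)
  finally show "cinner x (cadj a x) = cinner x (a x)" .
 qed
qed

lemma selfadj_swap: "bcl a ==> cadj a = a ==> cinner (a x) y = cinner x (a y)"
 using cadj(2) by metis

text \<open>On unit vectors the four squared norms in the polarization identity add up to 8;
  division by 4 leaves the factor 2. This turns bounds on quadratic forms into operator
  bounds.\<close>

lemma numeric_radius:
 assumes a: "bcl a" and q: "!!x. cmod (cinner x (a x)) <= C * (norm x)^2"
 shows "norm (a x) <= 2 * C * norm x"
proof -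
 have unit: "cmod (cinner x (a y)) <= 2 * C" if "norm x = 1" "norm y = 1" for x y
 proof -
  have "4 * cmod (cinner x (a y)) = cmod (4 * cinner x (a y))" by (simp add: norm_mult)
  also have "... <= cmod (cinner (x + y) (a (x + y))) + cmod (cinner (x - y) (a (x - y)))
  + cmod (cinner (x + \<i> *c y) (a (x + \<i> *c y))) + cmod (cinner (x - \<i> *c y) (a (x - \<i> *c y)))"
  unfolding polarization[of a, OF bcl_add[OF a] bcl_scale[OF a]]
  by (rule norm_triangle_le norm_triangle_le_diff add_mono order_refl | simp add: norm_mult)+
  also have "... <= C * (norm (x + y))^2 + C * (norm (x - y))^2 + C * (norm (x + \<i> *c y))^2 + C * (norm (x - \<i> *c y))^2"
  by (intro add_mono q)
  also have "... = C * 8"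
  unfolding norm_add_sq norm_diff_sq using that by (simp add: norm_scaleC algebra_simps)
  finally show ?thesis by simp
 qed
 show ?thesis
 proof (cases "x = 0 \<or> a x = 0")
  case True
  have "0 <= C * (norm x)^2" using q[of x] norm_ge_zero order_trans by blast
  hence "0 <= C \<or> x = 0" by (metis mult_le_0_iff norm_eq_zero power2_less_eq_zero_iff zero_le_mult_iff zero_le_power2)
  thus ?thesis using True bcl_zero[OF a] by auto
 next
  case False
  have "cmod (cinner (sgn (a x)) (a (sgn x))) <= 2 * C" using unit False by (simp add: norm_sgn)
  also have "cinner (sgn (a x)) (a (sgn x)) = cr (norm (a x) / norm x)"
  unfolding sgn_div_norm bcl_scaleR[OF a] cinner.scaleR_left cinner.scaleR_right cinner_self
  using False by (simp add: scaleR_conv_of_real power2_eq_square field_simps)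
  finally have "norm (a x) / norm x <= 2 * C" by (simp add: norm_divide)
  thus ?thesis using False by (simp add: field_simps)
 qed
qed

subsection \<open>Projections\<close>

definition csubspace :: "'a::complex_hilbert_space set => bool"
 where "csubspace K <-> 0 : K & (ALL x:K. ALL y:K. x + y : K) & (ALL c. ALL x:K. c *c x : K)"

lemma csubspaceD:
 assumes "csubspace K"
 shows "0 : K" "x : K ==> y : K ==> x + y : K" "x : K ==> c *c x : K" "x : K ==> y : K ==> x - y : K"
proof -
 show "0 : K" using assms by (simp add: csubspace_def)
 show sc: "x : K ==> c *c x : K" for x c using assms by (simp add: csubspace_def)
 show ad: "x : K ==> y : K ==> x + y : K" for x y using assms by (simp add: csubspace_def)
 show "x : K ==> y : K ==> x - y : K" using ad[of x "(-1) *c y"] sc[of y "-1"] by simp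
qed

lemma csubspace_subspace: "csubspace K ==> subspace K"
 unfolding csubspace_def subspace_def scaleR_scaleC by blast

lemma csubspace_closure:
 assumes "csubspace K" shows "csubspace (closure K)"
 unfolding csubspace_def
proof (intro conjI ballI allI)
 show "0 : closure K" using assms closure_subset csubspaceD(1) by blast
next
 fix x y assume "x : closure K" "y : closure K"
 then obtain f g where "ALL n. f n : K" "f ~> x" "ALL n. g n : K" "g ~> y"
  unfolding closure_sequential by blast
 hence "ALL n. f n + g n : K" "(%n. f n + g n) ~> x + y"
  using csubspaceD[OF assms] by (auto intro: tendsto_add)
 thus "x + y : closure K" unfolding closure_sequential by (intro exI[of _ "%n. f n + g n"]) blast
next
 fix c x assume "x : closure K"
 then obtain f where "ALL n. f n : K" "f ~> x" unfolding closure_sequential by blast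
 hence "ALL n. c *c f n : K" "(%n. c *c f n) ~> c *c x"
  using csubspaceD[OF assms] by (auto intro: scaleC.tendsto)
 thus "c *c x : closure K" unfolding closure_sequential by (intro exI[of _ "%n. c *c f n"]) blast
qed

lemma projI:
 assumes "bcl p" "!!x. p (p x) = p x" "!!x y. cinner (p x) y = cinner x (p y)"
 shows "projop p"
 unfolding projection_op_def using assms(1,2) cadj_unique[of p p, OF assms(3)] by (auto simp: fun_eq_iff)

lemma projD:
 assumes "projop p"
 shows "bcl p" "p (p x) = p x" "cadj p = p" "cinner (p x) y = cinner x (p y)"
  "cinner x (p x) = cr ((norm (p x))^2)" "norm (p x) <= norm x"
  "(norm x)^2 = (norm (p x))^2 + (norm (x - p x))^2"
proof -
 show b: "bcl p" and a: "cadj p = p" and pq: "!!x. p (p x) = p x"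
  using assms unfolding projection_op_def fun_eq_iff by auto
 show sw: "!!x y. cinner (p x) y = cinner x (p y)" using cadj(2)[OF b] a by metis
 show form: "cinner x (p x) = cr ((norm (p x))^2)"
  using sw[of x "p x"] by (simp add: pq cinner_self)
 show pyth: "(norm x)^2 = (norm (p x))^2 + (norm (x - p x))^2"
  unfolding norm_diff_sq using form by simp
 have "(norm (p x))^2 <= (norm x)^2" unfolding pyth by simp
 thus "norm (p x) <= norm x" by (rule power2_le_imp_le) simp
qed

lemma proj_id [simp]: "projop id" "projop (%x. x)"
 by (rule projI; simp)+

lemma proj_compl: assumes "projop p" shows "projop (%x. x - p x)"
 using projD(1,2,4)[OF assms] by (intro projI) (auto intro!: bcl_intros simp: bcl_simps cinner_simps)

lemma proj_eqI:
 assumes p: "projop p" and q: "projop q" and n: "!!x. norm (p x) = norm (q x)"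
 shows "p = q"
 using projD(1,5)[OF p] projD(1,5)[OF q] n by (intro op_eqI) auto

lemma projection_exists:
 assumes K: "csubspace K" "closed K"
 shows "EX p. projop p & range p = K & (ALL x. ALL y:K. cinner y (x - p x) = 0)"
proof -
 have "EX u:K. ALL y:K. inner u y = inner x y" for x
  by (rule riesz_subspace[OF csubspace_subspace[OF K(1)] K(2) bounded_linear_inner_right])
 then obtain p where p: "!!x. p x : K" "!!x y. y : K ==> inner (p x) y = inner x y" by metis
 have orth: "cinner y (x - p x) = 0" if y: "y : K" for x y
 proof (rule complex_eqI)
  have re: "Re (cinner z (x - p x)) = 0" if "z : K" for z
  using p(2)[OF that, of x] by (simp add: inner_eq_Re_cinner[symmetric] inner_diff inner_commute)
  show "Re (cinner y (x - p x)) = Re 0" using re[OF y] by simp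
  show "Im (cinner y (x - p x)) = Im 0"
  using re[of "\<i> *c y"] csubspaceD(3)[OF K(1) y] by simp
 qed
 have uniq: "u = p x" if "u : K" "!!y. y : K ==> cinner y (x - u) = 0" for u x
 proof -
  have d: "u - p x : K" using csubspaceD(4)[OF K(1)] that(1) p(1) by blast
  have "cinner (u - p x) ((x - p x) - (x - u)) = 0"
  unfolding cinner.diff_right[of _ "x - p x"] using that(2)[OF d] orth[OF d, of x] by simp
  hence "cinner (u - p x) (u - p x) = 0" by simp
  thus ?thesis by (simp add: cinner_self)
 qed
 have fix1: "p u = u" if "u : K" for u using uniq[OF that, of u] by simp
 have sw: "cinner (p x) y = cinner x (p y)" for x y
 proof -
  have "cinner (p x) y = cinner (p x) (p y)" using orth[OF p(1)[of x], of y] by (simp add: cinner_simps)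
  also have "... = cnj (cinner (p y) (p x))" by (rule cinner_commute)
  also have "cinner (p y) (p x) = cinner (p y) x" using orth[OF p(1)[of y], of x] by (simp add: cinner_simps)
  also have "cnj (cinner (p y) x) = cinner x (p y)" by (rule cinner_commute[symmetric])
  finally show ?thesis .
 qed
 have "bcl p"
 proof (rule bclI[of _ 1])
  fix x y c
  show "p (x + y) = p x + p y" by (rule cinner_ext) (metis sw cinner_add_right)
  show "p (c *c x) = c *c p x" by (rule cinner_ext) (metis sw cinner_scaleC_right)
  have "(norm (p x))^2 <= (norm x)^2"
  using norm_add_sq[of "p x" "x - p x"] orth[OF p(1)[of x], of x] by simp
  thus "norm (p x) <= 1 * norm x" unfolding mult_1 by (rule power2_le_imp_le) simp
 qed
 hence "projop p" by (rule projI) (rule fix1[OF p(1)], rule sw)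
 moreover have "range p = K" using fix1 p(1) by (metis (no_types) image_iff subsetI subset_antisym UNIV_I image_subset_iff)
 ultimately show ?thesis using orth by blast
qed

lemma proj_range:
 assumes p: "projop p"
 shows "csubspace (range p)" "closed (range p)" "x : range p <-> p x = x"
proof -
 note P = projD[OF p]
 show x: "x : range p <-> p x = x" for x using P(2) by (metis rangeE rangeI)
 show "csubspace (range p)"
  unfolding csubspace_def x using bcl_simps[OF P(1)] P(2) by auto
 show "closed (range p)"
  unfolding closed_sequential_limits x
 proof (intro allI impI)
  fix f l assume f: "(ALL n. p (f n) = f n) & f ~> l"
  hence "(%n. p (f n)) ~> p l" using bcl_tendsto[OF P(1)] by blast
  thus "p l = l" using f LIMSEQ_unique by auto
 qed
qed

subsection \<open>Positive operators and the sign of a self-adjoint contraction\<close>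

definition posop :: "('a::complex_hilbert_space => 'a) => bool"
 where "posop a <-> bcl a & (ALL x. cinner x (a x) : \<real>\<^sub>\<ge>\<^sub>0)"

lemma posopD: assumes "posop a" shows "bcl a" "cinner x (a x) : \<real>\<^sub>\<ge>\<^sub>0" "0 <= Re (cinner x (a x))"
 "cadj a = a" "cinner (a x) y = cinner x (a y)"
proof -
 show b: "bcl a" and c: "!!x. cinner x (a x) : \<real>\<^sub>\<ge>\<^sub>0" using assms by (auto simp: posop_def)
 show "0 <= Re (cinner x (a x))" using c[of x] by (simp add: complex_nonneg_Reals_iff)
 show a: "cadj a = a" using selfadj_iff_real[OF b] c nonneg_Reals_subset_Reals by blast
 show "cinner (a x) y = cinner x (a y)" using selfadj_swap[OF b a] .
qed

lemma posopI:
 assumes "bcl a" "!!x y. cinner (a x) y = cinner x (a y)" "!!x. 0 <= Re (cinner x (a x))"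
 shows "posop a"
proof -
 have "cadj a = a" using cadj_unique assms(2) by blast
 hence "cinner x (a x) : \<real>" for x using assms(1) selfadj_iff_real by blast
 thus ?thesis using assms(1,3) by (auto simp: posop_def complex_nonneg_Reals_iff complex_is_Real_iff)
qed

lemma posop_add: "posop a ==> posop b ==> posop (%x. a x + b x)"
 unfolding posop_def by (auto intro: bcl_plus nonneg_Reals_add_I simp: cinner_add_right)

lemma posop_scale: "posop a ==> 0 <= r ==> posop (%x. cr r *c a x)"
 unfolding posop_def by (auto intro!: bcl_scaleC nonneg_Reals_mult_I)

text \<open>Positivity is tested at \<open>C x - a x\<close>, and the term containing
  \<open>a (a x)\<close> is estimated by the upper bound \<open>C\<close>.\<close>

lemma posop_bound:
 assumes a: "posop a" and C: "0 < C" "!!x. Re (cinner x (a x)) <= C * (norm x)^2"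
 shows "(norm (a x))^2 <= C * Re (cinner x (a x))" "norm (a x) <= C * norm x"
proof -
 note A = posopD[OF a]
 let ?d = "cr C *c x - a x"
 have 1: "0 <= Re (cinner ?d (a ?d))" by (rule A(3))
 have 2: "Re (cinner (a x) (a (a x))) <= C * (norm (a x))^2" by (rule C(2))
 have e: "cinner x (a (a x)) = cr ((norm (a x))^2)" using A(5)[of x "a x"] by (simp add: cinner_self)
 have e2: "cinner (a x) (a x) = cr ((norm (a x))^2)" by (simp add: cinner_self)
 have "Re (cinner ?d (a ?d)) = C * (C * Re (cinner x (a x))) - 2 * (C * (norm (a x))^2) + Re (cinner (a x) (a (a x)))"
  by (simp add: bcl_simps[OF A(1)] cinner_simps e e2 algebra_simps del: of_real_power)
 hence "C * (norm (a x))^2 <= C * (C * Re (cinner x (a x)))" using 1 2 by linarith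
 thus 3: "(norm (a x))^2 <= C * Re (cinner x (a x))" using C(1) by simp
 also have "... <= C * (C * (norm x)^2)" using C(1) C(2)[of x] by simp
 finally have "(norm (a x))^2 <= (C * norm x)^2" by (simp add: power2_eq_square algebra_simps)
 thus "norm (a x) <= C * norm x" by (rule power2_le_imp_le) (use C in simp)
qed

primrec riesz_iter :: "('a::complex_hilbert_space => 'a) => nat => 'a => 'a" where
 "riesz_iter a 0 = a"
| "riesz_iter a (Suc n) = (%x. riesz_iter a n x - riesz_iter a n (riesz_iter a n x))"

text \<open>F. Riesz: writing a positive contraction as a strongly convergent series of squares
  \<open>\<Sum>c\<^sub>k\<^sup>2\<close> with \<open>c\<^sub>k\<^sub>+\<^sub>1 = c\<^sub>k - c\<^sub>k\<^sup>2\<close> reduces the claim to \<open>c\<^sub>k b c\<^sub>k \<ge> 0\<close>.\<close>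

lemma posop_comp_contraction:
 assumes a: "posop a" "posop (%x. x - a x)" and b: "posop b" and comm: "!!x. a (b x) = b (a x)"
 shows "posop (%x. a (b x))"
proof -
 note B = posopD[OF b]
 define c where "c = riesz_iter a"
 have c: "posop (c n) & posop (%x. x - c n x) & (ALL x. c n (b x) = b (c n x))" for n
 proof (induction n)
  case 0 thus ?case using a comm by (simp add: c_def)
 next
  case (Suc n)
  hence p: "posop (c n)" and q: "posop (%x. x - c n x)" and co: "!!x. c n (b x) = b (c n x)" by auto
  note P = posopD[OF p] and Q = posopD[OF q]
  have S: "c (Suc n) = (%x. c n x - c n (c n x))" by (simp add: c_def)
  \<comment> \<open>In terms of numbers, \<open>c - c^2 = c (1 - c) c + (1 - c) c (1 - c)\<close>, a
    sum of two positive terms.\<close>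
  have e: "cinner x (c n x - c n (c n x)) =
  cinner (c n x) (c n x - c n (c n x)) + cinner (x - c n x) (c n (x - c n x))" for x
  by (simp add: bcl_simps[OF P(1)] cinner_simps P(5))
  have "posop (%x. c n x - c n (c n x))"
  unfolding posop_def e using P(2) Q(2) by (auto intro!: bcl_intros bcl_comp(2)[OF P(1)] P(1) nonneg_Reals_add_I)
  moreover have "posop (%x. (x - c n x) + c n (c n x))"
  proof (rule posop_add[OF q])
  show "posop (%x. c n (c n x))"
  by (auto simp: posop_def P(5)[symmetric] cinner_self intro!: bcl_comp(2)[OF P(1) P(1)])
  qed
  ultimately show ?case unfolding S by (simp add: co bcl_diff[OF B(1)] diff_diff_eq2 diff_add_eq)
 qed
 have cS: "c (Suc n) = (%x. c n x - c n (c n x))" for n by (simp add: c_def)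
 have c0: "c 0 = a" by (simp add: c_def)
 note P = posopD[OF conjunct1[OF c]]
 have tel: "(\<Sum>k<n. c k (c k x)) = a x - c n x" for n x
  by (induction n) (auto simp: c0 cS)
 \<comment> \<open>The squares telescope to \<open>a - c n\<close>, so their forms are summable and
   the remainder \<open>c n x\<close> tends to 0.\<close>
 have sq: "(\<Sum>k<n. (norm (c k x))^2) <= Re (cinner x (a x))" for n x
 proof -
  have "(\<Sum>k<n. (norm (c k x))^2) = Re (cinner x (\<Sum>k<n. c k (c k x)))"
  by (simp add: cinner.sum_right P(5)[symmetric] cinner_self)
  also have "... <= Re (cinner x (a x))" unfolding tel using P(3)[of x n] by (simp add: cinner_simps)
  finally show ?thesis .
 qed
 have "summable (%k. (norm (c k x))^2)" for x by (rule summableI_nonneg_bounded[OF _ sq]) simp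
 hence "(%k. (norm (c k x))^2) ~> 0" for x by (rule summable_LIMSEQ_zero)
 hence "(%k. sqrt ((norm (c k x))^2)) ~> sqrt 0" for x by (rule tendsto_real_sqrt)
 hence lim: "(%k. c k x) ~> 0" for x by (simp add: tendsto_norm_zero_iff)
 have "cinner x (a (b x)) : \<real>\<^sub>\<ge>\<^sub>0" for x
 proof (rule closed_sequentially[OF closed_nonneg_Reals_complex])
  show "(\<Sum>k<n. cinner (c k x) (b (c k x))) : \<real>\<^sub>\<ge>\<^sub>0" for n
  by (induction n) (auto intro!: nonneg_Reals_add_I B(2))
  have "(\<Sum>k<n. cinner (c k x) (b (c k x))) = cinner x (a (b x)) - cinner x (c n (b x))" for n
  proof -
  have "(\<Sum>k<n. cinner (c k x) (b (c k x))) = cinner x (\<Sum>k<n. c k (c k (b x)))"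
  using c by (simp add: cinner.sum_right P(5))
  thus ?thesis unfolding tel by (simp add: cinner_simps)
  qed
  moreover have "(%n. cinner x (a (b x)) - cinner x (c n (b x))) ~> cinner x (a (b x)) - cinner x 0"
  by (intro tendsto_intros cinner.tendsto lim)
  ultimately show "(%n. \<Sum>k<n. cinner (c k x) (b (c k x))) ~> cinner x (a (b x))" by simp
 qed
 thus ?thesis using bcl_comp(2)[OF posopD(1)[OF a(1)] B(1)] by (auto simp: posop_def)
qed

lemma posop_comp:
 assumes a: "posop a" and b: "posop b" and comm: "!!x. a (b x) = b (a x)"
 shows "posop (%x. a (b x))"
proof -
 note A = posopD[OF a]
 obtain C where C: "C > 0" "!!x. norm (a x) <= C * norm x" using A(1) bcl_bound by metis
 have q: "Re (cinner x (a x)) <= C * (norm x)^2" for x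
 proof -
  have "Re (cinner x (a x)) <= norm x * norm (a x)"
  using complex_Re_le_cmod norm_cinner_le order_trans by blast
  also have "... <= norm x * (C * norm x)" by (intro mult_left_mono C) simp
  finally show ?thesis by (simp add: power2_eq_square algebra_simps)
 qed
 let ?a = "%x. cr (1 / C) *c a x"
 have pa: "posop ?a" by (rule posop_scale[OF a]) (use C in simp)
 have "posop (%x. ?a (b x))"
 proof (rule posop_comp_contraction[OF pa _ b])
  show "posop (%x. x - ?a x)"
  proof (rule posopI)
  show "bcl (%x. x - ?a x)" by (intro bcl_intros A(1))
  show "cinner (x - ?a x) y = cinner x (y - ?a y)" for x y using A(5) by (simp add: cinner_simps)
  show "0 <= Re (cinner x (x - ?a x))" for x
  using q[of x] C(1) by (simp add: cinner_simps cinner_self field_simps)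
  qed
 qed (use comm posopD(1)[OF b] in \<open>simp add: bcl_simps\<close>)
 from posop_scale[OF this, of C] show ?thesis using C(1) by simp
qed

text \<open>Replaces the notion of a function of \<open>a\<close> as long as no functional calculus
  is available.\<close>

definition in_bicommutant :: "('a::complex_hilbert_space => 'a) => ('a => 'a) => bool"
 where "in_bicommutant a g <-> bcl g &
  (ALL c. bcl c --> (ALL x. c (a x) = a (c x)) --> (ALL x. c (g x) = g (c x)))"

text \<open>The Newton-Schulz iteration for the matrix sign function.\<close>

primrec sgn_iter :: "('a::complex_hilbert_space => 'a) => nat => 'a => 'a" where
 "sgn_iter a 0 = a"
| "sgn_iter a (Suc n) = (%x. (3/2) *c sgn_iter a n x - (1/2) *c sgn_iter a n (sgn_iter a n (sgn_iter a n x)))"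

text \<open>The numbers \<open>r n\<close> increase and are bounded, hence form a Cauchy sequence,
  and their increments control the squared distances. In the applications \<open>r n\<close> is a
  squared norm, its negative, or a quadratic form.\<close>

lemma quadratic_convergent:
 fixes f :: "nat => 'a::{real_normed_vector,complete_space}"
 assumes le: "!!m n. m <= n ==> (norm (f n - f m))^2 <= r n - r m" and B: "!!n. r n <= B"
 shows "convergent f"
proof (rule Cauchy_convergent, rule CauchyI')
 fix e :: real assume e: "0 < e"
 have "incseq r" using le[OF le_SucI[OF order_refl]] by (intro incseq_SucI) (metis diff_ge_0_iff_ge order_trans zero_le_power2)
 then obtain L where "r ~> L" using incseq_convergent[of r B] B by blast
 then obtain M where M: "!!m n. m >= M ==> n >= M ==> dist (r m) (r n) < e^2"
  using Cauchy_def[of r] LIMSEQ_imp_Cauchy[of r L] e by (meson zero_less_power)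
 have "dist (f m) (f n) < e" if "m >= M" "n > m" for m n
 proof -
  have "(norm (f n - f m))^2 < e^2" using le[of m n] M[of m n] that by (simp add: dist_real_def)
  thus ?thesis using e by (simp add: dist_norm norm_minus_commute power2_less_imp_less)
 qed
 thus "EX M. ALL m>=M. ALL n>m. dist (f m) (f n) < e" by blast
qed

text \<open>The iteration \<open>t \<mapsto> t (3 - t\<^sup>2) / 2\<close> moves every point of \<open>[-1, 1]\<close> monotonically to its sign.\<close>

lemma sign_operator:
 assumes a: "bcl a" and sa: "!!x y. cinner (a x) y = cinner x (a y)"
  and contr: "!!x. norm (a x) <= norm x"
 shows "EX w. in_bicommutant a w & (ALL x y. cinner (w x) y = cinner x (w y)) & (ALL x. w (w (w x)) = w x)
  & posop (%x. a (w x)) & (ALL x. w x = 0 <-> a x = 0)"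
proof -
 define X where "X = sgn_iter a"
 have X0: "X 0 = a" and XS: "X (Suc n) = (%x. (3/2) *c X n x - (1/2) *c X n (X n (X n x)))" for n
  by (simp_all add: X_def)
 have "in_bicommutant a (X n) & (ALL x y. cinner (X n x) y = cinner x (X n y)) & (ALL x. norm (X n x) <= norm x)" for n
 proof (induction n)
  case 0 thus ?case using a sa contr by (simp add: X0 in_bicommutant_def)
 next
  case (Suc n)
  hence b: "bcl (X n)" and s: "!!x y. cinner (X n x) y = cinner x (X n y)"
  and c: "!!x. norm (X n x) <= norm x" by (auto simp: in_bicommutant_def)
  have "in_bicommutant a (X (Suc n))"
  using Suc b unfolding in_bicommutant_def XS by (auto intro!: bcl_intros bcl_comp(2)[OF b] simp: bcl_simps)
  moreover have "cinner (X (Suc n) x) y = cinner x (X (Suc n) y)" for x y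
  unfolding XS by (simp add: cinner_simps s)
  \<comment> \<open>In terms of numbers, \<open>4 - t^2 (3 - t^2)^2 = (4 - t^2) (1 - t^2)^2\<close>,
    which is nonnegative on \<open>[-1, 1]\<close>; facts 4 and 5 below express exactly
    this.\<close>
  moreover have "norm (X (Suc n) x) <= norm x" for x
  proof -
  let ?v1 = "X n x" and ?v2 = "X n (X n x)" and ?v3 = "X n (X n (X n x))"
  have e: "Re (cinner y (X n (X n y))) = (norm (X n y))^2" for y
  unfolding s[symmetric, of y] cinner_self by simp
  have 1: "(norm (x - ?v2))^2 = (norm x)^2 - 2 * (norm ?v1)^2 + (norm ?v2)^2"
  unfolding norm_diff_sq e by simp
  have 2: "(norm (X n (x - ?v2)))^2 = (norm ?v1)^2 - 2 * (norm ?v2)^2 + (norm ?v3)^2"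
  unfolding bcl_diff[OF b] norm_diff_sq e by simp
  have 3: "4 * (norm (X (Suc n) x))^2 = 9 * (norm ?v1)^2 - 6 * (norm ?v2)^2 + (norm ?v3)^2"
  unfolding XS norm_diff_sq cinner_scaleC_left cinner_scaleC_right
  by (simp add: e power_mult_distrib power_divide norm_divide field_simps)
  have 4: "(norm (X n (x - ?v2)))^2 <= (norm (x - ?v2))^2" by (intro power_mono c) simp
  have 5: "0 <= (norm (x - ?v2))^2" by simp
  have "(norm (X (Suc n) x))^2 <= (norm x)^2" using 1 2 3 4 5 by argo
  thus ?thesis by (rule power2_le_imp_le) simp
  qed
  ultimately show ?case by blast
 qed
 hence bi: "!!n. in_bicommutant a (X n)" and s: "!!n x y. cinner (X n x) y = cinner x (X n y)"
  and c: "!!n x. norm (X n x) <= norm x" and b: "!!n. bcl (X n)" by (auto simp: in_bicommutant_def)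
 have Xa: "X n (a x) = a (X n x)" for n x using bi[of n] a unfolding in_bicommutant_def by metis
 have XX: "X n (X m x) = X m (X n x)" for n m x
  using bi[of m] b[of n] Xa unfolding in_bicommutant_def by metis
 \<comment> \<open>With this positive \<open>h m\<close> one step reads
   \<open>X (Suc m) = X m (1 + h m)\<close>.\<close>
 define h where "h m x = (1/2) *c (x - X m (X m x))" for m x
 have h: "posop (h m)" for m
 proof (rule posopI)
  show "bcl (h m)" unfolding h_def by (intro bcl_intros bcl_comp(2)[OF b] b)
  show "cinner (h m x) y = cinner x (h m y)" for x y unfolding h_def by (simp add: cinner_simps s)
  show "0 <= Re (cinner x (h m x))" for x
  proof -
  have "(norm (X m x))^2 <= (norm x)^2" by (intro power_mono c) simp
  thus ?thesis unfolding h_def by (simp add: cinner_simps s[symmetric] cinner_self)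
  qed
 qed
 \<comment> \<open>\<open>G\<close> is the product of the factors \<open>1 + h\<close> between the
   two indices, hence at least 1: the iterates grow in modulus and keep their sign.\<close>
 have ratio: "EX G. in_bicommutant a G & posop (%x. G x - x) & (ALL x. X (n + k) x = X n (G x))" for n k
 proof (induction k)
  case 0
  have "posop (%x. 0 :: 'a)" by (simp add: posop_def)
  thus ?case by (intro exI[of _ "%x. x"]) (simp add: in_bicommutant_def)
 next
  case (Suc k)
  then obtain G where G: "in_bicommutant a G" "posop (%x. G x - x)" "!!x. X (n + k) x = X n (G x)" by blast
  have Gb: "bcl G" using G(1) by (simp add: in_bicommutant_def)
  let ?h = "h (n + k)"
  have hb: "bcl ?h" using h posopD(1) by blast
  have hbi: "in_bicommutant a ?h"
  using bi[of "n+k"] hb unfolding in_bicommutant_def h_def by (auto simp: bcl_simps)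
  have "?h (a x) = a (?h x)" for x using hbi a unfolding in_bicommutant_def by metis
  hence comm: "G (?h x) = ?h (G x)" for x using G(1) hb unfolding in_bicommutant_def by metis
  have "posop (%x. (G (?h x) - ?h x) + ((G x - x) + ?h x))"
  using posop_comp[OF G(2) h, of "n + k"] comm
  by (intro posop_add G(2) h) (simp add: bcl_simps[OF hb])
  hence "posop (%x. G (x + ?h x) - x)" by (simp add: bcl_simps[OF Gb] algebra_simps)
  moreover have "in_bicommutant a (%x. G (x + ?h x))"
  using G(1) hbi hb Gb unfolding in_bicommutant_def by (auto intro!: bcl_intros bcl_comp(2)[OF Gb] simp: bcl_simps)
  moreover have "X (n + Suc k) x = X n (G (x + ?h x))" for x
  proof -
  have "X (n + Suc k) x = X (n + k) (x + ?h x)"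
  using scaleC_add_left[of 1 "1/2" "X (n + k) x"] unfolding add_Suc_right XS
  by (simp add: h_def bcl_simps[OF b] scaleC.diff_right algebra_simps)
  thus ?thesis unfolding G(3) .
  qed
  ultimately show ?case by (intro exI[of _ "%x. G (x + ?h x)"]) simp
 qed
 have mono: "(norm (X n x))^2 <= Re (cinner (X n x) (X (n + k) x))" for n k x
 proof -
  obtain G where G: "in_bicommutant a G" "posop (%x. G x - x)" "!!x. X (n + k) x = X n (G x)"
  using ratio by blast
  have Gb: "bcl G" using G(1) by (simp add: in_bicommutant_def)
  have "G (X n y) = X n (G y)" for y
  proof -
  have "X n (G y) = G (X n y)" using G(1) b[of n] Xa unfolding in_bicommutant_def by metis
  thus ?thesis by simp
  qed
  hence "Re (cinner (X n x) (X (n + k) x)) = Re (cinner (X n x) (G (X n x) - X n x)) + (norm (X n x))^2"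
  unfolding G(3) by (simp add: cinner_simps cinner_self)
  thus ?thesis using posopD(3)[OF G(2), of "X n x"] by simp
 qed
 have mono2: "(norm (X (n + k) x - X n x))^2 <= (norm (X (n + k) x))^2 - (norm (X n x))^2" for n k x
  using mono[of n x k] unfolding norm_diff_sq by (simp add: cinner_commute[of "X (n + k) x"])
 have inc: "incseq (%n. (norm (X n x))^2)" for x
 proof (rule incseq_SucI)
  show "(norm (X n x))^2 <= (norm (X (Suc n) x))^2" for n
  using mono2[of n 1 x] zero_le_power2[of "norm (X (n + 1) x - X n x)"] unfolding Suc_eq_plus1 by argo
 qed
 have conv: "convergent (%n. X n x)" for x
 proof -
  have "(norm (X n x))^2 <= (norm x)^2" for n by (intro power_mono c) simp
  thus ?thesis
  by (intro quadratic_convergent[of "%n. X n x" "%n. (norm (X n x))^2"]) (metis le_add_diff_inverse mono2)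
 qed
 define w where "w x = lim (%n. X n x)" for x
 have w: "(%n. X n x) ~> w x" for x using conv unfolding w_def by (simp add: convergent_LIMSEQ_iff)
 have wb: "bcl w" by (rule bcl_limit[OF b w, of 1]) (simp add: c)
 have wbi: "in_bicommutant a w"
  unfolding in_bicommutant_def
 proof (intro conjI allI impI wb)
  fix d x assume d: "bcl d" "ALL x. d (a x) = a (d x)"
  have "(%n. d (X n x)) ~> d (w x)" by (rule bcl_tendsto[OF d(1) w])
  moreover have "d (X n x) = X n (d x)" for n using bi[of n] d unfolding in_bicommutant_def by blast
  ultimately show "d (w x) = w (d x)" using w[of "d x"] LIMSEQ_unique by auto
 qed
 have wsa: "cinner (w x) y = cinner x (w y)" for x y
  by (rule LIMSEQ_unique[OF cinner.tendsto[OF w tendsto_const]])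
  (simp add: s cinner.tendsto[OF tendsto_const w])
 \<comment> \<open>The iterates are contractions, so strong limits may be taken inside
   products.\<close>
 have prod: "(%n. X n (f n)) ~> w l" if "f ~> l" for f l
 proof -
  have "(%n. X n (f n - l)) ~> 0"
  proof (rule Lim_null_comparison)
  show "(%n. norm (f n - l)) ~> 0" using that by (simp add: LIM_zero tendsto_norm_zero)
  qed (use c in auto)
  from tendsto_add[OF this w[of l]] show ?thesis by (simp add: bcl_diff[OF b])
 qed
 have w3: "w (w (w x)) = w x" for x
 proof -
  have "(%n. X (Suc n) x) ~> (3/2) *c w x - (1/2) *c w (w (w x))"
  unfolding XS by (intro tendsto_intros scaleC.tendsto prod w)
  moreover have "(%n. X (Suc n) x) ~> w x" using w[of x] by (rule LIMSEQ_Suc)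
  ultimately have "(3/2) *c w x - (1/2) *c w (w (w x)) = w x" by (rule LIMSEQ_unique)
  hence "(3/2) *c w x - w x = (1/2) *c w (w (w x))" by (simp add: algebra_simps)
  also have "(3/2) *c w x - w x = (1/2) *c w x" using scaleC.diff_left[of "3/2" 1 "w x"] by simp
  finally have "2 *c (1/2) *c w x = 2 *c (1/2) *c w (w (w x))" by simp
  thus ?thesis by simp
 qed
 have "posop (%x. a (w x))"
 proof (rule posopI)
  show "bcl (%x. a (w x))" by (rule bcl_comp(2)[OF a wb])
  have aw: "a (w x) = w (a x)" for x using wbi a unfolding in_bicommutant_def by metis
  show "cinner (a (w x)) y = cinner x (a (w y))" for x y using sa wsa aw by metis
  fix x
  have "(%n. Re (cinner (X 0 x) (X (0 + n) x))) ~> Re (cinner (a x) (w x))"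
  unfolding X0 using w by (intro tendsto_Re cinner.tendsto tendsto_const) simp
  moreover have "0 <= Re (cinner (X 0 x) (X (0 + n) x))" for n
  using mono[of 0 x n] zero_le_power2 order_trans by blast
  ultimately have "0 <= Re (cinner (a x) (w x))" by (intro LIMSEQ_le_const) auto
  thus "0 <= Re (cinner x (a (w x)))" by (simp add: sa)
 qed
 moreover have "a x = 0" if "w x = 0" for x
 proof -
  have "(%n. (norm (X n x))^2) ~> (norm (w x))^2" by (intro tendsto_intros w)
  moreover have "(norm (a x))^2 <= (norm (X n x))^2" for n
  using incseqD[OF inc[of x], of 0 n] by (simp add: X0)
  ultimately have "(norm (a x))^2 <= (norm (w x))^2" by (intro LIMSEQ_le_const) auto
  thus ?thesis using that by simp
 qed
 moreover have "w x = 0" if "a x = 0" for x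
 proof -
  have "X n x = 0" for n by (induction n) (simp_all add: X0 XS that bcl_zero[OF b])
  thus ?thesis using w[of x] by (simp add: LIMSEQ_const_iff)
 qed
 ultimately show ?thesis using wbi wsa w3 by blast
qed

section \<open>Closed operators\<close>

instantiation prod :: (complex_hilbert_space, complex_hilbert_space) complex_hilbert_space
begin

definition scaleC_prod :: "complex => 'a \<times> 'b => 'a \<times> 'b"
 where "scaleC_prod c p = (c *c fst p, c *c snd p)"
definition cinner_prod :: "'a \<times> 'b => 'a \<times> 'b => complex"
 where "cinner_prod p q = cinner (fst p) (fst q) + cinner (snd p) (snd q)"

instance
proof
 fix x y z :: "'a \<times> 'b" and b c :: complex and r :: real
 show "c *c (x + y) = c *c x + c *c y" by (simp add: scaleC_prod_def scaleC_add_right)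
 show "(b + c) *c x = b *c x + c *c x" by (simp add: scaleC_prod_def scaleC_add_left)
 show "b *c c *c x = (b * c) *c x" by (simp add: scaleC_prod_def)
 show "r *\<^sub>R x = cr r *c x" by (simp add: scaleC_prod_def scaleR_prod_def scaleR_scaleC)
 show "cinner x y = cnj (cinner y x)" unfolding cinner_prod_def complex_cnj_add by (metis cinner_commute)
 show "cinner x (y + z) = cinner x y + cinner x z" by (simp add: cinner_prod_def cinner_add_right)
 show "cinner x (c *c y) = c * cinner x y" by (simp add: cinner_prod_def scaleC_prod_def algebra_simps)
 show "inner x y = Re (cinner x y)" by (simp add: cinner_prod_def inner_prod_def inner_eq_Re_cinner)
qed

end

lemma scaleC_Pair [simp]: "c *c (x, y) = (c *c x, c *c y)" by (simp add: scaleC_prod_def)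
lemma cinner_Pair [simp]: "cinner (x, y) (u, v) = cinner x u + cinner y v" by (simp add: cinner_prod_def)
lemma fst_scaleC [simp]: "fst (c *c p) = c *c fst p" and snd_scaleC [simp]: "snd (c *c p) = c *c snd p"
 by (simp_all add: scaleC_prod_def)

lemma closed_dd_op_iff:
 "closed_dd_op A <-> closed A & single_valued A & closure (Domain A) = UNIV & csubspace A"
 unfolding closed_dd_op_def csubspace_def by (auto simp: Ball_def zero_prod_def)

lemma closed_dd_opD:
 assumes "closed_dd_op A"
 shows "closed A" "single_valued A" "closure (Domain A) = UNIV" "csubspace A"
  "(x, y) : A ==> (x, y') : A ==> y = y'"
 using assms unfolding closed_dd_op_iff by (auto dest: single_valuedD)

lemma glinD:
 assumes "csubspace A"
 shows "(0, 0) : A" "(x, y) : A ==> (u, v) : A ==> (x + u, y + v) : A"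
  "(x, y) : A ==> (u, v) : A ==> (x - u, y - v) : A" "(x, y) : A ==> (c *c x, c *c y) : A"
 using csubspaceD[OF assms] by (force simp: zero_prod_def)+

lemma csubspace_Domain: assumes "csubspace A" shows "csubspace (Domain A)"
 using glinD[OF assms] unfolding csubspace_def by (auto simp: Domain_iff) blast+

lemma closed_seqD: "closed A ==> (!!n. (f n, g n) : A) ==> f ~> x ==> g ~> y ==> (x, y) : A"
 by (rule closed_sequentially[of A "%n. (f n, g n)"]) (auto intro: tendsto_Pair)

lemma dense_iff_orth:
 assumes K: "csubspace K"
 shows "closure K = UNIV <-> (ALL y. (ALL x:K. cinner y x = 0) --> y = 0)"
proof
 assume d: "closure K = UNIV"
 show "ALL y. (ALL x:K. cinner y x = 0) --> y = 0"
 proof (intro allI impI)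
  fix y assume y: "ALL x:K. cinner y x = 0"
  obtain f where f: "ALL n. f n : K" "f ~> y" using d closure_sequential[of y K] by auto
  have "(%n. cinner y (f n)) ~> cinner y y" by (intro cinner.tendsto f tendsto_const)
  hence "cinner y y = 0" using y f(1) LIMSEQ_unique[OF _ tendsto_const] by auto
  thus "y = 0" by (simp add: cinner_self)
 qed
next
 assume *: "ALL y. (ALL x:K. cinner y x = 0) --> y = 0"
 obtain p where p: "projop p" "range p = closure K" "!!x y. y : closure K ==> cinner y (x - p x) = 0"
  using projection_exists[OF csubspace_closure[OF K] closed_closure] by blast
 have "x - p x = 0" for x
 proof -
  have "cinner (x - p x) y = 0" if "y : K" for y
  using p(3)[of y x] that closure_subset cinner_commute[of "x - p x" y] by auto
  thus ?thesis using * by blast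
 qed
 hence "x : closure K" for x using p(2) by (metis eq_iff_diff_eq_0 rangeI)
 thus "closure K = UNIV" by blast
qed

lemma in_op_adj: "(u, v) : op_adj A <-> (ALL x y. (x, y) : A --> cinner u y = cinner v x)"
 unfolding op_adj_def by auto

lemma op_adj_closed: "closed (op_adj A)" "csubspace (op_adj A)"
proof -
 show "csubspace (op_adj A)"
  unfolding csubspace_def by (auto simp: in_op_adj zero_prod_def cinner_simps)
 show "closed (op_adj A)"
  unfolding closed_sequential_limits
 proof (intro allI impI)
  fix f l assume f: "(ALL n. f n : op_adj A) & f ~> l"
  have "cinner (fst l) y = cinner (snd l) x" if xy: "(x, y) : A" for x y
  proof (rule LIMSEQ_unique)
  show "(%n. cinner (fst (f n)) y) ~> cinner (fst l) y"
  using f by (intro cinner.tendsto tendsto_const tendsto_fst) auto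
  have "cinner (fst (f n)) y = cinner (snd (f n)) x" for n
  using f xy in_op_adj[of "fst (f n)" "snd (f n)" A] by auto
  moreover have "(%n. cinner (snd (f n)) x) ~> cinner (snd l) x"
  using f by (intro cinner.tendsto tendsto_const tendsto_snd) auto
  ultimately show "(%n. cinner (fst (f n)) y) ~> cinner (snd l) x" by simp
  qed
  thus "l : op_adj A" using in_op_adj[of "fst l" "snd l" A] by simp
 qed
qed

text \<open>The adjoint graph is the orthogonal complement of \<open>A\<close>, rotated by a quarter
  turn. If \<open>d\<close> is the component of \<open>w\<close> orthogonal to \<open>A\<close>, its
  rotation lies in the adjoint; membership of \<open>w\<close> in the double adjoint then makes
  \<open>w\<close> orthogonal to \<open>d\<close>, so \<open>d = 0\<close>.\<close>

lemma op_adj_adj: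
 assumes A: "closed A" "csubspace A"
 shows "op_adj (op_adj A) = A"
proof
 show "A <= op_adj (op_adj A)"
  by (auto simp: in_op_adj) (metis cinner_commute)
 show "op_adj (op_adj A) <= A"
 proof
  fix w assume w: "w : op_adj (op_adj A)"
  obtain p where p: "projop p" "range p = A" "!!x y. y : A ==> cinner y (x - p x) = 0"
  using projection_exists[OF A(2,1)] by blast
  define d where "d = w - p w"
  have orth: "cinner y d = 0" if "y : A" for y using p(3)[OF that] by (simp add: d_def)
  have "(snd d, - fst d) : op_adj A"
  unfolding in_op_adj
  proof (intro allI impI)
  fix x y assume "(x, y) : A"
  hence "cinner (x, y) d = 0" by (rule orth)
  hence "cinner x (fst d) + cinner y (snd d) = 0" by (simp add: cinner_prod_def)
  hence "cnj (cinner x (fst d)) + cnj (cinner y (snd d)) = 0" by (metis complex_cnj_add complex_cnj_zero)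
  thus "cinner (snd d) y = cinner (- fst d) x"
  by (simp add: cinner_commute[symmetric] add_eq_0_iff)
  qed
  hence "cinner (fst w) (- fst d) = cinner (snd w) (snd d)"
  using w in_op_adj[of "fst w" "snd w" "op_adj A"] by (metis prod.collapse)
  hence "cinner w d = 0" by (simp add: cinner_prod_def add_eq_0_iff)
  moreover have "cinner (p w) d = 0" using orth p(2) by blast
  ultimately have "cinner d d = 0" by (simp add: d_def cinner.diff_left)
  hence "d = 0" by (simp add: cinner_self)
  hence "w = p w" by (simp add: d_def)
  thus "w : A" using p(2) by (metis rangeI)
 qed
qed

lemma op_adj_single_valued:
 assumes "csubspace A" "closure (Domain A) = UNIV"
 shows "single_valued (op_adj A)"
proof (rule single_valuedI)
 fix u v w assume "(u, v) : op_adj A" "(u, w) : op_adj A"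
 hence "ALL x:Domain A. cinner (v - w) x = 0" by (auto simp: in_op_adj cinner.diff_left)
 hence "v - w = 0" using dense_iff_orth[OF csubspace_Domain[OF assms(1)]] assms(2) by blast
 thus "v = w" by simp
qed

text \<open>A vector \<open>y\<close> orthogonal to the domain of the adjoint puts
  \<open>(0, y)\<close> into the double adjoint, which is \<open>A\<close> itself and single
  valued.\<close>

lemma closed_dd_op_adj:
 assumes A: "closed_dd_op A"
 shows "closed_dd_op (op_adj A)"
 unfolding closed_dd_op_iff
proof (intro conjI op_adj_closed op_adj_single_valued)
 note a = closed_dd_opD[OF A]
 show "csubspace A" "closure (Domain A) = UNIV" by fact+
 have "y = 0" if "ALL x:Domain (op_adj A). cinner y x = 0" for y
 proof -
  have "(0, y) : op_adj (op_adj A)" unfolding in_op_adj[of 0 y] using that by auto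
  hence "(0, y) : A" using op_adj_adj a by blast
  thus ?thesis using a(5) glinD(1)[OF a(4)] by blast
 qed
 thus "closure (Domain (op_adj A)) = UNIV"
  using dense_iff_orth[OF csubspace_Domain[OF op_adj_closed(2)]] by blast
qed

lemma op_adj_mono: "A <= B ==> op_adj B <= op_adj A"
 by (auto simp: in_op_adj subset_iff)

lemma sa_subset_eq: "op_sa A ==> op_sa B ==> A <= B ==> A = B"
 unfolding op_selfadjoint_def using op_adj_mono by blast

lemma saD:
 assumes "op_sa A"
 shows "closed_dd_op A" "op_adj A = A" "closed A" "single_valued A" "closure (Domain A) = UNIV" "csubspace A"
  "(x, y) : A ==> (u, v) : A ==> cinner x v = cinner y u"
proof -
 show 1: "closed_dd_op A" "op_adj A = A" using assms by (auto simp: op_selfadjoint_def)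
 thus "closed A" "single_valued A" "closure (Domain A) = UNIV" "csubspace A" using closed_dd_opD by blast+
 show "(x, y) : A ==> (u, v) : A ==> cinner x v = cinner y u" using 1(2) in_op_adj by metis
qed

section \<open>Symmetric operators off the real axis\<close>

definition symmetric_graph :: "'h::complex_hilbert_space opgraph => bool"
 where "symmetric_graph A <-> csubspace A & (ALL x y u v. (x, y) : A --> (u, v) : A --> cinner x v = cinner y u)"

lemma sa_symmetric: "op_sa A ==> symmetric_graph A"
 unfolding symmetric_graph_def using saD by metis

lemma sym_Im:
 assumes "symmetric_graph A" "(x, y) : A"
 shows "Im (cinner x y) = 0" "Im (cinner x (y - z *c x)) = - Im z * (norm x)^2"
proof -
 have "cinner x y = cinner y x" using assms unfolding symmetric_graph_def by blast
 also have "... = cnj (cinner x y)" by (rule cinner_commute)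
 finally show "Im (cinner x y) = 0" by (simp add: complex_eq_iff)
 thus "Im (cinner x (y - z *c x)) = - Im z * (norm x)^2"
  by (simp add: cinner_simps cinner_self del: of_real_power)
qed

text \<open>The imaginary part of \<open>cinner x (y - z x)\<close> already bounds
  \<open>y - z x\<close> from below. From this come closed ranges, injectivity and the norm bound of
  the resolvent.\<close>

lemma sym_bound:
 assumes "symmetric_graph A" "(x, y) : A"
 shows "\<bar>Im z\<bar> * norm x <= norm (y - z *c x)"
proof (cases "x = 0")
 case False
 have "\<bar>Im z\<bar> * (norm x)^2 = \<bar>Im (cinner x (y - z *c x))\<bar>"
  unfolding sym_Im(2)[OF assms] by (simp add: abs_mult)
 also have "... <= norm x * norm (y - z *c x)" using abs_Im_le_cmod norm_cinner_le order_trans by blast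
 finally have "norm x * (\<bar>Im z\<bar> * norm x) <= norm x * norm (y - z *c x)" by (simp add: power2_eq_square algebra_simps)
 thus ?thesis using False by simp
qed simp

lemma sym_range_closed:
 assumes A: "symmetric_graph A" "closed A" and z: "Im z ~= 0"
 shows "csubspace {y - z *c x | x y. (x, y) : A}" (is "csubspace ?K") and "closed {y - z *c x | x y. (x, y) : A}"
proof -
 have A': "csubspace A" using A by (simp add: symmetric_graph_def)
 note g = glinD[OF A']
 show K: "csubspace ?K"
  unfolding csubspace_def
 proof (intro conjI ballI allI)
  have "0 = 0 - z *c (0::'a)" by simp
  thus "0 : ?K" using g(1) by blast
 next
  fix a b assume "a : ?K" "b : ?K"
  then obtain x y u v where "(x, y) : A" "(u, v) : A" "a = y - z *c x" "b = v - z *c u" by blast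
  hence "a + b = (y + v) - z *c (x + u)" "(x + u, y + v) : A"
  using g(2) by (auto simp: scaleC_add_right)
  thus "a + b : ?K" by blast
 next
  fix c a assume "a : ?K"
  then obtain x y where "(x, y) : A" "a = y - z *c x" by blast
  hence "c *c a = (c *c y) - z *c (c *c x)" "(c *c x, c *c y) : A"
  using g(4) by (auto simp: scaleC.diff_right mult.commute)
  thus "c *c a : ?K" by blast
 qed
 show "closed ?K"
  unfolding closed_sequential_limits
 proof (intro allI impI)
  fix f l assume f: "(ALL n. f n : ?K) & f ~> l"
  hence "ALL n. EX x y. (x, y) : A & f n = y - z *c x" by blast
  then obtain X Y where XY: "!!n. (X n, Y n) : A" "!!n. f n = Y n - z *c X n" by metis
  have bd: "\<bar>Im z\<bar> * dist (X m) (X n) <= dist (f m) (f n)" for m n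
  using sym_bound[OF A(1) g(3)[OF XY(1) XY(1)], of z m n]
  by (simp add: dist_norm XY(2) scaleC.diff_right algebra_simps)
  have "Cauchy X"
  proof (rule metric_CauchyI)
  fix e :: real assume e: "0 < e"
  have "Cauchy f" using f LIMSEQ_imp_Cauchy by blast
  then obtain M where M: "!!m n. m >= M ==> n >= M ==> dist (f m) (f n) < \<bar>Im z\<bar> * e"
  unfolding Cauchy_def using e z by (metis zero_less_abs_iff zero_less_mult_iff)
  have "dist (X m) (X n) < e" if "m >= M" "n >= M" for m n
  proof -
  have "\<bar>Im z\<bar> * dist (X m) (X n) < \<bar>Im z\<bar> * e" using bd M[OF that] le_less_trans by blast
  thus ?thesis using z by simp
  qed
  thus "EX M. ALL m>=M. ALL n>=M. dist (X m) (X n) < e" by blast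
  qed
  then obtain x where x: "X ~> x" by (rule complex_Cauchy_imp_limit)
  have "(%n. f n + z *c X n) ~> l + z *c x" using f x by (intro tendsto_intros scaleC.tendsto) auto
  hence "(x, l + z *c x) : A" using closed_seqD[OF A(2) XY(1) x] XY(2) by simp
  moreover have "l = (l + z *c x) - z *c x" by simp
  ultimately show "l : ?K" by blast
 qed
qed

subsection \<open>The resolvent of a self-adjoint operator\<close>

text \<open>The inverse of \<open>A - z\<close> at \<open>w\<close>: the equation
  \<open>w = y - z x\<close> is solved for the second component of the graph.\<close>

definition res :: "'h::complex_hilbert_space opgraph => complex => 'h => 'h"
 where "res A z w = (THE x. (x, w + z *c x) : A)"

context
 fixes A :: "'h::complex_hilbert_space opgraph"
 assumes A: "op_sa A"
begin

lemma res_unique: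
 assumes z: "Im z ~= 0" and "(x, w + z *c x) : A"
 shows "res A z w = x"
 unfolding res_def
proof (rule the_equality)
 show "(x, w + z *c x) : A" by (rule assms(2))
 fix u assume "(u, w + z *c u) : A"
 from glinD(3)[OF saD(6)[OF A] this assms(2)] have "(u - x, z *c (u - x)) : A"
  by (simp add: scaleC.diff_right)
 from sym_bound[OF sa_symmetric[OF A] this, of z] show "u = x" using z by (simp add: mult_le_0_iff)
qed

text \<open>A vector orthogonal to the range of \<open>A - z\<close> is an eigenvector of the
  adjoint, that is of \<open>A\<close>, with eigenvalue \<open>cnj z\<close>;
  \<open>sym_bound\<close> excludes this. So the range is dense, and it is closed.\<close>

lemma res_in:
 assumes z: "Im z ~= 0"
 shows "(res A z w, w + z *c res A z w) : A"
proof -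
 let ?K = "{y - z *c x | x y. (x, y) : A}"
 note K = sym_range_closed[OF sa_symmetric[OF A] saD(3)[OF A] z]
 have "v = 0" if v: "ALL k:?K. cinner v k = 0" for v
 proof -
  have "(v, cnj z *c v) : op_adj A"
  unfolding in_op_adj
  proof (intro allI impI)
  fix x y assume "(x, y) : A"
  hence "cinner v (y - z *c x) = 0" using v by blast
  thus "cinner v y = cinner (cnj z *c v) x" by (simp add: cinner.diff_right)
  qed
  hence "(v, cnj z *c v) : A" by (simp add: saD(2)[OF A])
  from sym_bound[OF sa_symmetric[OF A] this, of "cnj z"] show "v = 0" using z by (simp add: mult_le_0_iff)
 qed
 hence "closure ?K = UNIV" using dense_iff_orth[OF K(1)] by blast
 hence "w : ?K" using K(2) by simp
 then obtain x y where xy: "(x, y) : A" "w = y - z *c x" by blast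
 hence "(x, w + z *c x) : A" by simp
 thus ?thesis using res_unique[OF z] by metis
qed

lemma res_iff: "Im z ~= 0 ==> (x, y) : A <-> res A z (y - z *c x) = x"
 using res_unique[of z x "y - z *c x"] res_in[of z "y - z *c x"] by force

lemma res_norm: "Im z ~= 0 ==> norm (res A z w) <= norm w / \<bar>Im z\<bar>"
 using sym_bound[OF sa_symmetric[OF A] res_in, of z z w] by (simp add: field_simps)

lemma res_bcl: assumes z: "Im z ~= 0" shows "bcl (res A z)"
proof (rule bclI[of _ "1 / \<bar>Im z\<bar>"])
 note g = glinD[OF saD(6)[OF A]]
 show "res A z (x + y) = res A z x + res A z y" for x y
  using g(2)[OF res_in[OF z, of x] res_in[OF z, of y]]
  by (intro res_unique z) (simp add: scaleC_add_right algebra_simps)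
 show "res A z (c *c x) = c *c res A z x" for c x
  using g(4)[OF res_in[OF z, of x], of c]
  by (intro res_unique z) (simp add: scaleC_add_right mult.commute)
 show "norm (res A z x) <= 1 / \<bar>Im z\<bar> * norm x" for x using res_norm[OF z, of x] by simp
qed

lemma res_swap: assumes z: "Im z ~= 0" shows "cinner (res A z x) y = cinner x (res A (cnj z) y)"
proof -
 have z': "Im (cnj z) ~= 0" using z by simp
 have "cinner (res A z x) (y + cnj z *c res A (cnj z) y) = cinner (x + z *c res A z x) (res A (cnj z) y)"
  by (rule saD(7)[OF A res_in[OF z] res_in[OF z']])
 thus ?thesis by (simp add: cinner_simps)
qed

lemma res_adj: "Im z ~= 0 ==> cadj (res A z) = res A (cnj z)"
 by (rule cadj_unique) (rule res_swap)

lemma res_commutes: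
 assumes c: "bcl c" "!!x y. (x, y) : A ==> (c x, c y) : A" and z: "Im z ~= 0"
 shows "c (res A z w) = res A z (c w)"
 using c(2)[OF res_in[OF z, of w]] by (intro res_unique[symmetric] z) (simp add: bcl_simps[OF c(1)])

lemma commutes_resD:
 assumes c: "bcl c" "!!w. c (res A z w) = res A z (c w)" and z: "Im z ~= 0" and xy: "(x, y) : A"
 shows "(c x, c y) : A"
 using xy unfolding res_iff[OF z] by (metis c bcl_diff bcl_scale)

lemma res_identity:
 assumes "Im z ~= 0" "Im v ~= 0"
 shows "res A z w - res A v w = (z - v) *c res A z (res A v w)"
proof -
 note g = glinD[OF saD(6)[OF A]]
 have "res A z ((w + v *c res A v w) - z *c res A v w) = res A v w"
  by (rule res_unique) (use assms res_in in auto)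
 hence "res A z w - (z - v) *c res A z (res A v w) = res A v w"
  by (simp add: bcl_simps[OF res_bcl[OF assms(1)]] scaleC.diff_left algebra_simps)
 thus ?thesis by (simp add: algebra_simps)
qed

lemma res_comm: assumes "Im z ~= 0" "Im v ~= 0" shows "res A z (res A v w) = res A v (res A z w)"
proof (rule res_commutes[OF res_bcl[OF assms(1)] _ assms(2)])
 fix x y assume xy: "(x, y) : A"
 hence "res A z (y - z *c x) = x" using res_iff assms by blast
 hence "res A z y = x + z *c res A z x" by (simp add: bcl_simps[OF res_bcl[OF assms(1)]] algebra_simps)
 thus "(res A z x, res A z y) : A" using res_in[OF assms(1), of x] by simp
qed

end

text \<open>For \<open>(u, v)\<close> in the adjoint, subtracting the solution \<open>(x, y)\<close>
  of \<open>y - i x = v - i u\<close> leaves a vector \<open>u - x\<close> orthogonal to the range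
  of \<open>A + i\<close>, which is everything.\<close>

lemma sa_criterion:
 assumes A: "symmetric_graph A" "closure (Domain A) = UNIV"
  and s: "!!w. EX x y. (x, y) : A & y + \<i> *c x = w" "!!w. EX x y. (x, y) : A & y - \<i> *c x = w"
 shows "op_sa A"
proof -
 have A': "csubspace A" using A by (simp add: symmetric_graph_def)
 have "(u, v) : A" if uv: "(u, v) : op_adj A" for u v
 proof -
  obtain x y where xy: "(x, y) : A" "y - \<i> *c x = v - \<i> *c u" using s(2) by blast
  obtain p q where pq: "(p, q) : A" "q + \<i> *c p = u - x" using s(1) by blast
  have "cinner u q = cinner v p" using uv pq(1) by (simp add: in_op_adj)
  moreover have "cinner x q = cinner y p" using A(1) xy pq(1) by (simp add: symmetric_graph_def)
  moreover have "v - y = \<i> *c (u - x)" using xy(2) by (simp add: scaleC.diff_right algebra_simps)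
  ultimately have "cinner (u - x) q = cinner (\<i> *c (u - x)) p"
  by (metis cinner.diff_left)
  hence "cinner (u - x) (q + \<i> *c p) = 0" by (simp add: cinner_add_right)
  hence "u = x" unfolding pq(2) by (simp add: cinner_self)
  moreover from this have "v = y" using xy(2) by simp
  ultimately show ?thesis using xy(1) by simp
 qed
 moreover have "A <= op_adj A" using A(1) by (auto simp: in_op_adj symmetric_graph_def)
 ultimately have "op_adj A = A" by auto
 thus ?thesis
  unfolding op_selfadjoint_def closed_dd_op_iff
  using op_adj_closed[of A] op_adj_single_valued[OF A' A(2)] A(2) A' by auto
qed

text \<open>The squared norms of \<open>p n x\<close> decrease, and their differences are the
  squared distances. Increasing families are treated through their complements.\<close>

lemma proj_decreasing_limit:
 assumes p: "!!n. projop (p n)" and dec: "!!n x. p n (p (Suc n) x) = p (Suc n) x"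
 shows "EX q. projop q & (ALL x. (%n. p n x) ~> q x) & (ALL n x. p n (q x) = q x)"
proof -
 note P = projD[OF p]
 have le: "p n (p m x) = p m x" if "n <= m" for n m x
  using that
 proof (induction m arbitrary: x rule: dec_induct)
  case base show ?case by (rule P(2))
 next
  case (step k)
  have "p n (p (Suc k) x) = p n (p k (p (Suc k) x))" by (simp only: dec)
  thus ?case using step.IH[of "p (Suc k) x"] by (simp add: dec)
 qed
 have diff: "(norm (p n x - p m x))^2 = (norm (p n x))^2 - (norm (p m x))^2" if "n <= m" for n m x
 proof -
  have "cinner (p n x) (p m x) = cinner x (p m x)" by (simp add: P(4) le[OF that])
  thus ?thesis unfolding norm_diff_sq by (simp add: P(5))
 qed
 have conv: "convergent (%n. p n x)" for x
 proof (rule quadratic_convergent[of _ "%n. - ((norm (p n x))^2)" 0])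
  show "(norm (p n x - p m x))^2 <= - ((norm (p n x))^2) - - ((norm (p m x))^2)" if "m <= n" for m n
  unfolding norm_minus_commute[of "p n x"] diff[OF that] by simp
 qed simp
 define q where "q x = lim (%n. p n x)" for x
 have q: "(%n. p n x) ~> q x" for x using conv unfolding q_def by (simp add: convergent_LIMSEQ_iff)
 have qb: "bcl q" by (rule bcl_limit[OF P(1) q, of 1]) (simp add: P(6))
 have pq: "p n (q x) = q x" for n x
 proof -
  have "(%m. p n (p m x)) ~> p n (q x)" by (rule bcl_tendsto[OF P(1) q])
  moreover have "eventually (%m. p n (p m x) = p m x) sequentially"
  using le eventually_sequentially by blast
  ultimately have "(%m. p m x) ~> p n (q x)" by (rule Lim_transform_eventually)
  thus ?thesis using q LIMSEQ_unique by blast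
 qed
 have "projop q"
 proof (rule projI[OF qb])
  show "q (q x) = q x" for x using q[of "q x"] by (simp add: pq LIMSEQ_const_iff)
  show "cinner (q x) y = cinner x (q y)" for x y
  by (rule LIMSEQ_unique[OF cinner.tendsto[OF q tendsto_const]])
  (simp add: P(4) cinner.tendsto[OF tendsto_const q])
 qed
 thus ?thesis using q pq by blast
qed

lemma sa_graph_mapI:
 assumes A: "op_sa A" and d: "!!x y. (x, y) : A ==> f x = (0::'b::complex_hilbert_space)" and f: "bcl f"
 shows "f x = 0"
proof -
 obtain g where g: "ALL n. g n : Domain A" "g ~> x"
  using saD(5)[OF A] closure_sequential[of x "Domain A"] by auto
 have "(%n. f (g n)) ~> f x" by (rule bcl_tendsto[OF f g(2)])
 moreover have "f (g n) = 0" for n using g(1) d by blast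
 ultimately show ?thesis by (simp add: LIMSEQ_const_iff)
qed

subsection \<open>Spectral cuts\<close>

text \<open>The cut is the spectral projection of the half line up to \<open>l\<close>. The real
  part \<open>s\<close> of the resolvent at \<open>l + i\<close> corresponds to
  \<open>(t - l) / ((t - l)^2 + 1)\<close>, which has the sign of \<open>t - l\<close>; the bounded
  operator \<open>s\<close> has a sign by \<open>sign_operator\<close>, although \<open>A\<close>
  may be unbounded.\<close>

lemma spectral_cut:
 fixes A :: "'h::complex_hilbert_space opgraph"
 assumes A: "op_sa A"
 shows "EX e. projop e
  & (ALL c. bcl c --> (ALL (x, y):A. (c x, c y) : A) --> (ALL x. c (e x) = e (c x)))
  & (ALL x y. (x, y) : A --> (e x, e y) : A)
  & (ALL x y. (x, y) : A --> e x = x --> Re (cinner x y) <= l * (norm x)^2)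
  & (ALL x y. (x, y) : A --> e x = 0 --> x ~= 0 --> l * (norm x)^2 < Re (cinner x y))"
proof -
 define z where "z = cr l + \<i>"
 have z: "Im z ~= 0" "Im (cnj z) ~= 0" by (simp_all add: z_def)
 define R where "R = res A z"
 define R' where "R' = res A (cnj z)"
 have Rb: "bcl R" "bcl R'" unfolding R_def R'_def using res_bcl[OF A] z by auto
 have RR': "cinner (R x) y = cinner x (R' y)" for x y unfolding R_def R'_def by (rule res_swap[OF A z(1)])
 have Rn: "norm (R x) <= norm x" "norm (R' x) <= norm x" for x
  unfolding R_def R'_def using res_norm[OF A z(1), of x] res_norm[OF A z(2), of x] by (simp_all add: z_def)
 define s where "s x = (1/2) *c (R x + R' x)" for x
 have sb: "bcl s" unfolding s_def by (intro bcl_intros Rb)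
 have ssa: "cinner (s x) y = cinner x (s y)" for x y
 proof -
  have "cinner (R' x) y = cinner x (R y)" by (metis RR' cinner_commute)
  thus ?thesis by (simp add: s_def cinner_simps RR' algebra_simps)
 qed
 have sn: "norm (s x) <= norm x" for x
 proof -
  have "norm (s x) <= (1/2) * (norm (R x) + norm (R' x))"
  unfolding s_def using norm_triangle_ineq[of "R x" "R' x"] by simp
  thus ?thesis using Rn[of x] by argo
 qed
 obtain w where w: "in_bicommutant s w" "!!x y. cinner (w x) y = cinner x (w y)" "!!x. w (w (w x)) = w x"
  "posop (%x. s (w x))" "!!x. w x = 0 <-> s x = 0"
  using sign_operator[OF sb ssa sn] by blast
 have wb: "bcl w" using w(1) by (simp add: in_bicommutant_def)
 have ws: "s (w x) = w (s x)" for x using w(1) sb unfolding in_bicommutant_def by metis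
 \<comment> \<open>\<open>w\<close> takes the values -1, 0, 1, and \<open>(w^2 + w) / 2\<close> is
   the indicator of the value 1, that is of \<open>t > l\<close>.\<close>
 define q where "q x = (1/2) *c (w (w x) + w x)" for x
 define e where "e x = x - q x" for x
 have qb: "bcl q" unfolding q_def by (intro bcl_intros bcl_comp(2)[OF wb] wb)
 have qq: "q (q x) = q x" for x
 proof -
  have "q (q x) = (1/2) *c (1/2) *c ((w (w x) + w x) + (w (w x) + w x))"
  unfolding q_def by (simp add: bcl_simps[OF wb] w(3) algebra_simps scaleC_add_right)
  also have "(w (w x) + w x) + (w (w x) + w x) = 2 *c (w (w x) + w x)"
  using scaleC_add_left[of 1 1 "w (w x) + w x"] by simp
  finally show ?thesis unfolding q_def by simp
 qed
 have wq: "w (q x) = q x" for x unfolding q_def by (simp add: bcl_simps[OF wb] w(3) add.commute)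
 have qp: "projop q"
 proof (rule projI[OF qb qq])
  show "cinner (q x) y = cinner x (q y)" for x y unfolding q_def by (simp add: cinner_simps w(2))
 qed
 have ep: "projop e" unfolding e_def by (rule proj_compl[OF qp])
 have comm: "c (e x) = e (c x)" if c: "bcl c" "ALL (x, y):A. (c x, c y) : A" for c x
 proof -
  have "c (R x) = R (c x)" "c (R' x) = R' (c x)" for x
  unfolding R_def R'_def using res_commutes[OF A c(1)] c(2) z by blast+
  hence "c (s x) = s (c x)" for x unfolding s_def by (simp add: bcl_simps[OF c(1)])
  hence "c (w x) = w (c x)" for x using w(1) c(1) unfolding in_bicommutant_def by blast
  thus ?thesis unfolding e_def q_def by (simp add: bcl_simps[OF c(1)])
 qed
 have RA: "ALL (x, y):A. (R x, R y) : A"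
  using commutes_resD[OF A Rb(1) _ z(1)] unfolding R_def by blast
 have eb: "bcl e" using ep projD(1) by blast
 have eR: "e (R x) = R (e x)" for x using comm[OF Rb(1) RA] by simp
 have eA: "(e x, e y) : A" if "(x, y) : A" for x y
  by (rule commutes_resD[OF A eb _ z(1) that]) (use eR in \<open>simp add: R_def\<close>)
 \<comment> \<open>In terms of numbers: for \<open>u = (t - z) x\<close> the factor \<open>s\<close>
   cancels \<open>cmod (t - z) ^ 2\<close> and leaves \<open>t - l\<close>.\<close>
 have form: "Re (cinner x y) - l * (norm x)^2 = Re (cinner (y - z *c x) (s (y - z *c x)))" if xy: "(x, y) : A" for x y
 proof -
  let ?u = "y - z *c x"
  have x: "R ?u = x" unfolding R_def using res_iff[OF A z(1)] xy by blast
  have "Re (cinner ?u (s ?u)) = (1/2) * (Re (cinner ?u (R ?u)) + Re (cinner ?u (R' ?u)))"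
  unfolding s_def by (simp add: cinner_simps)
  also have "Re (cinner ?u (R' ?u)) = Re (cinner (R ?u) ?u)" by (simp add: RR')
  also have "Re (cinner ?u (R ?u)) = Re (cinner (R ?u) ?u)"
  using cinner_commute[of ?u "R ?u"] by simp
  also have "(1/2) * (Re (cinner (R ?u) ?u) + Re (cinner (R ?u) ?u)) = Re (cinner x ?u)" unfolding x by simp
  also have "... = Re (cinner x y) - l * (norm x)^2"
  unfolding z_def by (simp add: cinner_simps cinner_self scaleC_add_left del: of_real_power)
  finally show ?thesis by simp
 qed
 have le: "Re (cinner x y) <= l * (norm x)^2" if xy: "(x, y) : A" and ex: "e x = x" for x y
 proof -
  let ?u = "y - z *c x"
  have "(x, e y) : A" using eA[OF xy] ex by simp
  hence "e y = y" using xy saD(4)[OF A] by (auto dest: single_valuedD)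
  hence eu: "e ?u = ?u" using ex by (simp add: bcl_simps[OF eb])
  \<comment> \<open>\<open>(w^2 - w) / 2\<close> projects onto the part where the sign is -1; there
    the form of \<open>s\<close> is at most 0.\<close>
  define p where "p = (1/2) *c (w (w ?u) - w ?u)"
  have wp: "w p = - p" unfolding p_def by (simp add: bcl_simps[OF wb] w(3) scaleC.diff_right)
  have "w (?u - w (w ?u)) = 0" by (simp add: bcl_simps[OF wb] w(3))
  hence "s (?u - w (w ?u)) = 0" using w(5) by blast
  hence s1: "s ?u = s (w (w ?u))" by (simp add: bcl_simps[OF sb])
  have "w (e v) = - ((1/2) *c (w (w v) - w v))" for v
  using scaleC_add_left[of "1/2" "1/2" "w v"] unfolding e_def q_def
  by (simp add: bcl_simps[OF wb] w(3) scaleC.diff_right scaleC_add_right diff_eq_eq)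
  hence "w (e ?u) = - p" unfolding p_def .
  hence wu: "w ?u = - p" using eu by simp
  hence wwu: "w (w ?u) = p" by (simp add: bcl_simps[OF wb] wp)
  have "Re (cinner ?u (s ?u)) = Re (cinner ?u (s (w (w ?u))))" using s1 by simp
  also have "... = Re (cinner (w ?u) (s (w ?u)))" by (simp add: ws w(2))
  also have "... = Re (cinner p (s p))" unfolding wu by (simp add: bcl_simps[OF sb])
  also have "... = - Re (cinner p (s (w p)))" unfolding wp by (simp add: bcl_simps[OF sb])
  also have "... <= 0" using posopD(3)[OF w(4)] by simp
  finally show ?thesis using form[OF xy] by simp
 qed
 have gt: "l * (norm x)^2 < Re (cinner x y)" if xy: "(x, y) : A" and ex: "e x = 0" and x0: "x ~= 0" for x y
 proof -
  let ?u = "y - z *c x"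
  have "(0, e y) : A" using eA[OF xy] ex by simp
  hence "e y = 0" using glinD(1)[OF saD(6)[OF A]] saD(4)[OF A] by (auto dest: single_valuedD)
  hence "e ?u = 0" using ex by (simp add: bcl_simps[OF eb])
  hence "q ?u = ?u" unfolding e_def by simp
  hence wu: "w ?u = ?u" using wq[of ?u] by simp
  have nn: "0 <= Re (cinner ?u (s ?u))" using posopD(3)[OF w(4), of ?u] unfolding wu .
  have "Re (cinner ?u (s ?u)) ~= 0"
  proof
  assume 0: "Re (cinner ?u (s ?u)) = 0"
  obtain C where C: "C > 0" "!!x. norm (s (w x)) <= C * norm x" using bcl_bound posopD(1)[OF w(4)] by metis
  have "Re (cinner x (s (w x))) <= C * (norm x)^2" for x
  proof -
  have "Re (cinner x (s (w x))) <= norm x * norm (s (w x))"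
  using complex_Re_le_cmod norm_cinner_le order_trans by blast
  also have "... <= norm x * (C * norm x)" by (intro mult_left_mono C) simp
  finally show ?thesis by (simp add: power2_eq_square algebra_simps)
  qed
  from posop_bound(1)[OF w(4) C(1) this, of ?u] have "s ?u = 0" unfolding wu using 0 by simp
  hence "w ?u = 0" using w(5) by blast
  hence "?u = 0" using wu by simp
  hence "x = 0" using res_iff[OF A z(1), of x y] xy bcl_zero[OF Rb(1)] unfolding R_def by simp
  thus False using x0 by simp
  qed
  thus ?thesis using nn form[OF xy] by simp
 qed
 show ?thesis using ep comm eA le gt by blast
qed

definition cut :: "'h::complex_hilbert_space opgraph => real => 'h => 'h"
 where "cut A l = (SOME e. projop e
  & (ALL c. bcl c --> (ALL (x, y):A. (c x, c y) : A) --> (ALL x. c (e x) = e (c x)))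
  & (ALL x y. (x, y) : A --> (e x, e y) : A)
  & (ALL x y. (x, y) : A --> e x = x --> Re (cinner x y) <= l * (norm x)^2)
  & (ALL x y. (x, y) : A --> e x = 0 --> x ~= 0 --> l * (norm x)^2 < Re (cinner x y)))"

context
 fixes A :: "'h::complex_hilbert_space opgraph"
 assumes A: "op_sa A"
begin

lemma cut:
 shows "projop (cut A l)"
  "bcl c ==> (!!x y. (x, y) : A ==> (c x, c y) : A) ==> c (cut A l x) = cut A l (c x)"
  "(x, y) : A ==> (cut A l x, cut A l y) : A"
  "(x, y) : A ==> cut A l x = x ==> Re (cinner x y) <= l * (norm x)^2"
  "(x, y) : A ==> cut A l x = 0 ==> x ~= 0 ==> l * (norm x)^2 < Re (cinner x y)"
 using someI_ex[OF spectral_cut[OF A, of l], folded cut_def] by blast+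

lemma cut_bcl: "bcl (cut A l)" using cut(1) projD(1) by blast

lemma cut_comm: "cut A l (cut A m x) = cut A m (cut A l x)"
 by (rule cut(2)[OF cut_bcl cut(3)])

text \<open>A nonzero vector fixed by the cut at \<open>l\<close> and killed by the cut at
  \<open>m\<close> would have a form at most \<open>l\<close> and greater than
  \<open>m\<close>.\<close>

lemma cut_mono:
 assumes "l <= m" shows "cut A m (cut A l x) = cut A l x"
proof -
 let ?f = "%x. cut A l x - cut A m (cut A l x)"
 note P = projD[OF cut(1)]
 have "?f x = 0"
 proof (rule sa_graph_mapI[OF A, where f = ?f])
  show "bcl ?f" by (intro bcl_intros bcl_comp(2)[OF cut_bcl] cut_bcl)
  fix x y assume xy: "(x, y) : A"
  have in_A: "(?f x, ?f y) : A" using glinD(3)[OF saD(6)[OF A]] cut(3) xy by blast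
  have 1: "cut A l (?f x) = ?f x" by (simp add: bcl_simps[OF cut_bcl] P(2) cut_comm[of l m])
  have 2: "cut A m (?f x) = 0" by (simp add: bcl_simps[OF cut_bcl] P(2))
  show "?f x = 0"
  proof (rule ccontr)
  assume n: "?f x ~= 0"
  have "m * (norm (?f x))^2 < l * (norm (?f x))^2"
  using cut(4)[OF in_A 1] cut(5)[OF in_A 2 n] by linarith
  thus False using assms mult_right_mono[of l m "(norm (?f x))^2"] by simp
  qed
 qed
 thus ?thesis by simp
qed

text \<open>On the range of the limit the form would lie below \<open>- n\<close> times the squared
  norm for every \<open>n\<close>.\<close>

lemma cut_tendsto_zero: "(%n. cut A (- real n) x) ~> 0"
proof -
 have "cut A (- real n) (cut A (- real (Suc n)) x) = cut A (- real (Suc n)) x" for n x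
  by (rule cut_mono) simp
 from proj_decreasing_limit[of "%n. cut A (- real n)", OF cut(1) this]
 obtain q where q: "projop q" "!!x. (%n. cut A (- real n) x) ~> q x" "!!n x. cut A (- real n) (q x) = q x"
  by auto
 have "q x = 0"
 proof (rule sa_graph_mapI[OF A, where f = q])
  show "bcl q" using q(1) projD(1) by blast
  fix x y assume "(x, y) : A"
  hence "(cut A (- real n) x, cut A (- real n) y) : A" for n by (rule cut(3))
  hence in_A: "(q x, q y) : A" by (rule closed_seqD[OF saD(3)[OF A] _ q(2)[of x] q(2)[of y]])
  show "q x = 0"
  proof (rule ccontr)
  assume "q x ~= 0"
  hence pos: "(norm (q x))^2 > 0" by simp
  obtain n where "- Re (cinner (q x) (q y)) / (norm (q x))^2 < real n" using reals_Archimedean2 by blast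
  hence "- Re (cinner (q x) (q y)) < real n * (norm (q x))^2"
  unfolding pos_divide_less_eq[OF pos] .
  thus False using cut(4)[OF in_A, of "- real n"] q(3) by simp
  qed
 qed
 thus ?thesis using q(2)[of x] by simp
qed

lemma cut_tendsto_id: "(%n. cut A (real n) x) ~> x"
proof -
 let ?p = "%n x. x - cut A (real n) x"
 have "?p n (?p (Suc n) x) = ?p (Suc n) x" for n x
  using cut_mono[of "real n" "real (Suc n)" x] cut_comm[of "real n" "real (Suc n)" x]
  by (simp add: bcl_simps[OF cut_bcl])
 from proj_decreasing_limit[of ?p, OF proj_compl[OF cut(1)] this]
 obtain q where q: "projop q" "!!x. (%n. ?p n x) ~> q x" "!!n x. ?p n (q x) = q x"
  by auto
 have "q x = 0"
 proof (rule sa_graph_mapI[OF A, where f = q])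
  show "bcl q" using q(1) projD(1) by blast
  fix x y assume "(x, y) : A"
  hence "(?p n x, ?p n y) : A" for n using glinD(3)[OF saD(6)[OF A]] cut(3) by blast
  hence in_A: "(q x, q y) : A" by (rule closed_seqD[OF saD(3)[OF A] _ q(2)[of x] q(2)[of y]])
  show "q x = 0"
  proof (rule ccontr)
  assume n: "q x ~= 0"
  hence pos: "(norm (q x))^2 > 0" by simp
  obtain n where "Re (cinner (q x) (q y)) / (norm (q x))^2 < real n" using reals_Archimedean2 by blast
  hence "Re (cinner (q x) (q y)) < real n * (norm (q x))^2"
  unfolding pos_divide_less_eq[OF pos] .
  thus False using cut(5)[OF in_A, of "real n"] q(3) n by simp
  qed
 qed
 hence "(%n. x - (x - cut A (real n) x)) ~> x - 0" using q(2)[of x] by (intro tendsto_diff tendsto_const) simp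
 thus ?thesis by simp
qed

text \<open>The bound on the range of a cut is not strict while the bound on its kernel is strict;
  the two collide on the difference between the limit and the cut at \<open>l\<close>.\<close>

lemma cut_right: "(%n. cut A (l + inverse (real (Suc n))) x) ~> cut A l x"
proof -
 define d where "d n = l + inverse (real (Suc n))" for n
 have d: "d (Suc n) <= d n" "l <= d n" for n unfolding d_def by (simp_all add: field_simps)
 have "cut A (d n) (cut A (d (Suc n)) x) = cut A (d (Suc n)) x" for n x
  by (rule cut_mono[OF d(1)])
 from proj_decreasing_limit[of "%n. cut A (d n)", OF cut(1) this]
 obtain q where q: "projop q" "!!x. (%n. cut A (d n) x) ~> q x" "!!n x. cut A (d n) (q x) = q x"
  by auto
 have ql: "q (cut A l x) = cut A l x" for x
  using q(2)[of "cut A l x"] cut_mono[OF d(2)] by (simp add: LIMSEQ_const_iff)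
 have lq: "cut A l (q x) = cut A l x" for x
 proof -
  have "(%n. cut A l (cut A (d n) x)) ~> cut A l (q x)" by (rule bcl_tendsto[OF cut_bcl q(2)])
  thus ?thesis using cut_mono[OF d(2)] by (simp add: cut_comm[of l] LIMSEQ_const_iff)
 qed
 let ?f = "%x. q x - cut A l x"
 have qb: "bcl q" using q(1) projD(1) by blast
 have "?f x = 0"
 proof (rule sa_graph_mapI[OF A, where f = ?f])
  show "bcl ?f" by (intro bcl_intros qb cut_bcl)
  fix x y assume xy: "(x, y) : A"
  hence "(cut A (d n) x, cut A (d n) y) : A" for n by (rule cut(3))
  hence "(q x, q y) : A" by (rule closed_seqD[OF saD(3)[OF A] _ q(2)[of x] q(2)[of y]])
  hence in_A: "(?f x, ?f y) : A" using glinD(3)[OF saD(6)[OF A]] cut(3)[OF xy] by blast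
  have 1: "cut A l (?f x) = 0" by (simp add: bcl_simps[OF cut_bcl] projD(2)[OF cut(1)] lq)
  have 2: "cut A (d n) (?f x) = ?f x" for n
  by (simp add: bcl_simps[OF cut_bcl] q(3) cut_mono[OF d(2)])
  show "?f x = 0"
  proof (rule ccontr)
  assume n: "?f x ~= 0"
  have "(%n. d n * (norm (?f x))^2) ~> (l + 0) * (norm (?f x))^2"
  unfolding d_def by (intro tendsto_intros LIMSEQ_inverse_real_of_nat)
  hence "Re (cinner (?f x) (?f y)) <= l * (norm (?f x))^2"
  using cut(4)[OF in_A 2] by (intro LIMSEQ_le_const) auto
  thus False using cut(5)[OF in_A 1 n] by simp
  qed
 qed
 thus ?thesis using q(2)[of x] unfolding d_def by simp
qed

end

section \<open>Projection-valued measures and functional calculus\<close>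

lemma space_bmo [simp]: "space (borel_measure_of f) = UNIV"
 and sets_bmo [simp, measurable_cong]: "sets (borel_measure_of f) = sets borel"
 unfolding borel_measure_of_def
 by (simp_all add: space_measure_of_conv sets_measure_of_conv) (metis sets.sigma_sets_eq space_borel)

lemma emeasure_bmo:
 assumes nn: "!!B. B : sets borel ==> 0 <= f B"
  and s: "!!B. range B <= sets borel ==> disjoint_family B ==> (%n. f (B n)) sums f (\<Union>n. B n)"
  and B: "B : sets borel"
 shows "emeasure (borel_measure_of f) B = ennreal (f B)"
proof -
 \<comment> \<open>Empty sets form a disjoint family, and a constant series converges only for the
   constant 0.\<close>
 have "(%n::nat. f {}) sums f (\<Union>n::nat. {})" by (rule s) (auto simp: disjoint_family_on_def)
 hence "summable (%n::nat. f {})" by (rule sums_summable)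
 hence f0: "f {} = 0" by (simp add: summable_const_iff)
 show ?thesis
 proof (rule emeasure_measure_of[OF borel_measure_of_def])
  show "positive (sets (borel_measure_of f)) (%B. ennreal (f B))" by (simp add: positive_def f0)
  show "countably_additive (sets (borel_measure_of f)) (%B. ennreal (f B))"
  proof (rule countably_additiveI)
  fix A :: "nat => real set"
  assume A: "range A <= sets (borel_measure_of f)" "disjoint_family A"
  hence "(%n. f (A n)) sums f (\<Union>n. A n)" by (intro s) auto
  thus "(\<Sum>i. ennreal (f (A i))) = ennreal (f (\<Union>n. A n))"
  using A(1) nn by (intro suminf_ennreal_eq) auto
  qed
 qed (use B in auto)
qed

lemma finite_bmo:
 assumes nn: "!!B. B : sets borel ==> 0 <= f B"
  and s: "!!B. range B <= sets borel ==> disjoint_family B ==> (%n. f (B n)) sums f (\<Union>n. B n)"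
 shows "finite_measure (borel_measure_of f)" "B : sets borel ==> measure (borel_measure_of f) B = f B"
proof -
 show "finite_measure (borel_measure_of f)"
  by (rule finite_measureI) (subst emeasure_bmo[OF nn s], auto)
 show "B : sets borel ==> measure (borel_measure_of f) B = f B"
  unfolding measure_def by (subst emeasure_bmo[OF nn s]) (auto simp: nn)
qed

lemma integral_indicator_complex:
 assumes "B : sets M" "space M = UNIV"
 shows "(\<integral>t. indicator B t \<partial>M) = cr (measure M B)"
proof -
 have "(%t. indicator B t) = (%t. cr (indicator B t))" by (auto simp: indicator_def)
 thus ?thesis using assms by (simp only: integral_complex_of_real) simp
qed

lemma cnj_mult_self: "cnj z * z = cr ((cmod z)^2)"
 by (simp only: complex_norm_square mult.commute)

definition smeas :: "(real set => 'h::complex_hilbert_space => 'h) => 'h => real measure"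
 where "smeas E x = borel_measure_of (%B. Re (cinner x (E B x)))"

lemma sets_smeas [simp, measurable_cong]: "sets (smeas E x) = sets borel"
 and space_smeas [simp]: "space (smeas E x) = UNIV"
 by (simp_all add: smeas_def)

text \<open>Bounded Borel functions, the arguments of the functional calculus
  \<open>fc\<close>.\<close>

definition bb :: "(real => complex) => bool"
 where "bb f <-> f : borel_measurable borel & (EX C. ALL t. cmod (f t) <= C)"

lemma bbI: "f : borel_measurable borel ==> (!!t. cmod (f t) <= C) ==> bb f"
 unfolding bb_def by blast

lemma bb_measurable [measurable_dest]: "bb f ==> f : borel_measurable borel"
 by (simp add: bb_def)

lemma bbD: assumes "bb f" obtains C where "C > 0" "!!t. cmod (f t) <= C"
proof -
 obtain C where "!!t. cmod (f t) <= C" using assms unfolding bb_def by blast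
 hence "max C 1 > 0" "!!t. cmod (f t) <= max C 1" by (auto simp: le_max_iff_disj)
 thus ?thesis using that by blast
qed

lemma bb_indicator: "B : sets borel ==> bb (indicator B)"
 by (rule bbI[of _ 1]) (auto simp: indicator_def)

lemma bb_const: "bb (%t. c)" by (rule bbI[of _ "cmod c"]) auto

lemma bb_add: assumes "bb f" "bb g" shows "bb (%t. f t + g t)"
proof -
 obtain C D where "!!t. cmod (f t) <= C" "!!t. cmod (g t) <= D" using assms bbD by metis
 thus ?thesis using assms by (intro bbI[of _ "C + D"]) (auto intro: norm_triangle_le add_mono)
qed

lemma bb_mult: assumes "bb f" "bb g" shows "bb (%t. f t * g t)"
proof -
 obtain C D where "C > 0" "!!t. cmod (f t) <= C" "!!t. cmod (g t) <= D" using assms bbD by metis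
 thus ?thesis using assms by (intro bbI[of _ "C * D"]) (auto simp: norm_mult intro!: mult_mono)
qed

lemma bb_cmult: "bb f ==> bb (%t. c * f t)" using bb_mult[OF bb_const] .

lemma bb_cnj: "bb f ==> bb (%t. cnj (f t))"
 unfolding bb_def using measurable_compose[OF _ borel_measurable_continuous_onI[of cnj]] by (auto intro!: continuous_intros)

lemma bb_diff: "bb f ==> bb g ==> bb (%t. f t - g t)"
 using bb_add[OF _ bb_cmult[of g "-1"], of f] by simp

text \<open>Rounding real and imaginary parts down to a grid yields finitely many values and a
  uniform error, so indicators, linear combinations and uniform limits reach every bounded Borel
  function.\<close>

lemma bb_induct [consumes 1, case_names ind add cmult lim]:
 assumes f: "bb f"
  and ind: "!!B. B : sets borel ==> P (indicator B)"
  and add: "!!f g. bb f ==> P f ==> bb g ==> P g ==> P (%t. f t + g t)"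
  and cmult: "!!c f. bb f ==> P f ==> P (%t. c * f t)"
  and lim: "!!f F. bb f ==> (!!n. bb (F n)) ==> (!!n. P (F n)) ==>
  (!!n t. cmod (F n t - f t) <= inverse (real (Suc n))) ==> P f"
 shows "P f"
proof -
 have simple: "bb (%t. \<Sum>c\<in>S. c * indicator (B c) t) & P (%t. \<Sum>c\<in>S. c * indicator (B c) t)"
  if "finite S" "!!c. c : S ==> B c : sets borel" for S and B :: "complex => real set"
  using that
 proof (induction S rule: finite_induct)
  case empty
  have "P (%t. 0 * indicator UNIV t)" by (intro cmult ind bb_indicator) auto
  thus ?case by (simp add: bb_const)
 next
  case (insert c S)
  let ?f = "%t. c * indicator (B c) t" and ?g = "%t. \<Sum>c\<in>S. c * indicator (B c) t"
  have B: "B c : sets borel" using insert by simp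
  have "bb ?f" "P ?f" by (rule bb_cmult cmult bb_indicator ind B)+
  moreover have "bb ?g" "P ?g" using insert by auto
  ultimately have "bb (%t. ?f t + ?g t)" "P (%t. ?f t + ?g t)" using bb_add add by blast+
  thus ?case by (simp only: sum.insert[OF insert.hyps] simp_thms)
 qed
 obtain C where C: "C > 0" "!!t. cmod (f t) <= C" using f bbD by blast
 \<comment> \<open>The factor 2 splits the error \<open>inverse (Suc n)\<close> evenly between real
   and imaginary part.\<close>
 define N where "N n = 2 * real (Suc n)" for n
 have N: "N n > 0" for n by (simp add: N_def)
 define d where "d n r = of_int \<lfloor>N n * r\<rfloor> / N n" for n r
 have d: "\<bar>d n r - r\<bar> <= 1 / N n" for n r
 proof -
  have "\<bar>of_int \<lfloor>N n * r\<rfloor> - N n * r\<bar> <= 1" by linarith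
  hence "\<bar>of_int \<lfloor>N n * r\<rfloor> - N n * r\<bar> / N n <= 1 / N n" by (rule divide_right_mono) (use N[of n] in simp)
  also have "\<bar>of_int \<lfloor>N n * r\<rfloor> - N n * r\<bar> / N n = \<bar>(of_int \<lfloor>N n * r\<rfloor> - N n * r) / N n\<bar>" using N[of n] by simp
  also have "(of_int \<lfloor>N n * r\<rfloor> - N n * r) / N n = d n r - r" using N[of n] by (simp add: d_def diff_divide_distrib)
  finally show ?thesis .
 qed
 define F where "F n t = Complex (d n (Re (f t))) (d n (Im (f t)))" for n t
 have F_eq: "F n = (%t. cr (d n (Re (f t))) + \<i> * cr (d n (Im (f t))))" for n
  by (auto simp: F_def complex_eq_iff)
 have fm: "f : borel_measurable borel" using f by (simp add: bb_def)
 have Fm: "F n : borel_measurable borel" for n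
  unfolding F_eq d_def using fm by measurable
 have fin: "finite (range (F n))" for n
 proof -
  let ?I = "(%k. of_int k / N n) ` {- \<lceil>N n * C\<rceil> - 1 .. \<lceil>N n * C\<rceil> + 1} :: real set"
  have "d n r : ?I" if "\<bar>r\<bar> <= C" for r
  proof -
  have "\<bar>N n * r\<bar> <= N n * C" using that N[of n] by (simp add: abs_mult)
  hence "\<lfloor>N n * r\<rfloor> : {- \<lceil>N n * C\<rceil> - 1 .. \<lceil>N n * C\<rceil> + 1}" by (auto simp: abs_le_iff) linarith+
  thus ?thesis unfolding d_def by blast
  qed
  hence "d n (Re (f t)) : ?I" "d n (Im (f t)) : ?I" for t
  using C(2) abs_Re_le_cmod abs_Im_le_cmod order_trans by blast+
  hence "F n t : (%(a, b). Complex a b) ` (?I \<times> ?I)" for t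
  unfolding F_def by (intro image_eqI[of _ _ "(d n (Re (f t)), d n (Im (f t)))"]) auto
  hence "range (F n) <= (%(a, b). Complex a b) ` (?I \<times> ?I)" by blast
  thus ?thesis by (rule finite_subset) auto
 qed
 have rep: "F n = (%t. \<Sum>c\<in>range (F n). c * indicator (F n -` {c}) t)" for n
 proof
  fix t
  have "(\<Sum>c\<in>range (F n). c * indicator (F n -` {c}) t) = (\<Sum>c\<in>range (F n). if c = F n t then c else 0)"
  by (rule sum.cong) (auto simp: indicator_def)
  also have "... = F n t" using fin by (simp add: sum.delta)
  finally show "F n t = (\<Sum>c\<in>range (F n). c * indicator (F n -` {c}) t)" ..
 qed
 have "F n -` {c} : sets borel" for n c
  using measurable_sets[OF Fm, of "{c}" n] by simp
 hence bP: "bb (F n) & P (F n)" for n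
  using simple[OF fin[of n], of "%c. F n -` {c}"] by (simp only: rep[symmetric])
 have close: "cmod (F n t - f t) <= inverse (real (Suc n))" for n t
 proof -
  have "cmod (F n t - f t) <= \<bar>Re (F n t - f t)\<bar> + \<bar>Im (F n t - f t)\<bar>" by (rule cmod_le)
  also have "... <= 1 / N n + 1 / N n" unfolding F_def by (intro add_mono) (simp_all add: d)
  also have "... = inverse (real (Suc n))" by (simp add: N_def field_simps)
  finally show ?thesis .
 qed
 show ?thesis by (rule lim[OF f, of F]) (use bP close in auto)
qed

text \<open>A bounded operator is determined by its quadratic form (\<open>op_eqI\<close>), so
  scalar integrals against \<open>smeas E x\<close> define the operator.\<close>

definition fc :: "(real set => 'h::complex_hilbert_space => 'h) => (real => complex) => 'h => 'h"
 where "fc E f = (THE a. bcl a & (ALL x. cinner x (a x) = (\<integral>t. f t \<partial>smeas E x)))"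

context
 fixes E :: "real set => 'h::complex_hilbert_space => 'h"
 assumes E: "pvmeas E"
begin

lemma pvm:
 shows "B : sets borel ==> projop (E B)" "B \<notin> sets borel ==> E B = (%_. 0)" "E UNIV = id"
  "range F <= sets borel ==> disjoint_family F ==> (%n. E (F n) x) sums E (\<Union>n. F n) x"
 using E unfolding projection_valued_measure_def by auto

lemmas pvmD = projD[OF pvm(1)]

lemma pvm_nonneg_sums:
 shows "B : sets borel ==> 0 <= Re (cinner x (E B x))"
  "range F <= sets borel ==> disjoint_family F ==> (%n. Re (cinner x (E (F n) x))) sums Re (cinner x (E (\<Union>n. F n) x))"
proof -
 show "B : sets borel ==> 0 <= Re (cinner x (E B x))" by (subst pvmD(5)) auto
 assume "range F <= sets borel" "disjoint_family F"
 from pvm(4)[OF this] have "(%n. cinner x (E (F n) x)) sums cinner x (E (\<Union>n. F n) x)"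
  by (rule bounded_linear.sums[OF cinner.bounded_linear_right])
 thus "(%n. Re (cinner x (E (F n) x))) sums Re (cinner x (E (\<Union>n. F n) x))" by (rule sums_Re)
qed

lemma smeas:
 shows "finite_measure (smeas E x)" "B : sets borel ==> measure (smeas E x) B = (norm (E B x))^2"
  "measure (smeas E x) UNIV = (norm x)^2"
proof -
 show "finite_measure (smeas E x)"
  unfolding smeas_def by (rule finite_bmo) (use pvm_nonneg_sums in auto)
 show 1: "measure (smeas E x) B = (norm (E B x))^2" if "B : sets borel" for B
 proof -
  have "measure (smeas E x) B = Re (cinner x (E B x))"
  unfolding smeas_def by (rule finite_bmo(2)) (use pvm_nonneg_sums that in auto)
  thus ?thesis by (simp add: pvmD(5)[OF that])
 qed
 show "measure (smeas E x) UNIV = (norm x)^2" using 1[of UNIV] by (simp add: pvm(3))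
qed

lemma pvm_empty: "E {} x = 0"
proof -
 have "measure (smeas E x) {} = 0" by simp
 thus ?thesis using smeas(2)[of "{}" x] by simp
qed

lemma pvm_Un:
 assumes "A : sets borel" "B : sets borel" "A Int B = {}"
 shows "E (A Un B) x = E A x + E B x"
proof -
 have "(%n. E (binaryset A B n) x) sums E (\<Union>n. binaryset A B n) x"
  by (rule pvm(4)) (use assms in \<open>auto simp: range_binaryset_eq disjoint_family_on_def binaryset_def\<close>)
 moreover have "(%n. E (binaryset A B n) x) sums (\<Sum>n<2. E (binaryset A B n) x)"
  by (rule sums_finite) (auto simp: binaryset_def pvm_empty)
 ultimately have "E (\<Union>n. binaryset A B n) x = (\<Sum>n<2. E (binaryset A B n) x)" by (rule sums_unique2)
 thus ?thesis by (simp add: UN_binaryset_eq numeral_2_eq_2 binaryset_def)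
qed

text \<open>For the vector \<open>E B x\<close> the set \<open>A Un B\<close> has at most the total
  mass, and \<open>B\<close> alone exhausts it.\<close>

lemma pvm_disjoint:
 assumes AB: "A : sets borel" "B : sets borel" "A Int B = {}"
 shows "E A (E B x) = 0"
proof -
 have "Re (cinner (E B x) (E (A Un B) (E B x))) <= (norm (E B x))^2"
  using pvmD(5,6)[of "A Un B" "E B x"] AB by (simp add: power_mono)
 hence "(norm (E A (E B x)))^2 + (norm (E B x))^2 <= (norm (E B x))^2"
  using AB by (simp add: pvm_Un cinner_add_right pvmD(2,5) cinner_self del: of_real_power)
 thus ?thesis by simp
qed

lemma pvm_Int:
 assumes "A : sets borel" "B : sets borel"
 shows "E A (E B x) = E (A Int B) x"
proof -
 have A: "E A y = E (A Int B) y + E (A - B) y" for y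
  using pvm_Un[of "A Int B" "A - B" y] assms by (auto simp: Int_Diff_Un)
 have "A Int B Un (B - A) = B" "A Int B Int (B - A) = {}" by auto
 hence B: "E B x = E (A Int B) x + E (B - A) x"
  using pvm_Un[of "A Int B" "B - A" x] assms by auto
 have "E (A - B) (E B x) = 0" using assms by (intro pvm_disjoint) auto
 hence "E A (E B x) = E (A Int B) (E (A Int B) x) + E (A Int B) (E (B - A) x)"
  unfolding A[of "E B x"] unfolding B using assms by (simp add: bcl_add[OF pvmD(1)])
 also have "E (A Int B) (E (B - A) x) = 0" using assms by (intro pvm_disjoint) auto
 finally show ?thesis using assms by (simp add: pvmD(2))
qed

lemma smeas_integrable: assumes "bb f" shows "integrable (smeas E x) f"
proof -
 obtain C where "C > 0" "!!t. cmod (f t) <= C" using assms bbD by blast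
 thus ?thesis
  using assms by (intro finite_measure.integrable_const_bound[OF smeas(1), where B = C]) (auto simp: bb_def)
qed

lemma smeas_integral_bound:
 assumes "bb f" "!!t. cmod (f t) <= C"
 shows "cmod (\<integral>t. f t \<partial>smeas E x) <= C * (norm x)^2"
proof -
 interpret finite_measure "smeas E x" by (rule smeas)
 have "cmod (\<integral>t. f t \<partial>smeas E x) <= (\<integral>t. cmod (f t) \<partial>smeas E x)" by (rule integral_norm_bound)
 also have "... <= (\<integral>t. C \<partial>smeas E x)"
  by (rule integral_mono) (use assms smeas_integrable in auto)
 finally show ?thesis by (simp add: smeas(3) mult.commute)
qed

lemma fc_exists:
 assumes "bb f" shows "EX a. bcl a & (ALL x. cinner x (a x) = (\<integral>t. f t \<partial>smeas E x))"
 using assms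
proof (induction f rule: bb_induct)
 case (ind B)
 have "cinner x (E B x) = (\<integral>t. indicator B t \<partial>smeas E x)" for x
  using ind by (simp add: pvmD(5) integral_indicator_complex smeas(2))
 thus ?case using pvmD(1)[OF ind] by blast
next
 case (add f g)
 then obtain a b where "bcl a" "!!x. cinner x (a x) = (\<integral>t. f t \<partial>smeas E x)"
  "bcl b" "!!x. cinner x (b x) = (\<integral>t. g t \<partial>smeas E x)" by blast
 thus ?case using add(1,2)
  by (intro exI[of _ "%x. a x + b x"]) (auto intro: bcl_plus simp: cinner_add_right smeas_integrable)
next
 case (cmult c f)
 then obtain a where "bcl a" "!!x. cinner x (a x) = (\<integral>t. f t \<partial>smeas E x)" by blast
 thus ?case by (intro exI[of _ "%x. c *c a x"]) (auto intro: bcl_scaleC)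
next
 case (lim f F)
 then obtain a where a: "!!n. bcl (a n)" "!!n x. cinner x (a n x) = (\<integral>t. F n t \<partial>smeas E x)" by metis
 let ?i = "%n. inverse (real (Suc n))"
 \<comment> \<open>The forms differ by at most \<open>?i n + ?i m\<close>, so the operators are
   uniformly Cauchy.\<close>
 have cl: "norm (a n x - a m x) <= 2 * (?i n + ?i m) * norm x" for n m x
 proof (rule numeric_radius[where a = "%x. a n x - a m x"])
  show "bcl (%x. a n x - a m x)" by (intro bcl_intros a)
  fix x
  have "cinner x (a n x - a m x) = (\<integral>t. F n t - F m t \<partial>smeas E x)"
  by (simp add: cinner.diff_right a smeas_integrable lim)
  also have "cmod ... <= (?i n + ?i m) * (norm x)^2"
  proof (rule smeas_integral_bound)
  show "bb (%t. F n t - F m t)" using lim by (intro bb_diff) auto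
  show "cmod (F n t - F m t) <= ?i n + ?i m" for t
  using norm_triangle_ineq4[of "F n t - f t" "F m t - f t"] lim(3)[of n t] lim(3)[of m t] by simp
  qed
  finally show "cmod (cinner x (a n x - a m x)) <= (?i n + ?i m) * (norm x)^2" .
 qed
 have "convergent (%n. a n x)" for x
 proof (rule Cauchy_convergent, rule metric_CauchyI)
  fix e :: real assume e: "0 < e"
  have "(%n. 4 * ?i n * norm x) ~> 4 * 0 * norm x" by (intro tendsto_intros LIMSEQ_inverse_real_of_nat)
  hence "eventually (%n. 4 * ?i n * norm x < e) sequentially" using e by (intro order_tendstoD(2)) auto
  then obtain M where M: "!!n. n >= M ==> 4 * ?i n * norm x < e" unfolding eventually_sequentially by blast
  have "dist (a m x) (a n x) < e" if "m >= M" "n >= M" for m n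
  using cl[of m x n] M[OF that(1)] M[OF that(2)] unfolding dist_norm distrib_left distrib_right by argo
  thus "EX M. ALL m>=M. ALL n>=M. dist (a m x) (a n x) < e" by blast
 qed
 then obtain b where b: "!!x. (%n. a n x) ~> b x" unfolding convergent_def by metis
 obtain C where C: "!!x. norm (a 0 x) <= C * norm x" using a(1)[of 0] bcl_bound by metis
 have bd: "norm (a n x) <= (C + 4) * norm x" for n x
 proof -
  have i: "?i n <= 1" "?i 0 = 1" by (auto simp: field_simps)
  have "norm (a n x) <= norm (a 0 x) + norm (a n x - a 0 x)" by (rule norm_triangle_sub)
  also have "... <= C * norm x + 2 * (?i n + ?i 0) * norm x" by (intro add_mono C cl)
  also have "... <= C * norm x + 2 * (1 + 1) * norm x" using i by (intro add_mono mult_right_mono) auto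
  finally show ?thesis by (simp add: algebra_simps)
 qed
 have "bcl b" by (rule bcl_limit[OF a(1) b bd])
 moreover have "cinner x (b x) = (\<integral>t. f t \<partial>smeas E x)" for x
 proof (rule LIMSEQ_unique)
  show "(%n. cinner x (a n x)) ~> cinner x (b x)" by (intro cinner.tendsto b tendsto_const)
  have "(%n. cinner x (a n x) - (\<integral>t. f t \<partial>smeas E x)) ~> 0"
  proof (rule Lim_null_comparison)
  show "\<forall>\<^sub>F n in sequentially. norm (cinner x (a n x) - (\<integral>t. f t \<partial>smeas E x)) <= ?i n * (norm x)^2"
  proof (rule always_eventually, rule allI)
  fix n
  have "cinner x (a n x) - (\<integral>t. f t \<partial>smeas E x) = (\<integral>t. F n t - f t \<partial>smeas E x)"
  using lim by (simp add: a smeas_integrable)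
  thus "norm (cinner x (a n x) - (\<integral>t. f t \<partial>smeas E x)) <= ?i n * (norm x)^2"
  using smeas_integral_bound[of "%t. F n t - f t" "?i n" x] lim by (simp add: bb_diff)
  qed
  have "(%n. ?i n * (norm x)^2) ~> 0 * (norm x)^2" by (intro tendsto_intros LIMSEQ_inverse_real_of_nat)
  thus "(%n. ?i n * (norm x)^2) ~> 0" by simp
  qed
  thus "(%n. cinner x (a n x)) ~> (\<integral>t. f t \<partial>smeas E x)" by (simp add: LIM_zero_iff)
 qed
 ultimately show ?case by blast
qed

lemma fc_unique:
 assumes "bcl a" "!!x. cinner x (a x) = (\<integral>t. f t \<partial>smeas E x)"
 shows "fc E f = a"
 unfolding fc_def
proof (rule the_equality)
 fix b assume "bcl b & (ALL x. cinner x (b x) = (\<integral>t. f t \<partial>smeas E x))"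
 thus "b = a" using assms by (intro op_eqI) auto
qed (use assms in blast)

lemma fc:
 assumes "bb f"
 shows "bcl (fc E f)" "cinner x (fc E f x) = (\<integral>t. f t \<partial>smeas E x)"
 using fc_exists[OF assms] fc_unique by metis+

lemma fc_ind: "B : sets borel ==> fc E (indicator B) = E B"
 by (rule fc_unique) (simp_all add: pvmD(1,5) integral_indicator_complex smeas(2))

lemma fc_add: "bb f ==> bb g ==> fc E (%t. f t + g t) = (%x. fc E f x + fc E g x)"
 by (rule fc_unique) (auto intro: bcl_plus simp: cinner_add_right smeas_integrable fc)

lemma fc_diff: "bb f ==> bb g ==> fc E (%t. f t - g t) = (%x. fc E f x - fc E g x)"
 by (rule fc_unique) (auto intro: bcl_minusop simp: cinner.diff_right smeas_integrable fc)

lemma fc_cmult: "bb f ==> fc E (%t. c * f t) = (%x. c *c fc E f x)"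
 by (rule fc_unique) (auto intro: bcl_scaleC simp: fc)

lemma fc_const: "fc E (%t. c) = (%x. c *c x)"
proof (rule fc_unique)
 show "bcl (%x. c *c x)" for c by (intro bcl_intros)
 interpret finite_measure "smeas E x" for x by (rule smeas)
 show "cinner x (c *c x) = (\<integral>t. c \<partial>smeas E x)" for x
  by (simp add: cinner_self smeas(3) scaleR_conv_of_real)
qed

lemma fc_cnj: assumes "bb f" shows "cadj (fc E f) = fc E (%t. cnj (f t))"
proof (rule fc_unique[symmetric])
 show "bcl (cadj (fc E f))" using cadj fc(1)[OF assms] by blast
 show "cinner x (cadj (fc E f) x) = (\<integral>t. cnj (f t) \<partial>smeas E x)" for x
  using cadj(2)[OF fc(1)[OF assms], of x x] fc(2)[OF assms, of x] cinner_commute[of "fc E f x" x] by simp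
qed

text \<open>The factor 2 stems from \<open>numeric_radius\<close> and is harmless in limits; the
  sharp bound is \<open>fc_norm_le\<close>, which relies on multiplicativity.\<close>

lemma fc_close2: "bb f ==> bb g ==> (!!t. cmod (f t - g t) <= C) ==> norm (fc E f x - fc E g x) <= 2 * C * norm x"
 using numeric_radius[OF fc(1)[OF bb_diff], of f g C x] smeas_integral_bound[OF bb_diff, of f g C]
 by (simp add: fc(2)[OF bb_diff]) (simp add: fc_diff)

lemma fc_lim:
 assumes "bb f" "!!n. bb (F n)" "!!n t. cmod (F n t - f t) <= inverse (real (Suc n))"
 shows "(%n. fc E (F n) x) ~> fc E f x"
proof -
 have "(%n. fc E (F n) x - fc E f x) ~> 0"
 proof (rule Lim_null_comparison)
  show "\<forall>\<^sub>F n in sequentially. norm (fc E (F n) x - fc E f x) <= 2 * inverse (real (Suc n)) * norm x"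
  using fc_close2 assms by (intro always_eventually allI) blast
  have "(%n. 2 * inverse (real (Suc n)) * norm x) ~> 2 * 0 * norm x"
  by (intro tendsto_intros LIMSEQ_inverse_real_of_nat)
  thus "(%n. 2 * inverse (real (Suc n)) * norm x) ~> 0" by simp
 qed
 thus ?thesis by (simp add: LIM_zero_iff)
qed

lemma fc_E_mult:
 assumes B: "B : sets borel" and g: "bb g"
 shows "E B (fc E g x) = fc E (%t. indicator B t * g t) x"
 using g
proof (induction g rule: bb_induct)
 case (ind C)
 have "(%t. indicator B t * indicator C t :: complex) = indicator (B Int C)" by (auto simp: indicator_def)
 thus ?case using B ind by (simp add: fc_ind pvm_Int)
next
 case (add f g)
 thus ?case using bb_mult[OF bb_indicator[OF B]]
  by (simp add: fc_add distrib_left bcl_add[OF pvmD(1)[OF B]])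
next
 case (cmult c f)
 have "(%t. indicator B t * (c * f t)) = (%t. c * (indicator B t * f t))" by (simp add: ac_simps)
 thus ?case using cmult bb_mult[OF bb_indicator[OF B] cmult(1)]
  by (simp add: fc_cmult bcl_scale[OF pvmD(1)[OF B]])
next
 case (lim f F)
 have "(%n. fc E (%t. indicator B t * F n t) x) ~> fc E (%t. indicator B t * f t) x"
 proof (rule fc_lim)
  show "cmod (indicator B t * F n t - indicator B t * f t) <= inverse (real (Suc n))" for n t
  using lim(3)[of n t] by (auto simp: indicator_def)
 qed (use lim bb_mult[OF bb_indicator[OF B]] in auto)
 moreover have "(%n. E B (fc E (F n) x)) ~> E B (fc E f x)"
  by (rule bcl_tendsto[OF pvmD(1)[OF B] fc_lim]) (use lim in auto)
 ultimately show ?case using lim(4) LIMSEQ_unique by auto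
qed

lemma fc_mult:
 assumes f: "bb f" and g: "bb g"
 shows "fc E f (fc E g x) = fc E (%t. f t * g t) x"
 using f
proof (induction f rule: bb_induct)
 case (ind B)
 thus ?case using fc_E_mult[OF _ g] by (simp add: fc_ind)
next
 case (add f h)
 thus ?case using bb_mult[OF _ g] by (simp add: fc_add distrib_right)
next
 case (cmult c f)
 thus ?case using bb_mult[OF cmult(1) g] by (simp add: fc_cmult mult.assoc)
next
 case (lim f F)
 obtain C where C: "C > 0" "!!t. cmod (g t) <= C" using g bbD by blast
 let ?i = "%n. inverse (real (Suc n))"
 have "(%n. fc E (%t. F n t * g t) x - fc E (%t. f t * g t) x) ~> 0"
 proof (rule Lim_null_comparison)
  show "\<forall>\<^sub>F n in sequentially. norm (fc E (%t. F n t * g t) x - fc E (%t. f t * g t) x) <= 2 * (?i n * C) * norm x"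
  proof (intro always_eventually allI fc_close2 bb_mult lim g)
  fix n t
  have "cmod (F n t * g t - f t * g t) = cmod (F n t - f t) * cmod (g t)"
  by (simp add: norm_mult[symmetric] left_diff_distrib)
  also have "... <= ?i n * C" by (intro mult_mono lim C) auto
  finally show "cmod (F n t * g t - f t * g t) <= ?i n * C" .
  qed
  have "(%n. 2 * (?i n * C) * norm x) ~> 2 * (0 * C) * norm x"
  by (intro tendsto_intros LIMSEQ_inverse_real_of_nat)
  thus "(%n. 2 * (?i n * C) * norm x) ~> 0" by simp
 qed
 hence "(%n. fc E (%t. F n t * g t) x) ~> fc E (%t. f t * g t) x" by (simp add: LIM_zero_iff)
 moreover have "(%n. fc E (F n) (fc E g x)) ~> fc E f (fc E g x)" by (rule fc_lim) (use lim in auto)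
 ultimately show ?case using lim(4) LIMSEQ_unique by auto
qed

lemma fc_norm_sq: assumes "bb f" shows "cr ((norm (fc E f x))^2) = (\<integral>t. cr ((cmod (f t))^2) \<partial>smeas E x)"
proof -
 have "cr ((norm (fc E f x))^2) = cinner (fc E f x) (fc E f x)" by (simp add: cinner_self)
 also have "... = cinner x (fc E (%t. cnj (f t)) (fc E f x))"
  using cadj(2)[OF fc(1)[OF assms]] fc_cnj[OF assms] by metis
 also have "... = cinner x (fc E (%t. cnj (f t) * f t) x)" using fc_mult[OF bb_cnj] assms by simp
 also have "... = (\<integral>t. cnj (f t) * f t \<partial>smeas E x)" using fc(2)[OF bb_mult[OF bb_cnj]] assms by blast
 also have "(%t. cnj (f t) * f t) = (%t. cr ((cmod (f t))^2))"
  by (simp only: cnj_mult_self)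
 finally show ?thesis .
qed

lemma fc_norm_sq': "bb f ==> (norm (fc E f x))^2 = (\<integral>t. (cmod (f t))^2 \<partial>smeas E x)"
 using fc_norm_sq unfolding integral_complex_of_real of_real_eq_iff .

lemma fc_norm_le:
 assumes "bb f" "!!t. cmod (f t) <= C" "C >= 0"
 shows "norm (fc E f x) <= C * norm x"
proof (rule power2_le_imp_le)
 have "cmod (cr ((norm (fc E f x))^2)) <= C^2 * (norm x)^2"
  unfolding fc_norm_sq[OF assms(1)]
 proof (rule smeas_integral_bound)
  show "bb (%t. cr ((cmod (f t))^2))"
  using bb_mult[OF bb_cnj[OF assms(1)] assms(1)] by (simp only: cnj_mult_self)
 qed (use assms in \<open>simp add: power_mono norm_power\<close>)
 thus "(norm (fc E f x))^2 <= (C * norm x)^2" by (simp add: power_mult_distrib norm_power)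
qed (use assms in simp)

text \<open>By \<open>fc_norm_sq'\<close> strong convergence is convergence in mean square against
  \<open>smeas E x\<close>, where dominated convergence applies.\<close>

lemma fc_tendsto:
 assumes f: "bb f" and F: "!!n. bb (F n)" "!!n t. cmod (F n t) <= C" and l: "!!t. (%n. F n t) ~> f t"
 shows "(%n. fc E (F n) x) ~> fc E f x"
proof -
 interpret finite_measure "smeas E x" by (rule smeas)
 have fC: "cmod (f t) <= C" for t
  by (rule tendsto_upperbound[OF tendsto_norm[OF l]]) (use F in auto)
 have "(%n. \<integral>t. (cmod (F n t - f t))^2 \<partial>smeas E x) ~> (\<integral>t. 0 \<partial>smeas E x)"
 proof (rule integral_dominated_convergence[where w = "%t. (2 * C)^2"])
  show "AE t in smeas E x. (%n. (cmod (F n t - f t))^2) ~> 0"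
  proof (rule AE_I2)
  fix t
  have "(%n. (cmod (F n t - f t))^2) ~> (cmod (f t - f t))^2" by (intro tendsto_intros l)
  thus "(%n. (cmod (F n t - f t))^2) ~> 0" by simp
  qed
  fix n
  have "cmod (F n t - f t) <= 2 * C" for t
  using norm_triangle_ineq4[of "F n t" "f t"] F(2)[of n t] fC[of t] by linarith
  thus "AE t in smeas E x. norm ((cmod (F n t - f t))^2) <= (2 * C)^2"
  by (intro AE_I2) (simp only: real_norm_def abs_power2, rule power_mono, auto)
  show "(%t. (cmod (F n t - f t))^2) : borel_measurable (smeas E x)"
  using F(1)[THEN bb_measurable] f[THEN bb_measurable]
  by (subst measurable_cong_sets[OF sets_smeas refl]) measurable
 qed auto
 hence "(%n. (norm (fc E (F n) x - fc E f x))^2) ~> 0"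
  using fc_norm_sq'[OF bb_diff[OF F(1) f]] by (simp add: fc_diff F(1) f)
 hence "(%n. sqrt ((norm (fc E (F n) x - fc E f x))^2)) ~> sqrt 0" by (rule tendsto_real_sqrt)
 thus ?thesis by (simp add: tendsto_norm_zero_iff LIM_zero_iff)
qed

lemma fc_commute:
 assumes c: "bcl c" "!!B x. B : sets borel ==> c (E B x) = E B (c x)" and f: "bb f"
 shows "c (fc E f x) = fc E f (c x)"
 using f
proof (induction f rule: bb_induct)
 case (ind B) thus ?case using c(2) by (simp add: fc_ind)
next
 case (add f h) thus ?case by (simp add: fc_add bcl_add[OF c(1)])
next
 case (cmult a f) thus ?case by (simp add: fc_cmult bcl_scale[OF c(1)])
next
 case (lim f F)
 have "(%n. fc E (F n) (c x)) ~> fc E f (c x)" by (rule fc_lim) (use lim in auto)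
 moreover have "(%n. c (fc E (F n) x)) ~> c (fc E f x)"
  by (rule bcl_tendsto[OF c(1) fc_lim]) (use lim in auto)
 ultimately show ?case using lim(4) LIMSEQ_unique by auto
qed

end

section \<open>The spectral theorem\<close>

definition ivl :: "nat => real set" where "ivl n = {- real n .. real n}"
definition trn :: "nat => real => complex" where "trn n t = cr (t * indicator (ivl n) t)"
definition rz :: "complex => real => complex" where "rz z t = 1 / (cr t - z)"

text \<open>The integral of \<open>t\<close> against \<open>E\<close>, described without reference
  to a domain: the equation only has to hold after cutting to each interval \<open>[-n, n]\<close>.
  Square integrability reappears as \<open>pvm_op_Domain\<close>.\<close>

definition pvm_op :: "(real set => 'h::complex_hilbert_space => 'h) => 'h opgraph"
 where "pvm_op E = {(x, y). ALL n. E (ivl n) y = fc E (trn n) x}"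

lemma ivl_borel [simp, measurable]: "ivl n : sets borel" by (simp add: ivl_def)

lemma bb_tr: "bb (trn n)"
proof (rule bbI[of _ "real n"])
 show "trn n : borel_measurable borel" unfolding trn_def by measurable
 show "cmod (trn n t) <= real n" for t
  unfolding trn_def by (auto simp: ivl_def indicator_def norm_mult simp del: of_real_mult)
qed

lemma rz_nz: "Im z ~= 0 ==> cr t - z ~= 0"
 by (metis Im_complex_of_real eq_iff_diff_eq_0)

lemma cmod_rz: assumes "Im z ~= 0" shows "cmod (rz z t) <= 1 / \<bar>Im z\<bar>"
proof -
 have "\<bar>Im z\<bar> <= cmod (cr t - z)" using abs_Im_le_cmod[of "cr t - z"] by simp
 thus ?thesis unfolding rz_def using assms by (simp add: norm_divide frac_le)
qed

lemma bb_rz: "Im z ~= 0 ==> bb (rz z)"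
 by (rule bbI[of _ "1 / \<bar>Im z\<bar>"]) (simp add: rz_def[abs_def], rule cmod_rz)

lemma rz_tr: "Im z ~= 0 ==> trn n t * rz z t = indicator (ivl n) t * (1 + z * rz z t)"
 using rz_nz[of z t] by (auto simp: trn_def rz_def indicator_def field_simps)

lemma ivl_eventually: "eventually (%n. t : ivl n) sequentially"
proof -
 obtain N where N: "\<bar>t\<bar> <= real N" using real_arch_simple by blast
 have "t : ivl n" if "n >= N" for n
 proof -
  have "real N <= real n" using that by simp
  thus ?thesis using N unfolding ivl_def by auto
 qed
 thus ?thesis by (auto simp: eventually_sequentially)
qed

context
 fixes E :: "real set => 'h::complex_hilbert_space => 'h"
 assumes E: "pvmeas E"
begin

lemmas pvmE = pvmD[OF E]

lemma ivl_tendsto: "(%n. E (ivl n) x) ~> x"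
proof -
 have "(%n. fc E (indicator (ivl n)) x) ~> fc E (%t. 1) x"
 proof (rule fc_tendsto[OF E, where C = 1])
  show "(%n. indicator (ivl n) t) ~> (1::complex)" for t
  by (rule tendsto_eventually) (rule eventually_mono[OF ivl_eventually[of t]], simp)
 qed (auto intro: bb_const bb_indicator simp: indicator_def)
 thus ?thesis by (simp add: fc_ind[OF E] fc_const[OF E])
qed

lemma pvm_op_res:
 assumes z: "Im z ~= 0"
 shows "(fc E (rz z) w, w + z *c fc E (rz z) w) : pvm_op E"
proof -
 have "E (ivl n) (w + z *c fc E (rz z) w) = fc E (trn n) (fc E (rz z) w)" for n
 proof -
  have b: "bb (%t. 1 + z * rz z t)" by (intro bb_add bb_const bb_cmult bb_rz z)
  have "fc E (trn n) (fc E (rz z) w) = fc E (%t. trn n t * rz z t) w" by (rule fc_mult[OF E bb_tr bb_rz[OF z]])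
  also have "... = E (ivl n) (fc E (%t. 1 + z * rz z t) w)"
  unfolding rz_tr[OF z] by (rule fc_E_mult[OF E ivl_borel b, symmetric])
  also have "fc E (%t. 1 + z * rz z t) w = w + z *c fc E (rz z) w"
  using bb_rz[OF z] by (simp add: fc_add[OF E] fc_const[OF E] fc_cmult[OF E] bb_const bb_cmult)
  finally show ?thesis by simp
 qed
 thus ?thesis by (simp add: pvm_op_def)
qed

lemma pvm_op_ivl: "(E (ivl n) x, fc E (trn n) x) : pvm_op E"
proof -
 have "E (ivl m) (fc E (trn n) x) = fc E (trn m) (E (ivl n) x)" for m
 proof -
  have "(%t. indicator (ivl m) t * trn n t) = (%t. trn m t * indicator (ivl n) t)"
  by (auto simp: trn_def indicator_def)
  thus ?thesis
  using fc_E_mult[OF E ivl_borel bb_tr, of m n x] fc_mult[OF E bb_tr bb_indicator[OF ivl_borel], of m n x]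
  by (simp add: fc_ind[OF E])
 qed
 thus ?thesis by (simp add: pvm_op_def)
qed

lemma pvm_op_csubspace: "csubspace (pvm_op E)"
 using fc(1)[OF E bb_tr] pvmE(1)[OF ivl_borel]
 unfolding csubspace_def pvm_op_def by (auto simp: zero_prod_def bcl_simps)

lemma pvm_op_symmetric: "symmetric_graph (pvm_op E)"
 unfolding symmetric_graph_def
proof (intro conjI allI impI pvm_op_csubspace)
 fix x y u v assume xy: "(x, y) : pvm_op E" and uv: "(u, v) : pvm_op E"
 have tsa: "cinner (fc E (trn n) a) b = cinner a (fc E (trn n) b)" for n a b
 proof (rule selfadj_swap[OF fc(1)[OF E bb_tr]])
  show "cadj (fc E (trn n)) = fc E (trn n)" unfolding fc_cnj[OF E bb_tr] by (rule arg_cong[where f = "fc E"]) (simp add: trn_def fun_eq_iff)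
 qed
 have "cinner x (E (ivl n) v) = cinner (E (ivl n) y) u" for n
  using xy uv tsa by (simp add: pvm_op_def)
 hence "(%n. cinner (E (ivl n) y) u) ~> cinner x v"
  using cinner.tendsto[OF tendsto_const ivl_tendsto[of v], of x] by simp
 moreover have "(%n. cinner (E (ivl n) y) u) ~> cinner y u" by (intro cinner.tendsto tendsto_const ivl_tendsto)
 ultimately show "cinner x v = cinner y u" by (rule LIMSEQ_unique)
qed

lemma pvm_op_sa: "op_sa (pvm_op E)"
proof (rule sa_criterion[OF pvm_op_symmetric])
 have "x : closure (Domain (pvm_op E))" for x
  unfolding closure_sequential using pvm_op_ivl ivl_tendsto[of x]
  by (intro exI[of _ "%n. E (ivl n) x"]) blast
 thus "closure (Domain (pvm_op E)) = UNIV" by blast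
 show "EX x y. (x, y) : pvm_op E & y + \<i> *c x = w" for w
  by (rule exI, rule exI, rule conjI[OF pvm_op_res[of "-\<i>" w]]) auto
 show "EX x y. (x, y) : pvm_op E & y - \<i> *c x = w" for w
  by (rule exI, rule exI, rule conjI[OF pvm_op_res[of "\<i>" w]]) auto
qed

lemma res_pvm_op: assumes "Im z ~= 0" shows "res (pvm_op E) z = fc E (rz z)"
 by (rule ext) (rule res_unique[OF pvm_op_sa assms pvm_op_res[OF assms]])

text \<open>The squared norm of \<open>fc E (trn n) x\<close> is the truncated second moment. For
  \<open>(x, y)\<close> in the graph these moments stay below the squared norm of \<open>y\<close>;
  conversely a finite second moment makes the vectors Cauchy, and the closed graph contains the
  limit.\<close>

lemma pvm_op_Domain: "Domain (pvm_op E) = {x. integrable (smeas E x) (%t. t^2)}"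
proof -
 have sq: "(norm (fc E (trn n) x))^2 = (\<integral>t. t^2 * indicator (ivl n) t \<partial>smeas E x)" for n x
  unfolding fc_norm_sq'[OF E bb_tr]
  by (rule Bochner_Integration.integral_cong) (auto simp: trn_def indicator_def norm_mult)
 have int: "integrable (smeas E x) (%t. t^2 * indicator (ivl n) t)" for n x
 proof -
  have "integrable (smeas E x) (%t. trn n t * trn n t)" by (rule smeas_integrable[OF E bb_mult[OF bb_tr bb_tr]])
  hence "integrable (smeas E x) (%t. Re (trn n t * trn n t))" by (rule integrable_Re)
  moreover have "Re (trn n t * trn n t) = t^2 * indicator (ivl n) t" for t
  by (auto simp: trn_def indicator_def power2_eq_square)
  ultimately show ?thesis by simp
 qed
 have mono: "incseq (%n. t^2 * indicator (ivl n) t)" for t :: real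
  by (auto simp: incseq_def ivl_def indicator_def)
 have lim: "(%n. t^2 * indicator (ivl n) t) ~> t^2" for t :: real
  by (rule tendsto_eventually) (rule eventually_mono[OF ivl_eventually[of t]], simp)
 have "integrable (smeas E x) (%t. t^2)" if xy: "(x, y) : pvm_op E" for x y
 proof -
  have bd: "(\<integral>t. t^2 * indicator (ivl n) t \<partial>smeas E x) <= (norm y)^2" for n
  proof -
  have "(norm (fc E (trn n) x))^2 = (norm (E (ivl n) y))^2" using xy by (simp add: pvm_op_def)
  also have "... <= (norm y)^2" by (intro power_mono pvmE(6)) auto
  finally show ?thesis unfolding sq .
  qed
  have "incseq (%n. \<integral>t. t^2 * indicator (ivl n) t \<partial>smeas E x)"
  unfolding incseq_def using mono by (auto intro!: integral_mono int simp: incseq_def)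
  from incseq_convergent[OF this allI[OF bd]] obtain L where
  "(%n. \<integral>t. t^2 * indicator (ivl n) t \<partial>smeas E x) ~> L" by metis
  thus ?thesis
  by (intro integrable_monotone_convergence[OF int _ _ _]) (use mono lim in \<open>auto simp: mono_def incseq_def\<close>)
 qed
 moreover have "x : Domain (pvm_op E)" if x: "integrable (smeas E x) (%t. t^2)" for x
 proof -
  let ?I = "%n. \<integral>t. t^2 * indicator (ivl n) t \<partial>smeas E x"
  have I: "?I ~> (\<integral>t. t^2 \<partial>smeas E x)"
  by (rule integral_dominated_convergence[where w = "%t. t^2"])
  (use lim in \<open>auto intro!: x AE_I2 simp: indicator_def\<close>)
  have diff: "(norm (fc E (trn m) x - fc E (trn n) x))^2 = ?I m - ?I n" if "n <= m" for n m
  proof -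
  have nm: "ivl n <= ivl m" using that by (auto simp: ivl_def)
  have "(norm (fc E (trn m) x - fc E (trn n) x))^2 = (\<integral>t. (cmod (trn m t - trn n t))^2 \<partial>smeas E x)"
  using fc_norm_sq'[OF E bb_diff[OF bb_tr bb_tr], of m n x] by (simp add: fc_diff[OF E bb_tr bb_tr])
  also have "... = (\<integral>t. t^2 * indicator (ivl m) t - t^2 * indicator (ivl n) t \<partial>smeas E x)"
  by (rule Bochner_Integration.integral_cong) (use nm in \<open>auto simp: trn_def indicator_def norm_mult\<close>)
  also have "... = ?I m - ?I n" by (rule Bochner_Integration.integral_diff[OF int int])
  finally show ?thesis .
  qed
  have "Cauchy (%n. fc E (trn n) x)"
  proof (rule metric_CauchyI)
  fix e :: real assume e: "0 < e"
  then obtain M where M: "!!m n. m >= M ==> n >= M ==> dist (?I m) (?I n) < e^2"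
  using LIMSEQ_imp_Cauchy[OF I] unfolding Cauchy_def by (metis zero_less_power)
  have lt: "dist (fc E (trn m) x) (fc E (trn n) x) < e" if "n >= M" "m >= n" for m n
  proof -
  have "(norm (fc E (trn m) x - fc E (trn n) x))^2 < e^2"
  using diff[of n m] M[of m n] that by (simp add: dist_real_def)
  thus ?thesis using e by (simp add: dist_norm power2_less_imp_less)
  qed
  have "dist (fc E (trn m) x) (fc E (trn n) x) < e" if "m >= M" "n >= M" for m n
  using lt[of n m] lt[of m n] that by (cases "n <= m") (auto simp: dist_commute)
  thus "EX M. ALL m>=M. ALL n>=M. dist (fc E (trn m) x) (fc E (trn n) x) < e" by blast
  qed
  then obtain y where y: "(%n. fc E (trn n) x) ~> y" by (rule complex_Cauchy_imp_limit)
  have "(x, y) : pvm_op E"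
  by (rule closed_seqD[OF saD(3)[OF pvm_op_sa] pvm_op_ivl ivl_tendsto y])
  thus ?thesis by blast
 qed
 ultimately show ?thesis by auto
qed

lemma pvm_op_form:
 assumes xy: "(x, y) : pvm_op E"
 shows "cinner x y = cr (\<integral>t. t \<partial>smeas E x)"
proof (rule LIMSEQ_unique)
 have int2: "integrable (smeas E x) (%t. t^2)" using pvm_op_Domain xy by blast
 interpret finite_measure "smeas E x" by (rule smeas[OF E])
 show "(%n. cinner x (E (ivl n) y)) ~> cinner x y" by (intro cinner.tendsto tendsto_const ivl_tendsto)
 have "cinner x (E (ivl n) y) = cr (\<integral>t. t * indicator (ivl n) t \<partial>smeas E x)" for n
 proof -
  have "cinner x (E (ivl n) y) = cinner x (fc E (trn n) x)" using xy by (simp add: pvm_op_def)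
  also have "... = (\<integral>t. trn n t \<partial>smeas E x)" by (rule fc(2)[OF E bb_tr])
  finally show ?thesis unfolding trn_def integral_complex_of_real .
 qed
 moreover have "(%n. \<integral>t. t * indicator (ivl n) t \<partial>smeas E x) ~> (\<integral>t. t \<partial>smeas E x)"
 proof (rule integral_dominated_convergence[where w = "%t. 1 + t^2"])
  show "integrable (smeas E x) (%t. 1 + t^2)" using int2 by auto
  have "(%n. t * indicator (ivl n) t) ~> t" for t :: real
  by (rule tendsto_eventually) (rule eventually_mono[OF ivl_eventually[of t]], simp)
  thus "AE t in smeas E x. (%n. t * indicator (ivl n) t) ~> t" by simp
  have "\<bar>t\<bar> <= 1 + t^2" for t :: real
  proof -
  have "0 <= t^2 + 1 - 2 * \<bar>t\<bar>" using zero_le_power2[of "\<bar>t\<bar> - 1"] by (simp add: power2_diff)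
  thus ?thesis using zero_le_power2[of t] by argo
  qed
  thus "AE t in smeas E x. norm (t * indicator (ivl n) t) <= 1 + t^2" for n
  by (intro AE_I2) (auto simp: indicator_def intro: order_trans[of _ 0])
 qed auto
 ultimately show "(%n. cinner x (E (ivl n) y)) ~> cr (\<integral>t. t \<partial>smeas E x)"
  by (simp add: tendsto_of_real)
qed

lemma is_spectral_pvm_op: "is_spectral_measure (pvm_op E) E"
 unfolding is_spectral_measure_def smeas_def[symmetric]
 using E pvm_op_Domain pvm_op_form by auto

text \<open>\<open>is_spectral_measure\<close> prescribes only the domain and the quadratic form.
  The difference \<open>L\<close> of the two operators on their common domain has zero form, so it
  vanishes by polarization and density.\<close>

lemma spectral_eq_pvm_op:
 assumes A: "op_sa A" and s: "is_spectral_measure A E"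
 shows "A = pvm_op E"
proof (rule sa_subset_eq[OF A pvm_op_sa], rule subrelI)
 fix x y assume xy: "(x, y) : A"
 have D: "Domain A = Domain (pvm_op E)"
  using s pvm_op_Domain unfolding is_spectral_measure_def smeas_def[symmetric] by simp
 define L where "L = {(x, y - y') | x y y'. (x, y) : A & (x, y') : pvm_op E}"
 have L0: "cinner u d = 0" if ud: "(u, d) : L" for u d
 proof -
  obtain v v' where "d = v - v'" "(u, v) : A" "(u, v') : pvm_op E" using ud unfolding L_def by auto
  thus ?thesis using s pvm_op_form unfolding is_spectral_measure_def smeas_def[symmetric]
  by (auto simp: cinner.diff_right)
 qed
 have Ladd: "(u + v, d + e) : L" if "(u, d) : L" "(v, e) : L" for u v d e
 proof -
  obtain a a' where a: "d = a - a'" "(u, a) : A" "(u, a') : pvm_op E" using `(u, d) : L` unfolding L_def by auto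
  obtain b b' where b: "e = b - b'" "(v, b) : A" "(v, b') : pvm_op E" using `(v, e) : L` unfolding L_def by auto
  have "(u + v, a + b) : A" "(u + v, a' + b') : pvm_op E"
  using glinD(2)[OF saD(6)[OF A]] glinD(2)[OF pvm_op_csubspace] a b by blast+
  moreover have "d + e = (a + b) - (a' + b')" using a b by simp
  ultimately show ?thesis unfolding L_def by blast
 qed
 have Lscale: "(c *c u, c *c d) : L" if ud: "(u, d) : L" for c u d
 proof -
  obtain a a' where a: "d = a - a'" "(u, a) : A" "(u, a') : pvm_op E" using ud unfolding L_def by auto
  hence "(c *c u, c *c a) : A" "(c *c u, c *c a') : pvm_op E"
  using glinD(4)[OF saD(6)[OF A]] glinD(4)[OF pvm_op_csubspace] by blast+
  moreover have "c *c d = c *c a - c *c a'" using a by (simp add: scaleC.diff_right)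
  ultimately show ?thesis unfolding L_def by blast
 qed
 have Lorth: "cinner u e = 0" if ud: "(u, d) : L" and ve: "(v, e) : L" for u v d e
 proof -
  have 1: "cinner u e + cinner v d = 0"
  using L0[OF Ladd[OF ud ve]] L0[OF ud] L0[OF ve] by (simp add: cinner_simps add.commute)
  have 2: "\<i> * cinner u e - \<i> * cinner v d = 0"
  using L0[OF Ladd[OF ud Lscale[OF ve, of "\<i>"]]] L0[OF ud] L0[OF ve] by (simp add: cinner_simps)
  have "\<i> * (cinner u e - cinner v d) = 0" using 2 by (simp add: right_diff_distrib)
  hence "cinner u e = cinner v d" by simp
  thus ?thesis using 1 by simp
 qed
 obtain y' where y': "(x, y') : pvm_op E" using D xy by blast
 have xL: "(x, y - y') : L" using xy y' unfolding L_def by blast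
 have "cinner (y - y') u = 0" if "u : Domain A" for u
 proof -
  obtain v v' where "(u, v) : A" "(u, v') : pvm_op E" using `u : Domain A` D by blast
  hence "(u, v - v') : L" unfolding L_def by blast
  hence "cinner u (y - y') = 0" using Lorth xL by blast
  thus ?thesis using cinner_commute[of "y - y'" u] by simp
 qed
 hence "y - y' = 0"
  using dense_iff_orth[OF csubspace_Domain[OF saD(6)[OF A]]] saD(5)[OF A] by blast
 thus "(x, y) : pvm_op E" using y' by simp
qed

end

text \<open>Inversion of the Stieltjes transform: the imaginary part is a Poisson kernel, whose integral over
  an interval is a difference of arctangents.\<close>

lemma stieltjes_unique:
 assumes M: "finite_measure M" "sets M = sets borel" and N: "finite_measure N" "sets N = sets borel"
  and eq: "!!z. Im z > 0 ==> (\<integral>t. rz z t \<partial>M) = (\<integral>t. rz z t \<partial>N)"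
 shows "M = N"
proof -
 define P where "P e s t = e / ((t - s)^2 + e^2)" for e s t :: real
 define G where "G a b e t = arctan ((b - t) / e) - arctan ((a - t) / e)" for a b e t :: real
 have P_pos: "0 < P e s t" if "e > 0" for e s t
  unfolding P_def using that by (simp add: add_nonneg_pos)
 have P_rz: "Im (rz (Complex s e) t) = P e s t" for e s t
  unfolding rz_def P_def by (simp add: Im_divide power2_eq_square)
 have PG: "(\<integral>\<^sup>+s. ennreal (P e s t) * indicator {a..b} s \<partial>lborel) = ennreal (G a b e t)"
  if e: "e > 0" and ab: "a <= b" for a b e t
 proof -
  have "(\<integral>\<^sup>+s. ennreal (P e s t) * indicator {a..b} s \<partial>lborel)
  = ennreal (arctan ((b - t) / e) - arctan ((a - t) / e))"
  proof (rule nn_integral_FTC_Icc)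
  show "(%s. P e s t) : borel_measurable borel" unfolding P_def by measurable
  show "0 <= P e s t" for s using P_pos[OF e] less_imp_le by blast
  show "((%s. arctan ((s - t) / e)) has_real_derivative P e s t) (at s)" for s
  unfolding P_def using e
  by (auto intro!: derivative_eq_intros simp: power2_eq_square field_simps add_nonneg_eq_0_iff)
  qed (rule ab)
  thus ?thesis by (simp add: G_def)
 qed
 have main: "(\<integral>t. G a b e t \<partial>K) = enn2real (\<integral>\<^sup>+s. ennreal (Im (\<integral>t. rz (Complex s e) t \<partial>K)) * indicator {a..b} s \<partial>lborel)"
  if e: "e > 0" and ab: "a <= b" and K: "finite_measure K" and [measurable_cong]: "sets K = sets borel" for a b e K
 proof -
  interpret K: finite_measure K by (rule K)
  interpret pair_sigma_finite lborel K ..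
  have space: "space K = UNIV" using sets_eq_imp_space_eq[OF `sets K = sets borel`] by simp
  have int: "integrable K (rz (Complex s e))" for s
  proof (rule K.integrable_const_bound)
  show "AE t in K. cmod (rz (Complex s e) t) <= 1 / \<bar>e\<bar>" using cmod_rz[of "Complex s e"] e by simp
  show "rz (Complex s e) : borel_measurable K" unfolding rz_def by measurable
  qed
  have inner: "(\<integral>\<^sup>+t. ennreal (P e s t) \<partial>K) = ennreal (Im (\<integral>t. rz (Complex s e) t \<partial>K))" for s
  proof -
  have "integrable K (%t. P e s t)" using integrable_Im[OF int[of s]] by (simp add: P_rz)
  hence "(\<integral>\<^sup>+t. ennreal (P e s t) \<partial>K) = ennreal (\<integral>t. P e s t \<partial>K)"
  by (rule nn_integral_eq_integral) (intro AE_I2 less_imp_le P_pos e)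
  also have "(\<integral>t. P e s t \<partial>K) = Im (\<integral>t. rz (Complex s e) t \<partial>K)"
  using integral_Im[OF int[of s]] by (simp add: P_rz)
  finally show ?thesis .
  qed
  have "(\<integral>\<^sup>+t. ennreal (G a b e t) \<partial>K) = (\<integral>\<^sup>+t. (\<integral>\<^sup>+s. ennreal (P e s t) * indicator {a..b} s \<partial>lborel) \<partial>K)"
  by (simp add: PG[OF e ab])
  also have "... = (\<integral>\<^sup>+s. (\<integral>\<^sup>+t. ennreal (P e s t) * indicator {a..b} s \<partial>K) \<partial>lborel)"
  by (rule Fubini') (unfold P_def case_prod_beta', measurable)
  also have "... = (\<integral>\<^sup>+s. (\<integral>\<^sup>+t. ennreal (P e s t) \<partial>K) * indicator {a..b} s \<partial>lborel)"
  by (intro nn_integral_cong nn_integral_multc) (unfold P_def, measurable)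
  finally have nn: "(\<integral>\<^sup>+t. ennreal (G a b e t) \<partial>K)
  = (\<integral>\<^sup>+s. ennreal (Im (\<integral>t. rz (Complex s e) t \<partial>K)) * indicator {a..b} s \<partial>lborel)"
  unfolding inner .
  have "G a b e t >= 0" for t unfolding G_def using e ab by (simp add: arctan_monotone' divide_right_mono)
  moreover have "(%t. G a b e t) : borel_measurable K"
  proof -
  have "continuous_on UNIV (%t. G a b e t)" unfolding G_def using e by (intro continuous_intros) auto
  hence "(%t. G a b e t) : borel_measurable borel" by (rule borel_measurable_continuous_onI)
  thus ?thesis by simp
  qed
  ultimately show ?thesis using nn by (subst integral_eq_nn_integral) auto
 qed
 have geq: "(\<integral>t. G a b e t \<partial>M) = (\<integral>t. G a b e t \<partial>N)" if "e > 0" "a <= b" for a b e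
  using main[OF that M] main[OF that N] eq[of "Complex _ e"] that by simp
 \<comment> \<open>The interval from \<open>a + 1 / (n + 1)\<close> to \<open>a + 1 + n\<close>
   exhausts the open half line, while the height \<open>1 / (n + 1)^2\<close> is small against the
   gap \<open>1 / (n + 1)\<close> at \<open>a\<close>. At \<open>t = a\<close> both arctangents
   therefore tend to \<open>pi / 2\<close>, so a possible atom at \<open>a\<close> is not
   counted.\<close>
 have lim: "(%n. \<integral>t. G (a + 1 / real (Suc n)) (a + 1 + real n) (1 / (real (Suc n))^2) t \<partial>K) ~> pi * measure K {a<..}"
  if K: "finite_measure K" and sK: "sets K = sets borel" for a K
 proof -
  interpret K: finite_measure K by (rule K)
  let ?g = "%n. G (a + 1 / real (Suc n)) (a + 1 + real n) (1 / (real (Suc n))^2)"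
  have pw: "(%n. ?g n t) ~> pi * indicator {a<..} t" for t
  proof -
  have 1: "(%n. arctan ((a + 1 + real n - t) / (1 / (real (Suc n))^2))) ~> pi / 2"
  by real_asymp
  have 2: "(%n. arctan ((a + 1 / real (Suc n) - t) / (1 / (real (Suc n))^2))) ~> pi / 2 - pi * indicator {a<..} t"
  by (cases a t rule: linorder_cases) (simp; real_asymp)+
  show ?thesis unfolding G_def using tendsto_diff[OF 1 2] by simp
  qed
  have "(%n. \<integral>t. ?g n t \<partial>K) ~> (\<integral>t. pi * indicator {a<..} t \<partial>K)"
  proof (rule integral_dominated_convergence[where w = "%t. pi"])
  have "continuous_on UNIV (?g n)" for n unfolding G_def by (intro continuous_intros) auto
  hence "?g n : borel_measurable borel" for n by (rule borel_measurable_continuous_onI)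
  thus "?g n : borel_measurable K" for n unfolding measurable_cong_sets[OF sK refl] .
  show "AE t in K. norm (?g n t) <= pi" for n
  proof (rule AE_I2)
  fix t
  have "\<bar>arctan x\<bar> <= pi / 2" for x using arctan_bounded[of x] by linarith
  thus "norm (?g n t) <= pi"
  unfolding G_def real_norm_def by (intro order_trans[OF abs_triangle_ineq4]) (metis add_mono field_sum_of_halves)
  qed
  show "(%t. pi * indicator {a<..} t) : borel_measurable K" using sK by measurable
  show "AE t in K. (%n. ?g n t) ~> pi * indicator {a<..} t" using pw by simp
  qed auto
  also have "(\<integral>t. pi * indicator {a<..} t \<partial>K) = pi * measure K {a<..}"
  using sK sets_eq_imp_space_eq[OF sK] by simp
  finally show ?thesis .
 qed
 have meq: "measure M {a<..} = measure N {a<..}" for a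
 proof -
  have le: "a + 1 / real (Suc n) <= a + 1 + real n" for n
  using le_divide_eq_1[of 1 "real (Suc n)"] by (simp add: field_simps)
  have "(%n. \<integral>t. G (a + 1 / real (Suc n)) (a + 1 + real n) (1 / (real (Suc n))^2) t \<partial>M) ~> pi * measure N {a<..}"
  using lim[OF N, of a] geq[OF _ le] by simp
  with lim[OF M, of a] have "pi * measure M {a<..} = pi * measure N {a<..}" by (rule LIMSEQ_unique)
  thus ?thesis by simp
 qed
 interpret M: finite_measure M by (rule M)
 interpret N: finite_measure N by (rule N)
 show ?thesis
  by (rule measure_eqI_lessThan[OF M(2) N(2)])
  (simp_all add: M.emeasure_eq_measure N.emeasure_eq_measure meq)
qed

text \<open>Equal resolvents give equal Stieltjes transforms of the measures
  \<open>smeas E x\<close>, and these measures give the norms of \<open>E B x\<close>, which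
  determine a projection.\<close>

lemma pvm_op_inj:
 assumes E: "pvmeas E" and F: "pvmeas F" and eq: "pvm_op E = pvm_op F"
 shows "E = F"
proof (rule ext)
 fix B
 have "(\<integral>t. rz z t \<partial>smeas E x) = (\<integral>t. rz z t \<partial>smeas F x)" if "Im z > 0" for z x
  using res_pvm_op[OF E, of z] res_pvm_op[OF F, of z] that eq fc(2)[OF E bb_rz] fc(2)[OF F bb_rz]
  by (metis less_irrefl)
 hence s: "smeas E x = smeas F x" for x
  using smeas(1)[OF E] smeas(1)[OF F] by (intro stieltjes_unique) auto
 show "E B = F B"
 proof (cases "B : sets borel")
  case True
  have "(norm (E B x))^2 = (norm (F B x))^2" for x
  using smeas(2)[OF E True, of x] smeas(2)[OF F True, of x] s[of x] by simp
  thus ?thesis using True by (intro proj_eqI pvm(1) E F) (auto simp: power2_eq_iff_nonneg)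
 qed (simp add: pvm(2)[OF E] pvm(2)[OF F])
qed

lemma spectral_measure_pvm_op:
 assumes E: "pvmeas E"
 shows "spm (pvm_op E) = E"
 unfolding spectral_measure_def
proof (rule the_equality[where a = E])
 show "is_spectral_measure (pvm_op E) E" by (rule is_spectral_pvm_op[OF E])
 fix F assume F: "is_spectral_measure (pvm_op E) F"
 hence F': "pvmeas F" by (simp add: is_spectral_measure_def)
 hence "pvm_op E = pvm_op F" using spectral_eq_pvm_op[OF F' pvm_op_sa[OF E] F] by simp
 thus "F = E" using pvm_op_inj[OF E F'] by simp
qed

section \<open>From resolutions of the identity to projection-valued measures\<close>

locale resolution =
 fixes e :: "real => 'h::complex_hilbert_space => 'h"
 assumes proj: "projop (e l)"
  and mono: "l <= m ==> e m (e l x) = e l x"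
  and right: "(%n. e (l + inverse (real (Suc n))) x) ~> e l x"
  and zero: "(%n. e (- real n) x) ~> 0"
  and one: "(%n. e (real n) x) ~> x"
begin

lemmas P = projD[OF proj]

lemma mono': assumes "l <= m" shows "e l (e m x) = e l x"
 by (rule cinner_ext_left) (simp add: P(4) mono[OF assms])

definition F :: "'h => real => real" where "F x l = (norm (e l x))^2"

lemma F_mono: "l <= m ==> F x l <= F x m"
 unfolding F_def using P(6)[of l "e m x"] mono'[of l m x] by (simp add: power_mono)

lemma F_right: "continuous (at_right l) (F x)"
 unfolding continuous_within
proof (rule order_tendstoI)
 fix a assume a: "a < F x l"
 show "\<forall>\<^sub>F t in at_right l. a < F x t"
 proof (rule eventually_mono[OF eventually_at_right_less[of l]])
  show "a < F x t" if "l < t" for t using F_mono[of l t x] that a by simp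
 qed
next
 fix a assume a: "F x l < a"
 have "(%n. F x (l + inverse (real (Suc n)))) ~> F x l" unfolding F_def by (intro tendsto_intros right)
 hence "eventually (%n. F x (l + inverse (real (Suc n))) < a) sequentially" using a by (rule order_tendstoD)
 then obtain n where n: "F x (l + inverse (real (Suc n))) < a" by (auto simp: eventually_sequentially)
 hence "F x t < a" if "t < l + inverse (real (Suc n))" for t
  using F_mono[of t "l + inverse (real (Suc n))" x] that by simp
 thus "\<forall>\<^sub>F t in at_right l. F x t < a"
  unfolding eventually_at_right_field by (intro exI[of _ "l + inverse (real (Suc n))"]) auto
qed

definition mu :: "'h => real measure" where "mu x = interval_measure (F x)"

lemma sets_mu [simp, measurable_cong]: "sets (mu x) = sets borel" and space_mu [simp]: "space (mu x) = UNIV"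
 by (simp_all add: mu_def)

lemma mu_Ioc: "a <= b ==> emeasure (mu x) {a<..b} = ennreal (F x b - F x a)"
 unfolding mu_def by (rule emeasure_interval_measure_Ioc) (auto intro: F_mono F_right)

lemma mu_UNIV: "emeasure (mu x) UNIV = ennreal ((norm x)^2)"
proof (rule LIMSEQ_unique)
 have "(%n. emeasure (mu x) {- real n<..real n}) ~> emeasure (mu x) (\<Union>n. {- real n<..real n})"
  by (rule Lim_emeasure_incseq) (auto simp: incseq_def)
 also have "(\<Union>n. {- real n<..real n}) = UNIV"
 proof -
  have "EX n. - real n < t & t <= real n" for t
  proof -
  obtain n where "\<bar>t\<bar> < real n" using reals_Archimedean2 by blast
  thus ?thesis by (intro exI[of _ n]) auto
  qed
  thus ?thesis by auto
 qed
 finally show "(%n. emeasure (mu x) {- real n<..real n}) ~> emeasure (mu x) UNIV" .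
 have "(%n. F x (real n) - F x (- real n)) ~> (norm x)^2 - (norm (0::'h))^2"
  unfolding F_def by (intro tendsto_intros zero one)
 thus "(%n. emeasure (mu x) {- real n<..real n}) ~> ennreal ((norm x)^2)"
  by (simp add: mu_Ioc)
qed

lemma mu_finite: "finite_measure (mu x)"
 by (rule finite_measureI) (simp add: mu_UNIV)

lemma mu_measure_UNIV: "measure (mu x) UNIV = (norm x)^2"
 by (simp add: measure_def mu_UNIV)

lemma mu_measure_Ioc: "a <= b ==> measure (mu x) {a<..b} = F x b - F x a"
 by (simp add: measure_def mu_Ioc F_mono)

text \<open>The norms determine the projection, so it can be constructed set by set without naming
  it. The commutation clause is carried along to reach the spectral measure as
  \<open>E_commute\<close>.\<close>

definition has_proj :: "real set => ('h => 'h) => bool"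
 where "has_proj B p <-> projop p & (ALL x. measure (mu x) B = (norm (p x))^2)
  & (ALL c. bcl c --> (ALL l x. c (e l x) = e l (c x)) --> (ALL x. c (p x) = p (c x)))"

lemma has_proj_unique: "has_proj B p ==> has_proj B q ==> p = q"
 unfolding has_proj_def by (intro proj_eqI) (auto simp: power2_eq_iff_nonneg)

lemma has_proj_Ioc: assumes "a <= b" shows "has_proj {a<..b} (%x. e b x - e a x)"
 unfolding has_proj_def
proof (intro conjI allI impI)
 note m = mono[OF assms] mono'[OF assms]
 show pr: "projop (%x. e b x - e a x)"
  using P(1,2,4) by (intro projI) (auto intro!: bcl_intros simp: bcl_simps[OF P(1)] cinner_simps m)
 show "measure (mu x) {a<..b} = (norm (e b x - e a x))^2" for x
 proof -
  have "cinner (e b x) (e a x) = cinner x (e a x)" by (simp add: P(4) m)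
  thus ?thesis unfolding mu_measure_Ioc[OF assms] F_def norm_diff_sq by (simp add: P(5))
 qed
 show "c (e b x - e a x) = e b (c x) - e a (c x)" if "bcl c" "ALL l x. c (e l x) = e l (c x)" for c x
  using that by (simp add: bcl_diff)
qed

text \<open>The vector \<open>p j x\<close> has its full mass on \<open>A j\<close>, which makes the
  projections of disjoint sets orthogonal; their partial sums are increasing projections and
  converge strongly.\<close>

lemma has_proj_union:
 assumes A: "disjoint_family A" "range A <= sets borel" and p: "!!i. has_proj (A i) (p i)"
 shows "EX q. has_proj (\<Union>i::nat. A i) q & (ALL x. (%i. p i x) sums q x)"
proof -
 have pr: "projop (p i)" and me: "measure (mu x) (A i) = (norm (p i x))^2" for i x
  using p unfolding has_proj_def by auto
 note Q = projD[OF pr]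
 have orth: "p i (p j x) = 0" if "i ~= j" for i j x
 proof -
  interpret finite_measure "mu (p j x)" by (rule mu_finite)
  have "measure (mu (p j x)) (A i Un A j) = measure (mu (p j x)) (A i) + measure (mu (p j x)) (A j)"
  using A that by (intro finite_measure_Union) (auto simp: disjoint_family_on_def)
  moreover have "measure (mu (p j x)) (A i Un A j) <= (norm (p j x))^2"
  using bounded_measure[of "A i Un A j"] by (simp add: mu_measure_UNIV)
  ultimately show ?thesis by (simp add: me Q(2))
 qed
 define S where "S n x = (\<Sum>i<n. p i x)" for n x
 have pS: "p i (S n x) = (if i < n then p i x else 0)" for i n x
  unfolding S_def by (induction n) (auto simp: bcl_simps[OF Q(1)] orth Q(2) less_Suc_eq)
 have SS: "S n (S m x) = S n x" if "n <= m" for n m x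
  unfolding S_def[of n] using that by (intro sum.cong) (auto simp: pS)
 have S_form: "cinner x (S n x) = cr (\<Sum>i<n. (norm (p i x))^2)" for n x
  unfolding S_def by (simp add: cinner.sum_right Q(5))
 have Spr: "projop (S n)" for n
 proof (rule projI)
  show "bcl (S n)" unfolding S_def by (intro bcl_intros Q(1))
  show "S n (S n x) = S n x" for x by (rule SS) simp
  show "cinner (S n x) y = cinner x (S n y)" for x y
  unfolding S_def by (simp add: cinner.sum_right cinner.sum_left Q(4))
 qed
 have "(%x. x - S n x) ((%x. x - S (Suc n) x) x) = x - S (Suc n) x" for n x
  using SS[of n "Suc n" x] by (simp add: bcl_simps[OF projD(1)[OF Spr]])
 from proj_decreasing_limit[of "%n x. x - S n x", OF proj_compl[OF Spr] this]
 obtain r where r: "projop r" "!!x. (%n. x - S n x) ~> r x" by blast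
 let ?q = "%x. x - r x"
 have lim: "(%n. S n x) ~> ?q x" for x
  using tendsto_diff[OF tendsto_const[of x] r(2)[of x]] by simp
 have qp: "projop ?q" by (rule proj_compl[OF r(1)])
 have "has_proj (\<Union>i. A i) ?q"
  unfolding has_proj_def
 proof (intro conjI allI impI qp)
  fix x
  interpret finite_measure "mu x" by (rule mu_finite)
  have "(%n. cinner x (S n x)) ~> cinner x (?q x)" by (intro cinner.tendsto tendsto_const lim)
  hence "(%n. Re (cinner x (S n x))) ~> Re (cinner x (?q x))" by (rule tendsto_Re)
  hence "(%n. \<Sum>i<n. (norm (p i x))^2) ~> (norm (?q x))^2"
  unfolding S_form by (simp only: projD(5)[OF qp] Re_complex_of_real)
  moreover have "(%i. measure (mu x) (A i)) sums measure (mu x) (\<Union>i. A i)"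
  using A by (intro finite_measure_UNION) auto
  ultimately show "measure (mu x) (\<Union>i. A i) = (norm (?q x))^2"
  unfolding me sums_def using LIMSEQ_unique by blast
 next
  fix c x assume c: "bcl c" "ALL l x. c (e l x) = e l (c x)"
  have "c (p i x) = p i (c x)" for i x using p c unfolding has_proj_def by blast
  hence "c (S n x) = S n (c x)" for n unfolding S_def by (simp add: bcl_sum[OF c(1)])
  thus "c (?q x) = ?q (c x)"
  using LIMSEQ_unique[OF bcl_tendsto[OF c(1) lim[of x]]] lim[of "c x"] by simp
 qed
 thus ?thesis using lim unfolding sums_def S_def by blast
qed

lemma has_proj_exists: assumes "B : sets borel" shows "EX p. has_proj B p"
proof -
 let ?G = "range (%(a, b). {a<..b::real})"
 have st: "Int_stable ?G"
 proof (rule Int_stableI)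
  fix A B assume "A : ?G" "B : ?G"
  then obtain a b c d where "A = {a<..b}" "B = {c<..d}" by auto
  hence "A Int B = (%(a, b). {a<..b}) (max a c, min b d)" by auto
  thus "A Int B : ?G" by blast
 qed
 have "B : sigma_sets UNIV ?G" using assms unfolding borel_sigma_sets_Ioc by simp
 hence "B : sigma_sets UNIV ?G" "?G <= Pow UNIV" by auto
 from st this(2,1) show ?thesis
 proof (induction rule: sigma_sets_induct_disjoint)
  case (basic A)
  then obtain a b where A: "A = {a<..b}" by auto
  show ?case
  proof (cases "a <= b")
  case True thus ?thesis using has_proj_Ioc A by blast
  next
  case False
  thus ?thesis using has_proj_Ioc[of a a] A by (intro exI[of _ "%x. e a x - e a x"]) simp
  qed
 next
  case empty
  show ?case using has_proj_Ioc[of 0 0] by auto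
 next
  case (compl A)
  then obtain p where p: "has_proj A p" by blast
  have A: "A : sets borel" using compl(1) unfolding borel_sigma_sets_Ioc by simp
  have pr: "projop p" using p by (simp add: has_proj_def)
  have "has_proj (UNIV - A) (%x. x - p x)"
  unfolding has_proj_def
  proof (intro conjI allI impI proj_compl[OF pr])
  fix x
  interpret finite_measure "mu x" by (rule mu_finite)
  have "measure (mu x) (UNIV - A) = (norm x)^2 - (norm (p x))^2"
  using finite_measure_compl[of A] A p by (simp add: mu_measure_UNIV has_proj_def)
  thus "measure (mu x) (UNIV - A) = (norm (x - p x))^2" using projD(7)[OF pr, of x] by simp
  show "c (x - p x) = c x - p (c x)" if "bcl c" "ALL l x. c (e l x) = e l (c x)" for c
  using p that unfolding has_proj_def by (simp add: bcl_diff)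
  qed
  thus ?case by blast
 next
  case (union A)
  then obtain p where p: "!!i. has_proj (A i) (p i)" by metis
  have "range A <= sets borel" using union(2) unfolding borel_sigma_sets_Ioc by simp
  thus ?case using has_proj_union[OF union(1) _ p] by blast
 qed
qed

definition E :: "real set => 'h => 'h"
 where "E B = (if B : sets borel then SOME p. has_proj B p else (%_. 0))"

lemma E_has_proj: "B : sets borel ==> has_proj B (E B)"
 unfolding E_def using someI_ex[OF has_proj_exists] by simp

lemma E_eqI: "B : sets borel ==> has_proj B p ==> E B = p"
 using has_proj_unique E_has_proj by blast

lemma E_pvm: "pvmeas E"
 unfolding projection_valued_measure_def
proof (intro conjI ballI allI impI)
 show "projop (E B)" if "B : sets borel" for B using E_has_proj[OF that] by (simp add: has_proj_def)
 show "E B = (%_. 0)" if "B \<notin> sets borel" for B using that by (simp add: E_def)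
 show "E UNIV = id"
  by (rule E_eqI) (auto simp: has_proj_def mu_measure_UNIV)
 fix B :: "nat => real set" and x assume B: "range B <= sets borel" "disjoint_family B"
 obtain q where q: "has_proj (\<Union>i. B i) q" "!!x. (%i. E (B i) x) sums q x"
  using has_proj_union[OF B(2,1), of "%i. E (B i)"] E_has_proj B by blast
 have "(\<Union>i. B i) : sets borel" using B by blast
 from E_eqI[OF this q(1)] show "(%n. E (B n) x) sums E (\<Union>n. B n) x" using q(2) by simp
qed

lemma E_Ioc: "a <= b ==> E {a<..b} x = e b x - e a x"
 using E_eqI[OF _ has_proj_Ioc] by simp

lemma E_commute:
 assumes "bcl c" "!!l x. c (e l x) = e l (c x)"
 shows "c (E B x) = E B (c x)"
proof (cases "B : sets borel")
 case True
 thus ?thesis using E_has_proj[OF True] assms unfolding has_proj_def by blast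
next
 case False
 thus ?thesis using bcl_zero[OF assms(1)] by (simp add: E_def)
qed

end

text \<open>On the range of a narrow spectral piece the operator is nearly scalar: a symmetric form with values
  in \<open>[0, \<delta>]\<close> has norm at most \<open>\<delta>\<close>, even if the operator is not known to be bounded there.\<close>

lemma narrow_piece:
 assumes A: "op_sa A" and p: "projop p" and pA: "!!x y. (x, y) : A ==> (p x, p y) : A"
  and d: "dl > 0" and bounds: "!!x y. (x, y) : A ==> p x = x ==> a * (norm x)^2 <= Re (cinner x y) & Re (cinner x y) <= (a + dl) * (norm x)^2"
  and uy: "(u, y) : A" and pu: "p u = u"
 shows "norm (y - cr a *c u) <= dl * norm u"
proof -
 note P = projD[OF p] and g = glinD[OF saD(6)[OF A]]
 define d' where "d' = y - cr a *c u"
 have "(u, p y) : A" using pA[OF uy] pu by simp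
 hence "p y = y" using uy saD(4)[OF A] by (auto dest: single_valuedD)
 hence pd: "p d' = d'" unfolding d'_def by (simp add: bcl_simps[OF P(1)] pu)
 define f where "f x v = Re (cinner x v) - a * (norm x)^2" for x v :: 'a
 have f: "0 <= f x v" "f x v <= dl * (norm x)^2" if "(x, v) : A" "p x = x" for x v
  using bounds[OF that] unfolding f_def by (auto simp: algebra_simps)
 \<comment> \<open>With this weight the estimate \<open>key\<close>, taken at \<open>v = d'\<close>,
   becomes \<open>norm d' <= dl * norm u\<close>.\<close>
 let ?t = "cr (1 / dl)"
 have key: "2 * (1 / dl) * Re (cinner v d') <= dl * ((1 / dl)^2 * (norm v)^2 + (norm u)^2)"
  if v: "(v, w) : A" "p v = v" for v w
 proof -
  have tv: "(?t *c v, ?t *c w) : A" by (rule g(4)[OF v(1)])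
  have 1: "(?t *c v + u, ?t *c w + y) : A" "(?t *c v - u, ?t *c w - y) : A"
  using g(2,3) tv uy by blast+
  have 2: "p (?t *c v + u) = ?t *c v + u" "p (?t *c v - u) = ?t *c v - u"
  using v(2) pu by (simp_all add: bcl_simps[OF P(1)])
  have sym: "Re (cinner u w) = Re (cinner v y)"
  using saD(7)[OF A uy v(1)] cinner_commute[of v y] by simp
  have e: "Re (cinner v d') = Re (cinner v y) - a * Re (cinner v u)"
  by (simp add: d'_def cinner_simps)
  have "f (?t *c v + u) (?t *c w + y) - f (?t *c v - u) (?t *c w - y) = 4 * (1 / dl) * Re (cinner v d')"
  unfolding f_def norm_add_sq norm_diff_sq e
  by (simp add: cinner_simps sym cinner_commute[of u v] algebra_simps)
  moreover have "f (?t *c v + u) (?t *c w + y) + f (?t *c v - u) (?t *c w - y)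
  <= 2 * (dl * ((1 / dl)^2 * (norm v)^2 + (norm u)^2))"
  proof -
  have "f (?t *c v + u) (?t *c w + y) + f (?t *c v - u) (?t *c w - y)
  <= dl * (norm (?t *c v + u))^2 + dl * (norm (?t *c v - u))^2"
  using f 1 2 by (intro add_mono) blast+
  also have "... = 2 * (dl * ((norm (?t *c v))^2 + (norm u)^2))"
  unfolding norm_add_sq norm_diff_sq by (simp add: algebra_simps)
  also have "(norm (?t *c v))^2 = (1 / dl)^2 * (norm v)^2"
  unfolding norm_scaleC norm_of_real power_mult_distrib power2_abs ..
  finally show ?thesis .
  qed
  moreover have "0 <= f (?t *c v - u) (?t *c w - y)" using f 1 2 by blast
  ultimately show ?thesis by argo
 qed
 \<comment> \<open>\<open>d'\<close> need not lie in the domain of \<open>A\<close>, so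
   \<open>key\<close> is applied to projected domain vectors tending to \<open>d'\<close>.\<close>
 obtain v where v: "!!n. v n : Domain A" "v ~> d'"
  using saD(5)[OF A] closure_sequential[of d' "Domain A"] by auto
 have pv: "(%n. p (v n)) ~> d'" using bcl_tendsto[OF P(1) v(2)] pd by simp
 have "2 * (1 / dl) * Re (cinner d' d') <= dl * ((1 / dl)^2 * (norm d')^2 + (norm u)^2)"
 proof (rule LIMSEQ_le)
  show "(%n. 2 * (1 / dl) * Re (cinner (p (v n)) d')) ~> 2 * (1 / dl) * Re (cinner d' d')"
  by (intro tendsto_mult tendsto_const tendsto_Re cinner.tendsto pv)
  show "(%n. dl * ((1 / dl)^2 * (norm (p (v n)))^2 + (norm u)^2)) ~> dl * ((1 / dl)^2 * (norm d')^2 + (norm u)^2)"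
  by (intro tendsto_intros pv)
  have "EX w. (p (v n), w) : A" for n using v(1)[of n] pA by blast
  thus "EX N. ALL n>=N. 2 * (1 / dl) * Re (cinner (p (v n)) d') <= dl * ((1 / dl)^2 * (norm (p (v n)))^2 + (norm u)^2)"
  using key P(2) by blast
 qed
 hence "2 * (1 / dl) * (norm d')^2 <= dl * ((1 / dl)^2 * (norm d')^2 + (norm u)^2)"
  by (simp add: cinner_self del: of_real_power)
 hence "(norm d')^2 <= dl^2 * (norm u)^2"
  using d by (simp add: field_simps power2_eq_square)
 hence "(norm d')^2 <= (dl * norm u)^2" by (simp add: power_mult_distrib)
 thus ?thesis unfolding d'_def by (rule power2_le_imp_le) (use d in simp)
qed

text \<open>The cuts yield a measure \<open>E\<close>; what remains is that \<open>pvm_op E\<close>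
  is \<open>A\<close>, and for this the resolvents \<open>R\<close> and \<open>g\<close> at
  \<open>i\<close> are compared. On a spectral piece of width \<open>dl\<close> they differ by at
  most \<open>2 dl\<close>, and refining the partition of a bounded interval makes the difference
  vanish.\<close>

theorem spectral_theorem:
 fixes A :: "'h::complex_hilbert_space opgraph"
 assumes A: "op_sa A"
 shows "pvmeas (spm A)" "A = pvm_op (spm A)"
  and "bcl c ==> (!!x y. (x, y) : A ==> (c x, c y) : A) ==>
  c (spm A B x) = spm A B (c x)"
proof -
 interpret resolution "cut A"
  by unfold_locales (rule cut(1)[OF A] cut_mono[OF A] cut_right[OF A] cut_tendsto_zero[OF A] cut_tendsto_id[OF A] | assumption)+
 define R where "R = res A \<i>"
 have i: "Im \<i> ~= 0" by simp
 have Rb: "bcl R" unfolding R_def by (rule res_bcl[OF A i])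
 define g where "g = fc E (rz \<i>)"
 have gb: "bcl g" unfolding g_def by (rule fc(1)[OF E_pvm bb_rz[OF i]])
 have Rn: "norm (R w) <= norm w" for w unfolding R_def using res_norm[OF A i, of w] by simp
 have RA: "(R x, R y) : A" if "(x, y) : A" for x y
  unfolding R_def by (rule commutes_resD[OF A res_bcl[OF A i] _ i that]) simp
 have RE: "R (E B x) = E B (R x)" for B x
  by (rule E_commute[OF Rb]) (rule cut(2)[OF A Rb RA])
 have gE: "g (E B x) = E B (g x)" for B x
 proof -
  have "E B (g x) = g (E B x)" unfolding g_def
  by (rule fc_commute[OF E_pvm _ _ bb_rz[OF i]])
  (use pvmD(1)[OF E_pvm] pvm(2)[OF E_pvm] pvm_Int[OF E_pvm] in \<open>cases "B : sets borel"; auto simp: Int_commute bcl_zero\<close>)+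
  thus ?thesis by simp
 qed
 let ?T = "%x. R x - g x"
 have Tb: "bcl ?T" by (intro bcl_intros Rb gb)
 have piece: "norm (?T (E {a<..a + dl} x)) <= 2 * dl * norm (E {a<..a + dl} x)" if d: "dl > 0" for a dl x
 proof -
  let ?p = "E {a<..a + dl}"
  define w where "w = ?p x"
  have bor: "{a<..a + dl} : sets borel" by simp
  note Pp = pvmD[OF E_pvm bor]
  have pw: "?p w = w" unfolding w_def by (simp add: Pp(2))
  have pcut: "?p x = cut A (a + dl) x - cut A a x" for x using E_Ioc[of a "a + dl" x] d by simp
  define u where "u = R w"
  have pu: "?p u = u" unfolding u_def RE[symmetric] pw ..
  have uA: "(u, w + \<i> *c u) : A" unfolding u_def R_def by (rule res_in[OF A i])
  have ineq: "norm ((w + \<i> *c u) - cr a *c u) <= dl * norm u"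
  proof (rule narrow_piece[OF A pvm(1)[OF E_pvm bor] _ d _ uA pu])
  show "(?p x, ?p y) : A" if "(x, y) : A" for x y
  unfolding pcut using glinD(3)[OF saD(6)[OF A]] cut(3)[OF A that] by blast
  fix x y assume xy: "(x, y) : A" "?p x = x"
  have m: "a <= a + dl" using d by simp
  have "cut A (a + dl) x = x"
  using xy(2) unfolding pcut by (metis bcl_diff[OF P(1)] P(2) mono[OF m])
  moreover have "cut A a x = 0"
  using xy(2) calculation unfolding pcut by simp
  ultimately show "a * (norm x)^2 <= Re (cinner x y) & Re (cinner x y) <= (a + dl) * (norm x)^2"
  using cut(4)[OF A xy(1), of "a + dl"] cut(5)[OF A xy(1), of a] glinD(1)[OF saD(6)[OF A]]
  by (cases "x = 0") auto
  qed
  let ?c = "cr a - \<i>"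
  \<comment> \<open>\<open>(a - i) / (t - i) - 1 = (a - t) / (t - i)\<close>, which is at most
    \<open>dl\<close> in modulus on the piece.\<close>
  let ?h = "%t. indicator {a<..a + dl} t * ((?c * rz \<i> t) - 1)"
  have bh: "bb (%t. ?c * rz \<i> t - 1)" by (intro bb_diff bb_cmult bb_rz bb_const i)
  have "fc E ?h w = ?c *c g w - w"
  unfolding fc_E_mult[OF E_pvm bor bh, symmetric] g_def
  fc_diff[OF E_pvm bb_cmult[OF bb_rz[OF i]] bb_const] fc_cmult[OF E_pvm bb_rz[OF i]] fc_const[OF E_pvm]
  by (simp add: bcl_simps[OF Pp(1)] pw gE[unfolded g_def, symmetric])
  moreover have "norm (fc E ?h w) <= dl * norm w"
  proof (rule fc_norm_le[OF E_pvm bb_mult[OF bb_indicator[OF bor] bh]])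
  fix t
  show "cmod (?h t) <= dl"
  proof (cases "t : {a<..a + dl}")
  case True
  have "?c * rz \<i> t - 1 = cr (a - t) * rz \<i> t"
  unfolding rz_def using rz_nz[OF i, of t] by (simp add: field_simps)
  hence "cmod (?h t) = \<bar>a - t\<bar> * cmod (rz \<i> t)" using True by (simp add: norm_mult del: of_real_diff)
  also have "... <= dl * 1" using True cmod_rz[OF i, of t] by (intro mult_mono) auto
  finally show ?thesis by simp
  qed (use d in auto)
  qed (use d in simp)
  ultimately have 2: "norm (?c *c g w - w) <= dl * norm w" by simp
  have "?c *c (u - g w) = - ((w + \<i> *c u) - cr a *c u) - (?c *c g w - w)"
  by (simp add: scaleC.diff_left scaleC.diff_right algebra_simps)
  hence "norm (?c *c (u - g w)) <= norm ((w + \<i> *c u) - cr a *c u) + norm (?c *c g w - w)"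
  using norm_triangle_ineq4[of "- ((w + \<i> *c u) - cr a *c u)" "?c *c g w - w"]
  by (metis norm_minus_cancel)
  moreover have "norm (u - g w) <= norm (?c *c (u - g w))"
  proof -
  have "1 <= cmod ?c" using abs_Im_le_cmod[of ?c] by simp
  thus ?thesis unfolding norm_scaleC using mult_right_mono[of 1 "cmod ?c" "norm (u - g w)"] by simp
  qed
  moreover have "dl * norm u <= dl * norm w" unfolding u_def using Rn d by simp
  ultimately have "norm (u - g w) <= 2 * dl * norm w" using 2 ineq by linarith
  thus ?thesis unfolding u_def w_def .
 qed
 \<comment> \<open>\<open>?T\<close> respects the orthogonal decomposition into pieces, so squared
   norms add and the constant does not grow with the number of pieces.\<close>
 have pieces: "(norm (?T (E {a<..a + real m * dl} x)))^2 <= (2 * dl)^2 * (norm (E {a<..a + real m * dl} x))^2"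
  if d: "dl > 0" for a dl x m
 proof (induction m)
  case 0
  show ?case by (simp add: pvm_empty[OF E_pvm] bcl_zero[OF Tb])
 next
  case (Suc m)
  let ?A = "{a<..a + real m * dl}" and ?B = "{a + real m * dl<..a + real m * dl + dl}"
  have md: "0 <= real m * dl" using d by simp
  have U: "{a<..a + real (Suc m) * dl} = ?A Un ?B" "?A Int ?B = {}"
  proof -
  define r where "r = real m * dl"
  have r: "0 <= r" "real (Suc m) * dl = r + dl" using md by (simp_all add: r_def algebra_simps)
  show "{a<..a + real (Suc m) * dl} = ?A Un ?B" "?A Int ?B = {}"
  unfolding r(2) unfolding r_def[symmetric] using r(1) d by auto
  qed
  have AB: "?A : sets borel" "?B : sets borel" by auto
  have EU: "E {a<..a + real (Suc m) * dl} x = E ?A x + E ?B x"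
  unfolding U(1) by (rule pvm_Un[OF E_pvm AB U(2)])
  have TE: "?T (E C y) = E C (?T y)" if "C : sets borel" for C y
  by (simp add: RE gE bcl_diff[OF pvmD(1)[OF E_pvm that]])
  have orth: "cinner (E ?A y) (E ?B z) = 0" for y z
  using pvmD(4)[OF E_pvm AB(1), of y "E ?B z"] pvm_disjoint[OF E_pvm AB U(2)] by simp
  have "(norm (?T (E {a<..a + real (Suc m) * dl} x)))^2 = (norm (?T (E ?A x)))^2 + (norm (?T (E ?B x)))^2"
  unfolding EU bcl_add[OF Tb] norm_add_sq unfolding TE[OF AB(1)] TE[OF AB(2)] orth by simp
  also have "... <= (2 * dl)^2 * (norm (E ?A x))^2 + (2 * dl)^2 * (norm (E ?B x))^2"
  using Suc.IH power_mono[OF piece[OF d, of "a + real m * dl" x], of 2]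
  by (intro add_mono) (auto simp: power_mult_distrib)
  also have "... = (2 * dl)^2 * (norm (E {a<..a + real (Suc m) * dl} x))^2"
  unfolding EU norm_add_sq orth by (simp add: algebra_simps)
  finally show ?case .
 qed
 have zero: "?T (E {- real n<..real n} x) = 0" for n x
 proof (cases "n = 0")
  case True
  thus ?thesis by (simp add: pvm_empty[OF E_pvm] bcl_zero[OF Tb])
 next
  case False
  let ?y = "E {- real n<..real n} x"
  have "norm (?T ?y) <= (4 * real n * norm ?y) * inverse (real (Suc m))" for m
  proof -
  let ?d = "2 * real n / real (Suc m)"
  have d: "?d > 0" using False by simp
  have "- real n + real (Suc m) * ?d = real n" by simp
  hence "(norm (?T ?y))^2 <= (2 * ?d * norm ?y)^2"
  using pieces[OF d, of "- real n" "Suc m" x] by (simp only: power_mult_distrib)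
  hence "norm (?T ?y) <= 2 * ?d * norm ?y" by (rule power2_le_imp_le) simp
  thus ?thesis by (simp add: field_simps)
  qed
  moreover have "(%m. (4 * real n * norm ?y) * inverse (real (Suc m))) ~> (4 * real n * norm ?y) * 0"
  by (intro tendsto_intros LIMSEQ_inverse_real_of_nat)
  ultimately have "norm (?T ?y) <= (4 * real n * norm ?y) * 0" by (intro LIMSEQ_le_const) auto
  thus ?thesis by simp
 qed
 have "?T x = 0" for x
 proof -
  have "(%n. cut A (real n) x - cut A (- real n) x) ~> x - 0"
  by (intro tendsto_diff cut_tendsto_id[OF A] cut_tendsto_zero[OF A])
  hence "(%n. E {- real n<..real n} x) ~> x" by (simp add: E_Ioc)
  hence "(%n. ?T (E {- real n<..real n} x)) ~> ?T x" by (rule bcl_tendsto[OF Tb])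
  thus ?thesis unfolding zero by (simp add: LIMSEQ_const_iff)
 qed
 hence "res A \<i> = res (pvm_op E) \<i>"
  unfolding res_pvm_op[OF E_pvm i] by (auto simp: R_def g_def)
 hence "A = pvm_op E"
  using res_iff[OF A i] res_iff[OF pvm_op_sa[OF E_pvm] i] by auto
 moreover from this have "spm A = E" using spectral_measure_pvm_op[OF E_pvm] by simp
 ultimately show "pvmeas (spm A)" "A = pvm_op (spm A)"
  "bcl c ==> (!!x y. (x, y) : A ==> (c x, c y) : A) ==>
  c (spm A B x) = spm A B (c x)"
  using E_pvm E_commute cut(2)[OF A] by simp_all
qed

lemma res_fc: "op_sa A ==> Im z ~= 0 ==> res A z = fc (spm A) (rz z)"
 using spectral_theorem(1,2) res_pvm_op by metis

section \<open>Absolute value and polar decomposition\<close>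

text \<open>The image of \<open>E\<close> under \<open>f\<close>, compressed by an isometry
  \<open>j\<close> with adjoint \<open>j'\<close>. It is used with \<open>t -> -t\<close> and
  \<open>flip\<close>, and with the absolute value and the inclusion of the second summand.\<close>

definition push_pvm :: "(real set => 'h::complex_hilbert_space => 'h) => (real => real) =>
  ('k::complex_hilbert_space => 'h) => ('h => 'k) => real set => 'k => 'k"
 where "push_pvm E f j j' B = (if B : sets borel then (%x. j' (E (f -` B) (j x))) else (%_. 0))"

locale push =
 fixes E :: "real set => 'h::complex_hilbert_space => 'h" and ph :: "real => real"
  and j :: "'k::complex_hilbert_space => 'h" and j' :: "'h => 'k"
 assumes E: "pvmeas E" and ph: "ph : borel_measurable borel"
  and j: "bcl j" "bcl j'"
  and adj: "cinner (j x) y = cinner x (j' y)" and iso: "j' (j x) = x"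
  and comm: "B : sets borel ==> j (j' (E (ph -` B) (j x))) = E (ph -` B) (j x)"
begin

abbreviation "G \<equiv> push_pvm E ph j j'"

lemma vim: "B : sets borel ==> ph -` B : sets borel"
 using measurable_sets[OF ph] by simp

lemma adj': "cinner (j' y) x = cinner y (j x)"
 by (metis adj cinner_commute)

lemma G_pvm: "pvmeas G"
 unfolding projection_valued_measure_def
proof (intro conjI ballI allI impI)
 fix B :: "real set" assume B: "B : sets borel"
 note P = pvmD[OF E vim[OF B]]
 show "projop (G B)"
 proof (rule projI)
  show "bcl (G B)" unfolding push_pvm_def
  using B bcl_comp(2)[OF j(2) bcl_comp(2)[OF P(1) j(1)]] by simp
  show "G B (G B x) = G B x" for x using B by (simp add: push_pvm_def comm P(2))
  show "cinner (G B x) y = cinner x (G B y)" for x y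
  using B by (simp add: push_pvm_def adj' P(4) adj)
 qed
next
 show "G UNIV = id" by (simp add: push_pvm_def pvm(3)[OF E] iso fun_eq_iff)
 fix B :: "nat => real set" and x assume B: "range B <= sets borel" "disjoint_family B"
 have "range (%n. ph -` B n) <= sets borel" "disjoint_family (%n. ph -` B n)"
  using B vim by (auto simp: disjoint_family_on_def)
 from pvm(4)[OF E this, of "j x"] have "(%n. j' (E (ph -` B n) (j x))) sums j' (E (\<Union>n. ph -` B n) (j x))"
  by (rule bounded_linear.sums[OF bcl_linear[OF j(2)]])
 thus "(%n. G (B n) x) sums G (\<Union>n. B n) x"
  using B by (auto simp: push_pvm_def vimage_UN)
qed (auto simp: push_pvm_def)

lemma bb_phi: "bb f ==> bb (%t. f (ph t))"
 using measurable_compose[OF ph] unfolding bb_def by auto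

lemma smeas_G: "smeas G x = distr (smeas E (j x)) borel ph"
proof (rule measure_eqI)
 fix B assume "B : sets (smeas G x)"
 hence B: "B : sets borel" by simp
 interpret D: finite_measure "smeas E (j x)" by (rule smeas[OF E])
 interpret D': finite_measure "smeas G x" by (rule smeas[OF G_pvm])
 have "(norm (G B x))^2 = (norm (E (ph -` B) (j x)))^2"
 proof -
  have "cr ((norm (G B x))^2) = cinner x (G B x)" by (rule projD(5)[OF pvm(1)[OF G_pvm B], symmetric])
  also have "... = cinner (j x) (E (ph -` B) (j x))" using B by (simp add: push_pvm_def adj)
  also have "... = cr ((norm (E (ph -` B) (j x)))^2)" by (rule pvmD(5)[OF E vim[OF B]])
  finally show ?thesis by (simp only: of_real_eq_iff)
 qed
 thus "emeasure (smeas G x) B = emeasure (distr (smeas E (j x)) borel ph) B"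
  using B ph by (simp add: emeasure_distr D.emeasure_eq_measure D'.emeasure_eq_measure smeas(2)[OF G_pvm]
  smeas(2)[OF E] vim)
qed simp

lemma fc_G:
 assumes f: "bb f"
 shows "fc G f x = j' (fc E (%t. f (ph t)) (j x))" "j (fc G f x) = fc E (%t. f (ph t)) (j x)"
proof -
 have "fc G f = (%x. j' (fc E (%t. f (ph t)) (j x)))"
 proof (rule fc_unique[OF G_pvm])
  show "bcl (%x. j' (fc E (%t. f (ph t)) (j x)))"
  by (rule bcl_comp(2)[OF j(2) bcl_comp(2)[OF fc(1)[OF E bb_phi[OF f]] j(1)]])
  fix x
  have "cinner x (j' (fc E (%t. f (ph t)) (j x))) = (\<integral>t. f (ph t) \<partial>smeas E (j x))"
  unfolding adj[symmetric] by (rule fc(2)[OF E bb_phi[OF f]])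
  also have "... = (\<integral>t. f t \<partial>smeas G x)"
  unfolding smeas_G using f ph by (subst integral_distr) (auto simp: bb_def)
  finally show "cinner x (j' (fc E (%t. f (ph t)) (j x))) = (\<integral>t. f t \<partial>smeas G x)" .
 qed
 thus 1: "fc G f x = j' (fc E (%t. f (ph t)) (j x))" for x by simp
 have "j (j' (fc E (%t. f (ph t)) (j x))) = fc E (%t. f (ph t)) (j x)"
  using f
 proof (induction f rule: bb_induct)
  case (ind B)
  have "(%t. indicator B (ph t)) = (indicator (ph -` B) :: real => complex)" by (auto simp: indicator_def)
  thus ?case using comm[OF ind] vim[OF ind] by (simp add: fc_ind[OF E])
 next
  case (add f g)
  thus ?case by (simp add: fc_add[OF E] bb_phi bcl_simps[OF j(1)] bcl_simps[OF j(2)])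
 next
  case (cmult c f)
  thus ?case by (simp add: fc_cmult[OF E] bb_phi bcl_simps[OF j(1)] bcl_simps[OF j(2)])
 next
  case (lim f F)
  have *: "(%n. fc E (%t. F n (ph t)) (j x)) ~> fc E (%t. f (ph t)) (j x)"
  by (rule fc_lim[OF E]) (use lim bb_phi in auto)
  have "(%n. j (j' (fc E (%t. F n (ph t)) (j x)))) ~> j (j' (fc E (%t. f (ph t)) (j x)))"
  by (intro bcl_tendsto[OF j(1)] bcl_tendsto[OF j(2)] *)
  thus ?case using * lim(4) LIMSEQ_unique by auto
 qed
 thus "j (fc G f x) = fc E (%t. f (ph t)) (j x)" using 1 by simp
qed

end

section \<open>The off-diagonal matrix of an operator and its polar decomposition\<close>

definition hat :: "'h::complex_hilbert_space opgraph => ('h \<times> 'h) opgraph"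
 where "hat T = {((a, b), (c, d)) | a b c d. (b, c) : T & (a, d) : op_adj T}"

lemma in_hat [simp]: "((a, b), (c, d)) : hat T <-> (b, c) : T & (a, d) : op_adj T"
 by (simp add: hat_def)

lemma hat_sa:
 assumes T: "closed_dd_op T"
 shows "op_sa (hat T)"
proof -
 note t = closed_dd_opD[OF T] and t' = closed_dd_opD[OF closed_dd_op_adj[OF T]]
 have adj: "op_adj (hat T) = hat T"
 proof (rule set_eqI)
  fix p :: "('a \<times> 'a) \<times> ('a \<times> 'a)"
  obtain u v a b where p: "p = ((u, v), (a, b))" by (metis prod.exhaust)
  have "((u, v), (a, b)) : op_adj (hat T) <->
  (ALL c d e f. (d, e) : T --> (c, f) : op_adj T --> cinner u e + cinner v f = cinner a c + cinner b d)"
  unfolding in_op_adj[of "(u, v)"] by auto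
  also have "... <-> (u, b) : op_adj T & (v, a) : op_adj (op_adj T)"
  proof (intro iffI conjI)
  assume *: "ALL c d e f. (d, e) : T --> (c, f) : op_adj T --> cinner u e + cinner v f = cinner a c + cinner b d"
  show "(u, b) : op_adj T" unfolding in_op_adj[of u] using *[rule_format, OF _ glinD(1)[OF t'(4)]] by simp
  show "(v, a) : op_adj (op_adj T)" unfolding in_op_adj[of v] using *[rule_format, OF glinD(1)[OF t(4)]] by simp
  qed (auto simp: in_op_adj[of u] in_op_adj[of v])
  also have "... <-> ((u, v), (a, b)) : hat T" using op_adj_adj[OF t(1,4)] by auto
  finally show "p : op_adj (hat T) <-> p : hat T" unfolding p .
 qed
 have "Domain (hat T) = Domain (op_adj T) \<times> Domain T" by (auto simp: hat_def Domain_iff)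
 hence "closure (Domain (hat T)) = UNIV" by (simp add: closure_Times t(3) t'(3))
 moreover have "single_valued (hat T)"
  using t(2) t'(2) unfolding single_valued_def hat_def by blast
 ultimately show ?thesis
  using op_adj_closed[of "hat T"] unfolding op_selfadjoint_def closed_dd_op_iff adj by simp
qed

text \<open>The diagonal matrix with entries 1 and -1. It conjugates \<open>hat T\<close> into its
  negative, so even functions of \<open>hat T\<close> are diagonal and odd ones
  off-diagonal.\<close>

definition flip :: "'h \<times> 'h => 'h \<times> ('h::complex_hilbert_space)" where "flip p = (fst p, - snd p)"

lemma flip [simp]: "flip (a, b) = (a, - b)" "flip (flip p) = p" by (simp_all add: flip_def)

lemma bcl_fst: "bcl fst"
 by (rule bclI[of _ 1]) (simp_all, metis norm_fst_le prod.collapse)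

lemma bcl_snd: "bcl snd"
 by (rule bclI[of _ 1]) (simp_all, metis norm_snd_le prod.collapse)

lemma bcl_Pair: "bcl f ==> bcl g ==> bcl (%x. (f x, g x))"
 unfolding bounded_clinear_def by (auto intro: bounded_linear_Pair)

lemma bcl_flip: "bcl flip"
 unfolding flip_def[abs_def] by (intro bcl_Pair bcl_fst bcl_uminus bcl_snd)

lemma flip_adj: "cinner (flip p) q = cinner p (flip q)"
 by (simp add: cinner_prod_def flip_def)

definition sgx :: "real => complex" where "sgx t = cr (sgn t)"

lemma bb_sg: "bb sgx"
proof (rule bbI[of _ 1])
 have sgx: "sgx = (%t. indicator {0<..} t - indicator {..<0} t)" by (auto simp: sgx_def indicator_def sgn_if)
 show "sgx : borel_measurable borel" unfolding sgx by measurable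
qed (simp add: sgx_def sgn_if)

definition atr :: "nat => real => complex" where "atr n t = trn n \<bar>t\<bar>"

lemma sg_tr: "sgx t * trn n t = atr n t" "sgx t * atr n t = trn n t"
 by (auto simp: sgx_def atr_def trn_def ivl_def indicator_def sgn_if abs_if)

lemma bb_atr: "bb (atr n)"
 using bb_mult[OF bb_sg bb_tr, of n] by (simp add: sg_tr)

lemma abs_ivl: "abs -` ivl n = ivl n" by (auto simp: ivl_def abs_if split: if_splits)

lemma uminus_ivl: "uminus -` ivl n = ivl n" by (auto simp: ivl_def)

lemma self_neg_zero: "x = - x ==> x = (0::'a::real_vector)"
 using real_vector.scale_cancel_right[of 2 x 0] by (simp add: scaleR_2 eq_neg_iff_add_eq_0)

text \<open>The sign is odd, so \<open>W\<close> consists of the two off-diagonal corners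
  \<open>U\<close> and \<open>U'\<close>, the phase and its adjoint. The absolute value is even, and
  its lower right corner \<open>P\<close> is the absolute value of \<open>T\<close>.\<close>

locale polar =
 fixes T :: "'h::complex_hilbert_space opgraph"
 assumes T: "closed_dd_op T"
begin

definition E where "E = spm (hat T)"

lemma E: "pvmeas E" and hat_E: "hat T = pvm_op E"
 unfolding E_def using spectral_theorem hat_sa[OF T] by blast+

lemma in_hat_iff: "((a, b), (c, d)) : hat T <-> (ALL n. E (ivl n) (c, d) = fc E (trn n) (a, b))"
 unfolding hat_E by (simp add: pvm_op_def)

text \<open>Pushing \<open>E\<close> along \<open>t -> -t\<close> and conjugating by
  \<open>flip\<close> again gives a measure for \<open>hat T\<close>; \<open>pvm_op_inj\<close>
  identifies the two.\<close>

lemma flip_E: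
 assumes "B : sets borel" shows "flip (E (uminus -` B) x) = E B (flip x)"
proof -
 interpret push E uminus flip flip
  by unfold_locales (auto intro: E bcl_flip flip_adj)
 have "pvm_op G = pvm_op E"
 proof (rule set_eqI)
  fix p :: "('h \<times> 'h) \<times> ('h \<times> 'h)"
  obtain a b c d where p: "p = ((a, b), (c, d))" by (metis prod.exhaust)
  have trn: "fc E (%t. trn n (- t)) = (%x. - fc E (trn n) x)" for n
  proof -
  have "- t : ivl n <-> t : ivl n" for t by (auto simp: ivl_def)
  hence "(%t. trn n (- t)) = (%t. (-1) * trn n t)" by (simp add: trn_def indicator_def)
  thus ?thesis by (simp only: fc_cmult[OF E bb_tr]) simp
  qed
  have "p : pvm_op G <-> (ALL n. flip (E (ivl n) (flip (c, d))) = flip (- fc E (trn n) (flip (a, b))))"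
  unfolding p pvm_op_def by (simp add: fc_G(1)[OF bb_tr] trn) (simp add: push_pvm_def uminus_ivl)
  also have "... <-> (ALL n. E (ivl n) (- c, d) = fc E (trn n) (a, - b))"
  proof (intro all_cong1)
  fix n
  have "E (ivl n) (c, - d) = - E (ivl n) (- c, d)"
  using bcl_minus[OF pvmD(1)[OF E ivl_borel[of n]], of "(- c, d)"] by simp
  thus "(flip (E (ivl n) (flip (c, d))) = flip (- fc E (trn n) (flip (a, b))))
  <-> (E (ivl n) (- c, d) = fc E (trn n) (a, - b))"
  by (metis flip neg_equal_iff_equal)
  qed
  also have "... <-> ((a, - b), (- c, d)) : hat T" by (simp only: in_hat_iff)
  also have "... <-> ((a, b), (c, d)) : hat T"
  using glinD(4)[OF closed_dd_opD(4)[OF T], of "- b" "- c" "-1"] glinD(4)[OF closed_dd_opD(4)[OF T], of b c "-1"]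
  by auto
  finally show "p : pvm_op G <-> p : pvm_op E" unfolding p hat_E .
 qed
 from pvm_op_inj[OF G_pvm E this] have "G B (flip x) = E B (flip x)" by simp
 thus ?thesis using assms by (simp add: push_pvm_def)
qed

lemma flip_fc: assumes f: "bb f" shows "flip (fc E (%t. f (- t)) x) = fc E f (flip x)"
proof -
 interpret push E uminus flip flip
  by unfold_locales (auto intro: E bcl_flip flip_adj)
 have "G = E"
 proof (rule ext)
  show "G B = E B" for B
  using flip_E[of B] pvm(2)[OF E, of B] by (auto simp: push_pvm_def)
 qed
 thus ?thesis using fc_G(1)[OF f, of "flip x"] by simp
qed

definition W where "W = fc E sgx"

lemma W_flip: "W (flip x) = - flip (W x)"
proof -
 have "(%t. sgx (- t)) = (%t. (-1) * sgx t)" by (auto simp: sgx_def)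
 hence "fc E (%t. sgx (- t)) x = - W x" unfolding W_def by (simp only: fc_cmult[OF E bb_sg]) simp
 thus ?thesis using flip_fc[OF bb_sg, of x] bcl_minus[OF bcl_flip] unfolding W_def by metis
qed

lemma Wb: "bcl W" unfolding W_def by (rule fc(1)[OF E bb_sg])

lemma W_adj: "cinner (W x) y = cinner x (W y)"
proof (rule selfadj_swap[OF Wb])
 show "cadj W = W" unfolding W_def fc_cnj[OF E bb_sg]
  by (rule arg_cong[where f = "fc E"]) (simp add: sgx_def fun_eq_iff)
qed

lemma W_off: "fst (W (a, 0)) = 0" "snd (W (0, b)) = 0"
proof -
 have "W (a, 0) = - flip (W (a, 0))" using W_flip[of "(a, 0)"] by simp
 thus "fst (W (a, 0)) = 0" by (metis self_neg_zero flip_def fst_conv fst_uminus)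
 have "- W (0, b) = - flip (W (0, b))" using W_flip[of "(0, b)"] bcl_minus[OF Wb, of "(0, b)"] by simp
 hence "W (0, b) = flip (W (0, b))" by simp
 thus "snd (W (0, b)) = 0" by (metis self_neg_zero flip_def snd_conv)
qed

definition U where "U b = fst (W (0, b))"
definition U' where "U' a = snd (W (a, 0))"

lemma W_U: "W (0, b) = (U b, 0)" "W (a, 0) = (0, U' a)"
 using W_off by (simp_all add: U_def U'_def prod_eq_iff)

lemma Ub: "bcl U" "bcl U'"
 unfolding U_def[abs_def] U'_def[abs_def]
 by (intro bcl_comp(2)[OF bcl_fst] bcl_comp(2)[OF bcl_snd] bcl_comp(2)[OF Wb] bcl_Pair bcl_intros)+

lemma U_adj: "cadj U = U'"
 by (rule cadj_unique) (use W_adj[of "(0, _)" "(_, 0)"] in \<open>simp add: W_U\<close>)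

sublocale A: push E abs "Pair 0" snd
proof
 fix B :: "real set" and x :: 'h
 assume B: "B : sets borel"
 have bor: "abs -` B : sets borel" using measurable_sets[of abs borel borel B] B by simp
 have "uminus -` (abs -` B) = abs -` B" by auto
 hence "flip (E (abs -` B) (0, x)) = E (abs -` B) (0, - x)" using flip_E[OF bor, of "(0, x)"] by simp
 also have "... = - E (abs -` B) (0, x)" using bcl_minus[OF pvmD(1)[OF E bor], of "(0, x)"] by simp
 finally have "fst (E (abs -` B) (0, x)) = - fst (E (abs -` B) (0, x))" by (metis flip_def fst_conv fst_uminus)
 hence "fst (E (abs -` B) (0, x)) = 0" by (rule self_neg_zero)
 thus "(0, snd (E (abs -` B) (0, x))) = E (abs -` B) (0, x)" by (simp add: prod_eq_iff)
qed (auto intro: E bcl_Pair bcl_intros bcl_snd simp: cinner_prod_def)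

definition P where "P = pvm_op A.G"

lemma P_sa: "op_sa P" unfolding P_def by (rule pvm_op_sa[OF A.G_pvm])

lemma P_iff: "(x, y) : P <-> (ALL n. E (ivl n) (0, y) = fc E (atr n) (0, x))"
proof -
 have "A.G (ivl n) y = fc A.G (trn n) x <-> E (ivl n) (0, y) = fc E (atr n) (0, x)" for n
 proof -
  have "(0, A.G (ivl n) y) = E (ivl n) (0, y)" using A.comm[OF ivl_borel, of n y] by (simp add: push_pvm_def abs_ivl)
  moreover have "(0, fc A.G (trn n) x) = fc E (atr n) (0, x)" using A.fc_G(2)[OF bb_tr, of n x] by (simp add: atr_def[abs_def])
  ultimately show ?thesis by (metis snd_conv)
 qed
 thus ?thesis by (simp add: P_def pvm_op_def)
qed

lemma W_ivl: "E (ivl n) (W x) = W (E (ivl n) x)"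
 unfolding W_def fc_ind[OF E ivl_borel, symmetric] fc_mult[OF E bb_sg bb_indicator[OF ivl_borel]]
  fc_mult[OF E bb_indicator[OF ivl_borel] bb_sg] by (simp add: mult.commute)

lemma W_tr: "W (fc E (trn n) x) = fc E (atr n) x" "W (fc E (atr n) x) = fc E (trn n) x"
  "fc E (trn n) (W x) = fc E (atr n) x" "fc E (atr n) (W x) = fc E (trn n) x"
 unfolding W_def fc_mult[OF E bb_sg bb_tr] fc_mult[OF E bb_sg bb_atr] fc_mult[OF E bb_tr bb_sg] fc_mult[OF E bb_atr bb_sg]
 by (simp_all add: sg_tr mult.commute[of _ "sgx _"])

lemma P_T: "(x, y) : P ==> (x, U y) : T"
proof -
 assume "(x, y) : P"
 hence "E (ivl n) (U y, 0) = fc E (trn n) (0, x)" for n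
  unfolding P_iff W_U(1)[symmetric] W_ivl by (simp add: W_tr)
 hence "((0, x), (U y, 0)) : hat T" by (simp only: in_hat_iff) simp
 thus "(x, U y) : T" by simp
qed

lemma W_sq: "W (W x) = x - E {0} x"
proof -
 have "(%t. sgx t * sgx t) = (%t. 1 - indicator {0} t)" by (auto simp: sgx_def indicator_def sgn_if)
 thus ?thesis unfolding W_def fc_mult[OF E bb_sg bb_sg]
  by (simp add: fc_diff[OF E bb_const bb_indicator] fc_const[OF E] fc_ind[OF E])
qed

text \<open>A vector in the range of \<open>hat T\<close> has no component in \<open>E {0}\<close>,
  because \<open>t\<close> vanishes at 0; and \<open>W W\<close> is the complement of
  \<open>E {0}\<close>.\<close>

lemma WW: assumes "!!n. E (ivl n) x = fc E (trn n) y" shows "W (W x) = x"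
proof -
 have "fc E (indicator {0}) (fc E (trn n) y) = 0" for n
 proof -
  have "(%t. indicator {0} t * trn n t) = (%t. 0)" by (auto simp: trn_def indicator_def)
  thus ?thesis by (simp add: fc_mult[OF E bb_indicator bb_tr] fc_const[OF E])
 qed
 hence "E {0} (E (ivl n) x) = 0" for n using assms fc_ind[OF E, of "{0}"] by simp
 moreover have "(%n. E {0} (E (ivl n) x)) ~> E {0} x"
  by (rule bcl_tendsto[OF pvmD(1)[OF E] ivl_tendsto[OF E]]) simp
 ultimately show ?thesis by (simp add: W_sq LIMSEQ_const_iff)
qed

lemma T_P:
 assumes "(x, c) : T"
 shows "(x, U' c) : P" "U (U' c) = c"
proof -
 have "((0, x), (c, 0)) : hat T" using assms glinD(1)[OF op_adj_closed(2)] by simp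
 hence 1: "E (ivl n) (c, 0) = fc E (trn n) (0, x)" for n by (simp only: in_hat_iff)
 show "(x, U' c) : P" unfolding P_iff W_U(2)[symmetric] W_ivl 1 W_tr by simp
 show "U (U' c) = c" using WW[OF 1] by (simp add: W_U)
qed

lemma T_eq: "T = {(x, U y) | x y. (x, y) : P}"
 using P_T T_P by force

lemma adj_P: "(c, w) : op_adj T <-> (ALL n. E (ivl n) (0, w) = fc E (trn n) (c, 0))"
 using in_hat_iff[of c 0 0 w] glinD(1)[OF closed_dd_opD(4)[OF T]] by simp

lemma P_square: "P O P = T O op_adj T"
proof (intro set_eqI iffI; clarify)
 fix x y w assume xy: "(x, y) : P" and yw: "(y, w) : P"
 have "(U y, w) : op_adj T" using yw unfolding adj_P W_U(1)[symmetric] W_tr P_iff .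
 thus "(x, w) : T O op_adj T" using P_T[OF xy] by blast
next
 fix x c w assume xc: "(x, c) : T" and cw: "(c, w) : op_adj T"
 have "(U' c, w) : P" unfolding P_iff
  using cw T_P(2)[OF xc] unfolding adj_P by (metis W_U(1) W_tr(3))
 thus "(x, w) : P O P" using T_P(1)[OF xc] by blast
qed

lemma P_positive: "op_positive P"
 unfolding op_positive_def
proof (intro conjI P_sa ballI, clarify)
 fix x y assume "(x, y) : P"
 hence "cinner x y = cr (\<integral>t. t \<partial>smeas A.G x)" unfolding P_def by (rule pvm_op_form[OF A.G_pvm])
 also have "(\<integral>t. t \<partial>smeas A.G x) = (\<integral>t. \<bar>t\<bar> \<partial>smeas E (0, x))"
  unfolding A.smeas_G by (subst integral_distr) auto
 finally show "cinner x y : \<real>\<^sub>\<ge>\<^sub>0" by simp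
qed

lemma W_zero_iff: "W v = 0 <-> (ALL n. fc E (trn n) v = 0)"
proof
 assume "W v = 0"
 thus "ALL n. fc E (trn n) v = 0" using W_tr(4)[of _ v] bcl_zero[OF fc(1)[OF E bb_atr]] by simp
next
 assume 0: "ALL n. fc E (trn n) v = 0"
 \<comment> \<open>The sign cut off near 0 and near infinity is \<open>trn n\<close> times the
   bounded function \<open>h n\<close>; as \<open>n\<close> grows it tends to the full sign.\<close>
 define f where "f n t = sgx t * indicator ({- real n..real n} - {- (1 / real (Suc n))<..<1 / real (Suc n)}) t" for n t
 define h where "h n t = f n t * cr (1 / t)" for n t
 have bf: "bb (f n)" for n unfolding f_def by (intro bb_mult bb_sg bb_indicator) auto
 have bh: "bb (h n)" for n
 proof (rule bbI[of _ "real (Suc n)"])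
  show "h n : borel_measurable borel" unfolding h_def using bf[THEN bb_measurable] by measurable
  show "cmod (h n t) <= real (Suc n)" for t
  proof (cases "1 / real (Suc n) <= \<bar>t\<bar>")
  case True
  hence "0 < \<bar>t\<bar>" by (rule less_le_trans[rotated]) simp
  with True have "1 / \<bar>t\<bar> <= 1 / (1 / real (Suc n))" by (intro divide_left_mono mult_pos_pos) auto
  hence "\<bar>1 / t\<bar> <= real (Suc n)" by simp
  moreover have "cmod (f n t) <= 1" by (simp add: f_def sgx_def sgn_if indicator_def)
  ultimately have "cmod (f n t) * \<bar>1 / t\<bar> <= 1 * real (Suc n)" by (intro mult_mono) auto
  thus ?thesis unfolding h_def norm_mult norm_of_real by simp
  next
  case False
  hence "t : {- (1 / real (Suc n))<..<1 / real (Suc n)}" by auto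
  thus ?thesis by (simp add: h_def f_def)
  qed
 qed
 have fh: "f n t = h n t * trn n t" for n t
 proof (cases "t = 0")
  case False thus ?thesis by (simp add: h_def f_def trn_def ivl_def indicator_def)
 qed (simp add: h_def f_def sgx_def)
 hence "fc E (f n) v = fc E (h n) (fc E (trn n) v)" for n
  using fc_mult[OF E bh bb_tr, of n n "v"] fh[abs_def] by presburger
 hence "fc E (f n) v = 0" for n by (simp add: 0 bcl_zero[OF fc(1)[OF E bh]])
 moreover have "(%n. fc E (f n) v) ~> W v"
  unfolding W_def
 proof (rule fc_tendsto[OF E bb_sg bf, where C = 1])
  show "cmod (f n t) <= 1" for n t by (simp add: f_def sgx_def sgn_if indicator_def)
  show "(%n. f n t) ~> sgx t" for t
  proof (cases "t = 0")
  case False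
  have "eventually (%n. inverse (real (Suc n)) < \<bar>t\<bar>) sequentially"
  using LIMSEQ_inverse_real_of_nat False by (intro order_tendstoD(2)) auto
  hence "eventually (%n. f n t = sgx t) sequentially"
  using ivl_eventually[of t] by eventually_elim (auto simp: f_def ivl_def indicator_def inverse_eq_divide)
  thus ?thesis by (rule tendsto_eventually)
  qed (simp add: f_def sgx_def)
 qed
 ultimately show "W v = 0" by (simp add: LIMSEQ_const_iff)
qed

lemma hat_zero_iff: "(v, (0, 0)) : hat T <-> W v = 0"
proof -
 have "E (ivl n) (0, 0) = 0" for n by (metis zero_prod_def bcl_zero pvmD(1)[OF E ivl_borel])
 hence "(v, (0, 0)) : hat T <-> (ALL n. 0 = fc E (trn n) v)"
  using in_hat_iff[of "fst v" "snd v" 0 0] by simp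
 thus ?thesis unfolding W_zero_iff by auto
qed

lemma kernel: "U x = 0 <-> (x, 0) : T"
 using hat_zero_iff[of "(0, x)"] glinD(1)[OF op_adj_closed(2)[of T]] unfolding in_hat W_U zero_prod_def by blast

lemma kernel': "U' x = 0 <-> (x, 0) : op_adj T"
 using hat_zero_iff[of "(x, 0)"] glinD(1)[OF closed_dd_opD(4)[OF T]] unfolding in_hat W_U zero_prod_def by blast

end

text \<open>The factorization \<open>P^2 - z^2 = (P + z) (P - z)\<close> expresses the unbounded
  square through two bounded resolvents.\<close>

lemma square_resolvent:
 assumes P: "op_sa P" and z: "Im z ~= 0"
 shows "(x, v) : P O P <-> x = res P (- z) (res P z (v - z^2 *c x))"
proof
 have z': "Im (- z) ~= 0" using z by simp
 note g = glinD[OF saD(6)[OF P]]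
 {
  assume "(x, v) : P O P"
  then obtain y where xy: "(x, y) : P" and yv: "(y, v) : P" by blast
  have "(y + z *c x, v + z *c y) : P" by (rule g(2)[OF yv g(4)[OF xy]])
  hence "res P z ((v + z *c y) - z *c (y + z *c x)) = y + z *c x" using res_iff[OF P z] by blast
  hence "res P z (v - z^2 *c x) = y + z *c x"
  by (simp add: scaleC_add_right power2_eq_square algebra_simps)
  moreover have "res P (- z) (y + z *c x) = x" using res_iff[OF P z', of x y] xy by simp
  ultimately show "x = res P (- z) (res P z (v - z^2 *c x))" by simp
 }
 assume x: "x = res P (- z) (res P z (v - z^2 *c x))"
 let ?a = "res P z (v - z^2 *c x)"
 have 1: "(?a, (v - z^2 *c x) + z *c ?a) : P" by (rule res_in[OF P z])
 have 2: "(x, ?a - z *c x) : P" using res_in[OF P z', of ?a] x by simp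
 have "(?a - z *c x, ((v - z^2 *c x) + z *c ?a) - z *c (?a - z *c x)) : P"
  by (rule g(3)[OF 1 g(4)[OF 2]])
 hence "(?a - z *c x, v) : P" by (simp add: scaleC.diff_right power2_eq_square)
 thus "(x, v) : P O P" using 2 by blast
qed

text \<open>On the spectral subspace of \<open>[-n, -1/(n+1)]\<close> the form is at most
  \<open>-1/(n+1)\<close> times the squared norm, yet nonnegative. These intervals exhaust the
  negative half line.\<close>

lemma op_positive_support:
 assumes P: "op_positive P" and F: "pvmeas F" "P = pvm_op F"
 shows "measure (smeas F x) {..<0} = 0"
proof -
 have "F {- real n..- (1 / real (Suc n))} x = 0" for n
 proof -
  let ?C = "{- real n..- (1 / real (Suc n))}"
  have C: "?C : sets borel" by simp
  define y where "y = F ?C x"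
  have Cy: "F ?C y = y" unfolding y_def by (rule pvmD(2)[OF F(1) C])
  have CI: "?C <= ivl n"
  proof
  fix t assume "t : ?C"
  hence t: "- real n <= t" "t <= - (1 / real (Suc n))" by auto
  have "t <= 0" by (rule order_trans[OF t(2)]) simp
  thus "t : ivl n" unfolding ivl_def using t(1) by auto
  qed
  have "F (ivl n) y = y" unfolding y_def using CI pvm_Int[OF F(1) ivl_borel C] by (simp add: Int_absorb1)
  hence "(y, fc F (trn n) y) : P" using pvm_op_ivl[OF F(1), of n y] F(2) by simp
  hence "0 <= Re (cinner y (fc F (trn n) y))"
  using P unfolding op_positive_def by (auto simp: complex_nonneg_Reals_iff)
  also have "fc F (trn n) y = fc F (%t. trn n t * indicator ?C t) y"
  using fc_mult[OF F(1) bb_tr bb_indicator[OF C], of n y] unfolding fc_ind[OF F(1) C] Cy .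
  also have "cinner y ... = (\<integral>t. cr (t * indicator ?C t) \<partial>smeas F y)"
  unfolding fc(2)[OF F(1) bb_mult[OF bb_tr bb_indicator[OF C]]]
  by (rule Bochner_Integration.integral_cong) (use CI in \<open>auto simp: trn_def indicator_def\<close>)
  also have "Re ... = (\<integral>t. t * indicator ?C t \<partial>smeas F y)" unfolding integral_complex_of_real by simp
  also have "... <= (\<integral>t. - (1 / real (Suc n)) * indicator ?C t \<partial>smeas F y)"
  proof (rule integral_mono)
  interpret finite_measure "smeas F y" by (rule smeas[OF F(1)])
  show "integrable (smeas F y) (%t. t * indicator ?C t)"
  using CI by (intro integrable_const_bound[of _ "real n"] AE_I2) (auto simp: indicator_def ivl_def abs_le_iff)
  show "integrable (smeas F y) (%t. - (1 / real (Suc n)) * indicator ?C t)"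
  by (intro integrable_const_bound[of _ "1 / real (Suc n)"] AE_I2) (auto simp: indicator_def)
  qed (auto simp: indicator_def)
  also have "... = - (1 / real (Suc n)) * (norm y)^2" using smeas(2)[OF F(1) C, of y] Cy by simp
  finally have "(1 / real (Suc n)) * (norm y)^2 <= 0" by simp
  thus ?thesis by (simp add: y_def divide_le_0_iff)
 qed
 hence "measure (smeas F x) {- real n..- (1 / real (Suc n))} = 0" for n by (simp add: smeas(2)[OF F(1)])
 hence "{- real n..- (1 / real (Suc n))} : null_sets (smeas F x)" for n
  using finite_measure.emeasure_eq_measure[OF smeas(1)[OF F(1)]] by (intro null_setsI) auto
 hence null: "(\<Union>n. {- real n..- (1 / real (Suc n))}) : null_sets (smeas F x)" by (rule null_sets_UN)
 have sub: "{..<0} <= (\<Union>n. {- real n..- (1 / real (Suc n))})"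
 proof
  fix t :: real assume "t : {..<0}"
  hence t: "t < 0" by simp
  obtain n where n: "inverse (real (Suc n)) < - t" using reals_Archimedean[of "- t"] t by auto
  obtain m where m: "- t < real m" using reals_Archimedean2 by blast
  have "inverse (real (Suc (max n m))) <= inverse (real (Suc n))" by (intro le_imp_inverse_le) auto
  moreover have "real m <= real (max n m)" by simp
  ultimately have "t : {- real (max n m)..- (1 / real (Suc (max n m)))}"
  using n m unfolding inverse_eq_divide atLeastAtMost_iff by linarith
  thus "t : (\<Union>n. {- real n..- (1 / real (Suc n))})" by blast
 qed
 have "{..<0} : null_sets (smeas F x)" by (rule null_sets_subset[OF null _ sub]) simp
 thus ?thesis by (simp add: measure_def null_setsD1)
qed

text \<open>The square determines the resolvent products, hence the image of each scalar measure
  under \<open>t -> t^2\<close>; positivity confines the measures to the half line, where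
  \<open>sqrt\<close> inverts this map.\<close>

lemma positive_sqrt_unique:
 assumes P: "op_positive P" "op_positive Q" and sq: "P O P = Q O Q"
 shows "P = Q"
proof -
 have sa: "op_sa P" "op_sa Q" using P by (auto simp: op_positive_def)
 obtain F G where F: "pvmeas F" "P = pvm_op F" and G: "pvmeas G" "Q = pvm_op G"
  using spectral_theorem[OF sa(1)] spectral_theorem[OF sa(2)] by blast
 have res_eq: "res P (- z) (res P z s) = res Q (- z) (res Q z s)" if z: "Im z ~= 0" for z s
 proof -
  let ?x = "res P (- z) (res P z s)"
  have "(?x, s + z^2 *c ?x) : P O P" unfolding square_resolvent[OF sa(1) z] by simp
  hence "?x = res Q (- z) (res Q z ((s + z^2 *c ?x) - z^2 *c ?x))"
  unfolding sq square_resolvent[OF sa(2) z] .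
  thus ?thesis by simp
 qed
 have resF: "cinner s (res P' (- z) (res P' z s)) = (\<integral>t. rz (z^2) (t^2) \<partial>smeas F' s)"
  if z: "Im z ~= 0" and F': "pvmeas F'" "P' = pvm_op F'" for z s P' and F' :: "real set => 'a => 'a"
 proof -
  have z': "Im (- z) ~= 0" using z by simp
  have "res P' (- z) (res P' z s) = fc F' (%t. rz (- z) t * rz z t) s"
  unfolding F'(2) res_pvm_op[OF F'(1) z] res_pvm_op[OF F'(1) z'] by (rule fc_mult[OF F'(1) bb_rz[OF z'] bb_rz[OF z]])
  hence "cinner s (res P' (- z) (res P' z s)) = (\<integral>t. rz (- z) t * rz z t \<partial>smeas F' s)"
  using fc(2)[OF F'(1) bb_mult[OF bb_rz[OF z'] bb_rz[OF z]]] by simp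
  also have "(%t. rz (- z) t * rz z t) = (%t. rz (z^2) (t^2))"
  by (simp add: rz_def power2_eq_square algebra_simps)
  finally show ?thesis .
 qed
 have "F = G"
 proof (rule pvm_op_inj[OF F(1) G(1)], rule arg_cong[where f = pvm_op], rule ext)
  fix B
  have meas: "measure (smeas F x) B = measure (smeas G x) B" if B: "B : sets borel" for x
  proof -
  have fin: "finite_measure (distr (smeas F' x) borel (%t. t^2))" if "pvmeas F'" for F' :: "real set => 'a => 'a"
  by (rule finite_measure.finite_measure_distr[OF smeas(1)[OF that]]) simp
  have D: "distr (smeas F x) borel (%t. t^2) = distr (smeas G x) borel (%t. t^2)"
  proof (rule stieltjes_unique[OF fin[OF F(1)] _ fin[OF G(1)]])
  fix w :: complex assume w: "Im w > 0"
  \<comment> \<open>A square root of a point in the upper half plane is not real, so both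
    \<open>z\<close> and \<open>- z\<close> are admissible.\<close>
  obtain z where z1: "z^2 = w" by (metis power2_csqrt)
  have z2: "Im z ~= 0" using w unfolding z1[symmetric] by (auto simp: power2_eq_square)
  have "(\<integral>t. rz w t \<partial>distr (smeas F x) borel (%t. t^2)) = cinner x (res P (- z) (res P z x))"
  unfolding resF[OF z2 F] z1 by (subst integral_distr) (auto simp: rz_def[abs_def])
  also have "... = (\<integral>t. rz w t \<partial>distr (smeas G x) borel (%t. t^2))"
  unfolding res_eq[OF z2] resF[OF z2 G] z1 by (subst integral_distr) (auto simp: rz_def[abs_def])
  finally show "(\<integral>t. rz w t \<partial>distr (smeas F x) borel (%t. t^2)) = (\<integral>t. rz w t \<partial>distr (smeas G x) borel (%t. t^2))" .
  qed auto
  let ?C = "sqrt -` B"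
  have C: "?C : sets borel" using measurable_sets[of sqrt borel borel B] B by simp
  have key: "measure (smeas F' x) B = measure (distr (smeas F' x) borel (%t. t^2)) ?C"
  if F': "pvmeas F'" and s: "measure (smeas F' x) {..<0} = 0" for F' :: "real set => 'a => 'a"
  proof -
  interpret finite_measure "smeas F' x" by (rule smeas[OF F'])
  have null: "AE t in smeas F' x. \<not> t < 0"
  by (rule AE_I[of _ _ "{..<0}"]) (use s in \<open>auto simp: emeasure_eq_measure\<close>)
  have sqb: "(%t::real. t^2) -` ?C : sets borel" using measurable_sets[of "%t::real. t^2" borel borel ?C] C by simp
  have "measure (smeas F' x) B = measure (smeas F' x) ((%t. t^2) -` ?C)"
  proof (rule finite_measure_eq_AE)
  show "AE t in smeas F' x. t : B <-> t : (%t. t^2) -` ?C"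
  using null by (rule AE_mp) (auto intro!: AE_I2 simp: abs_if)
  qed (use B sqb in auto)
  also have "... = measure (distr (smeas F' x) borel (%t. t^2)) ?C"
  by (subst measure_distr) (use C in auto)
  finally show ?thesis .
  qed
  show ?thesis
  using key[OF F(1) op_positive_support[OF P(1) F]] key[OF G(1) op_positive_support[OF P(2) G]] D by simp
  qed
  show "F B = G B"
  proof (cases "B : sets borel")
  case True
  have "norm (F B x) = norm (G B x)" for x
  using meas[OF True, of x] by (simp add: smeas(2)[OF F(1) True] smeas(2)[OF G(1) True] power2_eq_iff_nonneg)
  thus ?thesis by (intro proj_eqI pvm(1) F(1) G(1) True)
  qed (simp add: pvm(2)[OF F(1)] pvm(2)[OF G(1)])
 qed
 thus ?thesis using F G by simp
qed

context polar
begin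

lemma op_abs_eq: "op_abs T = P"
 unfolding op_abs_def
proof (rule the_equality)
 fix Q assume "op_positive Q & Q O Q = T O op_adj T"
 thus "Q = P" using positive_sqrt_unique[OF _ P_positive, of Q] P_square by simp
qed (rule conjI[OF P_positive P_square])

lemma spectral_abs: "spm (op_abs T) = A.G"
 unfolding op_abs_eq P_def by (rule spectral_measure_pvm_op[OF A.G_pvm])

lemma op_phase_eq: "op_phase T = U"
 unfolding op_phase_def
proof (rule the_equality)
 have "cadj U \<circ> U = (%b. b - A.G {0} b)"
 proof (rule ext)
  fix b
  have "(0, (cadj U \<circ> U) b) = W (W (0, b))" by (simp add: U_adj W_U)
  also have "... = (0, b) - E (abs -` {0}) (0, b)" unfolding W_sq by (simp add: vimage_def)
  also have "... = (0, b - A.G {0} b)" using A.comm[of "{0}" b] by (simp add: push_pvm_def prod_eq_iff)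
  finally show "(cadj U \<circ> U) b = b - A.G {0} b" by simp
 qed
 hence "projop (cadj U \<circ> U)" using proj_compl[OF pvm(1)[OF A.G_pvm, of "{0}"]] by simp
 thus "bcl U & projop (cadj U \<circ> U) & T = {(x, U y) |x y. (x, y) : op_abs T}
  & (ALL x. (U x = 0) = ((x, 0) : T))"
  using Ub(1) T_eq kernel by (simp add: op_abs_eq)
 fix V assume V: "bcl V & projop (cadj V \<circ> V) & T = {(x, V y) |x y. (x, y) : op_abs T}
  & (ALL x. (V x = 0) = ((x, 0) : T))"
 hence Vb: "bcl V" by blast
 \<comment> \<open>Both operators agree on the range of the absolute value because they produce the
   same \<open>T\<close>; a vector orthogonal to that range lies in the kernel, where both
   vanish.\<close>
 let ?K = "{v. V v = U v}"
 have K: "csubspace ?K"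
  unfolding csubspace_def using bcl_simps[OF Vb] bcl_simps[OF Ub(1)] by auto
 have clK: "closed ?K"
  unfolding closed_sequential_limits
 proof (intro allI impI)
  fix f l assume f: "(ALL n. f n : ?K) & f ~> l"
  hence "(%n. V (f n)) ~> V l" "(%n. V (f n)) ~> U l"
  using bcl_tendsto[OF Vb] bcl_tendsto[OF Ub(1)] by (blast, force)
  thus "l : ?K" using LIMSEQ_unique by blast
 qed
 have "v = 0" if v: "ALL x:?K. cinner v x = 0" for v
 proof -
  have "y : ?K" if "(x, y) : P" for x y
  proof -
  have "(x, V y) : T" using V that op_abs_eq by blast
  thus ?thesis using P_T[OF that] closed_dd_opD(5)[OF T] by blast
  qed
  hence "(v, 0) : op_adj P" using v by (auto simp: in_op_adj)
  hence "(v, 0) : P" using saD(2)[OF P_sa] by simp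
  hence "(v, 0) : T" using P_T[of v 0] bcl_zero[OF Ub(1)] by simp
  hence "V v = 0" "U v = 0" using V kernel by blast+
  hence "v : ?K" by simp
  hence "cinner v v = 0" using v by blast
  thus "v = 0" by (simp add: cinner_self)
 qed
 hence "closure ?K = UNIV" using dense_iff_orth[OF K] by blast
 thus "V = U" using clK by auto
qed

end

section \<open>Von Neumann algebras\<close>

text \<open>Affiliation speaks of unitaries of the commutant, so membership is phrased with
  unitaries too. In this form the property passes easily to \<open>M2 N\<close> and to
  \<open>Wstar T\<close>.\<close>

definition vna :: "('h::complex_hilbert_space => 'h) set => bool"
 where "vna N <-> (ALL a:N. bcl a & cadj a : N) &
  (ALL a. bcl a --> (ALL u:commutant N. unitary_op u --> (ALL x. u (a x) = a (u x))) --> a : N)"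

lemma in_commutant: "a : commutant X <-> bcl a & (ALL b:X. ALL x. a (b x) = b (a x))"
 by (auto simp: commutant_def fun_eq_iff)

lemma commutant_adj:
 assumes X: "!!b. b : X ==> bcl b & cadj b : X" and a: "a : commutant X"
 shows "cadj a : commutant X"
 unfolding in_commutant
proof (intro conjI ballI allI)
 have ab: "bcl a" using a by (simp add: in_commutant)
 thus "bcl (cadj a)" by (rule cadj)
 fix b x assume b: "b : X"
 hence bb: "bcl b" and b': "cadj b : X" using X by auto
 show "cadj a (b x) = b (cadj a x)"
 proof (rule cinner_ext)
  fix z
  have "cinner z (cadj a (b x)) = cinner (cadj b (a z)) x" by (simp add: cadj[OF ab] cadj[OF bb])
  also have "cadj b (a z) = a (cadj b z)" using a b' by (simp add: in_commutant)
  finally show "cinner z (cadj a (b x)) = cinner z (b (cadj a x))" by (simp add: cadj[OF ab] cadj[OF bb])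
 qed
qed

lemma unitary_opD:
 assumes "unitary_op u"
 shows "bcl u" "cadj u (u x) = x" "u (cadj u x) = x" "bcl (cadj u)" "unitary_op (cadj u)"
proof -
 show b: "bcl u" and 1: "cadj u (u x) = x" and 2: "u (cadj u x) = x" for x
  using assms unfolding unitary_op_def by (auto simp: fun_eq_iff)
 show c: "bcl (cadj u)" by (rule cadj(1)[OF b])
 show "unitary_op (cadj u)" unfolding unitary_op_def using b c 1 2 by (auto simp: fun_eq_iff)
qed

lemma vna_bcl: "vna N ==> a : N ==> bcl a"
 and vna_adj: "vna N ==> a : N ==> cadj a : N"
 by (auto simp: vna_def)

lemma vna_memI:
 assumes N: "vna N" and a: "bcl a"
  and u: "!!u x. u : commutant N ==> unitary_op u ==> cadj u : commutant N ==> u (a x) = a (u x)"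
 shows "a : N"
proof -
 have "cadj u : commutant N" if "u : commutant N" for u
  using commutant_adj[OF _ that] N unfolding vna_def by blast
 thus ?thesis using N a u unfolding vna_def by blast
qed

lemma commD: "u : commutant N ==> a : N ==> u (a x) = a (u x)"
 by (simp add: in_commutant)

lemma vna_alg:
 assumes N: "vna N"
 shows "id : N" "(%x. x) : N" "(%x. 0) : N" "(%x. c *c x) : N"
  "a : N ==> b : N ==> (%x. a x + b x) : N" "a : N ==> b : N ==> (%x. a x - b x) : N"
  "a : N ==> (%x. c *c a x) : N" "a : N ==> b : N ==> a \<circ> b : N" "a : N ==> b : N ==> (%x. a (b x)) : N"
  "a : N ==> (%x. x - a x) : N"
proof -
 note I = vna_memI[OF N] and bcl = vna_bcl[OF N] and U = bcl_simps[OF unitary_opD(1)]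
 show "id : N" by (rule I) simp_all
 show 1: "(%x. x) : N" by (rule I) simp_all
 show "(%x. 0) : N" by (rule I) (simp_all add: U)
 show "(%x. c *c x) : N" by (rule I) (simp_all add: U bcl_scaleC)
 show "(%x. a x + b x) : N" if "a : N" "b : N" for a b
 proof (rule I[OF bcl_plus[OF bcl[OF that(1)] bcl[OF that(2)]]])
  fix u x assume u: "u : commutant N" "unitary_op u"
  show "u (a x + b x) = a (u x) + b (u x)" by (simp add: U[OF u(2)] commD[OF u(1) that(1)] commD[OF u(1) that(2)])
 qed
 show d: "(%x. a x - b x) : N" if "a : N" "b : N" for a b
 proof (rule I[OF bcl_minusop[OF bcl[OF that(1)] bcl[OF that(2)]]])
  fix u x assume u: "u : commutant N" "unitary_op u"
  show "u (a x - b x) = a (u x) - b (u x)" by (simp add: U[OF u(2)] commD[OF u(1) that(1)] commD[OF u(1) that(2)])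
 qed
 show "(%x. c *c a x) : N" if "a : N" for a
 proof (rule I[OF bcl_scaleC[OF bcl[OF that]]])
  fix u x assume u: "u : commutant N" "unitary_op u"
  show "u (c *c a x) = c *c a (u x)" by (simp add: U[OF u(2)] commD[OF u(1) that])
 qed
 show c: "(%x. a (b x)) : N" if "a : N" "b : N" for a b
 proof (rule I[OF bcl_comp(2)[OF bcl[OF that(1)] bcl[OF that(2)]]])
  fix u x assume u: "u : commutant N" "unitary_op u"
  show "u (a (b x)) = a (b (u x))" by (simp add: U[OF u(2)] commD[OF u(1) that(1)] commD[OF u(1) that(2)])
 qed
 show "a \<circ> b : N" if "a : N" "b : N" for a b
  unfolding comp_def by (rule c[OF that])
 show "(%x. x - a x) : N" if "a : N" for a
  by (rule d[OF 1 that])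
qed

lemma vna_limit:
 assumes N: "vna N" and f: "!!n. f n : N" and l: "!!x. (%n. f n x) ~> a x" and a: "bcl a"
 shows "a : N"
proof (rule vna_memI[OF N a])
 fix u x assume u: "u : commutant N" "unitary_op u"
 have "(%n. u (f n x)) ~> u (a x)" by (rule bcl_tendsto[OF unitary_opD(1)[OF u(2)] l])
 moreover have "u (f n x) = f n (u x)" for n using u(1) f by (simp add: in_commutant)
 ultimately show "u (a x) = a (u x)" using l[of "u x"] LIMSEQ_unique by auto
qed

lemma op_graph_sa:
 assumes b: "bcl b" "cadj b = b"
 shows "op_sa (op_graph b)"
proof -
 have "op_adj (op_graph b) = op_graph b"
  unfolding op_graph_def
 proof (auto simp: in_op_adj)
  fix u v assume *: "ALL x. cinner u (b x) = cinner v x"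
  have "b u = v" by (rule cinner_ext_left) (metis * selfadj_swap[OF b])
  thus "v = b u" by simp
 next
  fix u x show "cinner u (b x) = cinner (b u) x" by (simp add: selfadj_swap[OF b])
 qed
 moreover have "Domain (op_graph b) = UNIV" by (auto simp: op_graph_def)
 moreover have "single_valued (op_graph b)" by (auto simp: op_graph_def single_valued_def)
 ultimately show ?thesis
  using op_adj_closed[of "op_graph b"] unfolding op_selfadjoint_def closed_dd_op_iff by simp
qed

text \<open>The Cayley transforms of its self-adjoint elements generate the commutant, so commuting with its
  unitaries is enough for membership in the bicommutant.\<close>

lemma vna_von_neumann:
 assumes N: "von_neumann_algebra N"
 shows "vna N"
proof -
 have NN: "commutant (commutant N) = N" and adj: "!!a. a : N ==> cadj a : N"
  using N by (auto simp: von_neumann_algebra_def)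
 have bcl: "bcl a" if "a : N" for a using that NN by (auto simp: commutant_def)
 have "a : N" if a: "bcl a" and u: "ALL u:commutant N. unitary_op u --> (ALL x. u (a x) = a (u x))" for a
 proof -
  have sa: "a (b x) = b (a x)" if b: "b : commutant N" "cadj b = b" for b x
  proof -
  have bb: "bcl b" using b by (simp add: in_commutant)
  define B where "B = op_graph b"
  have B: "op_sa B" unfolding B_def by (rule op_graph_sa[OF bb b(2)])
  have z: "Im \<i> ~= 0" "Im (- \<i>) ~= 0" by simp_all
  define R where "R = res B (- \<i>)"
  define R' where "R' = res B \<i>"
  have Rb: "bcl R" "bcl R'" unfolding R_def R'_def using res_bcl[OF B] z by auto
  have RR: "R x - R' x = - (2 * \<i>) *c R (R' x)" "R (R' x) = R' (R x)" for x
  using res_identity[OF B z(2,1), of x] res_comm[OF B z(2,1), of x] by (simp_all add: R_def R'_def)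
  \<comment> \<open>\<open>R\<close> is the inverse of \<open>b + i\<close>, so \<open>w\<close> is
    the Cayley transform \<open>(b - i) / (b + i)\<close> and \<open>w'\<close> its adjoint.\<close>
  define w where "w x = x - (2 * \<i>) *c R x" for x
  define w' where "w' x = x + (2 * \<i>) *c R' x" for x
  have wb: "bcl w" unfolding w_def by (intro bcl_intros Rb)
  have adjw: "cadj w = w'"
  proof (rule cadj_unique)
  show "cinner (w x) y = cinner x (w' y)" for x y
  using res_swap[OF B z(2), of x y] by (simp add: w_def w'_def R_def R'_def cinner_simps)
  qed
  have "w' (w x) = x" "w (w' x) = x" for x
  proof -
  let ?k = "2 * \<i>"
  have "R' x - R x = - (R x - R' x)" by simp
  also have "... = ?k *c R (R' x)" unfolding RR(1) scaleC.minus_left by simp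
  finally have "?k *c (R' x - R x) = ?k *c ?k *c R (R' x)" by simp
  hence e: "?k *c R' x - ?k *c R x - ?k *c ?k *c R (R' x) = 0"
  unfolding scaleC.diff_right by simp
  have "w' (w x) = x + (?k *c R' x - ?k *c R x - ?k *c ?k *c R (R' x))"
  unfolding w_def w'_def RR(2) bcl_diff[OF Rb(2)] bcl_scale[OF Rb(2)] scaleC.diff_right by simp
  thus "w' (w x) = x" unfolding e by simp
  have "w (w' x) = x + (?k *c R' x - ?k *c R x - ?k *c ?k *c R (R' x))"
  unfolding w_def w'_def bcl_add[OF Rb(1)] bcl_scale[OF Rb(1)] scaleC_add_right by simp
  thus "w (w' x) = x" unfolding e by simp
  qed
  hence wu: "unitary_op w" unfolding unitary_op_def adjw using wb by (auto simp: fun_eq_iff)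
  have "R (c x) = c (R x)" if c: "c : N" for c x
  proof -
  have "c (R x) = R (c x)" unfolding R_def
  by (rule res_commutes[OF B bcl[OF c] _ z(2)]) (use b(1) c in \<open>auto simp: B_def op_graph_def in_commutant\<close>)
  thus ?thesis by simp
  qed
  hence "w : commutant N" unfolding in_commutant w_def using wb bcl
  by (auto intro!: bcl_intros Rb simp: bcl_simps)
  hence "w (a x) = a (w x)" for x using u wu by blast
  hence "(2 * \<i>) *c R (a x) = (2 * \<i>) *c a (R x)" for x unfolding w_def by (simp add: bcl_simps[OF a])
  hence "(1 / (2 * \<i>)) *c (2 * \<i>) *c R (a x) = (1 / (2 * \<i>)) *c (2 * \<i>) *c a (R x)" for x by simp
  hence "a (R x) = R (a x)" for x by simp
  hence "(a x, a y) : B" if "(x, y) : B" for x y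
  using commutes_resD[OF B a _ z(2) that] unfolding R_def by blast
  thus ?thesis by (auto simp: B_def op_graph_def)
  qed
  have "a (c x) = c (a x)" if c: "c : commutant N" for c x
  proof -
  have cb: "bcl c" using c by (simp add: in_commutant)
  have c': "cadj c : commutant N" by (rule commutant_adj[OF _ c]) (use bcl adj in auto)
  define p where "p x = (1/2) *c (c x + cadj c x)" for x
  define q where "q x = (- \<i>/2) *c (c x - cadj c x)" for x
  have cc: "bcl (cadj c)" by (rule cadj(1)[OF cb])
  have "p : commutant N" "q : commutant N"
  using c c' bcl unfolding in_commutant p_def q_def by (auto intro!: bcl_intros simp: bcl_simps)
  moreover have "cadj p = p" "cadj q = q"
  by (rule cadj_unique, simp add: p_def q_def cadj[OF cb] cinner_simps algebra_simps)+
  ultimately have "a (p x) = p (a x)" "a (q x) = q (a x)" using sa by blast+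
  moreover have "c x = p x + \<i> *c q x" for x
  proof -
  have "p x + \<i> *c q x = (1/2 + 1/2) *c c x"
  unfolding scaleC_add_left by (simp add: p_def q_def scaleC_add_right scaleC.diff_right)
  thus ?thesis by simp
  qed
  ultimately show ?thesis by (simp add: bcl_simps[OF a])
  qed
  hence "a : commutant (commutant N)" using a by (simp add: in_commutant)
  thus ?thesis using NN by simp
 qed
 thus ?thesis unfolding vna_def using bcl adj by blast
qed

subsection \<open>Affiliated operators\<close>

lemma affiliatedD:
 assumes "A : affiliated N"
 shows "closed_dd_op A" "u : commutant N ==> unitary_op u ==> (x, y) : A ==> (u x, u y) : A"
 using assms unfolding affiliated_def by auto

lemma affiliatedI:
 assumes "closed_dd_op A" "!!u x y. u : commutant N ==> unitary_op u ==> (x, y) : A ==> (u x, u y) : A"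
 shows "A : affiliated N"
 using assms unfolding affiliated_def by auto

lemma affiliated_adj:
 assumes N: "vna N" and A: "A : affiliated N"
 shows "op_adj A : affiliated N"
proof (rule affiliatedI[OF closed_dd_op_adj[OF affiliatedD(1)[OF A]]])
 fix u x y assume u: "u : commutant N" "unitary_op u" and xy: "(x, y) : op_adj A"
 have u': "cadj u : commutant N" using commutant_adj[OF _ u(1)] N unfolding vna_def by blast
 note U = unitary_opD[OF u(2)]
 show "(u x, u y) : op_adj A"
  unfolding in_op_adj[of "u x"]
 proof (intro allI impI)
  fix a b assume "(a, b) : A"
  hence "(cadj u a, cadj u b) : A" using affiliatedD(2)[OF A u' U(5)] by blast
  thus "cinner (u x) b = cinner (u y) a" using xy by (simp add: in_op_adj cadj[OF U(1)])
 qed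
qed

lemma fc_in_vna:
 assumes N: "vna N" and A: "A : affiliated N" "op_sa A" and f: "bb f"
 shows "fc (spm A) f : N"
proof (rule vna_memI[OF N fc(1)[OF spectral_theorem(1)[OF A(2)] f]])
 fix u x assume u: "u : commutant N" "unitary_op u"
 note ub = unitary_opD(1)[OF u(2)]
 show "u (fc (spm A) f x) = fc (spm A) f (u x)"
  by (rule fc_commute[OF spectral_theorem(1)[OF A(2)] ub spectral_theorem(3)[OF A(2) ub] f])
  (rule affiliatedD(2)[OF A(1) u])
qed

lemma spectral_in_vna:
 assumes "vna N" "A : affiliated N" "op_sa A" "B : sets borel"
 shows "spm A B : N"
 using fc_in_vna[OF assms(1-3) bb_indicator[OF assms(4)]]
 unfolding fc_ind[OF spectral_theorem(1)[OF assms(3)] assms(4)] .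

lemma res_in_vna:
 assumes "vna N" "A : affiliated N" "op_sa A" "Im z ~= 0"
 shows "res A z : N"
 using fc_in_vna[OF assms(1-3) bb_rz[OF assms(4)]] unfolding res_fc[OF assms(3,4), symmetric] .

lemma op_graph_closed_dd: "bcl a ==> closed_dd_op (op_graph a)"
proof -
 assume a: "bcl a"
 have "closed (op_graph a)"
  unfolding closed_sequential_limits
 proof (intro allI impI, elim conjE)
  fix f l assume f: "ALL n. f n : op_graph a" "f ~> l"
  have "(%n. snd (f n)) ~> a (fst l)"
  using bcl_tendsto[OF a tendsto_fst[OF f(2)]] f(1) by (auto simp: op_graph_def elim!: back_subst[of "%g. g ~> _"])
  (metis fst_conv snd_conv)
  hence "snd l = a (fst l)" using tendsto_snd[OF f(2)] LIMSEQ_unique by blast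
  thus "l : op_graph a" by (auto simp: op_graph_def prod_eq_iff)
 qed
 thus ?thesis
  unfolding closed_dd_op_def using bcl_simps[OF a]
  by (auto simp: single_valued_def op_graph_def Domain_iff set_eq_iff intro: subsetD[OF closure_subset])
qed

lemma op_graph_affiliated: "vna N ==> a : N ==> op_graph a : affiliated N"
 by (rule affiliatedI[OF op_graph_closed_dd[OF vna_bcl]]) (auto simp: op_graph_def intro: commD)

lemma bounded_affiliated: assumes "vna N" "bcl a" "op_graph a : affiliated N" shows "a : N"
 using affiliatedD(2)[OF assms(3)] by (intro vna_memI assms) (auto simp: op_graph_def)

section \<open>Two-by-two matrix algebras and their affiliated operators\<close>

definition M2 :: "('h::complex_hilbert_space => 'h) set => ('h \<times> 'h => 'h \<times> 'h) set"
 where "M2 N = {X. bcl X & (%a. fst (X (a, 0))) : N & (%a. fst (X (0, a))) : N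
  & (%a. snd (X (a, 0))) : N & (%a. snd (X (0, a))) : N}"

lemma split_pair: "bcl X ==> X (a, b) = X (a, 0) + X (0, b)"
 using bcl_add[of X "(a, 0)" "(0, b)"] by simp

lemma bcl_entries:
 assumes X: "bcl X"
 shows "bcl (%a. fst (X (a, 0)))" "bcl (%a. fst (X (0, a)))"
  "bcl (%a. snd (X (a, 0)))" "bcl (%a. snd (X (0, a)))"
 by (intro bcl_comp(2)[OF bcl_fst] bcl_comp(2)[OF bcl_snd] bcl_comp(2)[OF X] bcl_Pair bcl_intros)+

lemma bcl_diag: "bcl u ==> bcl (%p. (u (fst p), u (snd p)))"
 by (rule bcl_Pair[OF bcl_comp(2)[OF _ bcl_fst] bcl_comp(2)[OF _ bcl_snd]])

text \<open>Commuting with the projection onto the first summand makes \<open>w\<close> map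
  \<open>(a, 0)\<close> into the first summand; commuting with the exchange of summands makes it act
  in the same way on the second.\<close>

lemma M2_commutant:
 assumes N: "vna N" and w: "w : commutant (M2 N)" "unitary_op w"
 obtains u where "u : commutant N" "unitary_op u" "!!a b. w (a, b) = (u a, u b)"
proof -
 note W = unitary_opD[OF w(2)] and alg = vna_alg[OF N]
 have M2I: "(%p. (c (fst p), d (snd p))) : M2 N" "(%p. (c (snd p), d (fst p))) : M2 N"
  if cd: "c : N" "d : N" for c d
 proof -
  note cb = vna_bcl[OF N cd(1)] and db = vna_bcl[OF N cd(2)]
  show "(%p. (c (fst p), d (snd p))) : M2 N" "(%p. (c (snd p), d (fst p))) : M2 N"
  using cd alg(3) unfolding M2_def
  by (auto simp: bcl_zero[OF cb] bcl_zero[OF db] intro!: bcl_Pair bcl_comp(2)[OF cb bcl_fst]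
  bcl_comp(2)[OF cb bcl_snd] bcl_comp(2)[OF db bcl_fst] bcl_comp(2)[OF db bcl_snd])
 qed
 have comm: "w (X p) = X (w p)" if "X : M2 N" for X p by (rule commD[OF w(1) that])
 define u where "u a = fst (w (a, 0))" for a
 have w1: "w (a, 0) = (u a, 0)" for a
  using comm[OF M2I(1)[OF alg(2) alg(3)], of "(a, 0)"] by (simp add: u_def prod_eq_iff)
 have w2: "w (0, b) = (0, u b)" for b
  using comm[OF M2I(2)[OF alg(2) alg(2)], of "(b, 0)"] by (simp add: w1)
 have wu: "w (a, b) = (u a, u b)" for a b using split_pair[OF W(1), of a b] by (simp add: w1 w2)
 have ub: "bcl u" unfolding u_def using bcl_entries(1)[OF W(1)] .
 have "u : commutant N"
  unfolding in_commutant
 proof (intro conjI ballI allI ub)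
  fix c x assume "c : N"
  thus "u (c x) = c (u x)" using comm[OF M2I(1)[OF _ alg(3)], of c "(x, 0)"] by (simp add: w1)
 qed
 moreover have "unitary_op u"
 proof -
  have c: "cinner (u x) y = cinner x (fst (cadj w (y, 0)))" for x y
  using cadj(2)[OF W(1), of "(x, 0)" "(y, 0)"] by (simp add: w1 cinner_prod_def)
  have adj: "cadj u = (%y. fst (cadj w (y, 0)))" by (rule cadj_unique) (rule c)
  have 1: "cadj u (u x) = x" for x unfolding adj using W(2)[of "(x, 0)"] by (simp add: w1)
  have 2: "u (cadj u y) = y" for y
  proof -
  have "u (fst (cadj w (y, 0))) = y"
  using W(3)[of "(y, 0)"] wu[of "fst (cadj w (y, 0))" "snd (cadj w (y, 0))"] by simp
  thus ?thesis using 1[of "fst (cadj w (y, 0))"] by simp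
  qed
  show ?thesis unfolding unitary_op_def using ub 1 2 by (auto simp: fun_eq_iff)
 qed
 ultimately show ?thesis using that wu by blast
qed

lemma M2_diag_commutant:
 assumes u: "u : commutant N" "unitary_op u"
 shows "(%p. (u (fst p), u (snd p))) : commutant (M2 N)" "unitary_op (%p. (u (fst p), u (snd p)))"
proof -
 note U = unitary_opD[OF u(2)]
 have adj: "cadj (%p. (u (fst p), u (snd p))) = (%p. (cadj u (fst p), cadj u (snd p)))"
  by (rule cadj_unique) (simp add: cinner_prod_def cadj[OF U(1)])
 show "unitary_op (%p. (u (fst p), u (snd p)))"
  unfolding unitary_op_def adj using U bcl_diag[OF U(1)] by (auto simp: fun_eq_iff)
 have "(u (fst (X p)), u (snd (X p))) = X (u (fst p), u (snd p))" if X: "X : M2 N" for X p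
 proof -
  have Xb: "bcl X" using X by (simp add: M2_def)
  have e: "u (fst (X (a, 0))) = fst (X (u a, 0))" "u (fst (X (0, a))) = fst (X (0, u a))"
  "u (snd (X (a, 0))) = snd (X (u a, 0))" "u (snd (X (0, a))) = snd (X (0, u a))" for a
  using X u(1) unfolding M2_def in_commutant by auto
  show ?thesis
  using split_pair[OF Xb, of "fst p" "snd p"] split_pair[OF Xb, of "u (fst p)" "u (snd p)"]
  by (simp add: bcl_simps[OF U(1)] e prod_eq_iff)
 qed
 thus "(%p. (u (fst p), u (snd p))) : commutant (M2 N)"
  unfolding in_commutant using bcl_diag[OF U(1)] by auto
qed

lemma cadj_entries:
 assumes X: "bcl X"
 shows "cadj (%a. fst (X (a, 0))) = (%a. fst (cadj X (a, 0)))" "cadj (%a. fst (X (0, a))) = (%a. snd (cadj X (a, 0)))"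
  "cadj (%a. snd (X (a, 0))) = (%a. fst (cadj X (0, a)))" "cadj (%a. snd (X (0, a))) = (%a. snd (cadj X (0, a)))"
proof -
 have c: "cinner (X p) q = cinner p (cadj X q)" for p q by (rule cadj(2)[OF X])
 show "cadj (%a. fst (X (a, 0))) = (%a. fst (cadj X (a, 0)))"
  by (rule cadj_unique) (use c[of "(_, 0)" "(_, 0)"] in \<open>simp add: cinner_prod_def\<close>)
 show "cadj (%a. fst (X (0, a))) = (%a. snd (cadj X (a, 0)))"
  by (rule cadj_unique) (use c[of "(0, _)" "(_, 0)"] in \<open>simp add: cinner_prod_def\<close>)
 show "cadj (%a. snd (X (a, 0))) = (%a. fst (cadj X (0, a)))"
  by (rule cadj_unique) (use c[of "(_, 0)" "(0, _)"] in \<open>simp add: cinner_prod_def\<close>)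
 show "cadj (%a. snd (X (0, a))) = (%a. snd (cadj X (0, a)))"
  by (rule cadj_unique) (use c[of "(0, _)" "(0, _)"] in \<open>simp add: cinner_prod_def\<close>)
qed

lemma vna_M2:
 assumes N: "vna N" shows "vna (M2 N)"
 unfolding vna_def
proof (intro conjI ballI allI impI)
 fix X assume X: "X : M2 N"
 thus Xb: "bcl X" by (simp add: M2_def)
 show "cadj X : M2 N"
  using X vna_adj[OF N] cadj(1)[OF Xb] unfolding M2_def mem_Collect_eq cadj_entries[OF Xb, symmetric] by blast
next
 fix X assume Xb: "bcl X" and c: "ALL w:commutant (M2 N). unitary_op w --> (ALL p. w (X p) = X (w p))"
 have "(u (fst (X p)), u (snd (X p))) = X (u (fst p), u (snd p))" if "u : commutant N" "unitary_op u" for u p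
  using bspec[OF c M2_diag_commutant(1)[OF that]] M2_diag_commutant(2)[OF that] by blast
 hence e: "u (fst (X (a, b))) = fst (X (u a, u b))" "u (snd (X (a, b))) = snd (X (u a, u b))"
  if "u : commutant N" "unitary_op u" for u a b
  using that by (metis fst_conv snd_conv)+
 have u0: "u 0 = 0" if "unitary_op u" for u :: "'a => 'a" using bcl_zero[OF unitary_opD(1)[OF that]] .
 show "X : M2 N"
  unfolding M2_def mem_Collect_eq
  by (intro conjI Xb vna_memI[OF N] bcl_entries[OF Xb]) (simp_all add: e u0)
qed

lemma hat_affiliated:
 assumes N: "vna N" and T: "T : affiliated N"
 shows "hat T : affiliated (M2 N)"
proof (rule affiliatedI)
 show "closed_dd_op (hat T)" using hat_sa[OF affiliatedD(1)[OF T]] saD(1) by blast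
 fix w x y assume w: "w : commutant (M2 N)" "unitary_op w" and xy: "(x, y) : hat T"
 obtain u where u: "u : commutant N" "unitary_op u" "!!a b. w (a, b) = (u a, u b)"
  using M2_commutant[OF N w] by blast
 obtain a b c d where "x = (a, b)" "y = (c, d)" "(b, c) : T" "(a, d) : op_adj T" using xy unfolding hat_def by blast
 thus "(w x, w y) : hat T"
  using affiliatedD(2)[OF T u(1,2)] affiliatedD(2)[OF affiliated_adj[OF N T] u(1,2)] by (simp add: u(3))
qed

text \<open>Phase and spectral projections are corners of functions of \<open>hat T\<close>, which
  is affiliated with \<open>M2 N\<close>.\<close>

lemma phase_abs_in_vna:
 assumes N: "vna N" and aff: "T : affiliated N"
 shows "op_phase T : N" "cadj (op_phase T) : N" "B : sets borel ==> spm (op_abs T) B : N"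
proof -
 interpret polar T by unfold_locales (rule affiliatedD(1)[OF aff])
 have fcM: "fc E f : M2 N" if "bb f" for f
  unfolding E_def by (rule fc_in_vna[OF vna_M2[OF N] hat_affiliated[OF N aff] hat_sa[OF T] that])
 show p: "op_phase T : N" using fcM[OF bb_sg] unfolding op_phase_eq U_def[abs_def] W_def M2_def by simp
 show "cadj (op_phase T) : N" by (rule vna_adj[OF N p])
 show "spm (op_abs T) B : N" if B: "B : sets borel"
 proof -
  have aB: "abs -` B : sets borel" using measurable_sets[of abs borel borel B] B by simp
  have "E (abs -` B) : M2 N" using fcM[OF bb_indicator[OF aB]] unfolding fc_ind[OF E aB] .
  thus ?thesis unfolding spectral_abs push_pvm_def M2_def using B by simp
 qed
qed

section \<open>The von Neumann algebra generated by an affiliated operator\<close>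

lemma Wstar_subset:
 assumes N: "von_neumann_algebra N" and T: "T : affiliated N"
 shows "Wstar T <= N"
 unfolding Wstar_def vn_generated_def using phase_abs_in_vna[OF vna_von_neumann[OF N] T] N by blast

lemma Wstar_gen: "op_phase T : Wstar T" "B : sets borel ==> spm (op_abs T) B : Wstar T"
 unfolding Wstar_def vn_generated_def by blast+

text \<open>Every algebra \<open>N'\<close> in the intersection has its commutant inside the
  commutant of \<open>Wstar T\<close>, so the unitary criterion can be applied in each
  \<open>N'\<close> separately.\<close>

lemma vna_Wstar:
 assumes N: "von_neumann_algebra N" and T: "T : affiliated N"
 shows "vna (Wstar T)"
 unfolding vna_def
proof (intro conjI ballI allI impI)
 fix a assume a: "a : Wstar T"
 thus "bcl a" using Wstar_subset[OF assms] vna_bcl[OF vna_von_neumann[OF N]] by blast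
 show "cadj a : Wstar T" using a unfolding Wstar_def vn_generated_def von_neumann_algebra_def by blast
next
 fix a assume a: "bcl a" "ALL u:commutant (Wstar T). unitary_op u --> (ALL x. u (a x) = a (u x))"
 have "a : N'" if N': "von_neumann_algebra N'" "{op_phase T} Un spm (op_abs T) ` sets borel <= N'" for N'
 proof -
  have "Wstar T <= N'" using N' unfolding Wstar_def vn_generated_def by blast
  hence "commutant N' <= commutant (Wstar T)" by (auto simp: in_commutant subset_iff)
  thus ?thesis using a vna_von_neumann[OF N'(1)] unfolding vna_def by blast
 qed
 thus "a : Wstar T" unfolding Wstar_def vn_generated_def by blast
qed

lemma affiliated_Wstar:
 assumes T: "closed_dd_op T"
 shows "T : affiliated (Wstar T)"
proof (rule affiliatedI[OF T])
 interpret polar T by unfold_locales (rule T)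
 fix u x c assume u: "u : commutant (Wstar T)" "unitary_op u" and xc: "(x, c) : T"
 note ub = unitary_opD(1)[OF u(2)]
 have "u (op_phase T x) = op_phase T (u x)" for x using u(1) Wstar_gen(1) unfolding in_commutant by blast
 hence uU: "u (U x) = U (u x)" for x unfolding op_phase_eq .
 have uG: "u (A.G B x) = A.G B (u x)" if "B : sets borel" for B x
  using u(1) Wstar_gen(2)[OF that, of T] unfolding in_commutant spectral_abs by blast
 obtain y where y: "(x, y) : P" "c = U y" using xc T_eq by blast
 have "(u x, u y) : P"
  using y(1) uG[OF ivl_borel] fc_commute[OF A.G_pvm ub uG bb_tr] unfolding P_def pvm_op_def by auto metis
 thus "(u x, u c) : T" using P_T y(2) uU by metis
qed

section \<open>Finite traces\<close>

text \<open>Turns a norm inequality into an inequality between \<open>cadj d d\<close> and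
  \<open>cadj a a\<close>, to which a trace can be applied.\<close>

lemma posop_sq_diff:
 assumes a: "bcl a" and d: "bcl d" and le: "!!x. norm (d x) <= C * norm (a x)"
 shows "posop (%x. cr (C^2) *c cadj a (a x) - cadj d (d x))"
proof (rule posopI)
 show "bcl (%x. cr (C^2) *c cadj a (a x) - cadj d (d x))"
  by (intro bcl_intros bcl_comp(2)[OF cadj(1)[OF a] a] bcl_comp(2)[OF cadj(1)[OF d] d])
 show "cinner (cr (C^2) *c cadj a (a x) - cadj d (d x)) y
  = cinner x (cr (C^2) *c cadj a (a y) - cadj d (d y))" for x y
  by (simp add: cinner_simps cadj(2)[OF a, symmetric] cadj(3)[OF a] cadj(2)[OF d, symmetric] cadj(3)[OF d])
 have "(norm (d x))^2 <= C^2 * (norm (a x))^2" for x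
  using power_mono[OF le norm_ge_zero, of x 2] by (simp add: power_mult_distrib)
 thus "0 <= Re (cinner x (cr (C^2) *c cadj a (a x) - cadj d (d x)))" for x
  by (simp add: cinner_simps cadj(2)[OF a, symmetric] cadj(2)[OF d, symmetric] cinner_self del: of_real_power)
qed

text \<open>A weakening of \<^const>\<open>tracial_vna\<close> that passes to two-by-two matrices; normality is only
  needed along increasing sequences.\<close>

locale fin_vna =
 fixes M :: "('h::complex_hilbert_space => 'h) set" and tr :: "('h => 'h) => complex"
 assumes vna: "vna M"
  and tr_add: "a : M ==> b : M ==> tr (%x. a x + b x) = tr a + tr b"
  and tr_scale: "a : M ==> tr (%x. c *c a x) = c * tr a"
  and tr_posop: "a : M ==> posop a ==> tr a : \<real>\<^sub>\<ge>\<^sub>0"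
  and tr_id: "tr (%x. x) = 1"
  and faithful: "a : M ==> tr (%x. cadj a (a x)) = 0 ==> a = (%_. 0)"
  and tracial: "a : M ==> b : M ==> tr (%x. a (b x)) = tr (%x. b (a x))"
  and normal: "(!!n. f n : M) ==> (!!n. posop (f n)) ==> (!!n. posop (%x. f (Suc n) x - f n x)) ==>
  (!!x. (%n. f n x) ~> a x) ==> a : M ==> (%n. tr (f n)) ~> tr a"
begin

lemmas alg = vna_alg[OF vna]
lemmas alg_intros = alg(2-7) alg(10)
lemmas bcl = vna_bcl[OF vna]
lemmas adj = vna_adj[OF vna]

lemma tr_diff: "a : M ==> b : M ==> tr (%x. a x - b x) = tr a - tr b"
 using tr_add[of a "%x. (-1) *c b x"] tr_scale[of b "-1"] alg(7)[of b "-1"] by simp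

lemma tr_const: "tr (%x. c *c x) = c" and tr_zero: "tr (%x. 0) = 0"
 using tr_scale[OF alg(2), of c] tr_scale[OF alg(2), of 0] by (simp_all add: tr_id)

lemma tr_compl: "a : M ==> tr (%x. x - a x) = 1 - tr a"
 using tr_diff[OF alg(2)] by (simp add: tr_id)

lemma tr_mono: "a : M ==> b : M ==> posop (%x. b x - a x) ==> Re (tr a) <= Re (tr b)"
 using tr_posop[OF alg(6)[of b a]] by (simp add: tr_diff complex_nonneg_Reals_iff)

lemma posop_adj_comp: "bcl a ==> posop (%x. cadj a (a x))"
 using bcl_comp(2)[OF cadj(1)] by (auto simp: posop_def cadj(2)[symmetric] cinner_self)

lemma tr_adj_comp: "a : M ==> tr (%x. cadj a (a x)) : \<real>\<^sub>\<ge>\<^sub>0"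
 using tr_posop[OF alg(9)[OF adj]] posop_adj_comp bcl by blast

lemma tr_shift:
 assumes a: "a : M"
 shows "tr (%x. cadj (%x. a x + k *c x) (a x + k *c x))
  = tr (%x. cadj a (a x)) + k * tr (cadj a) + cnj k * tr a + cnj k * k"
proof -
 note A = bcl[OF a] and A' = bcl[OF adj[OF a]]
 have c: "cadj (%x. a x + k *c x) = (%x. cadj a x + cnj k *c x)"
  by (rule cadj_unique) (simp add: cadj[OF A] cinner_simps)
 have "(%x. cadj (%x. a x + k *c x) (a x + k *c x))
  = (%x. (cadj a (a x) + k *c cadj a x) + (cnj k *c a x + (cnj k * k) *c x))"
  unfolding c by (simp add: bcl_simps[OF A'] scaleC_add_right)
 thus ?thesis
  using a adj[OF a] by (simp add: tr_add tr_scale tr_const alg)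
qed

text \<open>The trace of the square of \<open>a + k\<close> is real; the choices
  \<open>k = 1\<close> and \<open>k = i\<close> give the two real equations.\<close>

lemma tr_adj: assumes a: "a : M" shows "tr (cadj a) = cnj (tr a)"
proof -
 have r: "Im (k * tr (cadj a) + cnj k * tr a) = 0" for k
 proof -
  have "tr (%x. cadj (%x. a x + k *c x) (a x + k *c x)) : \<real>\<^sub>\<ge>\<^sub>0"
  by (rule tr_adj_comp) (intro alg_intros a)
  hence "Im (tr (%x. cadj a (a x)) + k * tr (cadj a) + cnj k * tr a + cnj k * k) = 0"
  unfolding tr_shift[OF a] by (simp add: complex_nonneg_Reals_iff)
  moreover have "Im (tr (%x. cadj a (a x))) = 0" using tr_adj_comp[OF a] by (simp add: complex_nonneg_Reals_iff)
  ultimately show ?thesis by simp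
 qed
 show ?thesis using r[of 1] r[of \<i>] by (simp add: complex_eq_iff)
qed

text \<open>The shift \<open>k = - tr a\<close> centers \<open>a\<close>: the claim is that a
  variance is nonnegative.\<close>

lemma tr_sq_le: assumes a: "a : M" shows "(cmod (tr a))^2 <= Re (tr (%x. cadj a (a x)))"
proof -
 let ?k = "- tr a"
 have "tr (%x. cadj (%x. a x + ?k *c x) (a x + ?k *c x)) : \<real>\<^sub>\<ge>\<^sub>0"
  by (rule tr_adj_comp) (intro alg_intros a)
 hence "0 <= Re (tr (%x. cadj a (a x)) + ?k * cnj (tr a) + cnj ?k * tr a + cnj ?k * ?k)"
  unfolding tr_shift[OF a] tr_adj[OF a] by (simp add: complex_nonneg_Reals_iff)
 moreover have "?k * cnj (tr a) + cnj ?k * tr a + cnj ?k * ?k = - cr ((cmod (tr a))^2)"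
  using cnj_mult_self[of "tr a"] by (simp add: mult.commute)
 ultimately show ?thesis by (simp only: add.assoc) (simp del: of_real_power add: cmod_power2)
qed

lemma tr_bound:
 assumes a: "a : M" and C: "!!x. norm (a x) <= C * norm x" "C >= 0"
 shows "cmod (tr a) <= C"
proof (rule power2_le_imp_le[OF _ C(2)])
 note A = bcl[OF a]
 have "Re (tr (%x. cadj a (a x))) <= Re (tr (%x. cr (C^2) *c x))"
  using posop_sq_diff[OF bcl_id(2) A C(1)] by (intro tr_mono alg_intros alg(9)[OF adj[OF a] a]) simp
 thus "(cmod (tr a))^2 <= C^2" using tr_sq_le[OF a] by (simp add: tr_const del: of_real_power)
qed

lemma posop_proj: "projop p ==> posop p"
 by (rule posopI) (simp_all only: projD(1,4,5), simp)

lemma tr_proj: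
 assumes p: "p : M" "projop p"
 shows "0 <= Re (tr p)" "Im (tr p) = 0" "Re (tr p) <= 0 ==> p x = 0"
proof -
 have nn: "tr p : \<real>\<^sub>\<ge>\<^sub>0" by (rule tr_posop[OF p(1) posop_proj[OF p(2)]])
 thus "0 <= Re (tr p)" "Im (tr p) = 0" by (simp_all add: complex_nonneg_Reals_iff)
 assume "Re (tr p) <= 0"
 hence "tr p = 0" using nn by (simp add: complex_nonneg_Reals_iff complex_eq_iff)
 moreover have "(%x. cadj p (p x)) = p" using projD(2,3)[OF p(2)] by (simp add: fun_eq_iff)
 ultimately have "p = (%_. 0)" using faithful[OF p(1)] by simp
 thus "p x = 0" by simp
qed

text \<open>Source and range projections of an element of \<open>M\<close>; by the polar decomposition they have equal trace.\<close>

lemma support_range: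
 assumes a: "a : M"
 obtains s f where "s : M" "f : M" "projop s" "projop f" "tr s = tr f"
  "!!x. s x = 0 <-> a x = 0" "!!c. f c = 0 <-> cadj a c = 0"
proof -
 note A = bcl[OF a]
 have adjA: "op_adj (op_graph a) = op_graph (cadj a)"
 proof (rule set_eqI, clarify)
  fix u v
  have "(u, v) : op_adj (op_graph a) <-> (ALL x. cinner u (a x) = cinner v x)"
  unfolding in_op_adj by (auto simp: op_graph_def)
  also have "... <-> cadj a u = v"
  using cadj(3)[OF A, of u] cinner_ext_left[of "cadj a u" v] by auto
  finally show "(u, v) : op_adj (op_graph a) <-> (u, v) : op_graph (cadj a)" by (auto simp: op_graph_def)
 qed
 note aff = op_graph_affiliated[OF vna a]
 have dd: "closed_dd_op (op_graph a)" by (rule op_graph_closed_dd[OF A])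
 interpret polar "op_graph a" by unfold_locales (rule dd)
 have U: "U : M" "U' : M"
  using phase_abs_in_vna(1,2)[OF vna aff] unfolding op_phase_eq U_adj by auto
 have E0: "projop (E {0})" by (rule pvm(1)[OF E]) simp
 have UU: "(0, U' (U x)) = (0, x) - E {0} (0, x)" "(U (U' x), 0) = (x, 0) - E {0} (x, 0)" for x
  using W_sq[of "(0, x)"] W_sq[of "(x, 0)"] by (simp_all add: W_U)
 have PI: "U (U' (U x)) = U x" "U' (U (U' x)) = U' x" for x
 proof -
  have "W (E {0} v) = 0" for v
  proof -
  have "(%t. sgx t * indicator {0} t) = (%t. 0)" by (auto simp: fun_eq_iff sgx_def indicator_def)
  thus ?thesis unfolding W_def fc_ind[OF E, of "{0}", simplified, symmetric] fc_mult[OF E bb_sg bb_indicator, of "{0}", simplified]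
  by (simp add: fc_const[OF E])
  qed
  hence WW: "W (W (W v)) = W v" for v by (simp add: W_sq bcl_simps[OF Wb])
  show "U (U' (U x)) = U x" "U' (U (U' x)) = U' x"
  using WW[of "(0, x)"] WW[of "(x, 0)"] by (simp_all add: W_U)
 qed
 have UUadj: "cinner (U x) y = cinner x (U' y)" "cinner (U' x) y = cinner x (U y)" for x y
  using cadj(2,3)[OF Ub(1)] unfolding U_adj by auto
 show thesis
 proof (rule that[of "%x. U' (U x)" "%x. U (U' x)"])
  show "(%x. U' (U x)) : M" "(%x. U (U' x)) : M" by (rule alg(9)[OF U(2,1)] alg(9)[OF U])+
  show "projop (%x. U' (U x))"
  by (rule projI) (simp_all add: bcl_comp(2)[OF Ub(2,1)] PI UUadj)
  show "projop (%x. U (U' x))"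
  by (rule projI) (simp_all add: bcl_comp(2)[OF Ub(1,2)] PI UUadj)
  show "tr (%x. U' (U x)) = tr (%x. U (U' x))" by (rule tracial[OF U(2,1)])
  have "U' (U x) = 0 <-> U x = 0" for x using PI(1)[of x] bcl_zero[OF Ub(1)] bcl_zero[OF Ub(2)] by auto
  thus "U' (U x) = 0 <-> a x = 0" for x using kernel[of x] by (auto simp: op_graph_def)
  have "U (U' x) = 0 <-> U' x = 0" for x using PI(2)[of x] bcl_zero[OF Ub(1)] bcl_zero[OF Ub(2)] by auto
  thus "U (U' c) = 0 <-> cadj a c = 0" for c using kernel'[of c] unfolding adjA by (auto simp: op_graph_def)
 qed
qed

lemma tr_one_proj:
 assumes "p : M" "projop p" "tr p = 1" shows "p x = x"
 using tr_proj(3)[OF alg(10)[OF assms(1)] proj_compl[OF assms(2)], of x] assms by (simp add: tr_compl)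

text \<open>Vanishing on the range of \<open>q\<close> makes \<open>f\<close> orthogonal to
  \<open>q\<close>, so \<open>(1 - q) - f\<close> is again a projection.\<close>

lemma proj_kernel_le:
 assumes f: "projop f" and q: "projop q" and z: "!!x. q x = x ==> f x = 0"
 shows "f (x - q x) = f x" "posop (%x. (x - q x) - f x)"
proof -
 note F = projD[OF f] and Q = projD[OF q]
 show fq: "f (x - q x) = f x" for x using z[of "q x"] by (simp add: bcl_diff[OF F(1)] Q(2))
 have "projop (%x. (x - q x) - f x)"
 proof (rule projI)
  have qf: "q (f x) = 0" for x
  by (rule cinner_ext) (metis F(4) Q(4) Q(2) z cinner.zero_left cinner.zero_right)
  show "bcl (%x. (x - q x) - f x)" by (intro bcl_intros F(1) Q(1))
  show "((x - q x) - f x) - q ((x - q x) - f x) - f ((x - q x) - f x) = (x - q x) - f x" for x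
  using fq[of x] by (simp add: bcl_diff[OF F(1)] bcl_diff[OF Q(1)] F(2) Q(2) qf)
  show "cinner ((x - q x) - f x) y = cinner x ((y - q y) - f y)" for x y
  by (simp add: cinner_simps F(4) Q(4))
 qed
 thus "posop (%x. (x - q x) - f x)" by (rule posop_proj)
qed

text \<open>The meet is \<open>p - s\<close> with \<open>s\<close> the support projection of
  \<open>a = (1 - q) p\<close>. The range projection of \<open>a\<close> modulo notation is
  \<open>f\<close>, has the same trace as \<open>s\<close>, and lies below \<open>1 - q\<close>;
  this bounds the trace of the complement.\<close>

lemma proj_meet:
 assumes p: "p : M" "projop p" and q: "q : M" "projop q"
 obtains r where "r : M" "projop r" "!!x. r x = x <-> p x = x & q x = x"
  "Re (tr (%x. x - r x)) <= Re (tr (%x. x - p x)) + Re (tr (%x. x - q x))"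
proof -
 note P = projD[OF p(2)] and Q = projD[OF q(2)]
 define a where "a x = p x - q (p x)" for x
 have a: "a : M" unfolding a_def by (rule alg(6)[OF p(1) alg(9)[OF q(1) p(1)]])
 obtain s f where s: "s : M" "f : M" "projop s" "projop f" "tr s = tr f"
  "!!x. s x = 0 <-> a x = 0" "!!c. f c = 0 <-> cadj a c = 0" using support_range[OF a] by metis
 note S = projD[OF s(3)]
 have sp: "s (p x) = s x" for x
 proof -
  have "a (x - p x) = 0" by (simp add: a_def bcl_diff[OF P(1)] P(2) bcl_zero[OF Q(1)])
  hence "s (x - p x) = 0" using s(6) by blast
  thus ?thesis by (simp add: bcl_diff[OF S(1)])
 qed
 have ps: "p (s x) = s x" for x
  by (rule cinner_ext) (metis P(4) S(4) sp)
 let ?r = "%x. p x - s x"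
 have r: "projop ?r"
  using P(1,2,4) S(1,2,4) sp ps by (intro projI) (auto intro!: bcl_intros simp: bcl_diff cinner_simps)
 have iff: "?r x = x <-> p x = x & q x = x" for x
 proof
  assume rx: "?r x = x"
  have "p (?r x) = ?r x" by (simp add: bcl_diff[OF P(1)] P(2) ps)
  hence px: "p x = x" using rx by simp
  hence "s x = 0" using rx by simp
  hence "a x = 0" using s(6) by blast
  thus "p x = x & q x = x" using px by (simp add: a_def)
 next
  assume "p x = x & q x = x"
  hence "a x = 0" by (simp add: a_def)
  thus "?r x = x" using s(6) `p x = x & q x = x` by simp
 qed
 have adja: "cadj a = (%x. p (x - q x))"
  by (rule cadj_unique) (simp add: a_def cinner_simps P(4) Q(4) bcl_diff[OF P(1)])
 have "f c = 0" if "q c = c" for c using s(7) that by (simp add: adja bcl_zero[OF P(1)])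
 from proj_kernel_le(2)[OF s(4) q(2) this]
 have "Re (tr f) <= Re (tr (%x. x - q x))" by (intro tr_mono s(2) alg(10) q(1))
 hence "Re (tr (%x. x - ?r x)) <= Re (tr (%x. x - p x)) + Re (tr (%x. x - q x))"
  using p q s alg by (simp add: tr_compl tr_diff)
 thus ?thesis using that[of ?r] r iff alg(6)[OF p(1) s(1)] by blast
qed

text \<open>Dense range means that the range projection is 1; the support projection then also has
  trace 1, and faithfulness makes it 1.\<close>

lemma dense_range_inj:
 assumes a: "a : M" and d: "closure (range a) = UNIV" and ax: "a x = 0"
 shows "x = 0"
proof -
 note A = bcl[OF a]
 obtain s f where s: "s : M" "f : M" "projop s" "projop f" "tr s = tr f"
  "!!x. s x = 0 <-> a x = 0" "!!c. f c = 0 <-> cadj a c = 0" using support_range[OF a] by metis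
 have cs: "csubspace (range a)"
  unfolding csubspace_def using bcl_add[OF A] bcl_scale[OF A] bcl_zero[OF A] by (auto simp: image_iff) metis+
 have f1: "f c = c" for c
 proof -
  let ?c = "c - f c"
  have "f ?c = 0" by (simp add: bcl_diff[OF projD(1)[OF s(4)]] projD(2)[OF s(4)])
  hence "cadj a ?c = 0" using s(7) by blast
  hence "ALL y:range a. cinner ?c y = 0" using cadj(3)[OF A, of ?c] by auto
  hence "?c = 0" using d dense_iff_orth[OF cs] by blast
  thus ?thesis by simp
 qed
 hence "f = (%x. x)" by auto
 hence "tr s = 1" using s(5) by (simp add: tr_id)
 hence "s x = x" by (rule tr_one_proj[OF s(1,3)])
 thus ?thesis using s(6)[of x] ax by simp
qed

text \<open>Let \<open>e\<close> project onto the closed range of \<open>X - z\<close>. The operator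
  \<open>a\<close>, which inverts \<open>X - z\<close> after \<open>e\<close>, belongs to
  \<open>M\<close>, and its range contains the dense domain of \<open>X\<close>. So \<open>a\<close>
  is injective, but it kills \<open>1 - e\<close>; hence \<open>X - z\<close> is onto.\<close>

lemma symmetric_affiliated_sa:
 assumes X: "closed X" "symmetric_graph X" "closure (Domain X) = UNIV"
  and inv: "!!u x y. u : commutant M ==> unitary_op u ==> (x, y) : X ==> (u x, u y) : X"
 shows "op_sa X"
proof -
 have Xs: "csubspace X" using X(2) by (simp add: symmetric_graph_def)
 have surj: "EX x y. (x, y) : X & y - z *c x = w" if z: "Im z ~= 0" for z w
 proof -
  let ?K = "{y - z *c x | x y. (x, y) : X}"
  note K = sym_range_closed[OF X(2,1) z]
  obtain e where e: "projop e" "range e = ?K" using projection_exists[OF K] by blast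
  note P = projD[OF e(1)]
  have ex: "EX x. (x, e w + z *c x) : X" for w
  proof -
  have "e w : ?K" using e(2) by blast
  then obtain x y where "(x, y) : X" "e w = y - z *c x" by blast
  hence "(x, e w + z *c x) : X" by simp
  thus ?thesis by blast
  qed
  then obtain a where a: "!!w. (a w, e w + z *c a w) : X" by metis
  have uniq: "x = a w" if "(x, e w + z *c x) : X" for x w
  proof -
  have "(x - a w, z *c (x - a w)) : X"
  using glinD(3)[OF Xs that a[of w]] by (simp add: scaleC.diff_right)
  from sym_bound[OF X(2) this, of z] show ?thesis using z by (simp add: mult_le_0_iff)
  qed
  have ab: "bcl a"
  proof (rule bclI[of _ "1 / \<bar>Im z\<bar>"])
  fix x y c
  show "a (x + y) = a x + a y"
  using glinD(2)[OF Xs a[of x] a[of y]]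
  by (intro uniq[symmetric]) (simp add: bcl_add[OF P(1)] scaleC_add_right algebra_simps)
  show "a (c *c x) = c *c a x"
  using glinD(4)[OF Xs a[of x], of c]
  by (intro uniq[symmetric]) (simp add: bcl_scale[OF P(1)] scaleC_add_right mult.commute)
  have "\<bar>Im z\<bar> * norm (a x) <= norm (e x)" using sym_bound[OF X(2) a[of x], of z] by simp
  also have "... <= norm x" by (rule P(6))
  finally show "norm (a x) <= 1 / \<bar>Im z\<bar> * norm x" using z by (simp add: field_simps)
  qed
  have "a : M"
  proof (rule vna_memI[OF vna ab])
  fix u v assume u: "u : commutant M" "unitary_op u" "cadj u : commutant M"
  note U = unitary_opD[OF u(2)]
  have Kinv: "w : ?K" if w: "w' : ?K" "w = v w'" "v : commutant M" "unitary_op v" for v w w'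
  proof -
  obtain x y where xy: "(x, y) : X" "w' = y - z *c x" using w(1) by blast
  have "w = v y - z *c v x" using w(2) xy(2) by (simp add: bcl_simps[OF unitary_opD(1)[OF w(4)]])
  thus ?thesis using inv[OF w(3,4) xy(1)] by blast
  qed
  have eK: "e w = w" if "w : ?K" for w using that proj_range(3)[OF e(1)] e(2) by blast
  have e0: "e w = 0" if "!!k. k : ?K ==> cinner k w = 0" for w
  proof -
  have "cinner (e w) w = 0" using that e(2) by blast
  hence "cinner w (e w) = 0" using cinner_commute[of w "e w"] by simp
  thus ?thesis unfolding P(5) by simp
  qed
  have "u (e w) = e (u w)" for w
  proof -
  have "e (u (e w)) = u (e w)" by (rule eK, rule Kinv[OF _ refl u(1,2)]) (simp only: e(2)[symmetric] rangeI)
  moreover have "e (u (w - e w)) = 0"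
  proof (rule e0)
  fix k assume "k : ?K"
  hence ck: "cadj u k : ?K" using Kinv[of k _ "cadj u"] u(3) U(5) by blast
  have "cinner k (u (w - e w)) = cinner (cadj u k) (w - e w)" using cadj(3)[OF U(1)] by simp
  also have "... = cinner (e (cadj u k)) (w - e w)" using eK[OF ck] by simp
  also have "... = 0" by (simp add: P(4) bcl_diff[OF P(1)] P(2))
  finally show "cinner k (u (w - e w)) = 0" .
  qed
  ultimately show ?thesis by (simp add: bcl_diff[OF U(1)] bcl_diff[OF P(1)])
  qed
  thus "u (a v) = a (u v)"
  using inv[OF u(1,2) a[of v]] by (intro uniq) (simp add: bcl_simps[OF U(1)])
  qed
  moreover have "closure (range a) = UNIV"
  proof -
  have "Domain X <= range a"
  proof
  fix x assume "x : Domain X"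
  then obtain y where xy: "(x, y) : X" by blast
  have "y - z *c x : range e" unfolding e(2) using xy by blast
  hence "e (y - z *c x) = y - z *c x" using proj_range(3)[OF e(1)] by blast
  hence "x = a (y - z *c x)" using xy by (intro uniq) simp
  thus "x : range a" by blast
  qed
  thus ?thesis using X(3) closure_mono by blast
  qed
  moreover have "a (w - e w) = 0"
  by (rule uniq[symmetric]) (simp add: bcl_diff[OF P(1)] P(2) glinD(1)[OF Xs])
  ultimately have "w - e w = 0" using dense_range_inj by blast
  hence "w : ?K" using e(2) by (metis eq_iff_diff_eq_0 rangeI)
  thus ?thesis by blast
 qed
 show ?thesis
  by (rule sa_criterion[OF X(2,3)]) (use surj[of "-\<i>"] surj[of \<i>] in auto)
qed

subsection \<open>Distributions\<close>

context
 fixes A :: "'h opgraph"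
 assumes A: "A : affiliated M" "op_sa A"
begin

abbreviation "E \<equiv> spm A"
lemmas E = spectral_theorem(1)[OF A(2)]
lemmas fcM = fc_in_vna[OF vna A]
lemmas EM = spectral_in_vna[OF vna A]

text \<open>The factor \<open>d\<close> is there for polarization: functionals such as
  \<open>tr (K f(A))\<close> become combinations of positive measures of this kind.\<close>

definition tr_meas :: "('h => 'h) => real measure"
 where "tr_meas d = borel_measure_of (%B. Re (tr (%x. cadj d (E B (d x)))))"

lemma op_distr_eq: "op_distr tr A = tr_meas (%x. x)"
 unfolding op_distr_def tr_meas_def by simp

lemma posop_conj: assumes "bcl d" "posop a" shows "posop (%x. cadj d (a (d x)))"
 using posopD(1,2)[OF assms(2)] bcl_comp(2)[OF cadj(1)[OF assms(1)] bcl_comp(2)[OF posopD(1)[OF assms(2)] assms(1)]]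
 by (auto simp: posop_def cadj(2)[OF assms(1), symmetric])

lemma tr_meas_conds:
 assumes d: "d : M"
 shows "B : sets borel ==> 0 <= Re (tr (%x. cadj d (E B (d x))))"
  "B : sets borel ==> Im (tr (%x. cadj d (E B (d x)))) = 0"
  "range F <= sets borel ==> disjoint_family F ==>
  (%n. Re (tr (%x. cadj d (E (F n) (d x))))) sums Re (tr (%x. cadj d (E (\<Union>n. F n) (d x))))"
proof -
 note D = bcl[OF d] and D' = bcl[OF adj[OF d]]
 have M: "(%x. cadj d (E B (d x))) : M" if "B : sets borel" for B by (rule alg(9)[OF adj[OF d] alg(9)[OF EM[OF that] d]])
 have pos: "posop (%x. cadj d (E B (d x)))" if "B : sets borel" for B
  by (rule posop_conj[OF D posop_proj[OF pvm(1)[OF E that]]])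
 show "B : sets borel ==> 0 <= Re (tr (%x. cadj d (E B (d x))))"
  "B : sets borel ==> Im (tr (%x. cadj d (E B (d x)))) = 0"
  using tr_posop[OF M pos] by (simp_all add: complex_nonneg_Reals_iff)
 assume F: "range F <= sets borel" "disjoint_family F"
 have Fb: "F n : sets borel" for n using F(1) by blast
 let ?f = "%n x. \<Sum>i<n. cadj d (E (F i) (d x))"
 have fM: "?f n : M & posop (?f n) & tr (?f n) = (\<Sum>i<n. tr (%x. cadj d (E (F i) (d x))))" for n
 proof (induction n)
  case 0 thus ?case using alg(3) by (simp add: tr_zero posop_def)
 next
  case (Suc n)
  thus ?case using alg(5)[OF _ M[OF Fb]] posop_add[OF _ pos[OF Fb]] tr_add[OF _ M[OF Fb]] by simp
 qed
 have "(%n. tr (?f n)) ~> tr (%x. cadj d (E (\<Union>n. F n) (d x)))"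
 proof (rule normal)
  show "?f n : M" "posop (?f n)" for n using fM by auto
  show "posop (%x. ?f (Suc n) x - ?f n x)" for n using pos[OF Fb] by simp
  show "(%n. ?f n x) ~> cadj d (E (\<Union>n. F n) (d x))" for x
  using bounded_linear.sums[OF bcl_linear[OF D'] pvm(4)[OF E F, of "d x"]] unfolding sums_def .
  show "(%x. cadj d (E (\<Union>n. F n) (d x))) : M" by (rule M) (use Fb in blast)
 qed
 hence "(%n. tr (%x. cadj d (E (F n) (d x)))) sums tr (%x. cadj d (E (\<Union>n. F n) (d x)))"
  unfolding sums_def using fM by simp
 thus "(%n. Re (tr (%x. cadj d (E (F n) (d x))))) sums Re (tr (%x. cadj d (E (\<Union>n. F n) (d x))))"
  by (rule sums_Re)
qed

lemma tr_meas:
 assumes d: "d : M"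
 shows "finite_measure (tr_meas d)" "B : sets borel ==> measure (tr_meas d) B = Re (tr (%x. cadj d (E B (d x))))"
  "sets (tr_meas d) = sets borel" "space (tr_meas d) = UNIV"
proof -
 note * = finite_bmo[of "%B. Re (tr (%x. cadj d (E B (d x))))", OF tr_meas_conds(1,3)[OF d]]
 show "finite_measure (tr_meas d)" unfolding tr_meas_def by (rule *(1))
 show "measure (tr_meas d) B = Re (tr (%x. cadj d (E B (d x))))" if "B : sets borel"
  unfolding tr_meas_def by (rule *(2)[OF _ _ _ that])
qed (simp_all add: tr_meas_def)

lemma tr_meas_integrable: "d : M ==> bb f ==> integrable (tr_meas d) f"
 using finite_measure.integrable_const_bound[OF tr_meas(1), of d f]
 by (auto simp: bb_def measurable_cong_sets[OF tr_meas(3) refl])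

lemma trace_integral:
 assumes d: "d : M" and f: "bb f"
 shows "tr (%x. cadj d (fc E f (d x))) = (\<integral>t. f t \<partial>tr_meas d)"
 using f
proof (induction f rule: bb_induct)
 case (ind B)
 thus ?case using tr_meas_conds(2)[OF d ind] tr_meas(2)[OF d ind] d
  by (simp add: fc_ind[OF E] integral_indicator_complex tr_meas complex_eq_iff)
next
 have D': "bcl (cadj d)" by (intro bcl adj d)
 have M: "(%x. cadj d (fc E f (d x))) : M" if "bb f" for f by (rule alg(9)[OF adj[OF d] alg(9)[OF fcM[OF that] d]])
 {
  case (add f g)
  thus ?case using M[OF add(1)] M[OF add(2)]
  by (simp add: fc_add[OF E] bcl_add[OF D'] tr_add tr_meas_integrable[OF d])
 next
  case (cmult c f)
  thus ?case using M[OF cmult(1)] by (simp add: fc_cmult[OF E] bcl_scale[OF D'] tr_scale)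
 next
  case (lim f F)
  interpret finite_measure "tr_meas d" by (rule tr_meas(1)[OF d])
  let ?i = "%n. inverse (real (Suc n))"
  obtain C where C: "C > 0" "!!x. norm (d x) <= C * norm x" using bcl_bound[OF bcl[OF d]] by blast
  have i0: "(%n. ?i n * k) ~> 0" for k
  using tendsto_mult[OF LIMSEQ_inverse_real_of_nat tendsto_const[of k]] by simp
  have "(%n. tr (%x. cadj d (fc E (F n) (d x))) - tr (%x. cadj d (fc E f (d x)))) ~> 0"
  proof (rule Lim_null_comparison[OF _ i0], rule always_eventually, rule allI)
  fix n
  have "tr (%x. cadj d (fc E (F n) (d x))) - tr (%x. cadj d (fc E f (d x)))
  = tr (%x. cadj d (fc E (F n) (d x)) - cadj d (fc E f (d x)))"
  using M[OF lim(2)] M[OF lim(1)] by (simp add: tr_diff)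
  also have "cmod ... <= ?i n * (2 * C * C)"
  proof (rule tr_bound[OF alg(6)[OF M[OF lim(2)] M[OF lim(1)]]])
  fix x
  have "norm (cadj d (fc E (F n) (d x)) - cadj d (fc E f (d x))) <= C * norm (fc E (F n) (d x) - fc E f (d x))"
  unfolding bcl_diff[OF D', symmetric] by (rule cadj_norm_le[OF bcl[OF d] C(2)])
  also have "... <= C * (2 * ?i n * norm (d x))"
  using C(1) fc_close2[OF E lim(2,1,3)] by (intro mult_left_mono) auto
  also have "... <= C * (2 * ?i n * (C * norm x))"
  using C by (intro mult_left_mono) auto
  finally show "norm (cadj d (fc E (F n) (d x)) - cadj d (fc E f (d x))) <= ?i n * (2 * C * C) * norm x"
  by (simp add: algebra_simps)
  qed (use C in simp)
  finally show "norm (tr (%x. cadj d (fc E (F n) (d x))) - tr (%x. cadj d (fc E f (d x)))) <= ?i n * (2 * C * C)" .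
  qed
  hence 1: "(%n. \<integral>t. F n t \<partial>tr_meas d) ~> tr (%x. cadj d (fc E f (d x)))"
  by (simp add: LIM_zero_iff lim(4))
  have "(%n. (\<integral>t. F n t \<partial>tr_meas d) - (\<integral>t. f t \<partial>tr_meas d)) ~> 0"
  proof (rule Lim_null_comparison[OF _ i0], rule always_eventually, rule allI)
  fix n
  have "(\<integral>t. F n t \<partial>tr_meas d) - (\<integral>t. f t \<partial>tr_meas d) = (\<integral>t. F n t - f t \<partial>tr_meas d)"
  using lim by (simp add: tr_meas_integrable[OF d])
  also have "cmod ... <= (\<integral>t. cmod (F n t - f t) \<partial>tr_meas d)" by (rule integral_norm_bound)
  also have "... <= (\<integral>t. ?i n \<partial>tr_meas d)"
  by (rule integral_mono) (use lim in \<open>auto intro!: integrable_norm tr_meas_integrable[OF d] bb_diff\<close>)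
  finally show "norm ((\<integral>t. F n t \<partial>tr_meas d) - (\<integral>t. f t \<partial>tr_meas d)) <= ?i n * measure (tr_meas d) (space (tr_meas d))"
  by (simp add: mult.commute)
  qed
  hence "(%n. \<integral>t. F n t \<partial>tr_meas d) ~> (\<integral>t. f t \<partial>tr_meas d)" by (simp add: LIM_zero_iff)
  with 1 show ?case by (rule LIMSEQ_unique)
 }
qed

lemma op_distr:
 shows "finite_measure (op_distr tr A)" "B : sets borel ==> measure (op_distr tr A) B = Re (tr (E B))"
  "sets (op_distr tr A) = sets borel" "space (op_distr tr A) = UNIV"
  "bb f ==> tr (fc E f) = (\<integral>t. f t \<partial>op_distr tr A)"
proof -
 note t = tr_meas[OF alg(2)]
 show "finite_measure (op_distr tr A)" "sets (op_distr tr A) = sets borel" "space (op_distr tr A) = UNIV"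
  unfolding op_distr_eq by (rule t)+
 show "B : sets borel ==> measure (op_distr tr A) B = Re (tr (E B))"
  unfolding op_distr_eq using t(2) by simp
 show "bb f ==> tr (fc E f) = (\<integral>t. f t \<partial>op_distr tr A)"
  unfolding op_distr_eq using trace_integral[OF alg(2), of f] by simp
qed

text \<open>Polarization over \<open>d k = K + k\<close> with \<open>k\<close> in
  \<open>1, -1, i, -i\<close> writes the trace as a combination of four positive measures.
  Conjugating \<open>z\<close> conjugates each of their Stieltjes transforms, so the hypothesis at
  \<open>z\<close> and at \<open>cnj z\<close> separates the two pairs; inversion then makes the
  measures of each pair equal.\<close>

lemma trace_fc_zero:
 assumes K: "K : M" and z: "!!z. Im z ~= 0 ==> tr (%x. K (res A z x)) = 0" and f: "bb f"
 shows "tr (%x. K (fc E f x)) = 0"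
proof -
 define d where "d k x = K x + k *c x" for k x
 define g where "g k f = (\<integral>t. f t \<partial>tr_meas (d k))" for k and f :: "real => complex"
 have dM: "d k : M" for k unfolding d_def by (intro alg_intros K)
 have K': "cadj K : M" by (rule adj[OF K])
 have pol: "4 * tr (%x. K (fc E f x)) = (g 1 f - g (- 1) f) + \<i> * (g \<i> f - g (- \<i>) f)" if f: "bb f" for f
 proof -
  let ?F = "fc E f"
  have FM: "?F : M" by (rule fcM[OF f])
  have "g k f = tr (%x. K (cadj K (?F x))) + cnj k * tr (%x. K (?F x)) + k * tr (%x. cadj K (?F x)) + k * cnj k * tr ?F" for k
  proof -
  have c: "cadj (d k) = (%x. cadj K x + cnj k *c x)"
  unfolding d_def by (rule cadj_unique) (simp add: cadj[OF bcl[OF K]] cinner_simps)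
  have "g k f = tr (%x. cadj (d k) (?F (d k x)))" unfolding g_def by (rule trace_integral[OF dM f, symmetric])
  also have "... = tr (%x. ?F (d k (cadj (d k) x)))" by (rule tracial[OF adj[OF dM] alg(9)[OF FM dM]])
  also have "... = tr (%x. d k (cadj (d k) (?F x)))" by (rule tracial[OF FM alg(9)[OF dM adj[OF dM]]])
  also have "(%x. d k (cadj (d k) (?F x))) = (%x. ((K (cadj K (?F x)) + cnj k *c K (?F x)) + k *c cadj K (?F x)) + (k * cnj k) *c ?F x)"
  unfolding c by (simp add: d_def bcl_simps[OF bcl[OF K]] scaleC_add_right add.assoc)
  finally show ?thesis
  using alg(9)[OF K alg(9)[OF K' FM]] alg(9)[OF K FM] alg(9)[OF K' FM] FM by (simp add: tr_add tr_scale alg(5,7))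
  qed
  thus ?thesis by (simp add: algebra_simps)
 qed
 have eq: "tr_meas (d 1) = tr_meas (d (- 1)) & tr_meas (d \<i>) = tr_meas (d (- \<i>))"
 proof -
  have "g 1 (rz z) = g (- 1) (rz z) & g \<i> (rz z) = g (- \<i>) (rz z)" if Im: "Im z > 0" for z
  proof -
  have z0: "Im z ~= 0" "Im (cnj z) ~= 0" using Im by auto
  have cn: "g k (rz (cnj z)) = cnj (g k (rz z))" for k
  proof -
  have "rz (cnj z) = (%t. cnj (rz z t))" by (simp add: rz_def fun_eq_iff)
  thus ?thesis unfolding g_def by (simp add: integral_cnj)
  qed
  have 1: "(g 1 (rz z) - g (- 1) (rz z)) + \<i> * (g \<i> (rz z) - g (- \<i>) (rz z)) = 0"
  using pol[OF bb_rz[OF z0(1)]] z[OF z0(1)] unfolding res_fc[OF A(2) z0(1)] by simp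
  have "cnj ((g 1 (rz z) - g (- 1) (rz z)) - \<i> * (g \<i> (rz z) - g (- \<i>) (rz z))) = 0"
  using pol[OF bb_rz[OF z0(2)]] z[OF z0(2)] unfolding res_fc[OF A(2) z0(2)] by (simp add: cn)
  hence 2: "(g 1 (rz z) - g (- 1) (rz z)) - \<i> * (g \<i> (rz z) - g (- \<i>) (rz z)) = 0" by (simp only: complex_cnj_zero_iff)
  have lin: "p = 0 & q = 0" if "p + \<i> * q = 0" "p - \<i> * q = 0" for p q
  using that by (auto simp: complex_eq_iff)
  show ?thesis using lin[OF 1 2] by simp
  qed
  thus ?thesis unfolding g_def
  by (intro conjI stieltjes_unique tr_meas dM) auto
 qed
 thus ?thesis using pol[OF f] unfolding g_def by simp
qed

end

lemma pvm_tau_tendsto: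
 assumes A: "A : affiliated M" "op_sa A"
 shows "(%n. Re (tr (%x. x - spm A (ivl n) x))) ~> 0"
proof -
 note E = spectral_theorem(1)[OF A(2)] and EM = spectral_in_vna[OF vna A]
 have "(%n. tr (spm A (ivl n))) ~> tr (%x. x)"
 proof (rule normal)
  show "spm A (ivl n) : M" for n by (rule EM) simp
  show "posop (spm A (ivl n))" for n by (rule posop_proj[OF pvm(1)[OF E ivl_borel]])
  show "posop (%x. spm A (ivl (Suc n)) x - spm A (ivl n) x)" for n
  proof -
  have "ivl (Suc n) = ivl n Un (ivl (Suc n) - ivl n)" by (auto simp: ivl_def)
  hence "spm A (ivl (Suc n)) x = spm A (ivl n) x + spm A (ivl (Suc n) - ivl n) x" for x
  using pvm_Un[OF E ivl_borel, of "ivl (Suc n) - ivl n" n x] by auto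
  thus ?thesis using posop_proj[OF pvm(1)[OF E, of "ivl (Suc n) - ivl n"]] by simp
  qed
  show "(%n. spm A (ivl n) x) ~> x" for x by (rule ivl_tendsto[OF E])
 qed (rule alg)
 hence "(%n. Re (1 - tr (spm A (ivl n)))) ~> Re (1 - 1)"
  unfolding tr_id by (intro tendsto_intros)
 thus ?thesis using tr_compl[OF EM[OF ivl_borel]] by simp
qed

text \<open>The closed sum is symmetric and invariant, so by \<open>symmetric_affiliated_sa\<close>
  only the density of its domain is at stake. The domain contains the meets of the spectral
  subspaces for \<open>[-n, n]\<close>, whose complements have trace tending to 0 by
  \<open>proj_meet\<close>.\<close>

lemma op_add_sa:
 assumes A: "A : affiliated M" "op_sa A" and B: "B : affiliated M" "op_sa B"
 shows "op_sa (op_add A B)" "op_add A B : affiliated M"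
proof -
 let ?L = "{(x, y + z) | x y z. (x, y) : A & (x, z) : B}"
 note E = spectral_theorem[OF A(2)] and F = spectral_theorem[OF B(2)]
 note EM = spectral_in_vna[OF vna A ivl_borel] and FM = spectral_in_vna[OF vna B ivl_borel]
 note gA = glinD[OF saD(6)[OF A(2)]] and gB = glinD[OF saD(6)[OF B(2)]]
 have X: "op_add A B = closure ?L" by (simp add: op_add_def)
 have Lc: "csubspace ?L"
  unfolding csubspace_def
 proof (intro conjI ballI allI)
  have "(0, 0 + 0) : ?L" using gA(1) gB(1) by blast
  thus "0 : ?L" by (simp add: zero_prod_def)
 next
  fix p q assume "p : ?L" "q : ?L"
  then obtain x y z u v w where "(x, y) : A" "(x, z) : B" "p = (x, y + z)" "(u, v) : A" "(u, w) : B" "q = (u, v + w)"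
  by blast
  hence "(x + u, y + v) : A" "(x + u, z + w) : B" "p + q = (x + u, (y + v) + (z + w))"
  using gA(2) gB(2) by auto
  thus "p + q : ?L" by blast
 next
  fix c p assume "p : ?L"
  then obtain x y z where "(x, y) : A" "(x, z) : B" "p = (x, y + z)" by blast
  hence "(c *c x, c *c y) : A" "(c *c x, c *c z) : B" "c *c p = (c *c x, c *c y + c *c z)"
  using gA(4) gB(4) by (auto simp: scaleC_add_right)
  thus "c *c p : ?L" by blast
 qed
 have inv: "(u x, u y) : op_add A B" if u: "u : commutant M" "unitary_op u" and xy: "(x, y) : op_add A B" for u x y
 proof -
  note U = unitary_opD(1)[OF u(2)]
  obtain f where f: "!!n. f n : ?L" "f ~> (x, y)" using xy unfolding X closure_sequential by blast
  have "(u (fst (f n)), u (snd (f n))) : ?L" for n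
  proof -
  obtain a b c where "(a, b) : A" "(a, c) : B" "f n = (a, b + c)" using f(1)[of n] by blast
  hence "(u a, u b) : A" "(u a, u c) : B" "(u (fst (f n)), u (snd (f n))) = (u a, u b + u c)"
  using affiliatedD(2)[OF A(1) u] affiliatedD(2)[OF B(1) u] by (simp_all add: bcl_add[OF U])
  thus ?thesis by blast
  qed
  moreover have "(%n. (u (fst (f n)), u (snd (f n)))) ~> (u x, u y)"
  using f(2) tendsto_fst[OF f(2)] tendsto_snd[OF f(2)] by (intro tendsto_Pair bcl_tendsto[OF U]) auto
  ultimately show ?thesis unfolding X closure_sequential by (intro exI[of _ "%n. (u (fst (f n)), u (snd (f n)))"]) blast
 qed
 have sym: "symmetric_graph (op_add A B)"
  unfolding symmetric_graph_def
 proof (intro conjI allI impI)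
  show "csubspace (op_add A B)" unfolding X by (rule csubspace_closure[OF Lc])
  fix x y u v assume "(x, y) : op_add A B" "(u, v) : op_add A B"
  then obtain f g where f: "!!n. f n : ?L" "f ~> (x, y)" and g: "!!n. g n : ?L" "g ~> (u, v)"
  unfolding X closure_sequential by blast
  have "cinner (fst (f n)) (snd (g n)) = cinner (snd (f n)) (fst (g n))" for n
  proof -
  obtain a b c where 1: "(a, b) : A" "(a, c) : B" "f n = (a, b + c)" using f(1)[of n] by blast
  obtain a' b' c' where 2: "(a', b') : A" "(a', c') : B" "g n = (a', b' + c')" using g(1)[of n] by blast
  show ?thesis using saD(7)[OF A(2) 1(1) 2(1)] saD(7)[OF B(2) 1(2) 2(2)] 1(3) 2(3) by (simp add: cinner_simps)
  qed
  moreover have "(%n. cinner (fst (f n)) (snd (g n))) ~> cinner x v"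
  using tendsto_fst[OF f(2)] tendsto_snd[OF g(2)] by (intro cinner.tendsto) auto
  moreover have "(%n. cinner (snd (f n)) (fst (g n))) ~> cinner y u"
  using tendsto_snd[OF f(2)] tendsto_fst[OF g(2)] by (intro cinner.tendsto) auto
  ultimately show "cinner x v = cinner y u" using LIMSEQ_unique by auto
 qed
 have dense: "closure (Domain (op_add A B)) = UNIV"
 proof -
  let ?p = "%n. spm A (ivl n)" and ?q = "%n. spm B (ivl n)"
  have "EX r. r : M & projop r & (ALL x. r x = x <-> ?p n x = x & ?q n x = x) &
  Re (tr (%x. x - r x)) <= Re (tr (%x. x - ?p n x)) + Re (tr (%x. x - ?q n x))" for n
  by (rule proj_meet[OF EM pvm(1)[OF E(1) ivl_borel] FM pvm(1)[OF F(1) ivl_borel], of n n]) blast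
  hence "ALL n. EX r. r : M & projop r & (ALL x. r x = x <-> ?p n x = x & ?q n x = x) &
  Re (tr (%x. x - r x)) <= Re (tr (%x. x - ?p n x)) + Re (tr (%x. x - ?q n x))" by blast
  from choice[OF this] obtain r where r: "!!n. r n : M" "!!n. projop (r n)" "!!n x. r n x = x <-> ?p n x = x & ?q n x = x"
  "!!n. Re (tr (%x. x - r n x)) <= Re (tr (%x. x - ?p n x)) + Re (tr (%x. x - ?q n x))" by blast
  note R = projD[OF r(2)]
  have "ivl n <= ivl (Suc n)" for n by (auto simp: ivl_def)
  hence up: "?p (Suc n) (?p n x) = ?p n x" "?q (Suc n) (?q n x) = ?q n x" for n x
  using pvm_Int[OF E(1) ivl_borel ivl_borel] pvm_Int[OF F(1) ivl_borel ivl_borel] by (simp_all add: Int_absorb1)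
  have rr: "r (Suc n) (r n x) = r n x" for n x
  proof -
  have "?p n (r n x) = r n x" "?q n (r n x) = r n x" using r(3) R(2) by blast+
  hence "?p (Suc n) (r n x) = r n x" "?q (Suc n) (r n x) = r n x" using up[of n "r n x"] by simp_all
  thus ?thesis using r(3) by blast
  qed
  have rr': "r n (r (Suc n) x) = r n x" for n x
  by (rule cinner_ext) (simp only: R(4)[symmetric] rr)
  have "(%x. x - r n x) ((%x. x - r (Suc n) x) x) = x - r (Suc n) x" for n x
  by (simp add: bcl_diff[OF R(1)] rr')
  from proj_decreasing_limit[of "%n x. x - r n x", OF proj_compl[OF r(2)] this]
  obtain g where g: "projop g" "!!x. (%n. x - r n x) ~> g x" "!!n x. g x - r n (g x) = g x" by auto
  have gM: "g : M" by (rule vna_limit[OF vna alg(10)[OF r(1)] g(2) projD(1)[OF g(1)]])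
  have "Re (tr g) <= Re (tr (%x. x - r n x))" for n
  proof (rule tr_mono[OF gM alg(10)[OF r(1)]])
  have "g x = 0" if "r n x = x" for x
  proof -
  have "r n (g y) = 0" for y using g(3)[of y n] by simp
  hence "cinner y (g x) = 0" for y using projD(4)[OF g(1), of y x] R(4)[of n "g y" x] that by simp
  thus ?thesis using cinner_ext[of "g x" 0] by simp
  qed
  thus "posop (%x. (x - r n x) - g x)" by (rule proj_kernel_le(2)[OF g(1) r(2)])
  qed
  hence "Re (tr g) <= Re (tr (%x. x - ?p n x)) + Re (tr (%x. x - ?q n x))" for n
  using r(4) order_trans by blast
  moreover have "(%n. Re (tr (%x. x - ?p n x)) + Re (tr (%x. x - ?q n x))) ~> 0 + 0"
  by (intro tendsto_add pvm_tau_tendsto A B)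
  ultimately have "Re (tr g) <= 0 + 0" by (intro LIMSEQ_le_const) blast+
  hence "Re (tr g) <= 0" by simp
  hence g0: "g x = 0" for x by (rule tr_proj(3)[OF gM g(1)])
  have "(%n. x - (x - r n x)) ~> x - g x" for x by (intro tendsto_diff tendsto_const g)
  hence rl: "(%n. r n x) ~> x" for x by (simp add: g0)
  have "r n x : Domain (op_add A B)" for n x
  proof -
  have "?p n (r n x) = r n x" "?q n (r n x) = r n x" using r(3) R(2) by blast+
  hence "(r n x, fc (spm A) (trn n) (r n x)) : A" "(r n x, fc (spm B) (trn n) (r n x)) : B"
  using pvm_op_ivl[OF E(1), of n "r n x"] pvm_op_ivl[OF F(1), of n "r n x"] E(2) F(2) by auto
  hence "(r n x, fc (spm A) (trn n) (r n x) + fc (spm B) (trn n) (r n x)) : ?L" by blast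
  hence "(r n x, fc (spm A) (trn n) (r n x) + fc (spm B) (trn n) (r n x)) : op_add A B"
  unfolding X by (rule closure_subset[THEN subsetD])
  thus ?thesis by (rule DomainI)
  qed
  hence "y : closure (Domain (op_add A B))" for y
  unfolding closure_sequential by (intro exI[of _ "%n. r n y"] conjI allI rl)
  thus ?thesis by blast
 qed
 show sa: "op_sa (op_add A B)"
  using symmetric_affiliated_sa[of "op_add A B"] sym dense inv by (simp add: X)
 show "op_add A B : affiliated M"
  using affiliatedI[OF saD(1)[OF sa]] inv by blast
qed

end

section \<open>The distribution of a sum of free operators\<close>

lemma tendsto_of_bound:
 assumes "!!k::nat. norm (a - f k) <= g k" "g ~> 0" shows "f ~> (a::'a::real_normed_vector)"
proof -
 have "(%k. a - f k) ~> 0" by (rule Lim_null_comparison[OF always_eventually assms(2)]) (use assms(1) in blast)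
 hence "(%k. a - (a - f k)) ~> a - 0" by (intro tendsto_intros)
 thus ?thesis by simp
qed

text \<open>With \<open>D = Y - z\<close> and \<open>D'\<close> its adjoint,
  \<open>Q = 1 - D' D / K\<close> lies between 0 and \<open>rh < 1\<close>, and the inverse of
  \<open>D\<close> is the sum of the \<open>Q^j D' / K\<close>. Unlike the expansion in powers of
  \<open>1 / z\<close>, this converges for every nonreal \<open>z\<close>. The summand 1 in
  \<open>K\<close> keeps \<open>rh\<close> strictly positive.\<close>

lemma neumann_resolvent:
 fixes Y :: "'h::complex_hilbert_space => 'h"
 assumes Y: "bcl Y" "cadj Y = Y" and C: "!!x. norm (Y x) <= C * norm x" "C >= 0" and z: "Im z ~= 0"
 defines "K \<equiv> (C + cmod z + 1)^2" and "rh \<equiv> 1 - (Im z)^2 / (C + cmod z + 1)^2"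
 defines "Q \<equiv> %v. v - cr (1 / K) *c (Y (Y v - z *c v) - cnj z *c (Y v - z *c v))"
 shows "0 <= rh" "rh < 1"
  "norm (res (op_graph Y) z w - cr (1 / K) *c (\<Sum>j<k. (Q ^^ j) (Y w - cnj z *c w))) <= rh ^ k / \<bar>Im z\<bar> * norm w"
proof -
 define D where "D x = Y x - z *c x" for x
 note sa = op_graph_sa[OF Y]
 have K: "K > 0" unfolding K_def using C(2) norm_ge_zero[of z] by (intro zero_less_power) linarith
 have "(Im z)^2 <= (cmod z)^2" using abs_Im_le_cmod[of z] by (simp add: abs_le_square_iff[symmetric])
 also have "(cmod z)^2 < K" unfolding K_def using C(2) norm_ge_zero[of z] by (intro power_strict_mono) linarith+
 finally have yK: "(Im z)^2 < K" .
 have rh: "rh = 1 - (Im z)^2 / K" unfolding rh_def K_def ..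
 have rh0: "0 < rh" unfolding rh using yK K by (simp add: field_simps)
 show rh01: "0 <= rh" "rh < 1" using rh0 K z by (simp_all add: rh)
 have Db: "bcl D" unfolding D_def by (intro bcl_intros Y)
 have Dadj: "cinner a (Y b - cnj z *c b) = cinner (D a) b" "cinner (Y b - cnj z *c b) a = cinner b (D a)" for a b
  using selfadj_swap[OF Y] by (simp_all add: D_def cinner_simps)
 have Dl: "\<bar>Im z\<bar> * norm x <= norm (D x)" for x
  unfolding D_def by (rule sym_bound[OF sa_symmetric[OF sa]]) (auto simp: op_graph_def)
 have Du: "(norm (D x))^2 <= K * (norm x)^2" for x
 proof -
  have "norm (D x) <= norm (Y x) + norm (z *c x)" unfolding D_def by (rule norm_triangle_ineq4)
  also have "... <= (C + cmod z + 1) * norm x" using C(1)[of x] by (simp add: algebra_simps add_increasing)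
  finally have "(norm (D x))^2 <= ((C + cmod z + 1) * norm x)^2" by (intro power_mono) auto
  thus ?thesis by (simp add: K_def power_mult_distrib)
 qed
 have Q: "Q v = v - cr (1 / K) *c (Y (D v) - cnj z *c D v)" for v by (simp add: Q_def D_def)
 define D' where "D' b = Y b - cnj z *c b" for b
 note Dadj = Dadj[folded D'_def]
 have Q: "Q v = v - cr (1 / K) *c D' (D v)" for v by (simp add: Q D'_def)
 have D'b: "bcl D'" unfolding D'_def by (intro bcl_intros Y)
 have form: "Re (cinner x (Q x)) = (norm x)^2 - (norm (D x))^2 / K" for x
  unfolding Q cinner.diff_right cinner_scaleC_right Dadj cinner_self by (simp del: of_real_power)
 have Qp: "posop Q"
 proof (rule posopI)
  show "bcl Q" unfolding Q by (intro bcl_intros bcl_comp(2)[OF D'b Db])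
  show "cinner (Q x) y = cinner x (Q y)" for x y
  unfolding Q by (simp add: cinner.diff_left cinner.diff_right cinner_scaleC_right cinner_scaleC_left Dadj del: of_real_divide)
  show "0 <= Re (cinner x (Q x))" for x unfolding form using Du[of x] K by (simp add: field_simps)
 qed
 have Qn: "norm (Q x) <= rh * norm x" for x
 proof (rule posop_bound(2)[OF Qp rh0])
  fix x
  have "(\<bar>Im z\<bar> * norm x)^2 <= (norm (D x))^2" by (intro power_mono Dl) auto
  thus "Re (cinner x (Q x)) <= rh * (norm x)^2"
  unfolding form rh using K by (simp add: field_simps power_mult_distrib)
 qed
 have Qk: "norm ((Q ^^ k) x) <= rh ^ k * norm x" for x
 proof (induction k)
  case (Suc k)
  have "norm (Q ((Q ^^ k) x)) <= rh * (rh ^ k * norm x)" using Qn mult_left_mono[OF Suc rh01(1)] order_trans by blast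
  thus ?case by (simp add: mult.assoc)
 qed simp
 define v where "v = res (op_graph Y) z w"
 have "(v, w + z *c v) : op_graph Y" unfolding v_def by (rule res_in[OF sa z])
 hence w: "w = D v" by (auto simp: op_graph_def D_def eq_diff_eq)
 have KK: "cr K *c (cr (1 / K) *c t) = t" for t :: 'h
  using K unfolding scaleC_scaleC of_real_mult[symmetric] by simp
 have eq: "cr (1 / K) *c (Y (D v) - cnj z *c D v) = v - Q v" by (simp add: Q D'_def)
 have YD: "Y w - cnj z *c w = cr K *c (v - Q v)"
  unfolding eq[symmetric] KK w ..
 have "(Q ^^ j) (Y w - cnj z *c w) = cr K *c ((Q ^^ j) v - (Q ^^ Suc j) v)" for j
  unfolding YD
 proof (induction j)
  case (Suc j)
  thus ?case by (simp add: bcl_simps[OF posopD(1)[OF Qp]])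
 qed simp
 hence "(\<Sum>j<k. (Q ^^ j) (Y w - cnj z *c w)) = cr K *c (v - (Q ^^ k) v)"
 proof (induction k)
  case (Suc k)
  thus ?case by (simp add: scaleC.diff_right)
 qed simp
 hence "v - cr (1 / K) *c (\<Sum>j<k. (Q ^^ j) (Y w - cnj z *c w)) = (Q ^^ k) v"
  using K by (simp add: scaleC_scaleC flip: of_real_mult del: of_real_divide)
 hence "norm (v - cr (1 / K) *c (\<Sum>j<k. (Q ^^ j) (Y w - cnj z *c w))) <= rh ^ k * norm v"
  using Qk[of v] by simp
 also have "... <= rh ^ k * (norm w / \<bar>Im z\<bar>)"
  unfolding v_def using rh01(1) by (intro mult_left_mono res_norm[OF sa z]) auto
 finally show "norm (res (op_graph Y) z w - cr (1 / K) *c (\<Sum>j<k. (Q ^^ j) (Y w - cnj z *c w))) <= rh ^ k / \<bar>Im z\<bar> * norm w"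
  unfolding v_def by (simp add: field_simps)
qed

context fin_vna begin

definition trunc :: "'h opgraph => 'h opgraph => nat => 'h => 'h"
 where "trunc A B n x = fc (spm A) (trn n) x + fc (spm B) (trn n) x"

text \<open>Where the resolvent \<open>R\<close> of the sum maps into the meet \<open>r\<close> of
  the spectral subspaces, sum and truncation agree, hence so do their resolvents. So the difference
  \<open>D\<close> is supported under the support projection of \<open>(1 - r) R\<close>, whose
  trace is at most that of \<open>1 - r\<close>; with the bound \<open>2 / abs (Im z)\<close> this
  controls the trace of \<open>D\<close>.\<close>

lemma trunc:
 assumes A: "A : affiliated M" "op_sa A" and B: "B : affiliated M" "op_sa B"
 shows "trunc A B n : M" "cadj (trunc A B n) = trunc A B n"
  "norm (trunc A B n x) <= 2 * real n * norm x"
  "Im z ~= 0 ==> res (op_graph (trunc A B n)) z : M"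
  "Im z ~= 0 ==> (%n. tr (res (op_graph (trunc A B n)) z)) ~> tr (res (op_add A B) z)"
proof -
 note E = spectral_theorem[OF A(2)] and F = spectral_theorem[OF B(2)]
 note EM = spectral_in_vna[OF vna A ivl_borel] and FM = spectral_in_vna[OF vna B ivl_borel]
 have ct: "(%t. cnj (trn n t)) = trn n" for n by (simp add: trn_def fun_eq_iff)
 show Y: "trunc A B n : M" for n
  unfolding trunc_def by (intro alg_intros fc_in_vna vna A B bb_tr)
 show Ya: "cadj (trunc A B n) = trunc A B n" for n
  unfolding trunc_def cadj_plus[OF fc(1)[OF E(1) bb_tr] fc(1)[OF F(1) bb_tr]] fc_cnj[OF E(1) bb_tr] fc_cnj[OF F(1) bb_tr] ct ..
 have trn: "cmod (trn n t) <= real n" for t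
  unfolding trn_def by (auto simp: ivl_def indicator_def norm_mult simp del: of_real_mult)
 show "norm (trunc A B n x) <= 2 * real n * norm x" for x
  unfolding trunc_def using fc_norm_le[OF E(1) bb_tr trn, of x] fc_norm_le[OF F(1) bb_tr trn, of x]
  by (intro norm_triangle_le) simp
 have Ysa: "op_sa (op_graph (trunc A B n))" for n by (rule op_graph_sa[OF bcl[OF Y] Ya])
 show SM: "res (op_graph (trunc A B n)) z : M" if "Im z ~= 0" for n
  by (rule res_in_vna[OF vna op_graph_affiliated[OF vna Y] Ysa that])
 assume z: "Im z ~= 0"
 note Xsa = op_add_sa[OF A B]
 let ?X = "op_add A B" and ?p = "%n. spm A (ivl n)" and ?q = "%n. spm B (ivl n)"
 let ?e = "%n. Re (tr (%x. x - ?p n x)) + Re (tr (%x. x - ?q n x))"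
 define R where "R = res ?X z"
 define S where "S n = res (op_graph (trunc A B n)) z" for n
 have RM: "R : M" unfolding R_def by (rule res_in_vna[OF vna Xsa(2,1) z])
 have SM: "S n : M" for n unfolding S_def by (rule SM[OF z])
 let ?C = "2 / \<bar>Im z\<bar>"
 have est: "(cmod (tr R - tr (S n)))^2 <= ?C^2 * ?e n" for n
 proof -
  obtain r where r: "r : M" "projop r" "!!x. r x = x <-> ?p n x = x & ?q n x = x" "Re (tr (%x. x - r x)) <= ?e n"
  by (rule proj_meet[OF EM pvm(1)[OF E(1) ivl_borel] FM pvm(1)[OF F(1) ivl_borel], of n n]) (rule that)
  note rD = projD[OF r(2)]
  define a where "a x = R x - r (R x)" for x
  have aM: "a : M" unfolding a_def by (rule alg(6)[OF RM alg(9)[OF r(1) RM]])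
  obtain s f where s: "s : M" "f : M" "projop s" "projop f" "tr s = tr f"
  "!!x. s x = 0 <-> a x = 0" "!!c. f c = 0 <-> cadj a c = 0" by (rule support_range[OF aM]) (rule that)
  note sD = projD[OF s(3)]
  have aadj: "cadj a = (%x. cadj R (x - r x))"
  by (rule cadj_unique) (simp add: a_def cinner_simps cadj(2)[OF bcl[OF RM]] rD(4) bcl_diff[OF cadj(1)[OF bcl[OF RM]]])
  have "f c = 0" if "r c = c" for c using s(7)[of c] that by (simp add: aadj bcl_zero[OF cadj(1)[OF bcl[OF RM]]])
  from proj_kernel_le(2)[OF s(4) r(2) this]
  have ts: "Re (tr s) <= ?e n" using tr_mono[OF s(2) alg(10)[OF r(1)]] r(4) s(5) by simp
  define D where "D x = R x - S n x" for x
  have DM: "D : M" unfolding D_def by (rule alg(6)[OF RM SM])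
  note Db = bcl[OF DM]
  have D0: "D v = 0" if "a v = 0" for v
  proof -
  have rv: "r (R v) = R v" using that by (simp add: a_def)
  hence pq: "?p n (R v) = R v" "?q n (R v) = R v" using r(3) by blast+
  hence "(R v, fc (spm A) (trn n) (R v)) : A" "(R v, fc (spm B) (trn n) (R v)) : B"
  using pvm_op_ivl[OF E(1), of n "R v"] pvm_op_ivl[OF F(1), of n "R v"] E(2) F(2) by auto
  hence "(R v, trunc A B n (R v)) : {(x, y + z) | x y z. (x, y) : A & (x, z) : B}" unfolding trunc_def by blast
  hence 1: "(R v, trunc A B n (R v)) : ?X" unfolding op_add_def by (rule closure_subset[THEN subsetD])
  have 2: "(R v, v + z *c R v) : ?X" unfolding R_def by (rule res_in[OF Xsa(1) z])
  have "trunc A B n (R v) = v + z *c R v"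
  using saD(1)[OF Xsa(1)] 1 2 unfolding closed_dd_op_def by (blast dest: single_valuedD)
  hence "S n v = R v" unfolding S_def by (intro res_unique[OF Ysa z]) (auto simp: op_graph_def)
  thus ?thesis by (simp add: D_def)
  qed
  have Ds: "D x = D (s x)" for x
  proof -
  have "s (x - s x) = 0" by (simp add: bcl_diff[OF sD(1)] sD(2))
  hence "D (x - s x) = 0" using s(6) D0 by blast
  thus ?thesis by (simp add: bcl_diff[OF Db])
  qed
  have Dn: "norm (D x) <= ?C * norm (s x)" for x
  proof -
  have "norm (D (s x)) <= norm (R (s x)) + norm (S n (s x))" unfolding D_def by (rule norm_triangle_ineq4)
  also have "... <= norm (s x) / \<bar>Im z\<bar> + norm (s x) / \<bar>Im z\<bar>"
  unfolding R_def S_def by (intro add_mono res_norm Xsa Ysa z)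
  finally show ?thesis using Ds[of x] by simp
  qed
  have "cmod (tr D) ^ 2 <= Re (tr (%x. cadj D (D x)))" by (rule tr_sq_le[OF DM])
  also have "... <= Re (tr (%x. cr (?C^2) *c s x))"
  using posop_sq_diff[OF sD(1) Db Dn] by (intro tr_mono alg(7) s(1) alg(9)[OF adj[OF DM] DM]) (simp add: sD(2,3))
  also have "... = ?C^2 * Re (tr s)" unfolding tr_scale[OF s(1)] by (simp del: of_real_power)
  also have "... <= ?C^2 * ?e n" by (intro mult_left_mono ts) simp
  also have "tr D = tr R - tr (S n)" unfolding D_def by (rule tr_diff[OF RM SM])
  finally show ?thesis .
 qed
 have "(%n. ?C^2 * ?e n) ~> ?C^2 * (0 + 0)"
  by (intro tendsto_intros pvm_tau_tendsto A B)
 hence "(%n. sqrt (?C^2 * ?e n)) ~> sqrt (?C^2 * (0 + 0))" by (rule tendsto_real_sqrt)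
 hence "(%n. tr (S n)) ~> tr R"
  by (intro tendsto_of_bound[OF real_le_rsqrt[OF est]]) simp
 thus "(%n. tr (res (op_graph (trunc A B n)) z)) ~> tr (res ?X z)" unfolding R_def S_def by simp
qed

end

subsection \<open>Traces of words\<close>

definition letters :: "(nat \<times> (real => complex)) set"
 where "letters = {0, 1} \<times> {f. bb f}"

lemma letters_iff: "(i, f) : letters <-> i : {0, 1} & bb f"
 by (auto simp: letters_def)

primrec wop :: "(nat => 'h::complex_hilbert_space opgraph) => (nat \<times> (real => complex)) list => 'h => 'h"
 where "wop X [] = (%x. x)"
 | "wop X (a # w) = (%x. fc (spm (X (fst a))) (snd a) (wop X w x))"

lemma wop_append: "wop X (u @ v) x = wop X u (wop X v x)"
 by (induction u) simp_all

lemma not_distinct_adj_fst: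
 "\<not> distinct_adj (map fst w) ==> EX u i f g v. w = u @ (i, f) # (i, g) # v"
proof (induction w rule: induct_list012)
 case (3 a b w)
 show ?case
 proof (cases "fst a = fst b")
  case True
  hence "a # b # w = [] @ (fst a, snd a) # (fst a, snd b) # w" by (simp add: prod_eq_iff)
  thus ?thesis by blast
 next
  case False
  then obtain u i f g v where "b # w = u @ (i, f) # (i, g) # v" using 3 by auto
  hence "a # b # w = (a # u) @ (i, f) # (i, g) # v" by simp
  thus ?thesis by blast
 qed
qed auto

locale free_pair = fin_vna M tr for M :: "('h::complex_hilbert_space => 'h) set" and tr +
 fixes X :: "nat => 'h opgraph"
 assumes aff: "i : {0, 1} ==> X i : affiliated M" and sa: "i : {0, 1} ==> op_sa (X i)"
  and free: "free_algebras tr {0, 1} (%i. {fc (spm (X i)) f | f. bb f})"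
begin

lemma letter: "i : {0, 1} ==> bb f ==> fc (spm (X i)) f : M"
 by (intro fc_in_vna vna aff sa)

lemma X01: "X 0 : affiliated M" "op_sa (X 0)" "X 1 : affiliated M" "op_sa (X 1)"
 by (simp_all add: aff sa)

lemmas pvmX = spectral_theorem(1)[OF sa]

lemma wop_in: "set w <= letters ==> wop X w : M"
proof (induction w)
 case (Cons a w)
 thus ?case unfolding wop.simps by (intro alg(9)[OF letter]) (auto simp: letters_def)
qed (simp add: alg)

lemma wop_merge:
 assumes "i : {0, 1}" "bb f" "bb g"
 shows "wop X (u @ (i, f) # (i, g) # v) = wop X (u @ (i, %t. f t * g t) # v)"
 by (rule ext) (simp add: wop_append fc_mult[OF pvmX[OF assms(1)] assms(2,3)])

lemma wop_center:
 assumes u: "set u <= letters" and v: "set v <= letters" and f: "i : {0, 1}" "bb f"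
 shows "tr (wop X (u @ (i, f) # v)) = tr (wop X (u @ (i, %t. f t - c) # v)) + c * tr (wop X (u @ v))"
proof -
 have "wop X (u @ (i, f) # v) = (%x. wop X (u @ (i, %t. f t - c) # v) x + c *c wop X (u @ v) x)"
  by (rule ext) (simp add: wop_append fc_diff[OF pvmX[OF f(1)] f(2) bb_const] fc_const[OF pvmX[OF f(1)]]
  bcl_simps[OF bcl[OF wop_in[OF u]]])
 moreover have "wop X (u @ (i, %t. f t - c) # v) : M" "wop X (u @ v) : M"
  using u v letters_iff[of i "%t. f t - c"] f(1) bb_diff[OF f(2) bb_const] by (auto intro!: wop_in simp del: insert_iff)
 ultimately show ?thesis using alg(7) by (simp add: tr_add tr_scale)
qed

lemma wop_centered:
 assumes w: "set w <= letters" "w ~= []" "distinct_adj (map fst w)"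
  and c: "!!i f. (i, f) : set w ==> tr (fc (spm (X i)) f) = 0"
 shows "tr (wop X w) = 0"
proof -
 let ?as = "map (%a. fc (spm (X (fst a))) (snd a)) w"
 have "wop X w = foldr (o) ?as id" by (induction w) (simp_all add: id_def comp_def)
 moreover have "tr (foldr (o) ?as id) = 0"
 proof (rule free[unfolded free_algebras_def, rule_format, of "map fst w"], intro conjI allI impI)
  fix k assume "k < length (map fst w)"
  hence "w ! k : set w" by simp
  moreover from this have "bb (snd (w ! k))" using w(1) by (force simp: letters_def)
  ultimately show "?as ! k : {fc (spm (X (map fst w ! k))) f | f. bb f}" "tr (?as ! k) = 0"
  using c[of "fst (w ! k)" "snd (w ! k)"] `k < length (map fst w)` by auto
 qed (use w in \<open>auto simp: letters_def\<close>)
 ultimately show ?thesis by simp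
qed

end

text \<open>Corresponding polynomials in the letters of both sides. A relation is used because an
  operator does not determine the word that produced it.\<close>

inductive wpair :: "(nat => 'h::complex_hilbert_space opgraph) => (nat => 'k::complex_hilbert_space opgraph) =>
  ('h => 'h) => ('k => 'k) => bool" for X Y
 where word: "set w <= letters ==> wpair X Y (wop X w) (wop Y w)"
 | add: "wpair X Y a a' ==> wpair X Y b b' ==> wpair X Y (%x. a x + b x) (%x. a' x + b' x)"
 | scale: "wpair X Y a a' ==> wpair X Y (%x. c *c a x) (%x. c *c a' x)"

locale free_pairs = P: free_pair M tr X + Q: free_pair N sg Y
 for M :: "('h::complex_hilbert_space => 'h) set" and tr X and N :: "('k::complex_hilbert_space => 'k) set" and sg Y +
 assumes distr: "i : {0, 1} ==> op_distr tr (X i) = op_distr sg (Y i)"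
begin

lemma letter_trace:
 assumes "i : {0, 1}" "bb f"
 shows "tr (fc (spm (X i)) f) = sg (fc (spm (Y i)) f)"
 using P.op_distr(5)[OF P.aff P.sa] Q.op_distr(5)[OF Q.aff Q.sa] assms distr by metis

definition noncentered :: "nat \<times> (real => complex) => bool"
 where "noncentered a <-> tr (fc (spm (X (fst a))) (snd a)) ~= 0"

text \<open>Freeness determines the trace of a word: merge neighbouring letters of the same algebra, then center the letters.\<close>

lemma word_trace: "set w <= letters ==> tr (wop X w) = sg (wop Y w)"
\<comment> \<open>Merging removes one letter and adds at most one to the count of noncentered
  letters, hence the weight 2 on the length; centering lowers that count by one or deletes a
  letter.\<close>
proof (induction w rule: measure_induct_rule[where f = "%w. 2 * length w + length (filter noncentered w)"])
 case (less w)
 consider "w = []" | "w ~= []" "distinct_adj (map fst w)" "\<not> (EX a:set w. noncentered a)"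
  | u i f g v where "w = u @ (i, f) # (i, g) # v" | a where "a : set w" "noncentered a"
  using not_distinct_adj_fst[of w] by blast
 thus ?case
 proof cases
  case 1
  thus ?thesis by (simp add: P.tr_id Q.tr_id)
 next
  case 2
  hence c: "tr (fc (spm (X i)) f) = 0" if "(i, f) : set w" for i f
  using that by (force simp: noncentered_def)
  have "sg (fc (spm (Y i)) f) = 0" if "(i, f) : set w" for i f
  proof -
  have "i : {0, 1}" "bb f" using less.prems that letters_iff[of i f] by auto
  thus ?thesis using letter_trace[of i f] c[OF that] by simp
  qed
  thus ?thesis using P.wop_centered[OF less.prems 2(1,2) c] Q.wop_centered[OF less.prems 2(1,2)] by simp
 next
  case 3
  hence l: "i : {0, 1}" "bb f" "bb g" "set u <= letters" "set v <= letters" using less.prems by (auto simp: letters_iff)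
  let ?w = "u @ (i, %t. f t * g t) # v"
  have "tr (wop X ?w) = sg (wop Y ?w)"
  by (rule less.IH) (use 3 l letters_iff[of i "%t. f t * g t"] bb_mult[OF l(2,3)] in \<open>auto simp del: insert_iff\<close>)
  thus ?thesis unfolding 3 P.wop_merge[OF l(1-3)] Q.wop_merge[OF l(1-3)] .
 next
  case 4
  obtain i f where a: "a = (i, f)" by (cases a)
  obtain u v where w: "w = u @ (i, f) # v" using split_list[OF 4(1)] unfolding a by blast
  have l: "i : {0, 1}" "bb f" "set u <= letters" "set v <= letters" using less.prems w by (auto simp: letters_iff)
  define c where "c = tr (fc (spm (X i)) f)"
  let ?g = "%t. f t - c"
  have "fc (spm (X i)) ?g = (%x. fc (spm (X i)) f x - c *c x)"
  by (simp only: fc_diff[OF P.pvmX[OF l(1)] l(2) bb_const] fc_const[OF P.pvmX[OF l(1)]])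
  hence g: "\<not> noncentered (i, ?g)"
  using P.tr_diff[OF P.letter[OF l(1,2)] P.alg(4)] by (simp add: noncentered_def P.tr_const c_def)
  have 1: "tr (wop X (u @ (i, ?g) # v)) = sg (wop Y (u @ (i, ?g) # v))"
  by (rule less.IH) (use g 4(2) l letters_iff[of i ?g] bb_diff[OF l(2) bb_const] in \<open>auto simp: w a simp del: insert_iff\<close>)
  have 2: "tr (wop X (u @ v)) = sg (wop Y (u @ v))"
  by (rule less.IH) (use l in \<open>auto simp: w\<close>)
  show ?thesis unfolding w P.wop_center[OF l(3,4,1,2), of c] Q.wop_center[OF l(3,4,1,2), of c] 1 2 ..
 qed
qed

lemma wpair_in: "wpair X Y a a' ==> a : M & a' : N & tr a = sg a'"
 by (induction rule: wpair.induct)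
  (simp_all add: P.wop_in Q.wop_in word_trace P.alg(5,7) Q.alg(5,7) P.tr_add Q.tr_add P.tr_scale Q.tr_scale)

lemma wpair_comp:
 assumes "wpair X Y a a'" and b: "wpair X Y b b'"
 shows "wpair X Y (%x. a (b x)) (%x. a' (b' x))"
 using assms(1)
proof induction
 case (word w)
 show ?case using b
 proof induction
  case (word v)
  thus ?case using wpair.word[of "w @ v" X Y] `set w <= letters` by (simp add: wop_append[abs_def])
 next
  case (add c c' d d')
  thus ?case using wpair.add by (simp add: bcl_add[OF P.bcl[OF P.wop_in[OF word]]] bcl_add[OF Q.bcl[OF Q.wop_in[OF word]]])
 next
  case (scale c c' k)
  thus ?case using wpair.scale by (simp add: bcl_scale[OF P.bcl[OF P.wop_in[OF word]]] bcl_scale[OF Q.bcl[OF Q.wop_in[OF word]]])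
 qed
qed (auto intro: wpair.add wpair.scale)

lemma wpair_id: "wpair X Y (%x. x) (%x. x)"
 using wpair.word[of "[]" X Y] by simp

lemma wpair_diff: "wpair X Y a a' ==> wpair X Y b b' ==> wpair X Y (%x. a x - b x) (%x. a' x - b' x)"
 using wpair.add[OF _ wpair.scale[of X Y b b' "-1"], of a a'] by simp

lemma wpair_trunc: "wpair X Y (P.trunc (X 0) (X 1) n) (Q.trunc (Y 0) (Y 1) n)"
proof -
 have "wpair X Y (fc (spm (X i)) (trn n)) (fc (spm (Y i)) (trn n))" if "i : {0, 1}" for i
  using wpair.word[of "[(i, trn n)]" X Y] that bb_tr by (simp add: letters_def)
 thus ?thesis unfolding P.trunc_def[abs_def] Q.trunc_def[abs_def] by (intro wpair.add) simp_all
qed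

text \<open>The Neumann approximants are corresponding polynomials in the letters, so their traces
  agree, and both sides have the same error bound.\<close>

lemma res_trunc_trace:
 assumes z: "Im z ~= 0"
 shows "tr (res (op_graph (P.trunc (X 0) (X 1) n)) z) = sg (res (op_graph (Q.trunc (Y 0) (Y 1) n)) z)"
proof -
 let ?A = "P.trunc (X 0) (X 1) n" and ?B = "Q.trunc (Y 0) (Y 1) n"
 note A = P.trunc(1-3)[OF P.X01, of n] and B = Q.trunc(1-3)[OF Q.X01, of n]
 define K rh where "K = (2 * real n + cmod z + 1)^2" and "rh = 1 - (Im z)^2 / (2 * real n + cmod z + 1)^2"
 define QA where "QA v = v - cr (1 / K) *c (?A (?A v - z *c v) - cnj z *c (?A v - z *c v))" for v
 define QB where "QB v = v - cr (1 / K) *c (?B (?B v - z *c v) - cnj z *c (?B v - z *c v))" for v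
 define TA where "TA k w = cr (1 / K) *c (\<Sum>j<k. (QA ^^ j) (?A w - cnj z *c w))" for k w
 define TB where "TB k w = cr (1 / K) *c (\<Sum>j<k. (QB ^^ j) (?B w - cnj z *c w))" for k w
 have n0: "0 <= 2 * real n" by simp
 note nA = neumann_resolvent[OF P.bcl[OF A(1)] A(2) A(3) n0 z, folded K_def rh_def, folded QA_def, folded TA_def]
  and nB = neumann_resolvent[OF Q.bcl[OF B(1)] B(2) B(3) n0 z, folded K_def rh_def, folded QB_def, folded TB_def]
 have D: "wpair X Y (%v. ?A v - k *c v) (%v. ?B v - k *c v)" for k
  by (intro wpair_diff wpair_trunc wpair.scale wpair_id)
 have Q: "wpair X Y QA QB"
  unfolding QA_def QB_def by (intro wpair_diff wpair.scale wpair_id wpair_comp[OF wpair_trunc D] D)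
 have Qj: "wpair X Y (QA ^^ j) (QB ^^ j)" for j
 proof (induction j)
  case (Suc j)
  thus ?case using wpair_comp[OF Q Suc] by (simp add: comp_def)
 qed (simp add: wpair_id id_def)
 have "wpair X Y (%w. \<Sum>j<k. (QA ^^ j) (?A w - cnj z *c w)) (%w. \<Sum>j<k. (QB ^^ j) (?B w - cnj z *c w))" for k
 proof (induction k)
  case 0
  show ?case using wpair.scale[OF wpair_id, of 0] by simp
 next
  case (Suc k)
  thus ?case unfolding sum.lessThan_Suc by (intro wpair.add wpair_comp[OF Qj D])
 qed
 hence T: "wpair X Y (TA k) (TB k)" for k unfolding TA_def TB_def by (intro wpair.scale)
 note RA = P.trunc(4)[OF P.X01 z, of n] and RB = Q.trunc(4)[OF Q.X01 z, of n]
 let ?dl = "tr (res (op_graph ?A) z) - sg (res (op_graph ?B) z)"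
 have "cmod ?dl <= 2 * (rh ^ k / \<bar>Im z\<bar>)" for k
 proof -
  have TM: "TA k : M" "TB k : N" "tr (TA k) = sg (TB k)" using wpair_in[OF T] by blast+
  have rh: "rh ^ k / \<bar>Im z\<bar> >= 0" using nA(1) by simp
  have "cmod (tr (%w. res (op_graph ?A) z w - TA k w)) <= rh ^ k / \<bar>Im z\<bar>"
  by (rule P.tr_bound[OF P.alg(6)[OF RA TM(1)] nA(3) rh])
  moreover have "cmod (sg (%w. res (op_graph ?B) z w - TB k w)) <= rh ^ k / \<bar>Im z\<bar>"
  by (rule Q.tr_bound[OF Q.alg(6)[OF RB TM(2)] nB(3) rh])
  ultimately have "cmod (tr (res (op_graph ?A) z) - tr (TA k)) <= rh ^ k / \<bar>Im z\<bar>"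
  "cmod (sg (res (op_graph ?B) z) - sg (TB k)) <= rh ^ k / \<bar>Im z\<bar>"
  using P.tr_diff[OF RA TM(1)] Q.tr_diff[OF RB TM(2)] by simp_all
  thus ?thesis
  using norm_triangle_ineq4[of "tr (res (op_graph ?A) z) - tr (TA k)" "sg (res (op_graph ?B) z) - sg (TB k)"] TM(3) by simp
 qed
 moreover have "(%k. 2 * (rh ^ k / \<bar>Im z\<bar>)) ~> 2 * (0 / \<bar>Im z\<bar>)"
  by (intro tendsto_intros LIMSEQ_realpow_zero nA) (use z in simp)
 ultimately have "cmod ?dl <= 2 * (0 / \<bar>Im z\<bar>)" by (intro LIMSEQ_le_const) blast+
 thus ?thesis by simp
qed

theorem op_distr_add_eq: "op_distr tr (op_add (X 0) (X 1)) = op_distr sg (op_add (Y 0) (Y 1))"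
proof -
 note XA = P.op_add_sa[OF P.X01] and YB = Q.op_add_sa[OF Q.X01]
 note dX = P.op_distr[OF XA(2,1)] and dY = Q.op_distr[OF YB(2,1)]
 show ?thesis
 proof (rule stieltjes_unique[OF dX(1,3) dY(1,3)])
  fix z :: complex assume "Im z > 0"
  hence z: "Im z ~= 0" by simp
  have "tr (res (op_add (X 0) (X 1)) z) = sg (res (op_add (Y 0) (Y 1)) z)"
  using P.trunc(5)[OF P.X01 z] Q.trunc(5)[OF Q.X01 z] LIMSEQ_unique
  unfolding res_trunc_trace[OF z] by auto
  thus "(\<integral>t. rz z t \<partial>op_distr tr (op_add (X 0) (X 1))) = (\<integral>t. rz z t \<partial>op_distr sg (op_add (Y 0) (Y 1)))"
  unfolding res_fc[OF XA(1) z] res_fc[OF YB(1) z] dX(5)[OF bb_rz[OF z]] dY(5)[OF bb_rz[OF z]] .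
 qed
qed

end

section \<open>Two-by-two matrices over a finite von Neumann algebra\<close>

definition slot :: "bool => 'h => 'h \<times> 'h::complex_hilbert_space" where "slot p a = (if p then (0, a) else (a, 0))"
definition coord :: "bool => 'h \<times> 'h => 'h::complex_hilbert_space" where "coord p v = (if p then snd v else fst v)"
definition entry :: "bool => bool => ('h \<times> 'h => 'h \<times> 'h) => 'h => 'h::complex_hilbert_space"
 where "entry p q X a = coord p (X (slot q a))"

lemma bcl_slot: "bcl (slot p)" and bcl_coord: "bcl (coord p)"
 unfolding slot_def[abs_def] coord_def[abs_def] by (cases p; simp add: bcl_fst bcl_snd bcl_Pair)+

lemma slot_coord: "slot False (coord False v) + slot True (coord True v) = v"
 by (simp add: slot_def coord_def)

lemma coord_slot: "coord p (slot q a) = (if p = q then a else 0)"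
 by (simp add: slot_def coord_def)

lemma cinner_slot: "cinner (slot p a) v = cinner a (coord p v)" "cinner v (slot p a) = cinner (coord p v) a"
 by (cases v; simp add: slot_def coord_def)+

lemma coord_ext: "(!!p. coord p u = coord p v) ==> u = v"
 using slot_coord by metis

lemma M2_iff: "X : M2 N <-> bcl X & (ALL p q. entry p q X : N)"
 unfolding M2_def entry_def[abs_def] slot_def coord_def by (simp add: all_bool_eq) blast

lemma bcl_entry: "bcl X ==> bcl (entry p q X)"
 unfolding entry_def[abs_def] by (rule bcl_comp(2)[OF bcl_coord bcl_comp(2)[OF _ bcl_slot]])

lemma cadj_entry: assumes "bcl X" shows "cadj (entry p q X) = entry q p (cadj X)"
 by (rule cadj_unique) (simp add: entry_def cinner_slot[symmetric] cadj(2)[OF assms])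

lemma entry_id: "entry p q (%x. x) = (%x. if p = q then x else 0)" "entry p q id = (%x. if p = q then x else 0)"
 by (simp_all add: entry_def fun_eq_iff coord_slot)

lemma entry_comp:
 assumes A: "bcl A"
 shows "entry p q (%x. A (B x)) = (%x. entry p False A (entry False q B x) + entry p True A (entry True q B x))"
proof
 fix x
 have "A (B (slot q x)) = A (slot False (coord False (B (slot q x)))) + A (slot True (coord True (B (slot q x))))"
  using slot_coord[of "B (slot q x)"] bcl_add[OF A] by metis
 thus "entry p q (%x. A (B x)) x = entry p False A (entry False q B x) + entry p True A (entry True q B x)"
  by (simp add: entry_def bcl_add[OF bcl_coord])
qed

lemma entry_lin:
 "entry p q (%x. X x + Y x) = (%x. entry p q X x + entry p q Y x)"
 "entry p q (%x. X x - Y x) = (%x. entry p q X x - entry p q Y x)"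
 "entry p q (%x. c *c X x) = (%x. c *c entry p q X x)"
 by (simp_all add: entry_def fun_eq_iff bcl_simps[OF bcl_coord])

lemma entry_ext:
 assumes "bcl X" "!!p q x. entry p q X x = 0" shows "X v = 0"
proof -
 have "X (slot q a) = 0" for q a
  by (rule coord_ext) (use assms(2) in \<open>simp add: entry_def bcl_zero[OF bcl_coord]\<close>)
 thus ?thesis using slot_coord[of v] bcl_add[OF assms(1), of "slot False (coord False v)" "slot True (coord True v)"] by simp
qed

lemma posop_entry: "posop X ==> posop (entry p p X)"
 unfolding posop_def by (simp only: bcl_entry) (simp only: entry_def cinner_slot(1)[symmetric] simp_thms)

lemma uminus_abs_borel: "(uminus :: real => real) : borel_measurable borel" "(abs :: real => real) : borel_measurable borel"
 by (intro borel_measurable_continuous_onI continuous_intros)+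

definition tr2 :: "(('h => 'h) => complex) => ('h \<times> 'h => 'h \<times> 'h::complex_hilbert_space) => complex"
 where "tr2 tr X = (tr (entry False False X) + tr (entry True True X)) / 2"

context fin_vna begin

lemma M2D: assumes "X : M2 M" shows "bcl X" "entry p q X : M"
 using assms by (simp_all add: M2_iff)

lemma tr2_comp:
 assumes A: "A : M2 M" and B: "B : M2 M"
 shows "tr2 tr (%x. A (B x)) = (tr (%x. entry False False A (entry False False B x)) + tr (%x. entry False True A (entry True False B x))
  + (tr (%x. entry True False A (entry False True B x)) + tr (%x. entry True True A (entry True True B x)))) / 2"
 unfolding tr2_def entry_comp[OF M2D(1)[OF A], of _ _ B]
 by (simp only: tr_add alg(9)[OF M2D(2)[OF A] M2D(2)[OF B]])

lemma fin_vna_M2: "fin_vna (M2 M) (tr2 tr)"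
proof
 note e = M2D(2)
 show "vna (M2 M)" by (rule vna_M2[OF vna])
 show "tr2 tr (%x. a x + b x) = tr2 tr a + tr2 tr b" if "a : M2 M" "b : M2 M" for a b
  using e[OF that(1)] e[OF that(2)] by (simp add: tr2_def entry_lin tr_add field_simps)
 show "tr2 tr (%x. c *c a x) = c * tr2 tr a" if "a : M2 M" for c a
  using e[OF that] by (simp add: tr2_def entry_lin tr_scale field_simps)
 show "tr2 tr a : \<real>\<^sub>\<ge>\<^sub>0" if "a : M2 M" "posop a" for a
  using tr_posop[OF e[OF that(1)] posop_entry[OF that(2)], of False] tr_posop[OF e[OF that(1)] posop_entry[OF that(2)], of True]
  by (simp add: tr2_def complex_nonneg_Reals_iff)
 show "tr2 tr (%x. x) = 1" by (simp add: tr2_def entry_id tr_id)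
 show "a = (%_. 0)" if a: "a : M2 M" and z: "tr2 tr (%x. cadj a (a x)) = 0" for a
 proof -
  let ?t = "%p q. tr (%x. cadj (entry p q a) (entry p q a x))"
  have "?t False False + ?t True False + (?t False True + ?t True True) = 0"
  using z unfolding tr2_comp[OF vna_adj[OF vna_M2[OF vna] a] a] cadj_entry[OF M2D(1)[OF a]] by simp
  moreover have nn: "0 <= Re (?t p q)" "Im (?t p q) = 0" for p q
  using tr_adj_comp[OF e[OF a], of p q] by (simp_all add: complex_nonneg_Reals_iff)
  ultimately have "Re (?t False False) + Re (?t True False) + (Re (?t False True) + Re (?t True True)) = 0"
  by (metis plus_complex.sel(1) zero_complex.sel(1))
  hence "ALL p q. Re (?t p q) = 0"
  using nn(1)[of False False] nn(1)[of True False] nn(1)[of False True] nn(1)[of True True]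
  unfolding all_bool_eq by linarith
  hence "?t p q = 0" for p q using nn(2) by (simp add: complex_eq_iff)
  hence "entry p q a = (%_. 0)" for p q using faithful[OF e[OF a]] by blast
  thus ?thesis using entry_ext[OF M2D(1)[OF a]] by (auto simp: fun_eq_iff)
 qed
 show "tr2 tr (%x. a (b x)) = tr2 tr (%x. b (a x))" if "a : M2 M" "b : M2 M" for a b
  unfolding tr2_comp[OF that] tr2_comp[OF that(2,1)]
  using tracial[OF e[OF that(1)] e[OF that(2)]] by (simp add: add_ac)
 show "(%n. tr2 tr (f n)) ~> tr2 tr a"
  if f: "!!n. f n : M2 M" "!!n. posop (f n)" "!!n. posop (%x. f (Suc n) x - f n x)" "!!x. (%n. f n x) ~> a x" "a : M2 M" for f a
 proof -
  have "(%n. tr (entry p p (f n))) ~> tr (entry p p a)" for p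
  proof (rule normal)
  show "posop (%x. entry p p (f (Suc n)) x - entry p p (f n) x)" for n
  using posop_entry[OF f(3), of p n] by (simp add: entry_lin)
  show "(%n. entry p p (f n) x) ~> entry p p a x" for x
  unfolding entry_def by (rule bcl_tendsto[OF bcl_coord f(4)])
  qed (use f in \<open>auto intro: posop_entry e\<close>)
  thus ?thesis unfolding tr2_def by (intro tendsto_intros) auto
 qed
qed

text \<open>\<open>op_add_sa\<close> covers self-adjoint operators only; for \<open>S\<close> and
  \<open>T\<close> it is applied to their matrices. Up to a permutation of coordinates, the graph of
  the algebraic sum of the matrices is the product of the sum graphs for \<open>S\<close>,
  \<open>T\<close> and for their adjoints, and closure commutes with products.\<close>

lemma op_add_hat:
 assumes S: "S : affiliated M" and T: "T : affiliated M"
 shows "closed_dd_op (op_add S T)" "hat (op_add S T) = op_add (hat S) (hat T)" "op_add (hat S) (hat T) : affiliated (M2 M)"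
proof -
 interpret M2: fin_vna "M2 M" "tr2 tr" by (rule fin_vna_M2)
 note hS = hat_affiliated[OF vna S] hat_sa[OF affiliatedD(1)[OF S]] and hT = hat_affiliated[OF vna T] hat_sa[OF affiliatedD(1)[OF T]]
 define X Y Z where "X = op_add (hat S) (hat T)" and "Y = op_add S T" and "Z = op_add (op_adj S) (op_adj T)"
 have sa: "op_sa X" and "X : affiliated (M2 M)" using M2.op_add_sa[OF hS hT] by (simp_all add: X_def)
 thus "op_add (hat S) (hat T) : affiliated (M2 M)" by (simp add: X_def)
 let ?L = "%A B. {(x, y + z) | x y z. (x, y) : A & (x, z) : B}"
 let ?f = "%((b, c), (a, d)). ((a, b), (c, d))" and ?g = "%((a, b), (c, d)). ((b, c), (a, d))"
 have eq: "?L (hat S) (hat T) = ?f ` (?L S T \<times> ?L (op_adj S) (op_adj T))"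
  unfolding hat_def by (auto simp: image_iff) blast+
 have "?f ` closure (?L S T \<times> ?L (op_adj S) (op_adj T)) <= closure (?L (hat S) (hat T))"
  unfolding eq by (intro image_closure_subset closure_subset) (auto simp: split_beta intro!: continuous_intros)
 moreover have "?g ` closure (?L (hat S) (hat T)) <= closure (?L S T \<times> ?L (op_adj S) (op_adj T))"
  unfolding eq by (intro image_closure_subset subset_trans[OF _ closure_subset]) (auto simp: split_beta intro!: continuous_intros, blast+)
 ultimately have X: "((a, b), (c, d)) : X <-> (b, c) : Y & (a, d) : Z" for a b c d
  unfolding X_def Y_def Z_def op_add_def closure_Times image_subset_iff by (force simp del: mem_Collect_eq)
 note g = glinD[OF saD(6)[OF sa]]
 have z0: "(0, 0) : Y" "(0, 0) : Z" using g(1) X[of 0 0 0 0] by (simp_all add: zero_prod_def)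
 have Y: "(b, c) : Y <-> ((0, b), (c, 0)) : X" for b c using X z0 by blast
 show dd: "closed_dd_op (op_add S T)"
  unfolding Y_def[symmetric] closed_dd_op_def
 proof (intro conjI allI impI)
  show "closed Y" by (simp add: Y_def op_add_def)
  show "single_valued Y"
  proof (rule single_valuedI)
  fix x y z assume "(x, y) : Y" "(x, z) : Y"
  hence "((0, x), (y, 0)) : X" "((0, x), (z, 0)) : X" by (simp_all only: Y)
  thus "y = z" using single_valuedD[OF saD(4)[OF sa]] by blast
  qed
  have "b : closure (Domain Y)" for b
  proof -
  have "(0, b) : closure (Domain X)" using saD(5)[OF sa] by blast
  then obtain f where f: "!!n. f n : Domain X" "f ~> (0, b)" unfolding closure_sequential by blast
  have "snd (f n) : Domain Y" for n
  proof -
  obtain v where v: "(f n, v) : X" using f(1) by blast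
  thus ?thesis using X[of "fst (f n)" "snd (f n)" "fst v" "snd v"] by auto
  qed
  thus ?thesis unfolding closure_sequential using tendsto_snd[OF f(2)] by (intro exI[of _ "%n. snd (f n)"]) simp
  qed
  thus "closure (Domain Y) = UNIV" by blast
  show "(x + x', y + y') : Y" if "(x, y) : Y" "(x', y') : Y" for x y x' y'
  using that g(2)[of "(0, x)" "(y, 0)" "(0, x')" "(y', 0)"] unfolding Y by simp
  show "(c *c x, c *c y) : Y" if "(x, y) : Y" for c x y
  using that g(4)[of "(0, x)" "(y, 0)" c] unfolding Y by simp
 qed (rule z0)
 \<comment> \<open>Self-adjointness of \<open>X\<close> identifies the closed sum of the adjoints
   with the adjoint of the closed sum.\<close>
 have Z: "(a, d) : op_adj Y <-> (a, d) : Z" for a d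
 proof -
  have "(a, d) : op_adj Y <-> ((a, 0), (0, d)) : op_adj X"
  proof
  assume A: "(a, d) : op_adj Y"
  show "((a, 0), (0, d)) : op_adj X"
  unfolding in_op_adj
  proof (intro allI impI)
  fix p q assume "(p, q) : X"
  hence "(snd p, fst q) : Y" using X[of "fst p" "snd p" "fst q" "snd q"] by simp
  hence "cinner a (fst q) = cinner d (snd p)" using A unfolding in_op_adj by blast
  thus "cinner (a, 0) q = cinner (0, d) p" by (cases p, cases q) simp
  qed
  next
  assume A: "((a, 0), (0, d)) : op_adj X"
  have "cinner a c = cinner d b" if "(b, c) : Y" for b c
  proof -
  have "((0, b), (c, 0)) : X" using that by (simp only: Y)
  from A[unfolded in_op_adj, rule_format, OF this] show ?thesis by simp
  qed
  thus "(a, d) : op_adj Y" unfolding in_op_adj by blast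
  qed
  thus ?thesis using saD(2)[OF sa] X z0 by simp
 qed
 show "hat (op_add S T) = op_add (hat S) (hat T)"
  unfolding Y_def[symmetric] X_def[symmetric]
 proof (rule set_eqI)
  fix p :: "('h \<times> 'h) \<times> ('h \<times> 'h)" obtain a b c d where "p = ((a, b), (c, d))" by (metis prod.exhaust)
  thus "p : hat Y <-> p : X" by (simp only: in_hat X Z)
 qed
qed

text \<open>The partial isometry of the polar decomposition interchanges the two diagonal corners.\<close>

lemma diag_trace:
 assumes Y: "closed_dd_op Y" and aff: "hat Y : affiliated (M2 M)" and f: "bb f"
 shows "tr (entry False False (fc (spm (hat Y)) f)) = tr (entry True True (fc (spm (hat Y)) f))"
proof -
 interpret H: polar Y by unfold_locales (rule Y)
 note Esm = H.E_def[symmetric]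
 let ?F = "fc H.E f" and ?Z = "H.E {0}"
 have mem: "entry p q (fc H.E g) : M" if "bb g" for p q g
  using fc_in_vna[OF vna_M2[OF vna] aff hat_sa[OF Y] that] unfolding Esm M2_iff by blast
 have WM: "entry p q H.W : M" for p q unfolding H.W_def by (rule mem[OF bb_sg])
 have ZM: "entry p q ?Z : M" for p q using mem[OF bb_indicator[of "{0}"]] unfolding fc_ind[OF H.E, of "{0}", simplified] by simp
 have U: "H.U = entry False True H.W" "H.U' = entry True False H.W"
  by (auto simp: fun_eq_iff H.U_def H.U'_def entry_def slot_def coord_def)
 have UM: "H.U : M" "H.U' : M" unfolding U by (rule WM)+
 have W0: "entry p p H.W x = 0" for p x
  using H.W_off by (cases p) (simp_all add: entry_def slot_def coord_def)
 note b = fc(1)[OF H.E f]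
 \<comment> \<open>Away from 0 the factors \<open>sgx\<close> cancel; at 0 they vanish, and the
   value \<open>f 0\<close> is carried by the kernel projection \<open>?Z\<close>.\<close>
 have dec: "?F = (%x. H.W (?F (H.W x)) + f 0 *c ?Z x)"
 proof -
  have "f = (%t. sgx t * (f t * sgx t) + f 0 * indicator {0} t)"
  by (auto simp: fun_eq_iff sgx_def indicator_def sgn_if)
  hence "?F = fc H.E (%t. sgx t * (f t * sgx t) + f 0 * indicator {0} t)" by simp
  also have "... = (%x. fc H.E (%t. sgx t * (f t * sgx t)) x + f 0 *c ?Z x)"
  by (simp add: fc_add[OF H.E] fc_cmult[OF H.E] fc_ind[OF H.E] bb_mult bb_sg f bb_cmult bb_indicator)
  finally show ?thesis unfolding H.W_def fc_mult[OF H.E f bb_sg] fc_mult[OF H.E bb_sg bb_mult[OF f bb_sg]] .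
 qed
 have FW: "?F (H.W (H.W x)) = ?F x - f 0 *c ?Z x" for x
 proof -
  have "?F (?Z x) = f 0 *c ?Z x"
  proof -
  have "(%t. f t * indicator {0} t) = (%t. f 0 * indicator {0} t)" by (auto simp: fun_eq_iff indicator_def)
  thus ?thesis using fc_mult[OF H.E f bb_indicator[of "{0}"], of x]
  by (simp add: fc_cmult[OF H.E bb_indicator] fc_ind[OF H.E])
  qed
  thus ?thesis by (simp add: H.W_sq bcl_diff[OF b])
 qed
 let ?e = "%p q. entry p q ?F"
 have 1: "?e False False = (%x. H.U (?e True True (H.U' x)) + f 0 *c entry False False ?Z x)"
  apply (subst dec) unfolding entry_lin entry_comp[OF H.Wb, of _ _ "%x. ?F (H.W x)"] entry_comp[OF b, of _ _ H.W] U by (simp add: W0 bcl_zero[OF bcl_entry[OF H.Wb]] bcl_zero[OF bcl_entry[OF b]])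
 have 2: "(%x. ?e True True (H.U' (H.U x))) = (%x. ?e True True x - f 0 *c entry True True ?Z x)"
 proof -
  have "entry True True (%x. ?F (H.W (H.W x))) = (%x. ?e True True (H.U' (H.U x)))"
  unfolding entry_comp[OF b, of _ _ "%x. H.W (H.W x)"] entry_comp[OF H.Wb, of _ _ H.W] U by (simp add: W0 bcl_zero[OF bcl_entry[OF H.Wb]] bcl_zero[OF bcl_entry[OF b]])
  thus ?thesis unfolding FW by (simp add: entry_lin)
 qed
 have Z: "(%x. x - H.U (H.U' x)) = entry False False ?Z" "(%x. x - H.U' (H.U x)) = entry True True ?Z"
 proof -
  have Zd: "?Z = (%x. x - H.W (H.W x))" by (simp add: fun_eq_iff H.W_sq)
  show "(%x. x - H.U (H.U' x)) = entry False False ?Z" "(%x. x - H.U' (H.U x)) = entry True True ?Z"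
  unfolding Zd entry_lin entry_comp[OF H.Wb, of _ _ H.W] U by (simp_all add: W0 entry_id)
 qed
 have tZ: "tr (entry False False ?Z) = tr (entry True True ?Z)"
  unfolding Z[symmetric] tr_compl[OF alg(9)[OF UM]] tr_compl[OF alg(9)[OF UM(2,1)]] using tracial[OF UM] by simp
 have "tr (?e False False) = tr (%x. H.U (?e True True (H.U' x))) + f 0 * tr (entry False False ?Z)"
  by (subst 1) (simp only: tr_add[OF alg(9)[OF UM(1) alg(9)[OF mem[OF f] UM(2)]] alg(7)[OF ZM]] tr_scale[OF ZM])
 also have "tr (%x. H.U (?e True True (H.U' x))) = tr (%x. ?e True True (H.U' (H.U x)))"
  by (rule tracial[OF UM(1) alg(9)[OF mem[OF f] UM(2)]])
 also have "... = tr (?e True True) - f 0 * tr (entry True True ?Z)"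
  unfolding 2 tr_diff[OF mem[OF f] alg(7)[OF ZM]] tr_scale[OF ZM] ..
 finally show ?thesis unfolding tZ Esm by simp
qed

text \<open>The law \<open>rh\<close> of \<open>hat Y\<close> is symmetric because of
  \<open>flip\<close>, and the law of the absolute value is its image under \<open>abs\<close>.
  Symmetrizing the image of a symmetric measure under \<open>abs\<close> gives back the
  measure.\<close>

lemma op_distr_hat:
 assumes Y: "closed_dd_op Y" and aff: "hat Y : affiliated (M2 M)"
 shows "op_distr (tr2 tr) (hat Y) = symmetrization (op_distr tr (op_abs Y))"
proof -
 interpret M2: fin_vna "M2 M" "tr2 tr" by (rule fin_vna_M2)
 interpret H: polar Y by unfold_locales (rule Y)
 note Esm = H.E_def[symmetric]
 define rh where "rh = op_distr (tr2 tr) (hat Y)"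
 note D = M2.op_distr[OF aff hat_sa[OF Y], folded rh_def, unfolded Esm]
 interpret rh: finite_measure rh by (rule D(1))
 have m: "measure rh B = Re (tr (entry True True (H.E B)))" if B: "B : sets borel" for B
  using diag_trace[OF Y aff bb_indicator[OF B]] unfolding D(2)[OF B] Esm fc_ind[OF H.E B] by (simp add: tr2_def)
 have sym: "measure rh (uminus -` B) = measure rh B" if B: "B : sets borel" for B
 proof -
  have B': "uminus -` B : sets borel" using measurable_sets[OF uminus_abs_borel(1) B] by simp
  have "entry True True (H.E (uminus -` B)) x = entry True True (H.E B) x" for x
  proof -
  have "flip (H.E (uminus -` B) (0, x)) = - H.E B (0, x)"
  unfolding H.flip_E[OF B] using bcl_minus[OF pvmD(1)[OF H.E B], of "(0, x)"] by simp
  thus ?thesis by (simp add: entry_def slot_def coord_def flip_def prod_eq_iff)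
  qed
  hence "entry True True (H.E (uminus -` B)) = entry True True (H.E B)" by (rule ext)
  thus ?thesis by (simp add: m B B')
 qed
 have vm: "abs -` B : sets borel" if "B : sets borel" for B :: "real set"
  using measurable_sets[OF uminus_abs_borel(2) that] by simp
 have G: "Re (tr (H.A.G B)) = measure rh (abs -` B)" if B: "B : sets borel" for B
  unfolding m[OF vm[OF B]] using B by (simp add: push_pvm_def entry_def[abs_def] slot_def coord_def)
 have em: "emeasure (op_distr tr (op_abs Y)) B = ennreal (measure rh (abs -` B))" if B: "B : sets borel" for B
  unfolding op_distr_def H.spectral_abs G[OF B, symmetric]
 proof (rule emeasure_bmo[OF _ _ B])
  show "0 <= Re (tr (H.A.G B))" if "B : sets borel" for B by (simp add: G[OF that])
  show "(%n. Re (tr (H.A.G (F n)))) sums Re (tr (H.A.G (\<Union>n. F n)))"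
  if F: "range F <= sets borel" "disjoint_family F" for F
  proof -
  have Fb: "F n : sets borel" for n using F(1) by blast
  have "(%n. measure rh (abs -` F n)) sums measure rh (\<Union>n. abs -` F n)"
  using F vm[OF Fb] D(3) by (intro rh.finite_measure_UNION) (auto simp: disjoint_family_on_def)
  moreover have "(\<Union>n. F n) : sets borel" using Fb by blast
  ultimately show ?thesis by (simp add: G Fb vimage_UN)
  qed
 qed
 \<comment> \<open>Splitting at 0: the positive and the negative part of \<open>B\<close> are
   doubled by symmetry, and the point 0 is counted once for \<open>B\<close> and once for its
   reflection.\<close>
 have key: "measure rh (abs -` B) + measure rh (abs -` (uminus ` B)) = 2 * measure rh B" if B: "B : sets borel" for B
 proof -
  let ?z = "B Int {0}" and ?p = "B Int {0<..}" and ?n = "B Int {..<0}"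
  have b: "?z : sets borel" "?p : sets borel" "?n : sets borel" using B by auto
  have b': "uminus -` ?p : sets borel" "uminus -` ?n : sets borel"
  using measurable_sets[OF uminus_abs_borel(1) b(2)] measurable_sets[OF uminus_abs_borel(1) b(3)] by simp_all
  have add: "measure rh (C1 Un (C2 Un C3)) = measure rh C1 + measure rh C2 + measure rh C3"
  if "C1 : sets borel" "C2 : sets borel" "C3 : sets borel" "C1 Int C2 = {}" "C1 Int C3 = {}" "C2 Int C3 = {}" for C1 C2 C3
  using that by (subst rh.finite_measure_Union) (auto simp: D(3) rh.finite_measure_Union)
  have e: "abs -` B = ?z Un (?p Un uminus -` ?p)" "B = ?z Un (?p Un ?n)" by (auto simp: abs_if split: if_splits)
  have e': "abs -` (uminus ` B) = ?z Un (?n Un uminus -` ?n)"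
  proof (rule set_eqI)
  fix t :: real
  have "\<bar>t\<bar> : uminus ` B <-> - \<bar>t\<bar> : B" by (auto simp: image_iff) (metis add.inverse_inverse)
  thus "t : abs -` (uminus ` B) <-> t : ?z Un (?n Un uminus -` ?n)" by (auto simp: abs_if split: if_splits)
  qed
  have "measure rh (abs -` B) = measure rh ?z + 2 * measure rh ?p"
  proof -
  have "?z Int ?p = {}" "?z Int uminus -` ?p = {}" "?p Int uminus -` ?p = {}" by auto
  from add[OF b(1,2) b'(1) this] show ?thesis unfolding e(1) sym[OF b(2)] by simp
  qed
  moreover have "measure rh (abs -` (uminus ` B)) = measure rh ?z + 2 * measure rh ?n"
  proof -
  have "?z Int ?n = {}" "?z Int uminus -` ?n = {}" "?n Int uminus -` ?n = {}" by auto
  from add[OF b(1,3) b'(2) this] show ?thesis unfolding e' sym[OF b(3)] by simp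
  qed
  moreover have "measure rh B = measure rh ?z + measure rh ?p + measure rh ?n"
  by (subst e(2), subst add[OF b]) auto
  ultimately show ?thesis by simp
 qed
 show ?thesis
  unfolding symmetrization_def op_distr_def[of "tr2 tr"] borel_measure_of_def Esm
 proof (rule measure_of_eq)
  fix B :: "real set" assume "B : sigma_sets UNIV (sets borel)"
  moreover have "sigma_sets UNIV (sets borel) = (sets borel :: real set set)"
  using sets.sigma_sets_eq[of "borel :: real measure"] by (simp only: space_borel)
  ultimately have B: "B : sets borel" by (simp only:)
  have B': "uminus ` B : sets borel"
  proof -
  have "uminus ` B = uminus -` B" by (auto simp: image_iff) (metis add.inverse_inverse)
  thus ?thesis using measurable_sets[OF uminus_abs_borel(1) B] by simp
  qed
  show "ennreal (Re (tr2 tr (H.E B))) = (emeasure (op_distr tr (op_abs Y)) B + emeasure (op_distr tr (op_abs Y)) (uminus ` B)) / 2"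
  unfolding em[OF B] em[OF B'] D(2)[OF B, symmetric]
  proof -
  have "ennreal x + ennreal y = ennreal (2 * w) ==> ennreal w = (ennreal x + ennreal y) / 2" if "w >= 0" for x y w
  using that by (simp add: ennreal_divide_numeral)
  thus "ennreal (measure rh B) = (ennreal (measure rh (abs -` B)) + ennreal (measure rh (abs -` (uminus ` B)))) / 2"
  using key[OF B] by (metis ennreal_plus measure_nonneg)
  qed
 qed simp
qed

end

section \<open>R-diagonal operators\<close>

lemma op_le_posop: "bcl a ==> bcl b ==> op_le a b <-> posop (%x. b x - a x)"
 using bcl_minusop[of b a] by (simp add: op_le_def posop_def)

lemma op_le_trans: assumes "op_le a b" "op_le b c" shows "op_le a c"
 unfolding op_le_def
proof
 fix x
 have "cinner x (b x - a x) + cinner x (c x - b x) : \<real>\<^sub>\<ge>\<^sub>0" using assms unfolding op_le_def by (intro nonneg_Reals_add_I) blast+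
 thus "cinner x (c x - a x) : \<real>\<^sub>\<ge>\<^sub>0" by (simp add: cinner.diff_right)
qed

lemma op_le_limit:
 assumes "!!n::nat. op_le (f n) (g n)" "!!x. (%n. f n x) ~> a x" "!!x. (%n. g n x) ~> b x"
 shows "op_le a b"
 unfolding op_le_def
proof
 fix x
 have "(%n. cinner x (g n x - f n x)) ~> cinner x (b x - a x)" by (intro cinner.tendsto tendsto_intros assms)
 moreover have "\<forall>\<^sub>F n in sequentially. cinner x (g n x - f n x) : \<real>\<^sub>\<ge>\<^sub>0"
  using assms(1) unfolding op_le_def by (intro always_eventually) blast
 ultimately show "cinner x (b x - a x) : \<real>\<^sub>\<ge>\<^sub>0"
  by (rule Lim_in_closed_set[OF closed_nonneg_Reals_complex _ sequentially_bot, rotated])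
qed

lemma tracial_vna_fin:
 assumes T: "tracial_vna M tr"
 shows "fin_vna M tr"
proof -
 have vN: "von_neumann_algebra M" and norm: "normal_functional M tr" using T by (simp_all add: tracial_vna_def)
 note vna = vna_von_neumann[OF vN]
 note alg = vna_alg[OF vna]
 have add: "tr (%x. a x + b x) = tr a + tr b" if "a : M" "b : M" for a b using T that unfolding tracial_vna_def by blast
 have scale: "tr (%x. c *c a x) = c * tr a" if "a : M" for c a using T that unfolding tracial_vna_def by blast
 have z: "tr (%x. 0) = 0" using scale[OF alg(2), of 0] by simp
 have sup: "tr a = cr (SUP d\<in>D. Re (tr d))"
  if "D <= {d : M. op_le (%_. 0) d}" "D ~= {}" "!!d e. d : D ==> e : D ==> EX f:D. op_le d f & op_le e f"
  "a : M" "!!d. d : D ==> op_le d a" "!!b. b : M ==> (!!d. d : D ==> op_le d b) ==> op_le a b" for D a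
  using norm[unfolded normal_functional_def, rule_format, of D a] that by blast
 \<comment> \<open>Positivity is given on elements \<open>cadj a a\<close>. For a positive
   \<open>a\<close>, normality is applied to the directed set consisting of 0 and \<open>a\<close>,
   whose supremum is \<open>a\<close>.\<close>
 have pos: "tr a : \<real>\<^sub>\<ge>\<^sub>0" if a: "a : M" "posop a" for a
 proof -
  have le: "op_le (%_. 0) a" "op_le (%_. 0) (%_. 0)" "op_le a a" using posopD(2)[OF a(2)] by (simp_all add: op_le_def)
  have "tr a = cr (SUP d\<in>{%_. 0, a}. Re (tr d))"
  by (rule sup) (use le a alg(3) in auto)
  also have "(SUP d\<in>{%_. 0, a}. Re (tr d)) = max 0 (Re (tr a))" by (simp add: z cSup_eq_Max)
  finally obtain r where "tr a = cr r" "r >= 0" by (metis max.cobounded1)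
  thus ?thesis by simp
 qed
 have diff: "tr (%x. a x - b x) = tr a - tr b" if "a : M" "b : M" for a b
  using add[OF that(1) alg(7)[OF that(2), of "-1"]] scale[OF that(2), of "-1"] by simp
 show ?thesis
 proof
  show "tr (%x. x) = 1" using T by (simp add: tracial_vna_def id_def)
  show "a = (%_. 0)" if "a : M" "tr (%x. cadj a (a x)) = 0" for a
  using T that unfolding tracial_vna_def comp_def by blast
  show "tr (%x. a (b x)) = tr (%x. b (a x))" if "a : M" "b : M" for a b
  using T that unfolding tracial_vna_def comp_def by blast
  show "(%n. tr (f n)) ~> tr a"
  if f: "!!n. f n : M" "!!n. posop (f n)" "!!n. posop (%x. f (Suc n) x - f n x)" "!!x. (%n. f n x) ~> a x" "a : M" for f a
  proof -
  have st: "op_le (f n) (f (Suc n))" for n using posopD(2)[OF f(3)] by (simp add: op_le_def)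
  have inc: "op_le (f m) (f n)" if "m <= n" for m n
  using that by (induction rule: dec_induct) (auto intro: op_le_trans st simp: op_le_def[of "f m" "f m"])
  have le: "op_le (f m) a" for m
  by (rule op_le_limit[of "%n. f m" "%n. f (n + m)"]) (simp_all add: inc LIMSEQ_ignore_initial_segment[OF f(4)])
  have Sup: "tr a = cr (SUP d\<in>range f. Re (tr d))"
  proof (rule sup)
  show "range f <= {d : M. op_le (%_. 0) d}" using f(1) posopD(2)[OF f(2)] by (auto simp: op_le_def)
  show "EX g:range f. op_le d g & op_le e g" if de: "d : range f" "e : range f" for d e
  proof -
  obtain m n where mn: "d = f m" "e = f n" using de by blast
  show ?thesis unfolding mn by (intro bexI[of _ "f (max m n)"] conjI inc) auto
  qed
  show "op_le a b" if "b : M" "!!d. d : range f ==> op_le d b" for b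
  by (rule op_le_limit[OF that(2) f(4) tendsto_const]) blast
  qed (use f le in auto)
  have mono: "Re (tr b) <= Re (tr c)" if "b : M" "c : M" "op_le b c" for b c
  proof -
  have "posop (%x. c x - b x)" using that(3) bcl_minusop[OF vna_bcl[OF vna that(2)] vna_bcl[OF vna that(1)]]
  by (simp add: posop_def op_le_def)
  from pos[OF alg(6)[OF that(2,1)] this] show ?thesis by (simp add: diff that complex_nonneg_Reals_iff)
  qed
  have "(%n. Re (tr (f n))) ~> (SUP n. Re (tr (f n)))"
  by (rule LIMSEQ_incseq_SUP) (auto intro!: bdd_aboveI[of _ "Re (tr a)"] incseq_SucI mono f le inc)
  hence "(%n. cr (Re (tr (f n)))) ~> tr a" unfolding Sup image_image by (rule tendsto_of_real)
  moreover have "cr (Re (tr (f n))) = tr (f n)" for n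
  using pos[OF f(1,2)] by (simp add: complex_nonneg_Reals_iff complex_eq_iff)
  ultimately show ?thesis by simp
  qed
 qed (use vna add scale pos in auto)
qed

lemma free_letter:
 assumes f: "free_algebras sg {0::nat, 1} \<A>" and a: "a : \<A> 0" "sg a = 0" and b: "b : \<A> 1" "sg b = 0"
 shows "sg (%x. a (b x)) = 0"
 using f[unfolded free_algebras_def, rule_format, of "[0, 1]" "[a, b]"] a b by (simp add: less_Suc_eq comp_def)

text \<open>A unitary factor on the left is invertible, so the algebraic product is already
  closed.\<close>

lemma op_mult_iff:
 assumes u: "unitary_op u" and H: "closed H"
 shows "(x, y) : op_mult (op_graph u) H <-> (x, cadj u y) : H"
proof -
 note U = unitary_opD[OF u]
 have eq: "H O op_graph u = {(x, y). (x, cadj u y) : H}"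
  using U(2,3) by (force simp: op_graph_def relcomp_unfold)
 have "closed {(x, y). (x, cadj u y) : H}"
  unfolding closed_sequential_limits
 proof (intro allI impI, elim conjE)
  fix f l assume f: "ALL n. f n : {(x, y). (x, cadj u y) : H}" "f ~> l"
  have "(fst l, cadj u (snd l)) : H"
  by (rule closed_seqD[OF H, of "%n. fst (f n)" "%n. cadj u (snd (f n))"])
  (use f(1) in \<open>auto simp: split_beta intro: tendsto_fst[OF f(2)] bcl_tendsto[OF U(4) tendsto_snd[OF f(2)]]\<close>)
  thus "l : {(x, y). (x, cadj u y) : H}" by (simp add: split_beta)
 qed
 thus ?thesis unfolding op_mult_def eq by simp
qed

lemma op_mult_graph:
 assumes A: "single_valued A" and c: "bcl c" and a: "!!q. (a q, c q) : A"
 shows "op_mult A (op_graph a) = op_graph c"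
proof -
 have "op_graph a O A = op_graph c" using a single_valuedD[OF A] by (fastforce simp: op_graph_def)
 thus ?thesis using op_graph_closed_dd[OF c] by (simp add: op_mult_def closed_dd_op_def)
qed

lemma op_mult_graphD:
 assumes A: "closed A" and a: "bcl a" and e: "op_mult A (op_graph a) = op_graph c"
 shows "(a q, c q) : A"
proof -
 have "(q, c q) : closure (op_graph a O A)" using e by (auto simp: op_mult_def op_graph_def)
 then obtain f where f: "!!n. f n : op_graph a O A" "f ~> (q, c q)" unfolding closure_sequential by blast
 have "(a (fst (f n)), snd (f n)) : A" for n using f(1)[of n] by (auto simp: op_graph_def)
 thus ?thesis
  by (rule closed_seqD[OF A]) (use tendsto_fst[OF f(2)] tendsto_snd[OF f(2)] bcl_tendsto[OF a] in auto)
qed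

text \<open>The lower right corner \<open>d\<close> and the off-diagonal corner \<open>b\<close> of the resolvent of \<open>hat S\<close> satisfy
  \<open>S d = z b\<close> and \<open>S\<^sup>* b = 1 + z d\<close>. For \<open>S = u H\<close> these equations give
  \<open>u\<^sup>* b = (R(z) + R(-z)) / 2\<close> with \<open>R\<close> the resolvent of \<open>H\<close>, so that freeness of \<open>u\<close> and \<open>H\<close> applies.\<close>

lemma R_diagonal_corner:
 fixes tr :: "('h::complex_hilbert_space => 'h) => complex"
 assumes M: "tracial_vna M tr" and S: "S : affiliated M" and R: "R_diagonal TYPE('k::complex_hilbert_space) tr S"
  and z: "Im z ~= 0"
 shows "tr (entry False True (res (hat S) z)) = 0"
proof -
 obtain N :: "('k => 'k) set" and sg u H ph \<psi> where N: "tracial_vna N sg" and u: "u : N" "haar_unitary sg u"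
  and H: "H : affiliated N" "op_positive H" and free: "star_free sg (op_graph u) H"
  and ph: "trace_isomorphism (Wstar S) tr (Wstar (op_mult (op_graph u) H)) sg ph"
  and \<psi>: "extends_to_affiliated (Wstar S) tr (Wstar (op_mult (op_graph u) H)) sg ph \<psi>" "\<psi> S = op_mult (op_graph u) H"
  using R unfolding R_diagonal_def same_star_distr_def by blast
 define T where "T = op_mult (op_graph u) H"
 have vM: "von_neumann_algebra M" and vN: "von_neumann_algebra N" using M N by (simp_all add: tracial_vna_def)
 note WS = vna_Wstar[OF vM S] and Sc = affiliatedD(1)[OF S]
 interpret N: fin_vna N sg by (rule tracial_vna_fin[OF N])
 have uu: "unitary_op u" and su: "sg u = 0" using u(2) unfolding haar_unitary_def by (auto dest: spec[of _ 1])
 note U = unitary_opD[OF uu]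
 have Hsa: "op_sa H" using H(2) by (simp add: op_positive_def)
 note hD = glinD[OF saD(6)[OF Hsa]]
 have T_iff: "(x, y) : T <-> (x, cadj u y) : H" for x y unfolding T_def by (rule op_mult_iff[OF uu saD(3)[OF Hsa]])
 have Tc: "closed T" by (simp add: T_def op_mult_def)
 have Tadj: "(cadj u y, v) : H" if "(y, v) : op_adj T" for y v
 proof -
  have "cinner (cadj u y) h = cinner v x" if h: "(x, h) : H" for x h
  proof -
  have "(x, u h) : T" using h by (simp add: T_iff U)
  hence "cinner y (u h) = cinner v x" using `(y, v) : op_adj T` by (simp add: in_op_adj)
  thus ?thesis by (simp add: cadj(3)[OF U(1)])
  qed
  hence "(cadj u y, v) : op_adj H" unfolding in_op_adj by blast
  thus ?thesis using saD(2)[OF Hsa] by simp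
 qed
 have Taff: "T : affiliated N"
 proof (rule affiliatedI)
  have "Domain T = Domain H" by (auto simp: T_iff Domain_iff) (metis U(2))
  moreover have "single_valued T"
  using single_valuedD[OF saD(4)[OF Hsa]] U(3) by (intro single_valuedI) (metis T_iff)
  ultimately show "closed_dd_op T"
  using Tc saD(5)[OF Hsa] hD by (auto simp: closed_dd_op_def T_iff bcl_simps[OF U(4)])
  fix v x y assume v: "v : commutant N" "unitary_op v" and xy: "(x, y) : T"
  have "v (cadj u y) = cadj u (v y)" by (rule commD[OF v(1) N.adj[OF u(1)]])
  thus "(v x, v y) : T" using affiliatedD(2)[OF H(1) v, of x "cadj u y"] xy by (simp add: T_iff)
 qed
 note WT = vna_Wstar[OF vN Taff]
 define b d where "b = entry False True (res (hat S) z)" and "d = entry True True (res (hat S) z)"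
 have "res (hat S) z : M2 (Wstar S)"
  by (rule res_in_vna[OF vna_M2[OF WS] hat_affiliated[OF WS affiliated_Wstar[OF Sc]] hat_sa[OF Sc] z])
 hence bd: "b : Wstar S" "d : Wstar S" by (simp_all add: b_def d_def M2_iff)
 have "(res (hat S) z (0, q), (0, q) + z *c res (hat S) z (0, q)) : hat S" for q by (rule res_in[OF hat_sa[OF Sc] z])
 moreover have "res (hat S) z (0, q) = (b q, d q)" for q by (simp add: b_def d_def entry_def slot_def coord_def)
 ultimately have eq: "(d q, z *c b q) : S" "(b q, q + z *c d q) : op_adj S" for q by simp_all
 let ?c = "%q. q + z *c d q"
 have c: "?c : Wstar S" "(%q. z *c b q) : Wstar S" using bd vna_alg[OF WS] by auto
 \<comment> \<open>The corner equations are rewritten as operator products, a form that the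
   extension \<open>\<psi>\<close> preserves.\<close>
 have 1: "op_mult S (op_graph d) = op_graph (%q. z *c b q)" "op_mult (op_adj S) (op_graph b) = op_graph ?c"
  using op_mult_graph[OF closed_dd_opD(2)[OF Sc] vna_bcl[OF WS c(2)] eq(1)]
  op_mult_graph[OF closed_dd_opD(2)[OF closed_dd_op_adj[OF Sc]] vna_bcl[OF WS c(1)] eq(2)] by auto
 note aS = affiliated_Wstar[OF Sc] and ag = op_graph_affiliated[OF WS]
 have 2: "op_mult T (op_graph (ph d)) = op_graph (ph (%q. z *c b q))" "op_mult (op_adj T) (op_graph (ph b)) = op_graph (ph ?c)"
 proof -
  have \<psi>m: "\<psi> (op_mult A B) = op_mult (\<psi> A) (\<psi> B)" if "A : affiliated (Wstar S)" "B : affiliated (Wstar S)" for A B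
  using \<psi>(1) that unfolding extends_to_affiliated_def by blast
  have \<psi>g: "\<psi> (op_graph a) = op_graph (ph a)" if "a : Wstar S" for a
  using \<psi>(1) that unfolding extends_to_affiliated_def by blast
  have \<psi>a: "\<psi> (op_adj S) = op_adj T" using \<psi> aS unfolding extends_to_affiliated_def T_def by metis
  show "op_mult T (op_graph (ph d)) = op_graph (ph (%q. z *c b q))"
  using \<psi>m[OF aS ag[OF bd(2)]] unfolding 1 \<psi>g[OF c(2)] \<psi>g[OF bd(2)] \<psi>(2) T_def by simp
  show "op_mult (op_adj T) (op_graph (ph b)) = op_graph (ph ?c)"
  using \<psi>m[OF affiliated_adj[OF WS aS] ag[OF bd(1)]] unfolding 1 \<psi>g[OF c(1)] \<psi>g[OF bd(1)] \<psi>a by simp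
 qed
 have bij: "bij_betw ph (Wstar S) (Wstar T)" using ph by (simp add: trace_isomorphism_def T_def)
 have phadd: "ph (%x. a x + b x) = (%x. ph a x + ph b x)" if "a : Wstar S" "b : Wstar S" for a b
  using ph that unfolding trace_isomorphism_def by blast
 have phscale: "ph (%x. c *c a x) = (%x. c *c ph a x)" if "a : Wstar S" for a c
  using ph that unfolding trace_isomorphism_def by blast
 have phcomp: "ph (a \<circ> b) = ph a \<circ> ph b" if "a : Wstar S" "b : Wstar S" for a b
  using ph that unfolding trace_isomorphism_def by blast
 have phtr: "sg (ph a) = tr a" if "a : Wstar S" for a using ph that unfolding trace_isomorphism_def by blast
 have phM: "ph a : Wstar T" if "a : Wstar S" for a using bij that by (auto simp: bij_betw_def)
 \<comment> \<open>Unitality follows from multiplicativity applied to a preimage of the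
   identity.\<close>
 have phid: "ph (%x. x) = (%x. x)"
 proof -
  obtain a where a: "a : Wstar S" "ph a = (%x. x)" using bij vna_alg(2)[OF WT] by (metis bij_betw_def imageE)
  have "ph ((%x. x) \<circ> a) = ph (%x. x) \<circ> ph a" by (rule phcomp[OF vna_alg(2)[OF WS] a(1)])
  moreover have "(%x. x) \<circ> a = a" by (rule ext) simp
  ultimately have "(%x. x) = ph (%x. x) \<circ> (%x. x)" by (simp only: a(2))
  thus ?thesis by (auto simp: fun_eq_iff)
 qed
 define b' d' where "b' = ph b" and "d' = ph d"
 have b'd': "b' : Wstar T" "d' : Wstar T" using phM bd by (simp_all add: b'_def d'_def)
 have phc: "ph ?c = (%q. q + z *c d' q)" "ph (%q. z *c b q) = (%q. z *c b' q)"
  using phadd[OF vna_alg(2,7)[OF WS] , OF bd(2)] phscale[OF bd(2)] phscale[OF bd(1)] by (simp_all add: phid b'_def d'_def)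
 have eqT: "(d' q, z *c b' q) : T" "(b' q, q + z *c d' q) : op_adj T" for q
  using op_mult_graphD[OF Tc vna_bcl[OF WT b'd'(2)] 2(1)[unfolded phc, folded d'_def]]
  op_mult_graphD[OF op_adj_closed(1) vna_bcl[OF WT b'd'(1)] 2(2)[unfolded phc, folded b'_def]] by auto
 define g where "g q = cadj u (b' q)" for q
 have gH: "(d' q, z *c g q) : H" "(g q, q + z *c d' q) : H" for q
  using eqT(1)[of q] Tadj[OF eqT(2)[of q]] by (simp_all add: T_iff g_def bcl_scale[OF U(4)])
 have z': "Im (- z) ~= 0" using z by simp
 \<comment> \<open>The equations \<open>H d' = z g\<close> and \<open>H g = 1 + z d'\<close> are
   decoupled by taking sum and difference.\<close>
 have "(d' q + g q, q + z *c (d' q + g q)) : H" for q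
  using hD(2)[OF gH(1)[of q] gH(2)[of q]] by (simp add: scaleC_add_right algebra_simps)
 moreover have "(g q - d' q, q + (- z) *c (g q - d' q)) : H" for q
  using hD(3)[OF gH(2)[of q] gH(1)[of q]] by (simp add: scaleC.diff_right scaleC.minus_left algebra_simps)
 ultimately have "res H z q = d' q + g q" "res H (- z) q = g q - d' q" for q
  using res_unique[OF Hsa z] res_unique[OF Hsa z'] by blast+
 hence g: "g = (%q. (1 / 2) *c (res H z q + res H (- z) q))"
  by (auto simp: fun_eq_iff scaleC_add_left[symmetric] scaleC_add_right simp flip: scaleC_add_left)
 have WH: "vna (Wstar H)" by (rule vna_Wstar[OF vN H(1)])
 have gW: "g : Wstar H"
  unfolding g using affiliated_Wstar[OF saD(1)[OF Hsa]]
  by (intro vna_alg(5,7)[OF WH] res_in_vna[OF WH] Hsa z z')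
 have Wu: "u : Wstar (op_graph u)"
  by (rule bounded_affiliated[OF vna_Wstar[OF vN op_graph_affiliated[OF N.vna u(1)]] U(1) affiliated_Wstar[OF op_graph_closed_dd[OF U(1)]]])
 have gN: "g : N" using gW Wstar_subset[OF vN H(1)] by blast
 have gN0: "(%x. g x - sg g *c x) : N" by (rule N.alg(6)[OF gN N.alg(4)])
 have "sg (%x. u (g x - sg g *c x)) = 0"
  by (rule free_letter[OF free[unfolded star_free_def]])
  (use Wu gW vna_alg(4,6)[OF WH] in \<open>auto simp: su N.tr_diff[OF gN N.alg(4)] N.tr_const\<close>)
 moreover have "(%x. u (g x)) = (%x. u (g x - sg g *c x) + sg g *c u x)" by (simp add: fun_eq_iff bcl_simps[OF U(1)])
 ultimately have "sg (%x. u (g x)) = 0"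
  using N.tr_add[OF N.alg(9)[OF u(1) gN0] N.alg(7)[OF u(1)]] by (simp add: N.tr_scale[OF u(1)] su)
 moreover have "(%x. u (g x)) = b'" by (simp add: g_def U)
 ultimately show ?thesis using phtr[OF bd(1)] by (simp add: b'_def b_def)
qed

text \<open>Multiplication by a matrix unit moves an off-diagonal corner to the diagonal.\<close>

lemma R_diagonal_entries:
 fixes tr :: "('h::complex_hilbert_space => 'h) => complex"
 assumes M: "tracial_vna M tr" and S: "S : affiliated M" and R: "R_diagonal TYPE('k::complex_hilbert_space) tr S"
  and f: "bb f" and pq: "p ~= q"
 shows "tr (entry p q (fc (spm (hat S)) f)) = 0"
proof -
 interpret fin_vna M tr by (rule tracial_vna_fin[OF M])
 interpret M2: fin_vna "M2 M" "tr2 tr" by (rule fin_vna_M2)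
 note hS = hat_affiliated[OF vna S] hat_sa[OF affiliatedD(1)[OF S]]
 have res0: "tr (entry p q (res (hat S) z)) = 0" if z: "Im z ~= 0" for z
 proof (cases p)
  case False
  thus ?thesis using pq R_diagonal_corner[OF M S R z] by simp
 next
  case True
  have z': "Im (cnj z) ~= 0" using z by simp
  note rM = res_in_vna[OF M2.vna hS z']
  have "entry p q (res (hat S) z) = cadj (entry False True (res (hat S) (cnj z)))"
  using True pq by (simp add: cadj_entry[OF M2.bcl[OF rM]] res_adj[OF hS(2) z'])
  thus ?thesis using tr_adj[OF M2D(2)[OF rM]] R_diagonal_corner[OF M S R z'] by simp
 qed
 let ?K = "%x. slot q (coord p x)"
 have Kb: "bcl ?K" by (rule bcl_comp(2)[OF bcl_slot bcl_coord])
 have KX: "entry i j (%x. ?K (X x)) = (if i = q then entry p j X else (%x. 0))" for i j X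
  by (simp add: entry_def fun_eq_iff coord_slot)
 have K: "?K : M2 M"
  unfolding M2_iff
 proof (intro conjI allI Kb)
  fix i j show "entry i j ?K : M"
  unfolding KX[of i j "%x. x"] entry_id using alg(2,3) by (cases "i = q"; cases "p = j") simp_all
 qed
 have tK: "tr2 tr (%x. ?K (X x)) = tr (entry p q X) / 2" for X
  unfolding tr2_def KX by (cases q) (simp_all add: tr_zero)
 show ?thesis using M2.trace_fc_zero[OF hS K _ f] res0 unfolding tK by simp
qed

text \<open>Centered letters of \<open>hat S\<close> and \<open>hat T\<close> have centered entries, so every entry of an alternating product
  is a sum of alternating centered products.\<close>

lemma free_pair_hat:
 fixes tr :: "('h::complex_hilbert_space => 'h) => complex"
 assumes M: "tracial_vna M tr" and S: "S : affiliated M" "T : affiliated M" and free: "star_free tr S T"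
  and R: "R_diagonal TYPE('k1::complex_hilbert_space) tr S" "R_diagonal TYPE('k2::complex_hilbert_space) tr T"
 shows "free_pair (M2 M) (tr2 tr) (%i::nat. hat (if i = 0 then S else T))"
proof -
 interpret fin_vna M tr by (rule tracial_vna_fin[OF M])
 have vM: "von_neumann_algebra M" using M by (simp add: tracial_vna_def)
 let ?X = "%i::nat. if i = 0 then S else T"
 have X: "?X i : affiliated M" for i using S by simp
 note hX = hat_affiliated[OF vna X] hat_sa[OF affiliatedD(1)[OF X]]
 have ent: "entry p q F : Wstar (?X i)" "tr (entry p q F) = 0" "bcl F"
  if F: "F = fc (spm (hat (?X i))) f" "bb f" "tr2 tr F = 0" for i f F p q
 proof -
  note W = vna_Wstar[OF vM X] and Xc = affiliatedD(1)[OF X]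
  have "F : M2 (Wstar (?X i))"
  unfolding F(1) by (rule fc_in_vna[OF vna_M2[OF W] hat_affiliated[OF W affiliated_Wstar[OF Xc]] hat_sa[OF Xc] F(2)])
  thus "entry p q F : Wstar (?X i)" "bcl F" by (simp_all add: M2_iff)
  show "tr (entry p q F) = 0"
  proof (cases "p = q")
  case False
  thus ?thesis unfolding F(1)
  using R_diagonal_entries[OF M S(1) R(1) F(2)] R_diagonal_entries[OF M S(2) R(2) F(2)] by simp
  next
  case True
  have "tr (entry False False F) = tr (entry True True F)" unfolding F(1) by (rule diag_trace[OF Xc hX(1) F(2)])
  thus ?thesis using True F(3) by (cases q) (simp_all add: tr2_def)
  qed
 qed
 \<comment> \<open>\<open>pre\<close>, with indices \<open>jx\<close>, collects scalar entries
   already split off on the left; \<open>as\<close>, with indices \<open>ix\<close>, holds the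
   remaining matrix letters. The induction moves one letter across, summing over the intermediate
   matrix index.\<close>
 have key: "tr (%x. foldr (o) pre id (entry p q (foldr (o) as id) x)) = 0"
  if "length pre = length jx" "length as = length ix" "set jx Un set ix <= {0, 1}" "distinct_adj (jx @ ix)" "jx @ ix ~= []"
  "!!k. k < length jx ==> pre ! k : Wstar (?X (jx ! k)) & tr (pre ! k) = 0"
  "!!k. k < length ix ==> as ! k : {fc (spm (hat (?X (ix ! k)))) f | f. bb f} & tr2 tr (as ! k) = 0"
  for pre as jx ix p q
  using that
 proof (induction as arbitrary: pre ix jx p)
  case Nil
  \<comment> \<open>All letters are split off: the diagonal entry of the identity leaves the
    alternating centered product \<open>pre\<close>, the off-diagonal entry leaves 0.\<close>
  have "tr (foldr (o) pre id) = 0"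
  using free[unfolded star_free_def free_algebras_def, rule_format, of jx pre] Nil by simp
  moreover have preb: "bcl (foldr (o) pre id)"
  proof -
  have "ALL a:set pre. bcl a"
  using Nil(6) vna_bcl[OF vna_Wstar[OF vM X]] Nil(1) by (metis in_set_conv_nth)
  thus ?thesis by (induction pre) (simp_all add: bcl_comp)
  qed
  moreover have "tr (%x. P (entry p q (foldr (o) [] id) x)) = 0" if "tr P = 0" "bcl P" for P
  using that by (cases "p = q") (simp_all add: entry_id bcl_zero tr_zero)
  ultimately show ?case by blast
 next
  case (Cons A as)
  obtain i ix' where ix: "ix = i # ix'" using Cons.prems(2) by (cases ix) auto
  obtain f where A: "A = fc (spm (hat (?X i))) f" "bb f" "tr2 tr A = 0"
  using Cons.prems(7)[of 0] by (auto simp: ix)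
  note eA = ent[OF A]
  let ?R = "foldr (o) as id" and ?pre = "foldr (o) pre id"
  have IH: "tr (%x. foldr (o) (pre @ [entry p r A]) id (entry r q ?R x)) = 0" for r
  proof (rule Cons.IH[of _ "jx @ [i]" ix'])
  fix k assume k: "k < length (jx @ [i])"
  show "(pre @ [entry p r A]) ! k : Wstar (?X ((jx @ [i]) ! k)) & tr ((pre @ [entry p r A]) ! k) = 0"
  proof (cases "k < length jx")
  case True
  thus ?thesis using Cons.prems(6)[OF True] Cons.prems(1) by (simp add: nth_append)
  next
  case False
  hence "k = length jx" using k by simp
  thus ?thesis using Cons.prems(1) eA(1,2)[of p r] by (simp add: nth_append)
  qed
  next
  fix k assume "k < length ix'"
  thus "as ! k : {fc (spm (hat (?X (ix' ! k)))) f | f. bb f} & tr2 tr (as ! k) = 0"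
  using Cons.prems(7)[of "Suc k"] by (simp add: ix)
  qed (use Cons.prems ix in auto)
  have preM: "?pre : M"
  proof -
  have "ALL a:set pre. a : M"
  using Cons.prems(1,6) Wstar_subset[OF vM X] by (metis in_set_conv_nth subsetD)
  thus ?thesis by (induction pre) (simp_all add: alg)
  qed
  have RM: "?R : M2 M"
  proof -
  have "ALL B:set as. B : M2 M"
  proof
  fix B assume "B : set as"
  then obtain k where "k < length as" "B = as ! k" by (auto simp: in_set_conv_nth)
  then obtain g where "B = fc (spm (hat (?X (ix' ! k)))) g" "bb g"
  using Cons.prems(2) Cons.prems(7)[of "Suc k"] by (auto simp: ix)
  thus "B : M2 M" using fc_in_vna[OF vna_M2[OF vna] hX] by simp
  qed
  thus ?thesis by (induction as) (simp_all add: vna_alg[OF vna_M2[OF vna]])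
  qed
  have AM: "entry p r A : M" for r using eA(1)[of p r] Wstar_subset[OF vM X] by blast
  have e: "(%x. ?pre (entry p q (A \<circ> ?R) x))
  = (%x. ?pre (entry p False A (entry False q ?R x)) + ?pre (entry p True A (entry True q ?R x)))"
  unfolding comp_def[of A] entry_comp[OF eA(3), of p q ?R] by (simp add: bcl_add[OF bcl[OF preM]])
  have fr: "foldr (o) (pre @ [entry p r A]) id = ?pre \<circ> entry p r A" for r
  by (induction pre) (simp_all add: o_assoc)
  have t: "tr (%x. ?pre (entry p r A (entry r q ?R x))) = 0" for r
  using IH[of r] unfolding fr by simp
  note mem = alg(9)[OF preM alg(9)[OF AM M2D(2)[OF RM]]]
  have "foldr (o) (A # as) id = A \<circ> ?R" by simp
  thus ?case by (simp only: e tr_add[OF mem mem] t add_0)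
 qed
 show ?thesis
 proof (rule free_pair.intro[OF fin_vna_M2], unfold_locales)
  show "free_algebras (tr2 tr) {0, 1} (%i. {fc (spm (hat (?X i))) f | f. bb f})"
  unfolding free_algebras_def
  proof (intro allI impI, elim conjE)
  fix ix as assume a: "ix ~= []" "length as = length ix" "set ix <= {0, 1}" "distinct_adj ix"
  "ALL k<length ix. as ! k : {fc (spm (hat (?X (ix ! k)))) f | f. bb f} & tr2 tr (as ! k) = 0"
  have "tr (entry p p (foldr (o) as id)) = 0" for p
  using key[of "[]" "[]" as ix p p] a by simp
  thus "tr2 tr (foldr (o) as id) = 0" by (simp add: tr2_def)
  qed
 qed (use hX in auto)
qed

section \<open>A realization on square-summable sequences\<close>

text \<open>The map is given as a relation, so that the norm bound also yields single-valuedness: a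
  pair in the closure with first component 0 has second component 0.\<close>

lemma extend_bounded:
 fixes R :: "('h::complex_hilbert_space \<times> 'k::complex_hilbert_space) set"
 assumes R: "csubspace R" and d: "closure (Domain R) = UNIV"
  and C: "!!x y. (x, y) : R ==> norm y <= C * norm x" "C >= 0"
 obtains t where "!!x y. t (x + y) = t x + t y" "!!c x. t (c *c x) = c *c t x" "!!x. norm (t x) <= C * norm x"
  "!!x y. (x, y) : R ==> t x = y"
proof -
 let ?G = "closure R"
 note g = glinD[OF R]
 have b: "norm y <= C * norm x" if xy: "(x, y) : ?G" for x y
 proof -
  obtain f where f: "!!n. f n : R" "f ~> (x, y)" using xy unfolding closure_sequential by blast
  have "(%n. norm (snd (f n))) ~> norm y" "(%n. C * norm (fst (f n))) ~> C * norm x"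
  using tendsto_norm[OF tendsto_snd[OF f(2)]] tendsto_mult[OF tendsto_const tendsto_norm[OF tendsto_fst[OF f(2)]]] by simp_all
  moreover have "norm (snd (f n)) <= C * norm (fst (f n))" for n using C(1)[of "fst (f n)" "snd (f n)"] f(1)[of n] by simp
  ultimately show ?thesis using LIMSEQ_le by blast
 qed
 note G = glinD[OF csubspace_closure[OF R]]
 have "EX y. (x, y) : ?G" for x
 proof -
  have "x : closure (Domain R)" using d by blast
  then obtain f where f: "!!n. f n : Domain R" "f ~> x" unfolding closure_sequential by blast
  hence "ALL n. EX y. (f n, y) : R" by blast
  then obtain h where h: "!!n. (f n, h n) : R" by metis
  have "Cauchy h"
  proof (rule CauchyI)
  fix e :: real assume e: "0 < e"
  obtain m where m: "!!i j. i >= m ==> j >= m ==> norm (f i - f j) < e / (C + 1)"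
  using CauchyD[OF LIMSEQ_imp_Cauchy[OF f(2)], of "e / (C + 1)"] e C(2) by auto
  have "norm (h i - h j) < e" if "i >= m" "j >= m" for i j
  proof -
  have "norm (h i - h j) <= C * norm (f i - f j)" by (rule C(1)[OF g(3)[OF h h]])
  also have "... <= C * (e / (C + 1))" using m[OF that] C(2) by (intro mult_left_mono) auto
  also have "... < e" using e C(2) by (simp add: field_simps)
  finally show ?thesis .
  qed
  thus "EX m. ALL i>=m. ALL j>=m. norm (h i - h j) < e" by blast
  qed
  then obtain y where "h ~> y" using Cauchy_convergent convergent_def by blast
  hence "(%n. (f n, h n)) ~> (x, y)" using f(2) by (intro tendsto_Pair)
  hence "(x, y) : ?G" unfolding closure_sequential using h by (intro exI[of _ "%n. (f n, h n)"]) simp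
  thus ?thesis by blast
 qed
 then obtain t where t: "!!x. (x, t x) : ?G" by metis
 have u: "t x = y" if "(x, y) : ?G" for x y using b[OF G(3)[OF t[of x] that]] by simp
 show ?thesis
  by (rule that[of t]) (use u t G(2)[OF t t] G(4)[OF t] b closure_subset in \<open>blast+\<close>)
qed

section \<open>The inner product of the trace\<close>

context fin_vna begin

definition ip :: "('h => 'h) => ('h => 'h) => complex"
 where "ip a b = tr (%x. cadj a (b x))"

lemma ip_mem: "a : M ==> b : M ==> (%x. cadj a (b x)) : M"
 by (rule alg(9)[OF adj])

lemma ip_lin:
 assumes "a : M" "b : M" "c : M"
 shows "ip a (%x. b x + c x) = ip a b + ip a c" "ip a (%x. b x - c x) = ip a b - ip a c" "ip a (%x. k *c b x) = k * ip a b"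
 unfolding ip_def using ip_mem[OF assms(1,2)] ip_mem[OF assms(1,3)]
 by (simp_all add: bcl_simps[OF cadj(1)[OF bcl[OF assms(1)]]] tr_add tr_diff tr_scale)

lemma ip_sym: assumes "a : M" "b : M" shows "ip b a = cnj (ip a b)"
proof -
 have "cadj (%x. cadj a (b x)) = (%x. cadj b (a x))"
  by (rule cadj_unique) (simp add: cadj[OF bcl[OF assms(1)]] cadj[OF bcl[OF assms(2)]])
 thus ?thesis using tr_adj[OF ip_mem[OF assms]] by (simp add: ip_def)
qed

lemma ip_pos: "a : M ==> ip a a = cr (Re (ip a a))" "a : M ==> 0 <= Re (ip a a)"
 "a : M ==> Re (ip a a) = 0 ==> a = (%_. 0)"
 using tr_adj_comp[of a] faithful[of a] by (auto simp: ip_def complex_nonneg_Reals_iff complex_eq_iff)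

lemma ip_zero: "a : M ==> ip a (%_. 0) = 0" "a : M ==> ip (%_. 0) a = 0"
 by (simp_all add: ip_def bcl_zero[OF cadj(1)[OF bcl]] tr_zero)

lemma ip_left: "y : M ==> a : M ==> ip (%x. y (a x)) b = ip a (%x. cadj y (b x))"
 using cadj_comp[OF bcl bcl, of y a] by (simp add: ip_def comp_def)

lemma ip_right:
 assumes "y : M" "a : M" "b : M" shows "ip (%x. a (y x)) b = ip a (%x. b (cadj y x))"
proof -
 have "ip (%x. a (y x)) b = tr (%x. cadj y (cadj a (b x)))"
  using cadj_comp[OF bcl bcl, of a y] assms by (simp add: ip_def comp_def)
 also have "... = tr (%x. cadj a (b (cadj y x)))" by (rule tracial[OF adj[OF assms(1)] ip_mem[OF assms(2,3)]])
 finally show ?thesis by (simp add: ip_def)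
qed

lemma ip_star: assumes "a : M" "b : M" shows "ip (cadj a) (cadj b) = ip b a"
 using tracial[OF assms(1) adj[OF assms(2)]] assms by (simp add: ip_def bcl)

text \<open>Left multiplication is an operator inequality under the trace. Right multiplication
  reduces to it because, by traciality, taking adjoints is isometric for \<open>ip\<close>.\<close>

lemma ip_bound:
 assumes y: "y : M" "!!x. norm (y x) <= C * norm x" "C >= 0" and a: "a : M"
 shows "Re (ip (%x. y (a x)) (%x. y (a x))) <= C^2 * Re (ip a a)"
  "Re (ip (%x. a (y x)) (%x. a (y x))) <= C^2 * Re (ip a a)"
proof -
 have 1: "Re (ip (%x. y (a x)) (%x. y (a x))) <= C^2 * Re (ip a a)"
  if y: "y : M" "!!x. norm (y x) <= C * norm x" and a: "a : M" for y a
 proof -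
  note yb = bcl[OF y(1)] and ab = bcl[OF a] and ya = alg(9)[OF y(1) a]
  have "Re (ip (%x. y (a x)) (%x. y (a x))) <= Re (tr (%x. cr (C^2) *c cadj a (a x)))"
  unfolding ip_def
  by (rule tr_mono[OF ip_mem[OF ya ya] alg(7)[OF ip_mem[OF a a]] posop_sq_diff[OF ab bcl[OF ya] y(2)]])
  thus ?thesis unfolding tr_scale[OF ip_mem[OF a a]] by (simp add: ip_def del: of_real_power)
 qed
 show "Re (ip (%x. y (a x)) (%x. y (a x))) <= C^2 * Re (ip a a)" by (rule 1[OF y(1,2) a])
 have ay: "(%x. a (y x)) : M" by (rule alg(9)[OF a y(1)])
 have c: "cadj (%x. a (y x)) = (%x. cadj y (cadj a x))" using cadj_comp[OF bcl[OF a] bcl[OF y(1)]] by (simp add: comp_def)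
 have "ip (%x. a (y x)) (%x. a (y x)) = ip (%x. cadj y (cadj a x)) (%x. cadj y (cadj a x))"
  using ip_star[OF ay ay] unfolding c by simp
 thus "Re (ip (%x. a (y x)) (%x. a (y x))) <= C^2 * Re (ip a a)"
  using 1[OF adj[OF y(1)] cadj_norm_le[OF bcl[OF y(1)] y(2)] adj[OF a]] ip_star[OF a a] by simp
qed

subsection \<open>Orthonormalization of a sequence\<close>

context
 fixes w :: "nat => 'h => 'h"
 assumes w: "w n : M"
begin

text \<open>The vector \<open>gs n\<close> is zero if \<open>w n\<close> depends on its predecessors: then the normalizing factor is \<open>1 / 0 = 0\<close>.\<close>

function gs :: "nat => 'h => 'h" where
 "gs n = (%x. cr (1 / sqrt (Re (ip (%x. w n x - (\<Sum>j<n. ip (gs j) (w n) *c gs j x)) (%x. w n x - (\<Sum>j<n. ip (gs j) (w n) *c gs j x)))))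
  *c (w n x - (\<Sum>j<n. ip (gs j) (w n) *c gs j x)))"
 by auto
termination by (relation less_than) auto

declare gs.simps [simp del]

definition gr :: "nat => 'h => 'h" where "gr n x = w n x - (\<Sum>j<n. ip (gs j) (w n) *c gs j x)"

lemma gs_gr: "gs n = (%x. cr (1 / sqrt (Re (ip (gr n) (gr n)))) *c gr n x)"
 unfolding gr_def[abs_def] by (rule gs.simps)

lemma M_sum: "(!!j. j < n ==> g j : M) ==> (%x. \<Sum>j<n. c j *c g j x) : M" for g :: "nat => 'h => 'h"
proof (induction n)
 case (Suc n)
 thus ?case unfolding sum.lessThan_Suc by (intro alg(5) alg(7)) simp_all
qed (simp add: alg(3))

lemma ip_sum: "a : M ==> (!!j. j < n ==> g j : M) ==> ip a (%x. \<Sum>j<n. c j *c g j x) = (\<Sum>j<n. c j * ip a (g j))"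
 for g :: "nat => 'h => 'h"
 by (induction n) (simp_all add: ip_zero ip_lin M_sum alg(7))

lemma gs_in: "gs n : M"
proof (induction n rule: less_induct)
 case (less n)
 hence "gr n : M" unfolding gr_def[abs_def] by (intro alg(6) w M_sum)
 thus ?case unfolding gs_gr by (rule alg(7))
qed

lemma gr_in: "gr n : M"
 unfolding gr_def[abs_def] by (intro alg(6) w M_sum gs_in)

lemma gs_norm: "ip (gs n) (gs n) = 1 \<or> gs n = (%_. 0)"
proof (cases "Re (ip (gr n) (gr n)) = 0")
 case True
 thus ?thesis unfolding gs_gr by simp
next
 case False
 define r where "r = Re (ip (gr n) (gr n))"
 have r: "r > 0" using False ip_pos(2)[OF gr_in, of n] unfolding r_def by linarith
 have e: "ip (gr n) (gr n) = cr r" unfolding r_def by (rule ip_pos(1)[OF gr_in])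
 let ?k = "cr (1 / sqrt r)"
 have g: "gs n = (%x. ?k *c gr n x)" unfolding r_def by (rule gs_gr)
 have 1: "ip (gr n) (gs n) = ?k * cr r" unfolding g ip_lin(3)[OF gr_in gr_in gr_in] e ..
 have "ip (gs n) (gs n) = ?k * ip (gs n) (gr n)" by (subst (2) g) (rule ip_lin(3)[OF gs_in gr_in gr_in])
 also have "ip (gs n) (gr n) = cnj (?k * cr r)" unfolding ip_sym[OF gr_in gs_in] 1 ..
 also have "?k * cnj (?k * cr r) = cr ((1 / sqrt r) * ((1 / sqrt r) * r))"
  by (simp only: complex_cnj_mult complex_cnj_complex_of_real of_real_mult)
 also have "(1 / sqrt r) * ((1 / sqrt r) * r) = 1" using r by (simp add: field_simps)
 finally show ?thesis by simp
qed

lemma gs_orth: "i < n ==> ip (gs i) (gs n) = 0"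
proof (induction n arbitrary: i rule: less_induct)
 case (less n)
 have o: "ip (gs i) (gs j) = 0" if "j < n" "j ~= i" for j
  using less.IH[OF that(1), of i] less.IH[OF less.prems, of j] that(2) ip_sym[OF gs_in gs_in, of j i] less.prems
  by (cases "i < j") auto
 have "ip (gs i) (gr n) = ip (gs i) (w n) - (\<Sum>j<n. ip (gs j) (w n) * ip (gs i) (gs j))"
  unfolding gr_def[abs_def] using ip_lin(2)[OF gs_in w M_sum[of n gs]] gs_in by (simp add: ip_sum gs_in)
 also have "(\<Sum>j<n. ip (gs j) (w n) * ip (gs i) (gs j)) = (\<Sum>j\<in>{i}. ip (gs j) (w n) * ip (gs i) (gs j))"
  using less.prems o by (intro sum.mono_neutral_right) auto
 also have "ip (gs i) (w n) - ... = 0" using gs_norm[of i] by (auto simp: ip_zero w)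
 finally show ?case by (subst gs_gr) (simp add: ip_lin(3)[OF gs_in gr_in gr_in])
qed

lemma gs_orth': "i ~= j ==> ip (gs i) (gs j) = 0"
 using gs_orth[of i j] gs_orth[of j i] ip_sym[OF gs_in gs_in, of i j] by (metis complex_cnj_zero linorder_neqE_nat)

text \<open>Membership in the span of the first \<open>n\<close> vectors, with the coefficients
  fixed as inner products; \<open>expandsI\<close> shows that arbitrary coefficients lead to the
  same notion.\<close>

definition expands :: "nat => ('h => 'h) => bool"
 where "expands n a <-> a : M & a = (%x. \<Sum>j<n. ip (gs j) a *c gs j x)"

lemma expandsI: assumes "a = (%x. \<Sum>j<n. c j *c gs j x)" shows "expands n a"
proof -
 have aM: "a : M" unfolding assms by (intro M_sum gs_in)
 have "ip (gs i) a *c gs i x = c i *c gs i x" if "i < n" for i x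
 proof -
  have "ip (gs i) a = (\<Sum>j<n. c j * ip (gs i) (gs j))" unfolding assms by (intro ip_sum gs_in)
  also have "... = (\<Sum>j\<in>{i}. c j * ip (gs i) (gs j))" using that gs_orth'[of i] by (intro sum.mono_neutral_right) auto
  finally show ?thesis using gs_norm[of i] by auto
 qed
 hence "(%x. \<Sum>j<n. ip (gs j) a *c gs j x) = (%x. \<Sum>j<n. c j *c gs j x)"
  by (intro ext sum.cong) auto
 also have "... = a" by (rule assms[symmetric])
 finally show ?thesis unfolding expands_def using aM by simp
qed

lemma expands_w: "expands (Suc n) (w n)"
proof (rule expandsI[where c = "%j. if j = n then cr (sqrt (Re (ip (gr n) (gr n)))) else ip (gs j) (w n)"])
 let ?r = "sqrt (Re (ip (gr n) (gr n)))"
 have "cr ?r *c gs n x = gr n x" for x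
 proof (cases "?r = 0")
  case True
  hence "gr n = (%_. 0)" using ip_pos(3)[OF gr_in] by simp
  thus ?thesis using True by simp
 qed (simp add: gs_gr scaleC_scaleC flip: of_real_mult del: real_sqrt_eq_zero_cancel_iff)
 thus "w n = (%x. \<Sum>j<Suc n. (if j = n then cr ?r else ip (gs j) (w n)) *c gs j x)"
  by (simp add: fun_eq_iff gr_def)
qed

lemma expands_mono: assumes "expands n a" "n <= m" shows "expands m a"
proof (rule expandsI[where c = "%j. if j < n then ip (gs j) a else 0"])
 have "(\<Sum>j<m. (if j < n then ip (gs j) a else 0) *c gs j x) = (\<Sum>j<n. ip (gs j) a *c gs j x)" for x
  using assms(2) by (intro sum.mono_neutral_cong_right) auto
 thus "a = (%x. \<Sum>j<m. (if j < n then ip (gs j) a else 0) *c gs j x)" using assms(1) unfolding expands_def by metis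
qed

lemma expandsD: "expands n a ==> a : M" "expands n a ==> (\<Sum>j<n. ip (gs j) a *c gs j x) = a x"
 unfolding expands_def by metis+

lemma expands_add: assumes "expands n a" "expands n b" shows "expands n (%x. a x + b x)"
 by (rule expandsI[where c = "%j. ip (gs j) a + ip (gs j) b"])
  (simp add: scaleC_add_left sum.distrib expandsD(2)[OF assms(1)] expandsD(2)[OF assms(2)])

lemma expands_scale: assumes "expands n a" shows "expands n (%x. c *c a x)"
 by (rule expandsI[where c = "%j. c * ip (gs j) a"])
  (simp add: expandsD(2)[OF assms] scaleC.sum_right[symmetric] flip: scaleC_scaleC)

lemma expands_ip:
 assumes "expands n a" "expands n b" shows "(\<Sum>j<n. cnj (ip (gs j) a) * ip (gs j) b) = ip a b"
proof -
 have M: "a : M" "b : M" and b: "b = (%x. \<Sum>j<n. ip (gs j) b *c gs j x)" using assms by (simp_all add: expands_def)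
 have "ip a b = (\<Sum>j<n. ip (gs j) b * ip a (gs j))" by (subst b) (rule ip_sum[OF M(1) gs_in])
 thus ?thesis using ip_sym[OF gs_in M(1)] by (simp add: mult.commute)
qed

text \<open>Countably many copies of the closed span of the sequence: the coordinates of \<open>\<Phi> m a\<close> are indexed by \<open>J \<times> \<nat>\<close>,
  where \<open>J\<close> is the set of the \<open>j\<close> with \<open>gs j \<noteq> 0\<close>.\<close>

lemma gns_vectors:
 assumes w0: "w n0 ~= (%_. 0)"
 obtains Ph :: "nat => ('h => 'h) => ell2"
 where "!!m m' a b n. expands n a ==> expands n b ==> cinner (Ph m a) (Ph m' b) = (if m = m' then ip a b else 0)"
  "!!v. (!!m j. cinner (Ph m (gs j)) v = 0) ==> v = 0"
proof -
 define J where "J = {j. gs j ~= (%_. 0)}"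
 have "J ~= {}"
 proof
  assume "J = {}"
  hence "gs j = (%_. 0)" for j by (auto simp: J_def)
  hence "w n0 = (%_. 0)" using expands_w[of n0] unfolding expands_def by (metis (no_types, lifting) scaleC.zero_right sum.neutral)
  thus False using w0 by blast
 qed
 \<comment> \<open>The copies make the index set infinite even if the span is finite dimensional, so
   it can be enumerated by all natural numbers.\<close>
 hence inf: "infinite (J \<times> (UNIV :: nat set))" by (simp add: finite_cartesian_product_iff)
 define f where "f = from_nat_into (J \<times> (UNIV :: nat set))"
 have f: "bij_betw f UNIV (J \<times> UNIV)" unfolding f_def by (rule bij_betw_from_nat_into[OF _ inf]) simp
 define c where "c m a k = (if snd (f k) = m then ip (gs (fst (f k))) a else 0)" for m a k
 define S where "S m n = {k. snd (f k) = m & fst (f k) < n}" for m n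
 have fj: "inj f" using f by (simp add: bij_betw_def)
 have fS: "finite (S m n)" for m n
 proof (rule finite_subset)
  show "S m n <= f -` ({..<n} \<times> {m})" by (auto simp: S_def mem_Times_iff)
  show "finite (f -` ({..<n} \<times> {m}))" by (rule finite_vimageI[OF _ fj]) simp
 qed
 have zero: "c m a k = 0" if "expands n a" "k \<notin> S m n" for m n a k
 proof (cases "snd (f k) = m")
  case True
  hence k: "fst (f k) >= n" using that(2) by (auto simp: S_def)
  have a: "a = (%x. \<Sum>j<n. ip (gs j) a *c gs j x)" using that(1) by (simp add: expands_def)
  have "ip (gs (fst (f k))) a = (\<Sum>j<n. ip (gs j) a * ip (gs (fst (f k))) (gs j))"
  by (subst a) (rule ip_sum[OF gs_in gs_in])
  also have "... = 0" using k gs_orth' by (intro sum.neutral) auto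
  finally show ?thesis by (simp add: c_def)
 qed (simp add: c_def)
 define Ph where "Ph m a = Abs_ell2 (c m a)" for m a
 have Rep: "Rep_ell2 (Ph m a) = c m a" if "expands n a" for m a n
 proof -
  have "summable (%k. (cmod (c m a k))^2)"
  by (rule summable_finite[OF fS[of m n]]) (simp add: zero[OF that])
  thus ?thesis unfolding Ph_def by (intro Abs_ell2_inverse) simp
 qed
 show ?thesis
 proof (rule that[of Ph])
  fix m m' a b n assume ab: "expands n a" "expands n b"
  have "cinner (Ph m a) (Ph m' b) = (\<Sum>k. cnj (c m a k) * c m' b k)"
  by (simp add: cinner_ell2.rep_eq Rep[OF ab(1)] Rep[OF ab(2)])
  also have "... = (\<Sum>k\<in>S m n. cnj (c m a k) * c m' b k)"
  by (rule suminf_finite[OF fS]) (simp add: zero[OF ab(1)])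
  also have "... = (if m = m' then ip a b else 0)"
  proof (cases "m = m'")
  case True
  have bij: "bij_betw (%k. fst (f k)) (S m n) (J Int {..<n})"
  proof (rule bij_betwI')
  show "(fst (f k) = fst (f l)) = (k = l)" if "k : S m n" "l : S m n" for k l
  using that injD[OF fj, of k l] by (auto simp: S_def prod_eq_iff)
  have "f k : J \<times> UNIV" for k using f by (auto simp: bij_betw_def)
  thus "fst (f k) : J Int {..<n}" if "k : S m n" for k using that by (auto simp: S_def mem_Times_iff)
  show "EX k:S m n. j = fst (f k)" if "j : J Int {..<n}" for j
  proof -
  have "(j, m) : range f" using f that by (auto simp: bij_betw_def)
  then obtain k where "f k = (j, m)" by (metis rangeE)
  thus ?thesis using that by (intro bexI[of _ k]) (auto simp: S_def)
  qed
  qed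
  have "(\<Sum>k\<in>S m n. cnj (c m a k) * c m' b k) = (\<Sum>k\<in>S m n. cnj (ip (gs (fst (f k))) a) * ip (gs (fst (f k))) b)"
  by (rule sum.cong) (auto simp: c_def S_def True)
  also have "... = (\<Sum>j\<in>J Int {..<n}. cnj (ip (gs j) a) * ip (gs j) b)"
  using sum.reindex_bij_betw[OF bij, of "%j. cnj (ip (gs j) a) * ip (gs j) b"] by simp
  also have "... = (\<Sum>j<n. cnj (ip (gs j) a) * ip (gs j) b)"
  proof (rule sum.mono_neutral_left)
  have "b : M" using ab(2) by (simp add: expands_def)
  thus "ALL j:{..<n} - J Int {..<n}. cnj (ip (gs j) a) * ip (gs j) b = 0" by (auto simp: J_def ip_zero)
  qed auto
  finally show ?thesis using expands_ip[OF ab] True by simp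
  next
  case False
  thus ?thesis by (auto simp: c_def intro!: sum.neutral)
  qed
  finally show "cinner (Ph m a) (Ph m' b) = (if m = m' then ip a b else 0)" .
 next
  fix v assume v: "!!m j. cinner (Ph m (gs j)) v = 0"
  have "Rep_ell2 v k = 0" for k
  proof -
  obtain j m where k: "f k = (j, m)" by (cases "f k")
  have jJ: "j : J" using f k by (metis bij_betw_def mem_Sigma_iff rangeI)
  have ex: "expands (Suc j) (gs j)"
  by (rule expandsI[where c = "%i. if i = j then 1 else 0"]) (simp add: fun_eq_iff)
  have "c m (gs j) l = (if l = k then 1 else 0)" for l
  proof (cases "l = k")
  case True
  thus ?thesis using gs_norm[of j] jJ by (simp add: c_def k J_def)
  next
  case False
  hence "f l ~= (j, m)" using injD[OF fj, of l k] k by auto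
  thus ?thesis using False gs_orth'[of "fst (f l)" j] by (auto simp: c_def prod_eq_iff)
  qed
  hence "(\<Sum>l. cnj (c m (gs j) l) * Rep_ell2 v l) = Rep_ell2 v k"
  using suminf_finite[of "{k}" "%l. cnj (c m (gs j) l) * Rep_ell2 v l"] by simp
  thus ?thesis using v[of m j] by (simp add: cinner_ell2.rep_eq Rep[OF ex])
  qed
  thus "v = 0" by (metis Rep_ell2_inject ext zero_ell2.rep_eq)
 qed
qed

end

end

lemma commutant_incl: "(!!g. g : X ==> bcl g) ==> X <= commutant (commutant X)"
 by (auto simp: in_commutant)

lemma commutant_anti: "X <= Y ==> commutant Y <= commutant X"
 unfolding commutant_def by blast

lemma bicommutant:
 assumes G: "!!g. g : G ==> bcl g & cadj g : G"
 shows "von_neumann_algebra (commutant (commutant G))" "G <= commutant (commutant G)"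
proof -
 note 1 = commutant_incl and anti = commutant_anti
 show "G <= commutant (commutant G)" using 1 G by blast
 have "commutant (commutant (commutant G)) = commutant G"
  using anti[OF `G <= _`] 1[of "commutant G"] by (metis (no_types, lifting) in_commutant subset_antisym)
 moreover have "bcl g & cadj g : commutant G" if "g : commutant G" for g
  using commutant_adj[OF G that] that by (simp add: in_commutant)
 ultimately show "von_neumann_algebra (commutant (commutant G))"
  unfolding von_neumann_algebra_def using commutant_adj[of "commutant G"] by auto
qed

section \<open>Words in resolvents at rational points\<close>

context free_pair begin

definition Xb :: "bool => 'h opgraph" where "Xb b = X (if b then 1 else 0)"

lemma Xb: "Xb b : affiliated M" "op_sa (Xb b)"
 by (simp_all add: Xb_def aff sa)

text \<open>A letter \<open>(b, p, q)\<close> stands for the resolvent of \<open>Xb b\<close> at \<open>p + q \<i>\<close>, or for the identity if \<open>q = 0\<close>.\<close>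

definition zl :: "bool \<times> rat \<times> rat => complex" where "zl l = Complex (of_rat (fst (snd l))) (of_rat (snd (snd l)))"
definition L :: "bool \<times> rat \<times> rat => 'h => 'h" where "L l = (if Im (zl l) = 0 then (%x. x) else res (Xb (fst l)) (zl l))"
definition star :: "bool \<times> rat \<times> rat => bool \<times> rat \<times> rat" where "star l = (fst l, fst (snd l), - snd (snd l))"

lemma zl_star: "zl (star l) = cnj (zl l)"
 by (simp add: zl_def star_def complex_eq_iff of_rat_minus)

lemma L: "L l : M" "cadj (L l) = L (star l)"
 using res_in_vna[OF vna Xb] res_adj[OF Xb(2)] alg(2) by (auto simp: L_def zl_star) (simp_all add: star_def)

text \<open>The alphabet is countable, so all words can be listed in one sequence and
  orthonormalized; this keeps the GNS space separable.\<close>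

primrec ew :: "(bool \<times> rat \<times> rat) list => 'h => 'h"
 where "ew [] = (%x. x)" | "ew (l # w) = (%x. L l (ew w x))"

lemma ew_append: "ew (u @ v) x = ew u (ew v x)"
 by (induction u) simp_all

lemma ew_in: "ew w : M"
 by (induction w) (auto intro: alg(2) alg(9)[OF L(1)])

text \<open>The parameter \<open>S\<close> makes it possible to restrict to the letters of one of
  the two operators.\<close>

inductive_set wsp :: "(bool \<times> rat \<times> rat) set => ('h => 'h) set" for S
 where word: "set w <= S ==> ew w : wsp S"
 | add: "a : wsp S ==> b : wsp S ==> (%x. a x + b x) : wsp S"
 | scale: "a : wsp S ==> (%x. c *c a x) : wsp S"

abbreviation "W \<equiv> wsp UNIV"

lemma wsp_in: "a : wsp S ==> a : M"
 by (induction rule: wsp.induct) (auto intro: ew_in alg(5,7))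

lemma wsp_basic: "(%x. x) : wsp S" "l : S ==> L l : wsp S" "(%x. 0) : wsp S"
  "a : wsp S ==> b : wsp S ==> (%x. a x - b x) : wsp S"
proof -
 show 1: "(%x. x) : wsp S" using wsp.word[of "[]" S] by simp
 show "l : S ==> L l : wsp S" using wsp.word[of "[l]" S] by simp
 show "(%x. 0) : wsp S" using wsp.scale[OF 1, of 0] by simp
 show "a : wsp S ==> b : wsp S ==> (%x. a x - b x) : wsp S" using wsp.add[OF _ wsp.scale[of b S "-1"], of a] by simp
qed

lemma wsp_comp:
 assumes "a : wsp S" and b: "b : wsp S" shows "(%x. a (b x)) : wsp S"
 using assms(1)
proof induction
 case (word w)
 note ewb = bcl[OF ew_in[of w]]
 show ?case using b
 proof induction
  case (word v)
  thus ?case using wsp.word[of "w @ v" S] `set w <= S` by (simp add: ew_append[abs_def])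
 qed (auto simp: bcl_simps[OF ewb] intro: wsp.add wsp.scale)
qed (auto intro: wsp.add wsp.scale)

lemma wsp_adj: assumes "!!l. l : S ==> star l : S" "a : wsp S" shows "cadj a : wsp S"
 using assms(2)
proof induction
 case (word w)
 thus ?case
 proof (induction w)
  case (Cons l w)
  have "cadj (ew (l # w)) = (%x. cadj (ew w) (L (star l) x))"
  using cadj_comp[OF bcl[OF L(1)] bcl[OF ew_in]] by (simp add: comp_def L(2))
  thus ?case using wsp_comp[OF Cons.IH wsp_basic(2)[OF assms(1)]] Cons.prems by simp
 qed (simp add: wsp_basic)
next
 case (add a b)
 show ?case unfolding cadj_plus[OF bcl[OF wsp_in[OF add.hyps(1)]] bcl[OF wsp_in[OF add.hyps(2)]]] by (rule wsp.add[OF add.IH])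
next
 case (scale a c)
 show ?case unfolding cadj_scale[OF bcl[OF wsp_in[OF scale.hyps]]] by (rule wsp.scale[OF scale.IH])
qed

lemma W_adj: "a : W ==> cadj a : W"
 by (rule wsp_adj) auto

lemma wsp_W: "a : wsp S ==> a : W"
 by (induction rule: wsp.induct) (auto intro: wsp.intros)

lemma wsp_fc:
 assumes "a : wsp {l. fst l = b}" shows "EX f. bb f & a = fc (spm (Xb b)) f"
 using assms
proof induction
 note E = spectral_theorem(1)[OF Xb(2)]
 have one: "(%x. x) = fc (spm (Xb b)) (%t. 1)" by (simp add: fc_const[OF E])
 {
  case (word w)
  thus ?case
  proof (induction w)
  case (Cons l w)
  then obtain f where f: "bb f" "ew w = fc (spm (Xb b)) f" by auto
  have "EX g. bb g & L l = fc (spm (Xb b)) g"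
  proof (cases "Im (zl l) = 0")
  case True
  thus ?thesis using one bb_const[of 1] unfolding L_def by auto
  next
  case False
  thus ?thesis using res_fc[OF Xb(2) False] bb_rz[OF False] Cons.prems unfolding L_def by auto
  qed
  then obtain g where "bb g" "L l = fc (spm (Xb b)) g" by blast
  thus ?case using fc_mult[OF E _ f(1)] bb_mult[OF _ f(1)] by (intro exI[of _ "%t. g t * f t"]) (simp add: f(2))
  qed (use one bb_const in auto)
 next
  case (add a c)
  then obtain f g where "bb f" "a = fc (spm (Xb b)) f" "bb g" "c = fc (spm (Xb b)) g" by blast
  thus ?case using fc_add[OF E, of f g] bb_add[of f g] by (intro exI[of _ "%t. f t + g t"]) simp
 next
  case (scale a c)
  then obtain f where "bb f" "a = fc (spm (Xb b)) f" by blast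
  thus ?case using fc_cmult[OF E, where f = f and c = c] bb_cmult[where f = f and c = c] by (intro exI[of _ "%t. c * f t"]) simp
 }
qed

text \<open>The functional calculus of \<open>Xb b\<close> at \<open>t\<^sup>2 / (1 + t\<^sup>2) < 1\<close>.\<close>

definition yy :: "bool => 'h => 'h" where "yy b x = x - L (b, 0, -1) (L (b, 0, 1) x)"

lemma zl_i: "zl (b, 0, 1) = \<i>" "zl (b, 0, -1) = - \<i>"
 by (simp_all add: zl_def complex_eq_iff)

lemma L_i: "L (b, 0, 1) = res (Xb b) \<i>" "L (b, 0, -1) = res (Xb b) (- \<i>)"
 by (simp_all add: L_def zl_i)

lemma yy_in: "yy b : W"
 unfolding yy_def[abs_def] by (rule wsp_basic(4)[OF wsp_basic(1) wsp_comp[OF wsp_basic(2) wsp_basic(2)]]) auto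

text \<open>Powers of a function with values in \<open>[0, 1)\<close> tend to 0 pointwise and
  boundedly. Being a statement about words, this passes to the GNS space, where it shows in
  \<open>Ab_sa\<close> that the represented resolvent has dense range.\<close>

lemma yy_power:
 assumes a: "a : M" shows "(%n. Re (ip (%x. (yy b ^^ n) (a x)) (%x. (yy b ^^ n) (a x)))) ~> 0"
proof -
 note E = spectral_theorem(1)[OF Xb(2)]
 let ?F = "fc (spm (Xb b))"
 define g where "g t = 1 - rz (- \<i>) t * rz \<i> t" for t
 have bg: "bb g" unfolding g_def by (intro bb_diff bb_const bb_mult bb_rz) simp_all
 have gt: "g t = cr (t^2 / (1 + t^2))" for t
 proof -
  have nz: "cr t + \<i> ~= 0" "cr t - \<i> ~= 0" "1 + t^2 ~= 0"
  by (simp_all add: complex_eq_iff add_pos_nonneg order.strict_implies_not_eq[symmetric] sum_power2_gt_zero_iff)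
  have m: "(cr t + \<i>) * (cr t - \<i>) = cr (1 + t^2)"
  by (simp add: algebra_simps power2_eq_square)
  have "rz (- \<i>) t * rz \<i> t = 1 / cr (1 + t^2)" unfolding rz_def m[symmetric] by simp
  hence "g t = cr (1 - 1 / (1 + t^2))" by (simp add: g_def)
  also have "1 - 1 / (1 + t^2) = t^2 / (1 + t^2)" using nz(3) by (simp add: field_simps)
  finally show ?thesis .
 qed
 have yF: "yy b = ?F g"
  unfolding g_def yy_def[abs_def] L_i res_fc[OF Xb(2), of \<i>, simplified] res_fc[OF Xb(2), of "-\<i>", simplified]
  using bb_rz[of \<i>] bb_rz[of "-\<i>"]
  by (simp add: fun_eq_iff fc_mult[OF E] fc_diff[OF E bb_const bb_mult] fc_const[OF E])
 have bgn: "bb (%t. g t ^ n)" for n by (induction n) (auto intro: bb_const bb_mult bg)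
 have yn: "yy b ^^ n = ?F (%t. g t ^ n)" for n
 proof (induction n)
  case 0 show ?case by (simp add: fc_const[OF E] id_def)
 next
  case (Suc n) thus ?case by (simp add: fun_eq_iff yF fc_mult[OF E bg bgn])
 qed
 have "ip (%x. (yy b ^^ n) (a x)) (%x. (yy b ^^ n) (a x)) = (\<integral>t. g t ^ n * g t ^ n \<partial>tr_meas (Xb b) a)" for n
 proof -
  have "cnj (g t) = g t" for t by (simp only: gt complex_cnj_complex_of_real)
  hence c: "cadj (yy b ^^ n) = yy b ^^ n" unfolding yn fc_cnj[OF E bgn] by simp
  have "yy b ^^ n : M" unfolding yn by (rule fc_in_vna[OF vna Xb bgn])
  from ip_left[OF this a]
  have "ip (%x. (yy b ^^ n) (a x)) (%x. (yy b ^^ n) (a x)) = tr (%x. cadj a (?F (%t. g t ^ n * g t ^ n) (a x)))"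
  by (simp add: c) (simp add: ip_def yn fc_mult[OF E bgn bgn])
  thus ?thesis using trace_integral[OF Xb a bb_mult[OF bgn bgn]] by simp
 qed
 moreover have "(%n. \<integral>t. g t ^ n * g t ^ n \<partial>tr_meas (Xb b) a) ~> (\<integral>t. 0 \<partial>tr_meas (Xb b) a)"
 proof (rule integral_dominated_convergence[where w = "%_. 1"])
  note T = tr_meas[OF Xb a]
  interpret finite_measure "tr_meas (Xb b) a" by (rule T(1))
  show "integrable (tr_meas (Xb b) a) (%_. 1 :: real)" by simp
  show "(%t. g t ^ n * g t ^ n) : borel_measurable (tr_meas (Xb b) a)" for n
  using bb_measurable[OF bb_mult[OF bgn bgn]] by (simp add: measurable_cong_sets[OF T(3) refl])
  have q: "0 <= t^2 / (1 + t^2)" "t^2 / (1 + t^2) < 1" for t :: real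
  by (simp_all add: add_pos_nonneg)
  have "(%n. g t ^ n * g t ^ n) ~> 0" for t
  proof -
  have "cmod (g t) < 1" unfolding gt norm_of_real using q[of t] by simp
  hence "(%n. g t ^ n) ~> 0" by (rule LIMSEQ_power_zero)
  from tendsto_mult[OF this this] show ?thesis by simp
  qed
  thus "AE t in tr_meas (Xb b) a. (%n. g t ^ n * g t ^ n) ~> 0" by simp
  have "cmod (g t ^ n * g t ^ n) <= 1" for t n
  proof -
  have "cmod (g t) <= 1" unfolding gt norm_of_real using q[of t] by simp
  hence "cmod (g t) ^ n <= 1" by (intro power_le_one) auto
  thus ?thesis by (simp add: norm_mult norm_power mult_le_one)
  qed
  thus "AE t in tr_meas (Xb b) a. norm (g t ^ n * g t ^ n) <= 1" for n by simp
 qed simp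
 ultimately have "(%n. ip (%x. (yy b ^^ n) (a x)) (%x. (yy b ^^ n) (a x))) ~> 0" by simp
 from tendsto_Re[OF this] show ?thesis by simp
qed

end

section \<open>The GNS representation and its von Neumann algebra\<close>

locale gns = free_pair M tr X for M :: "('h::complex_hilbert_space => 'h) set" and tr X +
 fixes Ph :: "nat => ('h => 'h) => ell2"
 assumes Ph_ip: "a : W ==> b : W ==> cinner (Ph m a) (Ph m' b) = (if m = m' then ip a b else 0)"
  and Ph_dense: "(!!m a. a : W ==> cinner (Ph m a) v = 0) ==> v = 0"

lemma (in free_pair) gns_exists: "EX Ph. gns M tr X Ph"
proof -
 define w where "w n = ew (from_nat n)" for n
 have wM: "w n : M" for n unfolding w_def by (rule ew_in)
 have w: "w (to_nat v) = ew v" for v by (simp add: w_def)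
 have one: "(%x. x) ~= (%_. 0 :: 'h)" using tr_id tr_zero by (metis zero_neq_one)
 obtain Ph :: "nat => ('h => 'h) => ell2" where
  Ph: "!!m m' a b n. expands w n a ==> expands w n b ==> cinner (Ph m a) (Ph m' b) = (if m = m' then ip a b else 0)"
  "!!v. (!!m j. cinner (Ph m (gs w j)) v = 0) ==> v = 0"
  using gns_vectors[of w "to_nat ([] :: (bool \<times> rat \<times> rat) list)", OF wM] one unfolding w by auto
 have ex: "EX n. expands w n a" if "a : W" for a
  using that
 proof induction
  case (word v)
  thus ?case using expands_w[of w "to_nat v", OF wM] unfolding w by blast
 next
  case (add a b)
  then obtain n m where "expands w n a" "expands w m b" by blast
  hence "expands w (max n m) a" "expands w (max n m) b" using expands_mono[of w, OF wM] by (meson max.cobounded1 max.cobounded2)+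
  thus ?case using expands_add[of w, OF wM] by blast
 next
  case (scale a c)
  thus ?case using expands_scale[of w, OF wM] by blast
 qed
 have gW: "gs w n : W" for n
 proof (induction n rule: less_induct)
  case (less n)
  have sum: "(%x. \<Sum>j<k. c j *c gs w j x) : W" if "k <= n" for k c
  using that
  proof (induction k)
  case (Suc k)
  thus ?case unfolding sum.lessThan_Suc using less by (intro wsp.add wsp.scale) auto
  qed (simp add: wsp_basic)
  have "gr w n : W"
  unfolding gr_def[of w, OF wM, abs_def] by (intro wsp_basic(4) sum) (simp_all add: w_def wsp.word)
  thus ?case unfolding gs_gr[of w, OF wM] by (rule wsp.scale)
 qed
 have "gns M tr X Ph"
 proof unfold_locales
  fix a b m m' assume "a : W" "b : W"
  then obtain n k where "expands w n a" "expands w k b" using ex by blast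
  hence "expands w (max n k) a" "expands w (max n k) b" using expands_mono[of w, OF wM] by (meson max.cobounded1 max.cobounded2)+
  thus "cinner (Ph m a) (Ph m' b) = (if m = m' then ip a b else 0)" by (rule Ph(1))
 next
  fix v assume "!!m a. a : W ==> cinner (Ph m a) v = 0"
  thus "v = 0" using Ph(2) gW by blast
 qed
 thus ?thesis by blast
qed

context gns begin

lemmas W_in = wsp_in[of _ UNIV]

lemma Ph_eqI: "(!!m a. a : W ==> cinner (Ph m a) u = cinner (Ph m a) v) ==> u = v"
 using Ph_dense[of "u - v"] by (simp add: cinner.diff_right)

lemma Ph_add: "a : W ==> b : W ==> Ph m (%x. a x + b x) = Ph m a + Ph m b"
 by (rule Ph_eqI) (simp add: Ph_ip wsp.add cinner_add_right ip_lin W_in)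

lemma Ph_scale: "a : W ==> Ph m (%x. c *c a x) = c *c Ph m a"
 by (rule Ph_eqI) (simp add: Ph_ip wsp.scale cinner_scaleC_right ip_lin(3)[OF W_in W_in W_in])

lemma Ph_zero: "Ph m (%x. 0) = 0"
 using Ph_scale[OF wsp_basic(1), of m 0] by simp

lemma Ph_diff: "a : W ==> b : W ==> Ph m (%x. a x - b x) = Ph m a - Ph m b"
 using Ph_add[OF _ wsp.scale[of b UNIV "-1"], of a m] Ph_scale[of b m "-1"] by simp

lemma op_ext:
 assumes s: "bcl (s :: ell2 => ell2)" and t: "bcl t" and eq: "!!m a. a : W ==> s (Ph m a) = t (Ph m a)"
 shows "s = t"
proof -
 have "cadj s v = cadj t v" for v
  by (rule Ph_eqI) (simp add: cadj(2)[OF s, symmetric] cadj(2)[OF t, symmetric] eq)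
 hence "cadj s = cadj t" by (rule ext)
 thus ?thesis using s t by (metis cadj_cadj)
qed

lemma norm_sum: "(!!m. b m : W) ==> (norm (\<Sum>m<n. Ph m (b m)))^2 = (\<Sum>m<n. Re (ip (b m) (b m)))"
proof (induction n)
 case (Suc n)
 have "cinner (\<Sum>m<n. Ph m (b m)) (Ph n (b n)) = 0"
  unfolding cinner.sum_left using Suc.prems by (intro sum.neutral) (simp add: Ph_ip)
 moreover have "(norm (Ph n (b n)))^2 = Re (ip (b n) (b n))"
  using cinner_self[of "Ph n (b n)"] Suc.prems by (simp add: Ph_ip)
 ultimately show ?case using Suc by (simp add: norm_add_sq)
qed simp

text \<open>The vectors \<open>Ph m a\<close> may satisfy linear relations; the bound on finite sums
  over distinct copies makes the prescription consistent.\<close>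

lemma extend:
 assumes add: "!!m a b. a : W ==> b : W ==> u m (%x. a x + b x) = u m a + u m b"
  and scale: "!!m a c. a : W ==> u m (%x. c *c a x) = c *c u m a"
  and C: "C >= 0" "!!n b. (!!m. b m : W) ==> (norm (\<Sum>m<n. u m (b m)))^2 <= C^2 * (\<Sum>m<n. Re (ip (b m) (b m)))"
 shows "EX t. bcl t & (ALL m. ALL a:W. t (Ph m a) = (u m a :: ell2))"
proof -
 define R where "R = {(\<Sum>m<n. Ph m (b m), \<Sum>m<n. u m (b m)) | n b. ALL m. b m : W}"
 have u0: "u m (%x. 0) = 0" for m using scale[OF wsp_basic(1), of m 0] by simp
 have pad: "(\<Sum>m<N. v m (if m < n then b m else (%x. 0))) = (\<Sum>m<n. v m (b m))"
  if "n <= N" "!!m. v m (%x. 0) = 0" for v :: "nat => ('h => 'h) => ell2" and n N b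
  using that by (intro sum.mono_neutral_cong_right) auto
 have cs: "csubspace R"
  unfolding csubspace_def
 proof (intro conjI ballI allI)
  have "(\<Sum>m<0. Ph m (%x. 0), \<Sum>m<0. u m (%x. 0)) : R" unfolding R_def using wsp_basic(3)
  by (intro CollectI exI[of _ 0] exI[of _ "%m x. 0"]) simp
  thus "0 : R" by (simp add: zero_prod_def)
 next
  fix p q assume "p : R" "q : R"
  then obtain n b k c where p: "p = (\<Sum>m<n. Ph m (b m), \<Sum>m<n. u m (b m))" "!!m. b m : W"
  and q: "q = (\<Sum>m<k. Ph m (c m), \<Sum>m<k. u m (c m))" "!!m. c m : W" unfolding R_def by auto
  let ?b = "%m. if m < n then b m else (%x. 0)" and ?c = "%m. if m < k then c m else (%x. 0)"
  define d where "d m = (%x. ?b m x + ?c m x)" for m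
  have bc: "?b m : W" "?c m : W" for m using p q wsp_basic(3) by auto
  have "(\<Sum>m<max n k. Ph m (d m)) = fst p + fst q"
  unfolding p q d_def Ph_add[OF bc] sum.distrib fst_conv by (simp add: pad[of _ _ Ph] Ph_zero)
  moreover have "(\<Sum>m<max n k. u m (d m)) = snd p + snd q"
  unfolding p q d_def add[OF bc] sum.distrib snd_conv by (simp add: pad[of _ _ u] u0)
  moreover have "d m : W" for m unfolding d_def by (rule wsp.add[OF bc])
  ultimately show "p + q : R" unfolding R_def by (intro CollectI exI[of _ "max n k"] exI[of _ d]) (simp add: prod_eq_iff)
 next
  fix c p assume "p : R"
  then obtain n b where p: "p = (\<Sum>m<n. Ph m (b m), \<Sum>m<n. u m (b m))" "!!m. b m : W" unfolding R_def by auto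
  thus "c *c p : R" unfolding R_def
  by (intro CollectI exI[of _ n] exI[of _ "%m x. c *c b m x"])
  (simp add: Ph_scale scale wsp.scale scaleC.sum_right)
 qed
 have in_R: "(Ph m a, u m a) : R" if "a : W" for m a
 proof -
  let ?b = "%k. if k = m then a else (%x. 0)"
  have "(\<Sum>k<Suc m. v k (?b k)) = v m a" if "!!m. v m (%x. 0) = 0" for v :: "nat => ('h => 'h) => ell2"
  using that by simp
  thus ?thesis unfolding R_def using that wsp_basic(3) Ph_zero u0
  by (intro CollectI exI[of _ "Suc m"] exI[of _ ?b]) simp
 qed
 have dn: "closure (Domain R) = UNIV"
  unfolding dense_iff_orth[OF csubspace_Domain[OF cs]]
 proof (intro allI impI)
  fix v assume "ALL y:Domain R. cinner v y = 0"
  hence "cinner v (Ph m a) = 0" if "a : W" for m a using in_R[OF that] by blast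
  thus "v = 0" by (intro Ph_dense) (metis cinner_commute complex_cnj_zero)
 qed
 have bd: "norm y <= C * norm x" if xy: "(x, y) : R" for x y
 proof (rule power2_le_imp_le)
  obtain n b where "x = (\<Sum>m<n. Ph m (b m))" "y = (\<Sum>m<n. u m (b m))" "!!m. b m : W" using xy unfolding R_def by auto
  thus "(norm y)^2 <= (C * norm x)^2" using C(2)[of b n] norm_sum[of b n] by (simp add: power_mult_distrib)
 qed (use C in simp)
 obtain t where t: "!!x y. t (x + y) = t x + t y" "!!c x. t (c *c x) = c *c t x" "!!x. norm (t x) <= C * norm x"
  "!!x y. (x, y) : R ==> t x = y" by (rule extend_bounded[of R C, OF cs dn _ C(1)]) (erule bd, rule that)
 have "bcl t" by (rule bclI[OF t(1-3)])
 thus ?thesis using t(4)[OF in_R] by blast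
qed

text \<open>Left multiplication by \<open>x\<close> in every copy at once: the GNS
  representation.\<close>

definition pp :: "('h => 'h) => ell2 => ell2"
 where "pp x = (SOME t. bcl t & (ALL m. ALL a:W. t (Ph m a) = Ph m (%s. x (a s))))"

lemma pp: assumes x: "x : W" shows "bcl (pp x)" "a : W ==> pp x (Ph m a) = Ph m (%s. x (a s))"
proof -
 note xb = bcl[OF W_in[OF x]]
 obtain C where C: "C > 0" "!!s. norm (x s) <= C * norm s" using bcl_bound[OF xb] by blast
 have "EX t. bcl t & (ALL m. ALL a:W. t (Ph m a) = Ph m (%s. x (a s)))"
 proof (rule extend[where C = C])
  show "(norm (\<Sum>m<n. Ph m (%s. x (b m s))))^2 <= C^2 * (\<Sum>m<n. Re (ip (b m) (b m)))" if b: "!!m. b m : W" for n b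
  unfolding norm_sum[of "%m s. x (b m s)", OF wsp_comp[OF x b]] sum_distrib_left
  using C b by (intro sum_mono ip_bound(1)[OF W_in[OF x]] W_in) auto
 qed (use C in \<open>auto simp: bcl_simps[OF xb] Ph_add Ph_scale wsp_comp[OF x]\<close>)
 from someI_ex[OF this] show "bcl (pp x)" "a : W ==> pp x (Ph m a) = Ph m (%s. x (a s))"
  unfolding pp_def by blast+
qed

text \<open>Right multiplication by \<open>w\<close>, from copy 0 into copy \<open>k\<close>. It
  commutes with all left multiplications and so supplies elements of the commutant.\<close>

lemma right_mult:
 assumes w: "w : W"
 shows "EX c. bcl c & (ALL m. ALL a:W. c (Ph m a) = (if m = 0 then Ph k (%s. a (w s)) else 0))"
proof -
 obtain C where C: "C > 0" "!!s. norm (w s) <= C * norm s" using bcl_bound[OF bcl[OF W_in[OF w]]] by blast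
 show ?thesis
 proof (rule extend[where C = C])
  show "(norm (\<Sum>m<n. if m = 0 then Ph k (%s. b m (w s)) else 0))^2 <= C^2 * (\<Sum>m<n. Re (ip (b m) (b m)))" if b: "!!m. b m : W" for n :: nat and b
  proof (cases n)
  case (Suc n')
  have pos: "0 <= Re (ip (b m) (b m))" for m by (rule ip_pos(2)[OF W_in[OF b]])
  have e: "(\<Sum>m<n. if m = 0 then Ph k (%s. b m (w s)) else 0) = Ph k (%s. b 0 (w s))"
  using Suc by (simp add: sum.delta')
  have e2: "(norm (Ph k (%s. b 0 (w s))))^2 = Re (ip (%s. b 0 (w s)) (%s. b 0 (w s)))"
  using cinner_self[of "Ph k (%s. b 0 (w s))"] Ph_ip[OF wsp_comp[OF b w] wsp_comp[OF b w]]
  by simp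
  have 1: "Re (ip (%s. b 0 (w s)) (%s. b 0 (w s))) <= C^2 * Re (ip (b 0) (b 0))" using C by (intro ip_bound(2) W_in w b) auto
  have 2: "Re (ip (b 0) (b 0)) <= (\<Sum>m<n. Re (ip (b m) (b m)))"
  using Suc pos by (intro member_le_sum) auto
  show ?thesis unfolding e e2 by (rule order_trans[OF 1 mult_left_mono[OF 2]]) simp
  qed simp
 qed (use C in \<open>auto simp: Ph_add[OF wsp_comp[OF _ w] wsp_comp[OF _ w]] Ph_scale[OF wsp_comp[OF _ w]]\<close>)
qed

lemma pp_comp: assumes "x : W" "y : W" shows "pp (%s. x (y s)) = (%v. pp x (pp y v))"
 by (rule op_ext[OF pp(1)[OF wsp_comp[OF assms]] bcl_comp(2)[OF pp(1)[OF assms(1)] pp(1)[OF assms(2)]]])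
  (simp add: pp(2) wsp_comp assms)

lemma pp_lin:
 assumes "x : W" "y : W"
 shows "pp (%s. x s + y s) = (%v. pp x v + pp y v)" "pp (%s. x s - y s) = (%v. pp x v - pp y v)" "pp (%s. c *c x s) = (%v. c *c pp x v)"
 by (rule op_ext; (intro bcl_intros pp(1) wsp.add wsp_basic(4) wsp.scale assms)?;
  simp add: pp(2) assms wsp.add wsp.scale wsp_basic(4) wsp_comp Ph_add Ph_diff Ph_scale)+

lemma pp_id: "pp (%s. s) = (%v. v)"
 by (rule op_ext) (simp_all add: pp wsp_basic)

lemma pp_adj: assumes "x : W" shows "cadj (pp x) = pp (cadj x)"
proof (rule op_ext[OF cadj(1)[OF pp(1)[OF assms]] pp(1)[OF W_adj[OF assms]]], rule Ph_eqI)
 fix m k a b assume ab: "a : W" "b : W"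
 show "cinner (Ph k b) (cadj (pp x) (Ph m a)) = cinner (Ph k b) (pp (cadj x) (Ph m a))"
  using ip_left[OF W_in[OF assms] W_in[OF ab(2)], of a] assms ab
  by (simp add: cadj(2)[OF pp(1)[OF assms], symmetric] pp(2) W_adj Ph_ip wsp_comp)
qed

definition N :: "(bool \<times> rat \<times> rat) set => (ell2 => ell2) set"
 where "N S = commutant (commutant (pp ` L ` S))"

definition Om :: ell2 where "Om = Ph 0 (%s. s)"
definition sg :: "(ell2 => ell2) => complex" where "sg t = cinner Om (t Om)"

lemma LW: "L l : W" by (rule wsp_basic(2)) simp

lemma N_vna:
 assumes S: "!!l. l : S ==> star l : S"
 shows "von_neumann_algebra (N S)" "l : S ==> pp (L l) : N S"
proof -
 have "bcl g & cadj g : pp ` L ` S" if "g : pp ` L ` S" for g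
  using that S by (auto simp: pp(1) LW pp_adj L(2))
 from bicommutant[OF this] show "von_neumann_algebra (N S)" "l : S ==> pp (L l) : N S" unfolding N_def by auto
qed

lemma N_UNIV: "von_neumann_algebra (N UNIV)" "N S <= N UNIV" "vna (N UNIV)"
proof -
 show "von_neumann_algebra (N UNIV)" by (rule N_vna) simp
 thus "vna (N UNIV)" by (rule vna_von_neumann)
 show "N S <= N UNIV" unfolding N_def commutant_def by blast
qed

lemma pp_N:
 assumes S: "!!l. l : S ==> star l : S" and x: "x : wsp S"
 shows "pp x : N S"
 using x
proof induction
 have v: "von_neumann_algebra (N S)" by (rule N_vna(1)) (rule S)
 note al = vna_alg[OF vna_von_neumann[OF v]]
 have lN: "pp (L l) : N S" if "l : S" for l by (rule N_vna(2)[OF _ that]) (rule S)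
 {
  case (word w)
  thus ?case
  proof (induction w)
  case (Cons l w)
  thus ?case using pp_comp[OF LW wsp_W[OF wsp.word[of w S]]] al(9)[OF lN] by simp
  qed (simp add: pp_id al)
 next
  case (add a b)
  show ?case unfolding pp_lin(1)[OF wsp_W[OF add.hyps(1)] wsp_W[OF add.hyps(2)]] by (rule al(5)[OF add.IH])
 next
  case (scale a c)
  show ?case unfolding pp_lin(3)[OF wsp_W[OF scale.hyps] wsp_W[OF scale.hyps]] by (rule al(7)[OF scale.IH])
 }
qed

lemma pp_Om: "x : W ==> pp x Om = Ph 0 x"
 by (simp add: Om_def pp(2) wsp_basic)

lemma sg_pp: "x : W ==> sg (pp x) = tr x" "x : W ==> cinner Om (Ph 0 x) = tr x"
proof -
 show "x : W ==> cinner Om (Ph 0 x) = tr x" unfolding Om_def by (simp add: Ph_ip wsp_basic ip_def)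
 thus "x : W ==> sg (pp x) = tr x" by (simp add: sg_def pp_Om)
qed

lemma right_mult_comm:
 assumes w: "w : W"
 obtains c where "c : commutant (N UNIV)" "!!a. a : W ==> c (Ph 0 a) = Ph k (%s. a (w s))" "!!m a. a : W ==> m ~= 0 ==> c (Ph m a) = 0"
proof -
 obtain c where c: "bcl c" "ALL m. ALL a:W. c (Ph m a) = (if m = 0 then Ph k (%s. a (w s)) else 0)"
  using right_mult[OF w, of k] by blast
 have "(%v. c (pp (L l) v)) = (%v. pp (L l) (c v))" for l
  by (rule op_ext[OF bcl_comp(2)[OF c(1) pp(1)[OF LW]] bcl_comp(2)[OF pp(1)[OF LW] c(1)]])
  (simp add: pp(2) LW c(2) wsp_comp w bcl_zero[OF pp(1)[OF LW]])
 hence "c : commutant (pp ` L ` UNIV)" using c(1) by (auto simp: in_commutant fun_eq_iff)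
 hence "c : commutant (N UNIV)"
  unfolding N_def using commutant_incl[of "commutant (pp ` L ` UNIV)"] in_commutant by blast
 thus ?thesis using that c(2) by auto
qed

text \<open>Elements of the commutant carry \<open>Om\<close> to every \<open>Ph m a\<close>, so an
  element of the algebra that kills \<open>Om\<close> kills a total set.\<close>

lemma separating: assumes t: "t : N UNIV" and 0: "t Om = 0" shows "t = (%_. 0)"
proof (rule op_ext[OF vna_bcl[OF N_UNIV(3) t]])
 fix m a assume a: "a : W"
 obtain c where c: "c : commutant (N UNIV)" "!!b. b : W ==> c (Ph 0 b) = Ph m (%s. b (a s))"
  using right_mult_comm[OF a, of m] by metis
 have "c Om = Ph m a" unfolding Om_def using c(2)[OF wsp_basic(1)] by simp
 moreover have "c 0 = 0" using c(1) by (simp add: in_commutant bcl_zero)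
 ultimately show "t (Ph m a) = 0" using commD[OF c(1) t, of Om] 0 by simp
qed simp

text \<open>The projection onto the closure of \<open>Ph 0\<close> on \<open>wsp S\<close> commutes
  with the represented letters, hence with \<open>t\<close>, and it fixes \<open>Om\<close>; so
  \<open>t Om\<close> stays in that closure.\<close>

lemma approx:
 assumes S: "!!l. l : S ==> star l : S" and t: "t : N S"
 obtains f where "!!n::nat. f n : wsp S" "(%n. Ph 0 (f n)) ~> t Om"
proof -
 let ?K = "Ph 0 ` wsp S"
 have K: "csubspace ?K"
  unfolding csubspace_def
 proof (intro conjI ballI allI)
  show "0 : ?K" using image_eqI[of 0 "Ph 0" "%x. 0" "wsp S"] wsp_basic(3) by (simp add: Ph_zero)
  fix p q assume "p : ?K" "q : ?K"
  then obtain a b where ab: "p = Ph 0 a" "q = Ph 0 b" "a : wsp S" "b : wsp S" by blast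
  show "p + q : ?K"
  unfolding ab(1,2) Ph_add[OF wsp_W[OF ab(3)] wsp_W[OF ab(4)], symmetric] by (rule imageI[OF wsp.add[OF ab(3,4)]])
 next
  fix c p assume "p : ?K"
  then obtain a where a: "p = Ph 0 a" "a : wsp S" by blast
  show "c *c p : ?K"
  unfolding a(1) Ph_scale[OF wsp_W[OF a(2)], symmetric] by (rule imageI[OF wsp.scale[OF a(2)]])
 qed
 obtain p where p: "projop p" "range p = closure ?K"
  using projection_exists[OF csubspace_closure[OF K]] by auto
 note P = projD[OF p(1)]
 have inv: "p (pp (L l) (p v)) = pp (L l) (p v)" if l: "l : S" for l v
 proof -
  note b = pp(1)[OF LW[of l]]
  have "p v : closure ?K" using p(2) by blast
  then obtain f where f: "!!n. f n : ?K" "f ~> p v" unfolding closure_sequential by blast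
  have "pp (L l) (f n) : ?K" for n
  proof -
  obtain a where "f n = Ph 0 a" "a : wsp S" using f(1) by blast
  thus ?thesis using pp(2)[OF LW wsp_W] wsp_comp[OF wsp_basic(2)[OF l]] by simp
  qed
  hence "pp (L l) (p v) : closure ?K"
  unfolding closure_sequential using bcl_tendsto[OF b f(2)] by (intro exI[of _ "%n. pp (L l) (f n)"]) simp
  thus ?thesis using proj_range(3)[OF p(1)] p(2) by blast
 qed
 have "p (pp (L l) v) = pp (L l) (p v)" if l: "l : S" for l v
 proof -
  note b = pp(1)[OF LW[of l]]
  have ad: "cinner (pp (L l) x) y = cinner x (pp (L (star l)) y)" for x y
  using cadj(2)[OF b] by (simp add: pp_adj[OF LW] L(2))
  have "cinner z (p (pp (L l) v)) = cinner z (pp (L l) (p v))" for z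
  proof -
  have ad': "cinner x (pp (L l) y) = cinner (pp (L (star l)) x) y" for x y
  using cadj(3)[OF b] by (simp add: pp_adj[OF LW] L(2))
  have "cinner z (p (pp (L l) v)) = cinner (pp (L (star l)) (p z)) v" by (simp add: P(4)[symmetric] ad')
  also have "... = cinner (p (pp (L (star l)) (p z))) v" using inv[OF S[OF l]] by simp
  also have "... = cinner z (p (pp (L l) (p v)))" by (simp only: P(4) ad'[symmetric])
  also have "... = cinner z (pp (L l) (p v))" using inv[OF l] by simp
  finally show ?thesis .
  qed
  thus ?thesis by (rule cinner_ext)
 qed
 hence "p : commutant (pp ` L ` S)" using P(1) by (auto simp: in_commutant)
 hence "t (p Om) = p (t Om)" using t by (auto simp: N_def in_commutant)
 moreover have "Om : closure ?K" unfolding Om_def using wsp_basic(1) closure_subset by blast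
 hence "p Om = Om" using proj_range(3)[OF p(1)] p(2) by blast
 ultimately have "t Om : closure ?K" using p(2) by (metis rangeI)
 then obtain g where g: "!!n. g n : ?K" "g ~> t Om" unfolding closure_sequential by blast
 hence "ALL n. EX a. a : wsp S & g n = Ph 0 a" by blast
 from choice[OF this] obtain f where f: "!!n. f n : wsp S" "!!n. g n = Ph 0 (f n)" by blast
 have "g = (%n. Ph 0 (f n))" using f(2) by (rule ext)
 thus ?thesis using that[OF f(1)] g(2) by simp
qed

text \<open>Traciality with one factor a word polynomial: right multiplication by \<open>x\<close>
  commutes with \<open>t\<close>, sends \<open>Om\<close> to \<open>Ph 0 x\<close>, and its adjoint
  sends \<open>Om\<close> to \<open>Ph 0 (cadj x)\<close>.\<close>

lemma half_trace:
 assumes t: "t : N UNIV" and x: "x : W"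
 shows "cinner Om (t (Ph 0 x)) = cinner (Ph 0 (cadj x)) (t Om)"
proof -
 obtain c where c: "c : commutant (N UNIV)" "!!a. a : W ==> c (Ph 0 a) = Ph 0 (%s. a (x s))" "!!m a. a : W ==> m ~= 0 ==> c (Ph m a) = 0"
  using right_mult_comm[OF x, of 0] by metis
 have cb: "bcl c" using c(1) by (simp add: in_commutant)
 have cO: "c Om = Ph 0 x" unfolding Om_def using c(2)[OF wsp_basic(1)] by simp
 have "cadj c Om = Ph 0 (cadj x)"
 proof (rule Ph_eqI)
  fix m a assume a: "a : W"
  show "cinner (Ph m a) (cadj c Om) = cinner (Ph m a) (Ph 0 (cadj x))"
  using ip_right[OF W_in[OF x] W_in[OF a] alg(2)] c(2)[OF a] c(3)[OF a] a x
  by (cases "m = 0") (simp_all add: cadj(2)[OF cb, symmetric] Om_def Ph_ip wsp_comp wsp_basic W_adj)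
 qed
 moreover have "t (Ph 0 x) = c (t Om)" using commD[OF c(1) t, of Om] by (simp add: cO)
 ultimately show ?thesis by (simp add: cadj(3)[OF cb, symmetric])
qed

text \<open>Approximate \<open>b Om\<close> by \<open>Ph 0 (f n)\<close>. Taking adjoints is
  isometric, so the vectors for \<open>cadj (f n)\<close> converge to some \<open>\<eta>\<close>;
  \<open>half_trace\<close> shows that \<open>\<eta>\<close> and \<open>cadj b Om\<close> have the
  same inner products with the vectors needed.\<close>

lemma sg_tracial:
 assumes a: "a : N UNIV" and b: "b : N UNIV"
 shows "sg (%v. a (b v)) = sg (%v. b (a v))"
proof -
 note ab = vna_bcl[OF N_UNIV(3) a] and bb = vna_bcl[OF N_UNIV(3) b] and b'N = vna_adj[OF N_UNIV(3) b]
 note b'b = vna_bcl[OF N_UNIV(3) b'N]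
 obtain f where f: "!!n. f n : W" "(%n. Ph 0 (f n)) ~> b Om" using approx[OF _ b] by auto
 let ?g = "%n. Ph 0 (cadj (f n))"
 have dist: "norm (?g n - ?g m) = norm (Ph 0 (f n) - Ph 0 (f m))" for n m
 proof -
  have d: "cadj (%x. f n x - f m x) = (%x. cadj (f n) x - cadj (f m) x)"
  by (rule cadj_minus) (intro bcl W_in f)+
  have dW: "(%x. f n x - f m x) : W" by (intro wsp_basic f)
  have nn: "(norm (Ph 0 c))^2 = Re (ip c c)" if "c : W" for c
  using cinner_self[of "Ph 0 c"] that by (simp add: Ph_ip)
  have "(norm (Ph 0 (cadj (%x. f n x - f m x))))^2 = (norm (Ph 0 (%x. f n x - f m x)))^2"
  unfolding nn[OF W_adj[OF dW]] nn[OF dW] ip_star[OF W_in[OF dW] W_in[OF dW]] ..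
  thus ?thesis unfolding d Ph_diff[OF f(1) f(1)] Ph_diff[OF W_adj[OF f(1)] W_adj[OF f(1)]] by simp
 qed
 have "Cauchy ?g"
  using LIMSEQ_imp_Cauchy[OF f(2)] unfolding Cauchy_iff dist .
 then obtain \<eta> where \<eta>: "?g ~> \<eta>" using Cauchy_convergent convergent_def by blast
 have lim: "cinner \<eta> (c Om) = cinner Om (c (b Om))" if c: "c : N UNIV" for c
 proof -
  have "(%n. cinner (?g n) (c Om)) ~> cinner \<eta> (c Om)" by (intro cinner.tendsto \<eta> tendsto_const)
  moreover have "(%n. cinner Om (c (Ph 0 (f n)))) ~> cinner Om (c (b Om))"
  by (intro cinner.tendsto tendsto_const bcl_tendsto[OF vna_bcl[OF N_UNIV(3) c] f(2)])
  ultimately show ?thesis unfolding half_trace[OF c f(1)] by (rule LIMSEQ_unique)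
 qed
 have \<eta>_eq: "cinner \<eta> (Ph 0 x) = cinner (cadj b Om) (Ph 0 x)" if x: "x : W" for x
 proof -
  have "cinner \<eta> (Ph 0 x) = cinner Om (pp x (b Om))"
  using lim[OF pp_N[of UNIV x]] x by (simp add: pp_Om)
  also have "... = cinner (Ph 0 (cadj x)) (b Om)"
  using cadj(3)[OF pp(1)[OF x], of Om "b Om"] by (simp add: pp_adj[OF x] pp_Om W_adj[OF x])
  also have "... = cinner (cadj b Om) (Ph 0 x)"
  unfolding half_trace[OF b x, symmetric] by (simp add: cadj(3)[OF bb])
  finally show ?thesis .
 qed
 have cl: "cinner \<eta> v = cinner (cadj b Om) v" if v: "v = a Om" for v
 proof -
  obtain h where h: "!!n. h n : W" "(%n. Ph 0 (h n)) ~> a Om" using approx[OF _ a] by auto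
  have "(%n. cinner \<eta> (Ph 0 (h n))) ~> cinner \<eta> (a Om)" "(%n. cinner (cadj b Om) (Ph 0 (h n))) ~> cinner (cadj b Om) (a Om)"
  by (intro cinner.tendsto h tendsto_const)+
  thus ?thesis unfolding \<eta>_eq[OF h(1)] v by (rule LIMSEQ_unique)
 qed
 have "cinner Om (a (b Om)) = cinner (cadj b Om) (a Om)" using lim[OF a] cl by simp
 thus ?thesis by (simp add: sg_def cadj(3)[OF bb])
qed

end

section \<open>Monotone limits, normality and the vector trace\<close>

lemma increasing_limit:
 assumes b: "!!n::nat. bcl (f n)" "bcl a"
  and le: "!!n. op_le (f n) (f (Suc n))" "!!n. op_le (f n) a"
 obtains g where "bcl g" "!!x. (%n. f n x) ~> g x"
proof -
 have mono: "op_le (f m) (f n)" if "m <= n" for m n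
  using that by (induction rule: dec_induct) (auto intro: op_le_trans le simp: op_le_def[of "f m" "f m"])
 obtain C where C: "C > 0" "!!x. norm (a x - f 0 x) <= C * norm x" using bcl_bound[OF bcl_minusop[OF b(2) b(1)[of 0]]] by blast
 obtain C' where C': "C' > 0" "!!x. norm (f 0 x) <= C' * norm x" using bcl_bound[OF b(1)] by blast
 have form: "Re (cinner x (f n x - f m x)) <= C * (norm x)^2" for m n x
 proof -
  have "Re (cinner x (f n x - f m x)) <= Re (cinner x (a x - f 0 x))"
  using le(2)[of n] mono[of 0 m] unfolding op_le_def by (simp add: complex_nonneg_Reals_iff cinner.diff_right) (smt (verit))
  also have "... <= norm x * norm (a x - f 0 x)" using complex_Re_le_cmod norm_cinner_le order_trans by blast
  also have "... <= norm x * (C * norm x)" by (intro mult_left_mono C) simp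
  finally show ?thesis by (simp add: power2_eq_square algebra_simps)
 qed
 have pb: "(norm (f n x - f m x))^2 <= C * Re (cinner x (f n x - f m x))" "norm (f n x - f m x) <= C * norm x" if "m <= n" for m n x
 proof -
  have p: "posop (%x. f n x - f m x)" using mono[OF that] op_le_posop[OF b(1) b(1), of m n] by simp
  show "(norm (f n x - f m x))^2 <= C * Re (cinner x (f n x - f m x))" "norm (f n x - f m x) <= C * norm x"
  by (rule posop_bound[OF p C(1) form])+
 qed
 have "convergent (%n. f n x)" for x
 proof (rule quadratic_convergent)
  show "(norm (f n x - f m x))^2 <= C * Re (cinner x (f n x)) - C * Re (cinner x (f m x))" if "m <= n" for m n
  using pb(1)[OF that, of x] by (simp add: cinner.diff_right algebra_simps)
  show "C * Re (cinner x (f n x)) <= C * Re (cinner x (a x))" for n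
  using le(2)[of n] C(1) unfolding op_le_def by (auto simp: complex_nonneg_Reals_iff cinner.diff_right)
 qed
 hence "ALL x. EX l. (%n. f n x) ~> l" unfolding convergent_def by blast
 from choice[OF this] obtain g where g: "!!x. (%n. f n x) ~> g x" by blast
 have "norm (f n x) <= (C + C') * norm x" for n x
  using norm_triangle_ineq[of "f n x - f 0 x" "f 0 x"] pb(2)[of 0 n x] C'(2)[of x] by (simp add: algebra_simps)
 from bcl_limit[OF b(1) g this] show ?thesis using that g by blast
qed

context gns begin

lemma Om_Om: "cinner Om Om = 1"
 unfolding Om_def by (simp add: Ph_ip wsp_basic ip_def tr_id)

lemma sg_mono: "op_le a b ==> Re (sg a) <= Re (sg b)"
 unfolding op_le_def sg_def by (drule spec[of _ Om]) (simp add: cinner.diff_right complex_nonneg_Reals_iff)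

text \<open>Since \<open>Om\<close> is separating, the limit of an increasing sequence in \<open>D\<close> that exhausts the supremum of \<open>\<sigma>\<close>
  already dominates \<open>D\<close>, so nets reduce to sequences.\<close>

lemma sg_normal: "normal_functional (N UNIV) sg"
 unfolding normal_functional_def
proof (intro allI impI, elim conjE)
 fix D a assume D: "D <= {d : N UNIV. op_le (%_. 0) d}" "D ~= {}" and dir: "ALL d:D. ALL e:D. EX f:D. op_le d f & op_le e f"
  and a: "a : N UNIV" "ALL d:D. op_le d a" and least: "ALL b:N UNIV. (ALL d:D. op_le d b) --> op_le a b"
 note V = N_UNIV(3) and bN = vna_bcl[OF N_UNIV(3)]
 have DN: "d : N UNIV" if "d : D" for d using D that by blast
 define s where "s = (SUP d\<in>D. Re (sg d))"
 have bdd: "bdd_above ((%d. Re (sg d)) ` D)" using a(2) sg_mono by (intro bdd_aboveI[of _ "Re (sg a)"]) blast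
 have le_s: "Re (sg d) <= s" if "d : D" for d unfolding s_def by (rule cSUP_upper[OF that bdd])
 have lim: "EX g. g : N UNIV & (ALL x. (%n. f n x) ~> g x) & (%n. Re (sg (f n))) ~> Re (sg g) & (ALL n. op_le (f n) g)"
  if f: "!!n::nat. f n : D" "!!n. op_le (f n) (f (Suc n))" for f
 proof -
  obtain g where g: "bcl g" "!!x. (%n. f n x) ~> g x"
  by (rule increasing_limit[of f a, OF bN[OF DN[OF f(1)]] bN[OF a(1)] f(2)]) (use a(2) f(1) in blast)+
  have "g : N UNIV" by (rule vna_limit[OF V DN[OF f(1)] g(2,1)])
  moreover have "(%n. Re (sg (f n))) ~> Re (sg g)"
  unfolding sg_def by (intro tendsto_Re cinner.tendsto tendsto_const g(2))
  moreover have "op_le (f m) g" for m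
  proof (rule op_le_limit[of "%n. f m" "%n. f (n + m)"])
  show "op_le (f m) (f (n + m))" for n
  by (induction n) (auto intro: op_le_trans f(2) simp: op_le_def[of "f m" "f m"])
  show "(%n. f (n + m) x) ~> g x" for x by (rule LIMSEQ_ignore_initial_segment[OF g(2)])
  qed simp
  ultimately show ?thesis using g(2) by blast
 qed
 have near: "EX e:D. s - 1 / real (Suc n) < Re (sg e)" for n
 proof -
  have "s - 1 / real (Suc n) < s" by simp
  thus ?thesis unfolding s_def less_cSUP_iff[OF D(2) bdd] .
 qed
 have "EX f. ALL n. (f n : D & s - 1 / real (Suc n) < Re (sg (f n))) & op_le (f n) (f (Suc n))"
 proof (rule dependent_nat_choice)
  show "EX x. x : D & s - 1 / real (Suc 0) < Re (sg x)" using near[of 0] by blast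
  fix x n assume x: "x : D & s - 1 / real (Suc n) < Re (sg x)"
  obtain e where e: "e : D" "s - 1 / real (Suc (Suc n)) < Re (sg e)" using near by blast
  obtain y where "y : D" "op_le x y" "op_le e y" using dir x e(1) by blast
  thus "EX y. (y : D & s - 1 / real (Suc (Suc n)) < Re (sg y)) & op_le x y"
  using e(2) sg_mono order_less_le_trans by blast
 qed
 then obtain f where f: "!!n. f n : D" "!!n. s - 1 / real (Suc n) < Re (sg (f n))" "!!n. op_le (f n) (f (Suc n))" by blast
 obtain g where g: "g : N UNIV" "!!x. (%n. f n x) ~> g x" "(%n. Re (sg (f n))) ~> Re (sg g)" "!!n. op_le (f n) g"
  using lim[of f] f(1,3) by blast
 have "(%n. s - 1 / real (Suc n)) ~> s - 0"
  by (intro tendsto_diff tendsto_const) (use LIMSEQ_inverse_real_of_nat in \<open>simp add: inverse_eq_divide\<close>)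
 hence "(%n. s - 1 / real (Suc n)) ~> s" by simp
 hence "s <= Re (sg g)" by (rule LIMSEQ_le[OF _ g(3)]) (use f(2) in \<open>intro exI[of _ 0] allI impI less_imp_le\<close>)
 have dom: "op_le e g" if e: "e : D" for e
 proof -
  \<comment> \<open>An increasing sequence in \<open>D\<close> above both \<open>f\<close> and
    \<open>e\<close>. Its limit \<open>k\<close> dominates \<open>g\<close> but has no larger value
    under \<open>sg\<close>, so \<open>k Om = g Om\<close> and separation gives
    \<open>k = g\<close>.\<close>
  have "EX h. ALL n. (h n : D & op_le (f n) (h n) & op_le e (h n)) & op_le (h n) (h (Suc n))"
  proof (rule dependent_nat_choice)
  show "EX x. x : D & op_le (f 0) x & op_le e x" using dir f(1) e by blast
  fix x n assume x: "x : D & op_le (f n) x & op_le e x"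
  obtain y where "y : D" "op_le x y" "op_le (f (Suc n)) y" using dir x f(1) by blast
  thus "EX y. (y : D & op_le (f (Suc n)) y & op_le e y) & op_le x y" using x op_le_trans by blast
  qed
  then obtain h where h: "!!n. h n : D" "!!n. op_le (f n) (h n)" "!!n. op_le e (h n)" "!!n. op_le (h n) (h (Suc n))" by blast
  obtain k where k: "k : N UNIV" "!!x. (%n. h n x) ~> k x" "(%n. Re (sg (h n))) ~> Re (sg k)" "!!n. op_le (h n) k"
  using lim[of h] h(1,4) by blast
  have "op_le g k" by (rule op_le_limit[OF h(2) g(2) k(2)])
  hence p: "posop (%x. k x - g x)" using op_le_posop[OF bN[OF g(1)] bN[OF k(1)]] by simp
  have "Re (sg k) <= s" by (rule LIMSEQ_le_const2[OF k(3)]) (use le_s h(1) in blast)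
  hence "Re (cinner Om (k Om - g Om)) <= 0" using `s <= Re (sg g)` by (simp add: sg_def cinner.diff_right)
  obtain C where C: "C > 0" "!!x. norm (k x - g x) <= C * norm x" using bcl_bound[OF posopD(1)[OF p]] by blast
  have "Re (cinner x (k x - g x)) <= C * (norm x)^2" for x
  proof -
  have "Re (cinner x (k x - g x)) <= norm x * norm (k x - g x)" using complex_Re_le_cmod norm_cinner_le order_trans by blast
  also have "... <= norm x * (C * norm x)" by (intro mult_left_mono C) simp
  finally show ?thesis by (simp add: power2_eq_square algebra_simps)
  qed
  from posop_bound(1)[OF p C(1) this, of Om] have "(norm (k Om - g Om))^2 <= C * Re (cinner Om (k Om - g Om))" .
  also have "... <= 0" using `Re (cinner Om (k Om - g Om)) <= 0` C(1) by (simp add: mult_le_0_iff)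
  finally have "k Om - g Om = 0" by simp
  hence "(%x. k x - g x) = (%_. 0)" by (intro separating vna_alg(6)[OF V] k g)
  hence "k = g" by (simp add: fun_eq_iff)
  thus ?thesis using op_le_trans[OF h(3) k(4)] by simp
 qed
 have "op_le a g" using least g(1) dom by blast
 hence "Re (sg a) <= Re (sg g)" by (rule sg_mono)
 also have "Re (sg g) <= s" by (rule LIMSEQ_le_const2[OF g(3)]) (use le_s f(1) in blast)
 finally have "Re (sg a) <= s" .
 moreover have "s <= Re (sg a)" unfolding s_def using D(2) a(2) sg_mono by (intro cSUP_least) auto
 moreover have "Im (sg a) = 0"
 proof -
  obtain d where "d : D" using D(2) by blast
  hence "op_le (%_. 0) a" using D(1) a(2) op_le_trans by blast
  thus ?thesis unfolding op_le_def sg_def by (auto simp: complex_nonneg_Reals_iff dest: spec[of _ Om])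
 qed
 ultimately show "sg a = cr (SUP d\<in>D. Re (sg d))" unfolding s_def[symmetric] by (simp add: complex_eq_iff)
qed

lemma tracial_N: "tracial_vna (N UNIV) sg"
 unfolding tracial_vna_def
proof (intro conjI ballI allI impI)
 fix a assume a: "a : N UNIV"
 note ab = vna_bcl[OF N_UNIV(3) a]
 have e: "sg (cadj a \<circ> a) = cr ((norm (a Om))^2)"
  by (simp add: sg_def cadj(2)[OF ab, symmetric] cinner_self del: of_real_power)
 show "sg (cadj a \<circ> a) : \<real>\<^sub>\<ge>\<^sub>0" unfolding e by (simp del: of_real_power)
 show "a = (%_. 0)" if "sg (cadj a \<circ> a) = 0" using that separating[OF a] unfolding e by simp
qed (use N_UNIV(1) sg_normal sg_tracial in \<open>auto simp: comp_def sg_def cinner_add_right Om_Om\<close>)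

text \<open>\<open>pp\<close> represents only bounded word polynomials, so the unbounded operator is
  recovered from its represented resolvent at \<open>i\<close>.\<close>

definition Ab :: "bool => ell2 opgraph"
 where "Ab b = {(pp (L (b, 0, 1)) w, w + \<i> *c pp (L (b, 0, 1)) w) | w. True}"

abbreviation "Sb b \<equiv> {l :: bool \<times> rat \<times> rat. fst l = b}"

lemma Sb_star: "l : Sb b ==> star l : Sb b"
 by (simp add: star_def)

lemma res_id:
 assumes "Im (zl l) ~= 0" "Im (zl k) ~= 0" "fst l = b" "fst k = b"
 shows "pp (L l) v - pp (L k) v = (zl l - zl k) *c pp (L l) (pp (L k) v)"
proof -
 have "(%x. L l x - L k x) = (%x. (zl l - zl k) *c L l (L k x))"
  using res_identity[OF Xb(2) assms(1,2), of b] assms by (simp add: L_def fun_eq_iff)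
 hence "pp (%x. L l x - L k x) v = pp (%x. (zl l - zl k) *c L l (L k x)) v" by simp
 thus ?thesis using pp_lin(2)[OF LW LW] pp_lin(3)[OF wsp_comp[OF LW LW] wsp_comp[OF LW LW]] pp_comp[OF LW LW] by simp
qed

lemma Ab_sa: "op_sa (Ab b)"
proof -
 define rh rh' where "rh = pp (L (b, 0, 1))" and "rh' = pp (L (b, 0, -1))"
 have rhb: "bcl rh" "bcl rh'" unfolding rh_def rh'_def by (rule pp(1)[OF LW])+
 have ad: "cinner (rh x) y = cinner x (rh' y)" "cinner (rh' x) y = cinner x (rh y)" for x y
  using cadj(2,3)[OF rhb(1)] unfolding rh_def rh'_def pp_adj[OF LW] L(2) by (simp_all add: star_def)
 have id: "rh v - rh' v = (2 * \<i>) *c rh (rh' v)" "rh v - rh' v = (2 * \<i>) *c rh' (rh v)" for v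
 proof -
  show "rh v - rh' v = (2 * \<i>) *c rh (rh' v)"
  using res_id[of "(b, 0, 1)" "(b, 0, -1)" b v] unfolding rh_def rh'_def by (simp add: zl_i)
  have "- (rh' v - rh v) = - ((- (2 * \<i>)) *c rh' (rh v))"
  using res_id[of "(b, 0, -1)" "(b, 0, 1)" b v] unfolding rh_def rh'_def by (simp add: zl_i)
  thus "rh v - rh' v = (2 * \<i>) *c rh' (rh v)" by (simp add: scaleC.minus_left)
 qed
 have Ab: "Ab b = {(rh w, w + \<i> *c rh w) | w. True}" by (simp add: Ab_def rh_def)
 show ?thesis
 proof (rule sa_criterion)
  show "symmetric_graph (Ab b)"
  unfolding symmetric_graph_def
  proof (intro conjI allI impI)
  show "csubspace (Ab b)"
  unfolding csubspace_def
  proof (intro conjI ballI allI)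
  show "0 : Ab b" unfolding Ab using bcl_zero[OF rhb(1)] by (intro CollectI exI[of _ 0]) (simp add: zero_prod_def)
  fix p q assume "p : Ab b" "q : Ab b"
  then obtain w v where "p = (rh w, w + \<i> *c rh w)" "q = (rh v, v + \<i> *c rh v)" unfolding Ab by blast
  thus "p + q : Ab b" unfolding Ab
  by (intro CollectI exI[of _ "w + v"]) (simp add: bcl_add[OF rhb(1)] scaleC_add_right algebra_simps)
  next
  fix c p assume "p : Ab b"
  then obtain w where "p = (rh w, w + \<i> *c rh w)" unfolding Ab by blast
  thus "c *c p : Ab b" unfolding Ab
  by (intro CollectI exI[of _ "c *c w"]) (simp add: bcl_scale[OF rhb(1)] scaleC_add_right scaleC_scaleC mult.commute)
  qed
  fix x y u v assume "(x, y) : Ab b" "(u, v) : Ab b"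
  then obtain w k where w: "x = rh w" "y = w + \<i> *c rh w" "u = rh k" "v = k + \<i> *c rh k" unfolding Ab by blast
  have "cinner (rh w - rh' w) k = cinner ((2 * \<i>) *c rh' (rh w)) k" unfolding id(2) ..
  thus "cinner x v = cinner y u" unfolding w by (simp add: cinner_simps ad algebra_simps)
  qed
  \<comment> \<open>A vector \<open>v\<close> orthogonal to the range of \<open>rh\<close> is killed
    by \<open>rh\<close> and \<open>rh'\<close>, so applying \<open>yy b\<close> on the other side
    of the inner product leaves it unchanged; the powers of \<open>yy b\<close> tend to 0, which
    forces \<open>v = 0\<close>.\<close>
  have inj: "v = 0" if v: "!!w. cinner v (rh w) = 0" for v
  proof (rule Ph_dense)
  fix m a assume a: "a : W"
  have "cinner (rh' v) w = 0" for w unfolding ad by (rule v)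
  hence rv: "rh' v = 0" using cinner_ext_left[of "rh' v" 0] by simp
  have yW: "yy b ^^ n : W" for n
  proof (induction n)
  case (Suc n)
  thus ?case using wsp_comp[OF yy_in Suc] by (simp add: comp_def)
  qed (simp add: id_def wsp_basic)
  have y: "pp (yy b) = (%v. v - rh' (rh v))"
  unfolding yy_def[abs_def] pp_lin(2)[OF wsp_basic(1) wsp_comp[OF LW LW]] pp_id pp_comp[OF LW LW] rh_def rh'_def ..
  have "cinner (Ph m (%x. (yy b ^^ n) (a x))) v = cinner (Ph m a) v" for n
  proof (induction n)
  case (Suc n)
  have aW: "(%x. (yy b ^^ n) (a x)) : W" by (rule wsp_comp[OF yW a])
  have "Ph m (%x. (yy b ^^ Suc n) (a x)) = pp (yy b) (Ph m (%x. (yy b ^^ n) (a x)))"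
  using pp(2)[OF yy_in aW] by simp
  moreover have "cinner (pp (yy b) u) v = cinner u v" for u
  unfolding y using id(1)[of v] id(2)[of v] rv bcl_zero[OF rhb(1)] by (simp add: cinner_simps ad)
  ultimately show ?case using Suc by simp
  qed simp
  moreover have "(%n. cinner (Ph m (%x. (yy b ^^ n) (a x))) v) ~> 0"
  proof -
  have n2: "(norm (Ph m c))^2 = Re (ip c c)" if "c : W" for c
  using cinner_self[of "Ph m c"] that by (simp add: Ph_ip)
  have "(%n. (norm (Ph m (%x. (yy b ^^ n) (a x))))^2) ~> 0"
  unfolding n2[OF wsp_comp[OF yW a]] by (rule yy_power[OF W_in[OF a]])
  from tendsto_real_sqrt[OF this] have "(%n. Ph m (%x. (yy b ^^ n) (a x))) ~> 0" by (simp add: tendsto_norm_zero_iff)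
  from cinner.tendsto[OF this tendsto_const[of v]] show ?thesis by simp
  qed
  ultimately have "(%n::nat. cinner (Ph m a) v) ~> 0" by simp
  from LIMSEQ_unique[OF tendsto_const this] show "cinner (Ph m a) v = 0" .
  qed
  have "Domain (Ab b) = range rh" unfolding Ab by auto
  moreover have "csubspace (range rh)"
  unfolding csubspace_def using bcl_add[OF rhb(1)] bcl_scale[OF rhb(1)] bcl_zero[OF rhb(1)] by (auto simp: image_iff) metis+
  ultimately show "closure (Domain (Ab b)) = UNIV" using inj by (auto simp: dense_iff_orth)
  show "EX x y. (x, y) : Ab b & y - \<i> *c x = w" for w
  unfolding Ab by (intro exI[of _ "rh w"] exI[of _ "w + \<i> *c rh w"]) auto
  show "EX x y. (x, y) : Ab b & y + \<i> *c x = w" for w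
  proof -
  \<comment> \<open>A Cayley transform of \<open>w\<close>, chosen so that
    \<open>rh ?u = rh' w\<close>, the value of the resolvent at \<open>-i\<close>.\<close>
  let ?u = "w - (2 * \<i>) *c rh' w"
  have "rh ?u = rh w - (2 * \<i>) *c rh (rh' w)" by (simp add: bcl_simps[OF rhb(1)])
  also have "... = rh' w" using id(1)[of w] by (simp add: algebra_simps)
  finally have u: "rh ?u = rh' w" .
  have "\<i> *c rh' w + \<i> *c rh' w = (2 * \<i>) *c rh' w" unfolding scaleC_add_left[symmetric] by simp
  hence "(?u + \<i> *c rh ?u) + \<i> *c rh ?u = w" unfolding u by (simp add: algebra_simps)
  moreover have "(rh ?u, ?u + \<i> *c rh ?u) : Ab b" unfolding Ab by blast
  ultimately show ?thesis by blast
  qed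
 qed
qed

lemma Ab_affiliated: "Ab b : affiliated (N (Sb b))" "Ab b : affiliated (N UNIV)"
proof -
 have N: "pp (L (b, 0, 1)) : N (Sb b)" by (rule N_vna(2)) (simp_all add: star_def)
 have "Ab b : affiliated N'" if "N (Sb b) <= N'" for N'
 proof (rule affiliatedI[OF saD(1)[OF Ab_sa]])
  fix u x y assume u: "u : commutant N'" "unitary_op u" and xy: "(x, y) : Ab b"
  then obtain w where w: "x = pp (L (b, 0, 1)) w" "y = w + \<i> *c pp (L (b, 0, 1)) w" unfolding Ab_def by blast
  have c: "u (pp (L (b, 0, 1)) v) = pp (L (b, 0, 1)) (u v)" for v using commD[OF u(1)] N that by blast
  show "(u x, u y) : Ab b" unfolding Ab_def w
  by (intro CollectI exI[of _ "u w"]) (simp add: c bcl_simps[OF unitary_opD(1)[OF u(2)]])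
 qed
 thus "Ab b : affiliated (N (Sb b))" "Ab b : affiliated (N UNIV)" using N_UNIV(2) by blast+
qed

lemma Ab_res:
 assumes z: "Im (zl l) ~= 0" and l: "fst l = b" shows "res (Ab b) (zl l) = pp (L l)"
proof
 fix w
 note P1 = pp(1)[OF LW[of "(b, 0, 1)"]]
 let ?u = "w + (zl l - \<i>) *c pp (L l) w"
 have "pp (L l) w - pp (L (b, 0, 1)) w = (zl l - \<i>) *c pp (L (b, 0, 1)) (pp (L l) w)"
 proof -
  have "- (pp (L (b, 0, 1)) w - pp (L l) w) = - ((\<i> - zl l) *c pp (L (b, 0, 1)) (pp (L l) w))"
  using res_id[of "(b, 0, 1)" l b w] z l by (simp add: zl_i)
  thus ?thesis by (simp flip: scaleC.minus_left)
 qed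
 hence "pp (L (b, 0, 1)) ?u = pp (L l) w" by (simp add: bcl_simps[OF P1] algebra_simps)
 moreover have "?u + \<i> *c pp (L l) w = w + zl l *c pp (L l) w" by (simp add: add.assoc flip: scaleC_add_left)
 ultimately have "(pp (L l) w, w + zl l *c pp (L l) w) : Ab b" unfolding Ab_def by (intro CollectI exI[of _ ?u]) simp
 thus "res (Ab b) (zl l) w = pp (L l) w" by (rule res_unique[OF Ab_sa z])
qed

text \<open>The letters only reach rational points. Approximating with larger imaginary parts keeps
  the dominating constant \<open>1 / Im z\<close>.\<close>

lemma rz_seq:
 assumes z: "Im z > 0" and mu: "finite_measure mu" "sets mu = sets borel" and f: "f ~> z" "!!n. Im (f n) > Im z"
 shows "(%n. \<integral>t. rz (f n) t \<partial>mu) ~> (\<integral>t. rz z t \<partial>mu)"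
proof (rule integral_dominated_convergence[where w = "%_. 1 / Im z"])
 interpret finite_measure mu by (rule mu)
 show "integrable mu (%_. 1 / Im z)" by simp
 have m: "rz v : borel_measurable mu" if "Im v ~= 0" for v
  using bb_measurable[OF bb_rz[OF that]] by (simp add: measurable_cong_sets[OF mu(2) refl])
 show "rz z : borel_measurable mu" using m z by auto
 show "rz (f n) : borel_measurable mu" for n using m[of "f n"] f(2)[of n] z by auto
 have "(%n. rz (f n) t) ~> rz z t" for t
  unfolding rz_def using z by (intro tendsto_intros f) (auto simp: complex_eq_iff)
 thus "AE t in mu. (%n. rz (f n) t) ~> rz z t" by simp
 have "cmod (rz (f n) t) <= 1 / Im z" for n t
 proof -
  have "cmod (rz (f n) t) <= 1 / \<bar>Im (f n)\<bar>" using cmod_rz[of "f n" t] f(2)[of n] z by simp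
  also have "... <= 1 / Im z" using f(2)[of n] z by (intro divide_left_mono) auto
  finally show ?thesis .
 qed
 thus "AE t in mu. norm (rz (f n) t) <= 1 / Im z" for n by simp
qed

lemma rat_seq: "EX q. (ALL n. x < of_rat (q n)) & (%n. of_rat (q n)) ~> x" for x :: real
proof -
 have "EX q. x < of_rat q & of_rat q < x + inverse (real (Suc n))" for n by (rule of_rat_dense) simp
 then obtain q where q: "!!n. x < of_rat (q n)" "!!n. of_rat (q n) < x + inverse (real (Suc n))" by metis
 have "(%n. of_rat (q n)) ~> x"
  by (rule tendsto_sandwich[OF _ _ tendsto_const LIMSEQ_inverse_real_of_nat_add])
  (use q in \<open>auto intro!: always_eventually less_imp_le\<close>)
 thus ?thesis using q(1) by blast
qed

lemma Ab_distr: "op_distr sg (Ab b) = op_distr tr (Xb b)"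
proof -
 interpret N: fin_vna "N UNIV" sg by (rule tracial_vna_fin[OF tracial_N])
 note dA = N.op_distr[OF Ab_affiliated(2)[of b] Ab_sa[of b]] and dX = op_distr[OF Xb]
 have rat: "(\<integral>t. rz (zl l) t \<partial>op_distr sg (Ab b)) = (\<integral>t. rz (zl l) t \<partial>op_distr tr (Xb b))"
  if l: "fst l = b" "Im (zl l) ~= 0" for l
 proof -
  have "sg (res (Ab b) (zl l)) = tr (L l)" unfolding Ab_res[OF l(2,1)] by (rule sg_pp(1)[OF LW])
  also have "L l = res (Xb b) (zl l)" using l by (simp add: L_def)
  finally show ?thesis
  unfolding res_fc[OF Ab_sa l(2)] res_fc[OF Xb(2) l(2)] dA(5)[OF bb_rz[OF l(2)]] dX(5)[OF bb_rz[OF l(2)]] .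
 qed
 show ?thesis
 proof (rule stieltjes_unique[OF dA(1,3) dX(1,3)])
  fix z :: complex assume z: "Im z > 0"
  obtain p q where p: "(%n. of_rat (p n)) ~> Re z" and q: "!!n. Im z < of_rat (q n)" "(%n. of_rat (q n)) ~> Im z"
  using rat_seq[of "Re z"] rat_seq[of "Im z"] by blast
  let ?f = "%n. zl (b, p n, q n)"
  have f: "?f ~> z" "!!n. Im (?f n) > Im z"
  using tendsto_Complex[OF p q(2)] q(1) by (simp_all add: zl_def)
  have nz: "Im (?f n) ~= 0" for n using f(2)[of n] z by linarith
  show "(\<integral>t. rz z t \<partial>op_distr sg (Ab b)) = (\<integral>t. rz z t \<partial>op_distr tr (Xb b))"
  proof (rule LIMSEQ_unique)
  have "(\<integral>t. rz (?f n) t \<partial>op_distr sg (Ab b)) = (\<integral>t. rz (?f n) t \<partial>op_distr tr (Xb b))" for n by (rule rat[OF _ nz]) simp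
  thus "(%n. \<integral>t. rz (?f n) t \<partial>op_distr tr (Xb b)) ~> (\<integral>t. rz z t \<partial>op_distr sg (Ab b))"
  using rz_seq[OF z dA(1,3) f] by simp
  show "(%n. \<integral>t. rz (?f n) t \<partial>op_distr tr (Xb b)) ~> (\<integral>t. rz z t \<partial>op_distr tr (Xb b))"
  by (rule rz_seq[OF z dX(1,3) f])
  qed
 qed
qed

text \<open>The entries of an alternating product are approximated in \<open>L\<^sup>2\<close> one at a time; by traciality the entry to be
  approximated can be moved next to \<open>Om\<close>.\<close>

lemma Ab_free: "star_free sg (Ab False) (Ab True)"
 unfolding star_free_def free_algebras_def
proof (intro allI impI, elim conjE)
 fix ix :: "nat list" and as
 assume ix: "ix ~= []" and len: "length as = length ix" and set: "set ix <= {0, 1}" and alt: "distinct_adj ix"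
  and as: "ALL k<length ix. as ! k : Wstar (if ix ! k = 0 then Ab False else Ab True) & sg (as ! k) = 0"
 note V = N_UNIV(3)
 note al = vna_alg[OF V]
 let ?S = "%k. Sb (ix ! k = 1)"
 have asN: "as ! k : N (?S k)" "sg (as ! k) = 0" if k: "k < length ix" for k
 proof -
  have "ix ! k : {0, 1}" using set k by (meson nth_mem subsetD)
  hence "(if ix ! k = 0 then Ab False else Ab True) = Ab (ix ! k = 1)" by auto
  hence "as ! k : Wstar (Ab (ix ! k = 1))" "sg (as ! k) = 0" using as k by auto
  thus "as ! k : N (?S k)" "sg (as ! k) = 0"
  using Wstar_subset[OF N_vna(1)[OF Sb_star] Ab_affiliated(1)] by blast+
 qed
 \<comment> \<open>The product is kept in cyclically rotated form: \<open>xs\<close> replaces the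
   factors from position \<open>k\<close> on and stands to the left of the first \<open>k\<close>
   factors, so the last factor not yet replaced acts directly on \<open>Om\<close>.\<close>
 have "sg (%v. pp (foldr (o) xs id) (foldr (o) (take k as) id v)) = 0"
  if "k <= length ix" "length xs + k = length ix" "!!j. j < length xs ==> xs ! j : wsp (?S (k + j)) & tr (xs ! j) = 0" for k xs
  using that
 proof (induction k arbitrary: xs)
  case 0
  have "tr (foldr (o) xs id) = 0"
  proof (rule free[unfolded free_algebras_def, rule_format, of ix], intro conjI allI impI)
  fix k assume k: "k < length ix"
  hence xk: "xs ! k : wsp (?S k)" "tr (xs ! k) = 0" using 0 by auto
  have "ix ! k : {0, 1}" using set k by (meson nth_mem subsetD)
  hence "Xb (ix ! k = 1) = X (ix ! k)" by (auto simp: Xb_def)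
  thus "xs ! k : {fc (spm (X (ix ! k))) f | f. bb f}" "tr (xs ! k) = 0"
  using wsp_fc[OF xk(1)] xk(2) by auto
  qed (use ix set alt 0 in auto)
  moreover have "foldr (o) xs id : W"
  proof -
  have "ALL x:set xs. x : W" using 0 wsp_W by (metis in_set_conv_nth)
  thus ?thesis by (induction xs) (auto simp: comp_def id_def wsp_basic intro: wsp_comp)
  qed
  moreover have "(%v. pp p (foldr (o) (take 0 as) id v)) = pp p" for p by simp
  ultimately show ?case using sg_pp(1) by (simp only:)
 next
  case (Suc k)
  hence k: "k < length ix" by simp
  note t = asN[OF k]
  let ?t = "as ! k" and ?p = "foldr (o) xs id" and ?Q = "foldr (o) (take k as) id"
  obtain f where f: "!!n. f n : wsp (?S k)" "(%n. Ph 0 (f n)) ~> ?t Om" using approx[OF Sb_star t(1)] by metis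
  note fW = wsp_W[OF f(1)]
  have "(%n. cinner Om (Ph 0 (f n))) ~> cinner Om (?t Om)" by (intro cinner.tendsto tendsto_const f)
  hence trf: "(%n. tr (f n)) ~> 0" using t(2) unfolding sg_pp(2)[OF fW] sg_def by simp
  \<comment> \<open>Centering keeps the induction hypothesis applicable; the correction vanishes in
    the limit because \<open>sg ?t = 0\<close>.\<close>
  define g where "g n = (%x. f n x - tr (f n) *c x)" for n
  have gS: "g n : wsp (?S k)" for n unfolding g_def by (intro wsp_basic(4) f wsp.scale wsp_basic(1))
  note gW = wsp_W[OF gS]
  have g0: "tr (g n) = 0" for n unfolding g_def using tr_diff[OF wsp_in[OF f(1)] alg(4)] by (simp add: tr_const)
  have "Ph 0 (g n) = Ph 0 (f n) - tr (f n) *c Om" for n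
  unfolding g_def Om_def Ph_diff[OF fW wsp.scale[OF wsp_basic(1)]] Ph_scale[OF wsp_basic(1)] ..
  moreover have "(%n. Ph 0 (f n) - tr (f n) *c Om) ~> ?t Om - 0 *c Om"
  by (intro tendsto_diff f scaleC.tendsto trf tendsto_const)
  ultimately have gl: "(%n. Ph 0 (g n)) ~> ?t Om" by simp
  have pW: "?p : W"
  proof -
  have "ALL x:set xs. x : W" using Suc.prems(3) wsp_W by (metis in_set_conv_nth)
  thus ?thesis by (induction xs) (auto simp: comp_def id_def wsp_basic intro: wsp_comp)
  qed
  have pN: "pp ?p : N UNIV" by (rule pp_N[OF _ pW]) simp
  have QN: "?Q : N UNIV"
  proof -
  have "ALL x:set (take k as). x : N UNIV"
  using asN(1) N_UNIV(2) len k by (auto simp: in_set_conv_nth) (metis order.strict_trans subsetD)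
  moreover have "foldr (o) us id : N UNIV" if "ALL x:set us. x : N UNIV" for us
  using that by (induction us) (auto simp: al(1) intro: al(8))
  ultimately show ?thesis by blast
  qed
  have PQ: "(%v. pp ?p (?Q v)) : N UNIV" by (rule al(9)[OF pN QN])
  have z: "cinner Om (pp ?p (?Q (Ph 0 (g n)))) = 0" for n
  proof -
  have gN: "pp (g n) : N UNIV" by (rule pp_N[OF _ gW]) simp
  have "cinner Om (pp ?p (?Q (Ph 0 (g n)))) = sg (%v. pp ?p (?Q (pp (g n) v)))" by (simp add: sg_def pp_Om gW)
  also have "... = sg (%v. pp (g n) (pp ?p (?Q v)))" by (rule sg_tracial[OF PQ gN])
  also have "(%v. pp (g n) (pp ?p (?Q v))) = (%v. pp (foldr (o) (g n # xs) id) (?Q v))"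
  using pp_comp[OF gW pW] by (simp add: comp_def)
  also have "sg ... = 0"
  proof (rule Suc.IH)
  fix j assume "j < length (g n # xs)"
  thus "(g n # xs) ! j : wsp (?S (k + j)) & tr ((g n # xs) ! j) = 0"
  using Suc.prems(3)[of "j - 1"] gS g0 by (cases j) auto
  qed (use Suc.prems in auto)
  finally show ?thesis .
  qed
  have "(%n. cinner Om (pp ?p (?Q (Ph 0 (g n))))) ~> cinner Om (pp ?p (?Q (?t Om)))"
  by (intro cinner.tendsto tendsto_const bcl_tendsto[OF vna_bcl[OF V PQ] gl])
  hence "cinner Om (pp ?p (?Q (?t Om))) = 0" unfolding z using LIMSEQ_unique[OF tendsto_const] by metis
  moreover have "foldr (o) (take (Suc k) as) id = ?Q \<circ> ?t"
  proof -
  have "foldr (o) (us @ [t]) id = foldr (o) us id \<circ> t" for us and t :: "ell2 => ell2"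
  by (induction us) (simp_all add: o_assoc)
  moreover have "take (Suc k) as = take k as @ [?t]" using k len by (simp add: take_Suc_conv_app_nth)
  ultimately show ?thesis by (simp only:)
  qed
  ultimately show ?case unfolding sg_def by (simp only: comp_apply)
 qed
 from this[of "length ix" "[]"] show "sg (foldr (o) as id) = 0"
  using len pp_id by (simp add: id_def)
qed

end

lemma (in free_pair) realization:
 "EX (N :: (ell2 => ell2) set) sg A B. tracial_vna N sg & A : affiliated N & op_sa A & B : affiliated N & op_sa B
  & star_free sg A B & op_distr sg A = op_distr tr (X 0) & op_distr sg B = op_distr tr (X 1)"
proof -
 obtain Ph where "gns M tr X Ph" using gns_exists by blast
 then interpret gns M tr X Ph .
 show ?thesis
  using tracial_N Ab_affiliated(2) Ab_sa Ab_free Ab_distr[of False] Ab_distr[of True] unfolding Xb_def by (metis (full_types))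
qed

section \<open>Comparison with arbitrary free pairs and conclusion\<close>

lemma free_algebras_mono:
 assumes f: "free_algebras sg I \<A>" and "!!i. \<B> i <= \<A> i" shows "free_algebras sg I \<B>"
 unfolding free_algebras_def
proof (intro allI impI, elim conjE)
 fix ix as assume "ix ~= []" "length as = length ix" "set ix <= I" "distinct_adj ix" "ALL k<length ix. as ! k : \<B> (ix ! k) & sg (as ! k) = 0"
 thus "sg (foldr (o) as id) = 0" using assms(2) by (intro f[unfolded free_algebras_def, rule_format, of ix]) blast
qed

lemma star_free_pair:
 assumes N: "tracial_vna N sg" and A: "A : affiliated N" "op_sa A" and B: "B : affiliated N" "op_sa B"
  and free: "star_free sg A B"
 shows "free_pair N sg (%i::nat. if i = 0 then A else B)"
proof (rule free_pair.intro[OF tracial_vna_fin[OF N]], unfold_locales)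
 have vN: "von_neumann_algebra N" using N by (simp add: tracial_vna_def)
 have "fc (spm Y) f : Wstar Y" if "Y : affiliated N" "op_sa Y" "bb f" for Y f
  by (rule fc_in_vna[OF vna_Wstar[OF vN that(1)] affiliated_Wstar[OF saD(1)[OF that(2)]] that(2,3)])
 hence "{fc (spm (if i = 0 then A else B)) f | f. bb f} <= Wstar (if i = 0 then A else B)" for i :: nat
  using A B by auto
 from free_algebras_mono[OF free[unfolded star_free_def] this]
 show "free_algebras sg {0, 1} (%i::nat. {fc (spm (if i = 0 then A else B)) f | f. bb f})"
  .
qed (use A B in auto)

theorem proposition3p11:
  fixes M :: "('h::complex_hilbert_space \<Rightarrow> 'h) set"
    and \<tau> :: "('h \<Rightarrow> 'h) \<Rightarrow> complex"
    and S T :: "'h opgraph"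
  assumes "tracial_vna M \<tau>"
    and "S \<in> affiliated M" and "T \<in> affiliated M"
    and "star_free \<tau> S T"
    and "R_diagonal TYPE('k1::complex_hilbert_space) \<tau> S"
    and "R_diagonal TYPE('k2::complex_hilbert_space) \<tau> T"
  shows "symmetrization (op_distr \<tau> (op_abs (op_add S T))) =
    symmetrization (op_distr \<tau> (op_abs S)) \<boxplus> symmetrization (op_distr \<tau> (op_abs T))"
proof -
 let ?s = "%X. symmetrization (op_distr \<tau> (op_abs X))"
 interpret F: fin_vna M \<tau> by (rule tracial_vna_fin[OF assms(1)])
 let ?X = "%i::nat. hat (if i = 0 then S else T)"
 interpret P: free_pair "M2 M" "tr2 \<tau>" ?X by (rule free_pair_hat[OF assms])
 note add = F.op_add_hat[OF assms(2,3)]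
 have S: "op_distr (tr2 \<tau>) (?X 0) = ?s S" and T: "op_distr (tr2 \<tau>) (?X 1) = ?s T"
  using F.op_distr_hat[OF affiliatedD(1)[OF assms(2)] hat_affiliated[OF F.vna assms(2)]]
  F.op_distr_hat[OF affiliatedD(1)[OF assms(3)] hat_affiliated[OF F.vna assms(3)]] by simp_all
 have ST: "op_distr (tr2 \<tau>) (op_add (?X 0) (?X 1)) = ?s (op_add S T)"
  using F.op_distr_hat[OF add(1)] add(2,3) by simp
 \<comment> \<open>This comparison serves twice: the realized pair shows that the description
   defining the convolution has a witness, and every other pair gives the same value.\<close>
 have eq: "op_distr sg (op_add A B) = ?s (op_add S T)"
  if h: "tracial_vna N sg" "A : affiliated N" "op_sa A" "B : affiliated N" "op_sa B" "star_free sg A B"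
  "op_distr sg A = ?s S" "op_distr sg B = ?s T"
  for N :: "(ell2 => ell2) set" and sg A B
 proof -
  let ?Y = "%i::nat. if i = 0 then A else B"
  interpret Q: free_pair N sg ?Y by (rule star_free_pair[OF h(1-6)])
  interpret free_pairs "M2 M" "tr2 \<tau>" ?X N sg ?Y
  by unfold_locales (use S T h(7,8) in auto)
  show ?thesis using op_distr_add_eq ST by simp
 qed
 let ?R = "%rh. EX (N :: (ell2 => ell2) set) sg A B. tracial_vna N sg
  & A : affiliated N & op_sa A & B : affiliated N & op_sa B
  & star_free sg A B & op_distr sg A = ?s S & op_distr sg B = ?s T
  & op_distr sg (op_add A B) = rh"
 show ?thesis
  unfolding free_add_convolution_def
 proof (rule the_equality[symmetric])
  obtain N :: "(ell2 => ell2) set" and sg A B where r: "tracial_vna N sg" "A : affiliated N" "op_sa A"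
  "B : affiliated N" "op_sa B" "star_free sg A B"
  "op_distr sg A = ?s S" "op_distr sg B = ?s T"
  using P.realization unfolding S T by blast
  with eq[OF r] show "?R (?s (op_add S T))" by blast
 next
  fix rh assume "?R rh"
  thus "rh = ?s (op_add S T)" using eq by blast
 qed
qed

end
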